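(* For every binary quadratic operad $\mathcal{O}$ over a field $\mathbb{K}$, the white product of $\mathcal{O}$ with ${}^2\mathcal{C}om$ equals their Hadamard product: $$\mathcal{O}\circ{}^2\mathcal{C}om=\mathcal{O}\otimes_H{}^2\mathcal{C}om .$$
   Context: Operads are $\mathbb{K}$-linear symmetric operads. $\mathcal{F}(V)$ is the free operad on an $\mathbb{S}$-module $V$ (spanned by rooted trees with labelled leaves and internal vertices decorated by $V$) and $\mathcal{F}_{(2)}(V)$ is the part spanned by trees with two internal vertices. A quadratic operad $\mathcal{F}(V)/(R)$ is the quotient by the operadic ideal generated by $R\subset\mathcal{F}_{(2)}(V)$ ($R$ is identified with the $\mathbb{S}$-submodule it spans); it is binary if $V(n)=0$ for $n\ne2$, and then we write $V$ for $V(2)$ and $\mathcal{F}_{(2)}(V)=\mathcal{F}(V)(3)$. ${}^2\mathcal{C}om$ (two totally compatible commutative associative products) is the binary quadratic operad generated by two symmetric binary operations $w,b$ with relations in arity 3: $w(w(1,2),3)=w(w(2,3),1)=w(w(3,1),2)$; $b(b(1,2),3)=b(b(2,3),1)=b(b(3,1),2)$; and the six trees $b(w(1,2),3)$, $b(w(2,3),1)$, $b(w(3,1),2)$, $w(b(1,2),3)$, $w(b(2,3),1)$, $w(b(3,1),2)$ are all equal. White product. For binary quadratic operads $\mathcal{F}(V)/(R)$ and $\mathcal{F}(W)/(S)$, let $\Phi:\mathcal{F}(V\otimes W)(3)\to\mathcal{F}(V)(3)\otimes\mathcal{F}(W)(3)$ send a tree with inner vertex decorated by $v\otimes w$ and root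 vertex decorated by $v'\otimes w'$ to (same labelled tree decorated by $v$ and $v'$) $\otimes$ (same labelled tree decorated by $w$ and $w'$). The white product is $\mathcal{F}(V)/(R)\circ\mathcal{F}(W)/(S):=\mathcal{F}(V\otimes W)/(\Phi^{-1}(R\otimes\mathcal{F}(W)(3)+\mathcal{F}(V)(3)\otimes S))$. Hadamard product: $(\mathcal{O}\otimes_H\mathcal{Q})(n):=\mathcal{O}(n)\otimes\mathcal{Q}(n)$ with composition $\mu(e\otimes q;e_1\otimes q_1,\dots,e_k\otimes q_k)=\mu(e;e_1,\dots,e_k)\otimes\mu(q;q_1,\dots,q_k)$. The equality means that the canonical morphism of operads from the white product to the Hadamard product, which is the identity on the generators in arity 2, is an isomorphism. *)

theory Defs
  imports "HOL-Algebra.Module" "HOL-Algebra.AbelCoset" "HOL-Combinatorics.Permutations"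
begin

section \<open>Linear algebra over a field, with explicit carriers\<close>

text \<open>
  Vector spaces over a field \<open>K\<close> are modules over \<open>K\<close> in the sense of HOL-Algebra.
  The fields \<open>mult\<close> and \<open>one\<close> of a module record play no role for modules; they are left undefined.
\<close>

definition lin_hom ::
  "('k, 'm) ring_scheme \<Rightarrow> ('k, 'a, 'p) module_scheme \<Rightarrow> ('k, 'b, 'q) module_scheme \<Rightarrow> ('a \<Rightarrow> 'b) set"
  where "lin_hom K M N =
    {f \<in> hom (add_monoid M) (add_monoid N).
      \<forall>a\<in>carrier K. \<forall>x\<in>carrier M. f (a \<odot>\<^bsub>M\<^esub> x) = a \<odot>\<^bsub>N\<^esub> f x}"

definition lin_span ::
  "('k, 'm) ring_scheme \<Rightarrow> ('k, 'a, 'p) module_scheme \<Rightarrow> 'a set \<Rightarrow> 'a set"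
  where "lin_span K M G = \<Inter>{H. submodule H K M \<and> G \<subseteq> H}"

definition quot_module :: "('k, 'a, 'p) module_scheme \<Rightarrow> 'a set \<Rightarrow> ('k, 'a set) module"
  where "quot_module M N =
    \<lparr>carrier = a_rcosets\<^bsub>M\<^esub> N, monoid.mult = undefined, one = undefined,
     zero = N, add = (\<lambda>X Y. X <+>\<^bsub>M\<^esub> Y),
     smult = (\<lambda>a X. \<Union>x\<in>X. N +>\<^bsub>M\<^esub> (a \<odot>\<^bsub>M\<^esub> x))\<rparr>"

definition supp :: "('k, 'm) ring_scheme \<Rightarrow> ('x \<Rightarrow> 'k) \<Rightarrow> 'x set"
  where "supp K f = {x. f x \<noteq> \<zero>\<^bsub>K\<^esub>}"

definition free_module :: "('k, 'm) ring_scheme \<Rightarrow> 'x set \<Rightarrow> ('k, 'x \<Rightarrow> 'k) module"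
  where "free_module K X =
    \<lparr>carrier = {f. range f \<subseteq> carrier K \<and> finite (supp K f) \<and> supp K f \<subseteq> X},
     monoid.mult = undefined, one = undefined,
     zero = (\<lambda>x. \<zero>\<^bsub>K\<^esub>), add = (\<lambda>f g x. f x \<oplus>\<^bsub>K\<^esub> g x), smult = (\<lambda>a f x. a \<otimes>\<^bsub>K\<^esub> f x)\<rparr>"

definition single :: "('k, 'm) ring_scheme \<Rightarrow> 'x \<Rightarrow> 'x \<Rightarrow> 'k"
  where "single K x = (\<lambda>y. if y = x then \<one>\<^bsub>K\<^esub> else \<zero>\<^bsub>K\<^esub>)"

text \<open>The linear extension of a map \<open>h\<close> between bases.\<close>

definition lin_ext :: "('k, 'm) ring_scheme \<Rightarrow> ('x \<Rightarrow> 'y) \<Rightarrow> ('x \<Rightarrow> 'k) \<Rightarrow> 'y \<Rightarrow> 'k"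
  where "lin_ext K h f = (\<lambda>y. finsum K f {x \<in> supp K f. h x = y})"

text \<open>
  The multilinear extension of a map \<open>c\<close> that takes one basis element and a list of
  basis elements.
\<close>

definition multilin_ext ::
  "('k, 'm) ring_scheme \<Rightarrow> ('x \<Rightarrow> 'x list \<Rightarrow> 'x) \<Rightarrow> ('x \<Rightarrow> 'k) \<Rightarrow> ('x \<Rightarrow> 'k) list \<Rightarrow> 'x \<Rightarrow> 'k"
  where "multilin_ext K c f fs = (\<lambda>z. finsum K
    (\<lambda>(x, xs). f x \<otimes>\<^bsub>K\<^esub> foldr (\<otimes>\<^bsub>K\<^esub>) (map2 (\<lambda>g y. g y) fs xs) \<one>\<^bsub>K\<^esub>)
    {(x, xs). x \<in> supp K f \<and> xs \<in> listset (map (supp K) fs) \<and> c x xs = z})"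

text \<open>
  The tensor product is the free module on pairs modulo the bilinearity relations.
\<close>

definition bilin_rel ::
  "('k, 'm) ring_scheme \<Rightarrow> ('k, 'a, 'p) module_scheme \<Rightarrow> ('k, 'b, 'q) module_scheme \<Rightarrow> ('a \<times> 'b \<Rightarrow> 'k) set"
  where "bilin_rel K M N = (let F = free_module K (carrier M \<times> carrier N) in lin_span K F
    ({single K ((a \<odot>\<^bsub>M\<^esub> x) \<oplus>\<^bsub>M\<^esub> x', y)
        \<ominus>\<^bsub>F\<^esub> ((a \<odot>\<^bsub>F\<^esub> single K (x, y)) \<oplus>\<^bsub>F\<^esub> single K (x', y)) | a x x' y.
        a \<in> carrier K \<and> x \<in> carrier M \<and> x' \<in> carrier M \<and> y \<in> carrier N} \<union>
     {single K (x, (a \<odot>\<^bsub>N\<^esub> y) \<oplus>\<^bsub>N\<^esub> y')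
        \<ominus>\<^bsub>F\<^esub> ((a \<odot>\<^bsub>F\<^esub> single K (x, y)) \<oplus>\<^bsub>F\<^esub> single K (x, y')) | a x y y'.
        a \<in> carrier K \<and> x \<in> carrier M \<and> y \<in> carrier N \<and> y' \<in> carrier N}))"

definition tensor ::
  "('k, 'm) ring_scheme \<Rightarrow> ('k, 'a, 'p) module_scheme \<Rightarrow> ('k, 'b, 'q) module_scheme
    \<Rightarrow> ('k, ('a \<times> 'b \<Rightarrow> 'k) set) module"
  where "tensor K M N = quot_module (free_module K (carrier M \<times> carrier N)) (bilin_rel K M N)"

definition tens ::
  "('k, 'm) ring_scheme \<Rightarrow> ('k, 'a, 'p) module_scheme \<Rightarrow> ('k, 'b, 'q) module_scheme
    \<Rightarrow> 'a \<Rightarrow> 'b \<Rightarrow> ('a \<times> 'b \<Rightarrow> 'k) set"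
  where "tens K M N x y =
    bilin_rel K M N +>\<^bsub>free_module K (carrier M \<times> carrier N)\<^esub> single K (x, y)"


section \<open>Symmetric operads\<close>

text \<open>
  The data of a \<open>K\<close>-linear symmetric operad: the spaces \<open>P(n)\<close>, the right actions of the symmetric
  groups (permutations of \<open>{1..n}\<close>), the unit in \<open>P(1)\<close>, and the total compositions
  \<open>comp P [n\<^sub>1, \<dots>, n\<^sub>k] e [e\<^sub>1, \<dots>, e\<^sub>k] = \<mu>(e; e\<^sub>1, \<dots>, e\<^sub>k)\<close> for \<open>e \<in> P(k)\<close> and \<open>e\<^sub>i \<in> P(n\<^sub>i)\<close>.
  The arities are passed explicitly because the carriers of different arities need not be disjoint.
\<close>

record ('k, 'a) operad =
  space :: "nat \<Rightarrow> ('k, 'a) module"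
  act :: "nat \<Rightarrow> (nat \<Rightarrow> nat) \<Rightarrow> 'a \<Rightarrow> 'a"
  ident :: 'a
  comp :: "nat list \<Rightarrow> 'a \<Rightarrow> 'a list \<Rightarrow> 'a"

definition composable :: "('k, 'a) operad \<Rightarrow> nat list \<Rightarrow> 'a \<Rightarrow> 'a list \<Rightarrow> bool"
  where "composable P ns e es \<longleftrightarrow>
    e \<in> carrier (space P (length ns)) \<and> es \<in> listset (map (\<lambda>n. carrier (space P n)) ns)"

definition operad_hom ::
  "('k, 'm) ring_scheme \<Rightarrow> ('k, 'a) operad \<Rightarrow> ('k, 'b) operad \<Rightarrow> (nat \<Rightarrow> 'a \<Rightarrow> 'b) \<Rightarrow> bool"
  where "operad_hom K P Q f \<longleftrightarrow>
    (\<forall>n. f n \<in> lin_hom K (space P n) (space Q n)) \<and>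
    (\<forall>n \<sigma>. \<sigma> permutes {1..n} \<longrightarrow> (\<forall>x\<in>carrier (space P n). f n (act P n \<sigma> x) = act Q n \<sigma> (f n x))) \<and>
    f 1 (ident P) = ident Q \<and>
    (\<forall>ns e es. composable P ns e es \<longrightarrow>
      f (sum_list ns) (comp P ns e es) = comp Q ns (f (length ns) e) (map2 f ns es))"

definition operad_iso ::
  "('k, 'm) ring_scheme \<Rightarrow> ('k, 'a) operad \<Rightarrow> ('k, 'b) operad \<Rightarrow> (nat \<Rightarrow> 'a \<Rightarrow> 'b) \<Rightarrow> bool"
  where "operad_iso K P Q f \<longleftrightarrow>
    operad_hom K P Q f \<and> (\<forall>n. bij_betw (f n) (carrier (space P n)) (carrier (space Q n)))"

definition S_submodule ::
  "('k, 'm) ring_scheme \<Rightarrow> ('k, 'a) operad \<Rightarrow> nat \<Rightarrow> 'a set \<Rightarrow> bool"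
  where "S_submodule K P n H \<longleftrightarrow> submodule H K (space P n) \<and>
    (\<forall>\<sigma>. \<sigma> permutes {1..n} \<longrightarrow> (\<forall>x\<in>H. act P n \<sigma> x \<in> H))"

definition S_span ::
  "('k, 'm) ring_scheme \<Rightarrow> ('k, 'a) operad \<Rightarrow> nat \<Rightarrow> 'a set \<Rightarrow> 'a set"
  where "S_span K P n G = \<Inter>{H. S_submodule K P n H \<and> G \<subseteq> H}"

definition operad_ideal ::
  "('k, 'm) ring_scheme \<Rightarrow> ('k, 'a) operad \<Rightarrow> (nat \<Rightarrow> 'a set) \<Rightarrow> bool"
  where "operad_ideal K P I \<longleftrightarrow>
    (\<forall>n. S_submodule K P n (I n)) \<and>
    (\<forall>ns e es. composable P ns e es \<and> (e \<in> I (length ns) \<or> (\<exists>i<length ns. es ! i \<in> I (ns ! i)))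
      \<longrightarrow> comp P ns e es \<in> I (sum_list ns))"

definition gen_ideal ::
  "('k, 'm) ring_scheme \<Rightarrow> ('k, 'a) operad \<Rightarrow> (nat \<Rightarrow> 'a set) \<Rightarrow> nat \<Rightarrow> 'a set"
  where "gen_ideal K P G n = \<Inter>{I n | I. operad_ideal K P I \<and> (\<forall>m. G m \<subseteq> I m)}"

definition quot_operad :: "('k, 'a) operad \<Rightarrow> (nat \<Rightarrow> 'a set) \<Rightarrow> ('k, 'a set) operad"
  where "quot_operad P I =
    \<lparr>space = (\<lambda>n. quot_module (space P n) (I n)),
     act = (\<lambda>n \<sigma> X. \<Union>x\<in>X. I n +>\<^bsub>space P n\<^esub> act P n \<sigma> x),
     ident = I 1 +>\<^bsub>space P 1\<^esub> ident P,
     comp = (\<lambda>ns X Xs. \<Union>x\<in>X. \<Union>xs\<in>listset Xs.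
       I (sum_list ns) +>\<^bsub>space P (sum_list ns)\<^esub> comp P ns x xs)\<rparr>"

text \<open>
  The linearization of an operad in sets, given by its sets of \<open>n\<close>-ary operations, actions, unit
  and compositions.
\<close>

definition lin_operad ::
  "('k, 'm) ring_scheme \<Rightarrow> (nat \<Rightarrow> 'x set) \<Rightarrow> (nat \<Rightarrow> (nat \<Rightarrow> nat) \<Rightarrow> 'x \<Rightarrow> 'x) \<Rightarrow> 'x
    \<Rightarrow> (nat list \<Rightarrow> 'x \<Rightarrow> 'x list \<Rightarrow> 'x) \<Rightarrow> ('k, 'x \<Rightarrow> 'k) operad"
  where "lin_operad K X a u c =
    \<lparr>space = (\<lambda>n. free_module K (X n)),
     act = (\<lambda>n \<sigma>. lin_ext K (a n \<sigma>)),
     ident = single K u,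
     comp = (\<lambda>ns. multilin_ext K (c ns))\<rparr>"

text \<open>
  The Hadamard product. By definition \<open>space (hadamard K P Q) n\<close> is
  \<open>tensor K (space P n) (space Q n)\<close>; on elementary tensors all operations are componentwise.
\<close>

definition hadamard ::
  "('k, 'm) ring_scheme \<Rightarrow> ('k, 'a) operad \<Rightarrow> ('k, 'b) operad \<Rightarrow> ('k, ('a \<times> 'b \<Rightarrow> 'k) set) operad"
  where "hadamard K P Q = quot_operad
    (lin_operad K
      (\<lambda>n. carrier (space P n) \<times> carrier (space Q n))
      (\<lambda>n \<sigma> (x, y). (act P n \<sigma> x, act Q n \<sigma> y))
      (ident P, ident Q)
      (\<lambda>ns (x, y) zs. (comp P ns x (map fst zs), comp Q ns y (map snd zs))))
    (\<lambda>n. bilin_rel K (space P n) (space Q n))"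


section \<open>Free operads on binary generators\<close>

text \<open>
  An \<open>\<S>\<close>-module concentrated in arity \<open>2\<close> is a representation \<open>V\<close> of the symmetric group on two
  letters, given by the involution \<open>twist V\<close> by which the transposition acts.
\<close>

record ('k, 'v) s2_rep = "('k, 'v) module" +
  twist :: "'v \<Rightarrow> 'v"

definition s2_module :: "('k, 'm) ring_scheme \<Rightarrow> ('k, 'v) s2_rep \<Rightarrow> bool"
  where "s2_module K V \<longleftrightarrow> module K V \<and> twist V \<in> lin_hom K V V \<and>
    (\<forall>v\<in>carrier V. twist V (twist V v) = v)"

definition tensor_s2 ::
  "('k, 'm) ring_scheme \<Rightarrow> ('k, 'v) s2_rep \<Rightarrow> ('k, 'w) s2_rep \<Rightarrow> ('k, ('v \<times> 'w \<Rightarrow> 'k) set) s2_rep"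
  where "tensor_s2 K V W = module.extend (tensor K V W) (s2_rep.fields
    (\<lambda>X. \<Union>f\<in>X. bilin_rel K V W +>\<^bsub>free_module K (carrier V \<times> carrier W)\<^esub>
      lin_ext K (\<lambda>(v, w). (twist V v, twist W w)) f))"

text \<open>
  Planar binary trees with decorated vertices and labelled leaves. A \<open>Node v l r\<close> is \<open>v\<close> with \<open>l\<close>
  plugged into its first and \<open>r\<close> into its second input.
\<close>

datatype 'v tree = Leaf nat | Node 'v "'v tree" "'v tree"

primrec leaves :: "'v tree \<Rightarrow> nat list"
  where
    "leaves (Leaf i) = [i]"
  | "leaves (Node v l r) = leaves l @ leaves r"

primrec decorations :: "'v tree \<Rightarrow> 'v set"
  where
    "decorations (Leaf i) = {}"
  | "decorations (Node v l r) = insert v (decorations l \<union> decorations r)"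

primrec relabel :: "(nat \<Rightarrow> nat) \<Rightarrow> 'v tree \<Rightarrow> 'v tree"
  where
    "relabel h (Leaf i) = Leaf (h i)"
  | "relabel h (Node v l r) = Node v (relabel h l) (relabel h r)"

definition trees :: "'v set \<Rightarrow> nat \<Rightarrow> 'v tree set"
  where "trees D n = {t. decorations t \<subseteq> D \<and> distinct (leaves t) \<and> set (leaves t) = {1..n}}"

text \<open>
  \<open>graft [n\<^sub>1, \<dots>, n\<^sub>k] t [t\<^sub>1, \<dots>, t\<^sub>k]\<close> replaces the leaf \<open>i\<close> of \<open>t\<close> by \<open>t\<^sub>i\<close>, whose labels are shifted
  by \<open>n\<^sub>1 + \<dots> + n\<^bsub>i-1\<^esub>\<close>.
\<close>

primrec graft :: "nat list \<Rightarrow> 'v tree \<Rightarrow> 'v tree list \<Rightarrow> 'v tree"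
  where
    "graft ns (Leaf i) ts = relabel (\<lambda>j. sum_list (take (i - 1) ns) + j) (ts ! (i - 1))"
  | "graft ns (Node v l r) ts = Node v (graft ns l ts) (graft ns r ts)"

text \<open>
  In the convention \<open>(\<mu>\<sigma>)(x\<^sub>1, \<dots>, x\<^sub>n) = \<mu>(x\<^bsub>\<sigma>\<^sup>-\<^sup>1(1)\<^esub>, \<dots>, x\<^bsub>\<sigma>\<^sup>-\<^sup>1(n)\<^esub>)\<close> for right actions, the leaf \<open>i\<close>
  receives the label \<open>\<sigma>\<^sup>-\<^sup>1(i)\<close>.
\<close>

definition tree_operad :: "('k, 'm) ring_scheme \<Rightarrow> 'v set \<Rightarrow> ('k, 'v tree \<Rightarrow> 'k) operad"
  where "tree_operad K D = lin_operad K (trees D) (\<lambda>n \<sigma>. relabel (inv_into UNIV \<sigma>)) (Leaf 1) graft"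

text \<open>
  Turning the free operad on the set \<open>carrier V\<close> into the free operad on the representation \<open>V\<close>:
  decorations are made linear, and exchanging the two inputs of a vertex twists its decoration.
\<close>

definition decoration_rel ::
  "('k, 'm) ring_scheme \<Rightarrow> ('k, 'v) s2_rep \<Rightarrow> ('v tree \<Rightarrow> 'k) set"
  where "decoration_rel K V = (let F = space (tree_operad K (carrier V)) 2;
      \<tau> = (\<lambda>v. single K (Node v (Leaf 1) (Leaf 2))) in
    {\<tau> ((a \<odot>\<^bsub>V\<^esub> v) \<oplus>\<^bsub>V\<^esub> v') \<ominus>\<^bsub>F\<^esub> ((a \<odot>\<^bsub>F\<^esub> \<tau> v) \<oplus>\<^bsub>F\<^esub> \<tau> v') | a v v'.
      a \<in> carrier K \<and> v \<in> carrier V \<and> v' \<in> carrier V} \<union>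
    {single K (Node v (Leaf 2) (Leaf 1)) \<ominus>\<^bsub>F\<^esub> \<tau> (twist V v) | v. v \<in> carrier V})"

definition decoration_ideal ::
  "('k, 'm) ring_scheme \<Rightarrow> ('k, 'v) s2_rep \<Rightarrow> nat \<Rightarrow> ('v tree \<Rightarrow> 'k) set"
  where "decoration_ideal K V =
    gen_ideal K (tree_operad K (carrier V)) (\<lambda>n. if n = 2 then decoration_rel K V else {})"

definition free_operad ::
  "('k, 'm) ring_scheme \<Rightarrow> ('k, 'v) s2_rep \<Rightarrow> ('k, ('v tree \<Rightarrow> 'k) set) operad"
  where "free_operad K V = quot_operad (tree_operad K (carrier V)) (decoration_ideal K V)"

definition tree_class ::
  "('k, 'm) ring_scheme \<Rightarrow> ('k, 'v) s2_rep \<Rightarrow> nat \<Rightarrow> 'v tree \<Rightarrow> ('v tree \<Rightarrow> 'k) set"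
  where "tree_class K V n t =
    decoration_ideal K V n +>\<^bsub>space (tree_operad K (carrier V)) n\<^esub> single K t"

text \<open>The element \<open>v'(v(i, j), k)\<close> of \<open>\<F>(V)(3)\<close>, with root \<open>v'\<close> and inner vertex \<open>v\<close>.\<close>

definition comb ::
  "('k, 'm) ring_scheme \<Rightarrow> ('k, 'v) s2_rep \<Rightarrow> 'v \<Rightarrow> 'v \<Rightarrow> nat \<Rightarrow> nat \<Rightarrow> nat \<Rightarrow> ('v tree \<Rightarrow> 'k) set"
  where "comb K V v' v i j k = tree_class K V 3 (Node v' (Node v (Leaf i) (Leaf j)) (Leaf k))"


section \<open>Binary quadratic operads and their white product\<close>

text \<open>
  With binary generators the trees with two vertices are exactly those with three leaves, so
  relations are elements of \<open>space (free_operad K V) 3\<close>.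
\<close>

definition relation_ideal ::
  "('k, 'm) ring_scheme \<Rightarrow> ('k, 'v) s2_rep \<Rightarrow> ('v tree \<Rightarrow> 'k) set set \<Rightarrow> nat \<Rightarrow> ('v tree \<Rightarrow> 'k) set set"
  where "relation_ideal K V R = gen_ideal K (free_operad K V) (\<lambda>n. if n = 3 then R else {})"

definition quadratic_operad ::
  "('k, 'm) ring_scheme \<Rightarrow> ('k, 'v) s2_rep \<Rightarrow> ('v tree \<Rightarrow> 'k) set set
    \<Rightarrow> ('k, ('v tree \<Rightarrow> 'k) set set) operad"
  where "quadratic_operad K V R = quot_operad (free_operad K V) (relation_ideal K V R)"

definition generator ::
  "('k, 'm) ring_scheme \<Rightarrow> ('k, 'v) s2_rep \<Rightarrow> ('v tree \<Rightarrow> 'k) set set \<Rightarrow> 'v \<Rightarrow> ('v tree \<Rightarrow> 'k) set set"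
  where "generator K V R v = relation_ideal K V R 2 +>\<^bsub>space (free_operad K V) 2\<^esub>
    tree_class K V 2 (Node v (Leaf 1) (Leaf 2))"

text \<open>
  The linear map \<open>\<Phi>\<close>. Its values on the carrier are determined by the condition below, since the
  trees \<open>v'(v(i, j), k)\<close> decorated by elementary tensors span the free operad in arity 3.
\<close>

definition white_map ::
  "('k, 'm) ring_scheme \<Rightarrow> ('k, 'v) s2_rep \<Rightarrow> ('k, 'w) s2_rep
    \<Rightarrow> ((('v \<times> 'w \<Rightarrow> 'k) set tree \<Rightarrow> 'k) set)
    \<Rightarrow> (('v tree \<Rightarrow> 'k) set \<times> ('w tree \<Rightarrow> 'k) set \<Rightarrow> 'k) set"
  where "white_map K V W = (let FV = space (free_operad K V) 3; FW = space (free_operad K W) 3 in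
    SOME \<phi>. \<phi> \<in> lin_hom K (space (free_operad K (tensor_s2 K V W)) 3) (tensor K FV FW) \<and>
      (\<forall>v'\<in>carrier V. \<forall>w'\<in>carrier W. \<forall>v\<in>carrier V. \<forall>w\<in>carrier W.
       \<forall>i j k. distinct [i, j, k] \<and> {i, j, k} = {1..3} \<longrightarrow>
        \<phi> (comb K (tensor_s2 K V W) (tens K V W v' w') (tens K V W v w) i j k) =
          tens K FV FW (comb K V v' v i j k) (comb K W w' w i j k)))"

definition white_rel ::
  "('k, 'm) ring_scheme \<Rightarrow> ('k, 'v) s2_rep \<Rightarrow> ('v tree \<Rightarrow> 'k) set set
    \<Rightarrow> ('k, 'w) s2_rep \<Rightarrow> ('w tree \<Rightarrow> 'k) set set \<Rightarrow> (('v \<times> 'w \<Rightarrow> 'k) set tree \<Rightarrow> 'k) set set"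
  where "white_rel K V R W S = (let FV = space (free_operad K V) 3; FW = space (free_operad K W) 3 in
    {x \<in> carrier (space (free_operad K (tensor_s2 K V W)) 3).
      white_map K V W x \<in> lin_span K (tensor K FV FW)
        ({tens K FV FW r y | r y. r \<in> S_span K (free_operad K V) 3 R \<and> y \<in> carrier FW} \<union>
         {tens K FV FW y s | y s. y \<in> carrier FV \<and> s \<in> S_span K (free_operad K W) 3 S})})"

definition white_product ::
  "('k, 'm) ring_scheme \<Rightarrow> ('k, 'v) s2_rep \<Rightarrow> ('v tree \<Rightarrow> 'k) set set
    \<Rightarrow> ('k, 'w) s2_rep \<Rightarrow> ('w tree \<Rightarrow> 'k) set set
    \<Rightarrow> ('k, (('v \<times> 'w \<Rightarrow> 'k) set tree \<Rightarrow> 'k) set set) operad"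
  where "white_product K V R W S = quadratic_operad K (tensor_s2 K V W) (white_rel K V R W S)"

text \<open>
  A morphism from the white product to the Hadamard product is canonical if in arity 2 it is the
  identity on generators, i.e. it maps the generator \<open>v \<otimes> w\<close> to the tensor product of the
  generators \<open>v\<close> and \<open>w\<close>.
\<close>

definition canonical_morphism ::
  "('k, 'm) ring_scheme \<Rightarrow> ('k, 'v) s2_rep \<Rightarrow> ('v tree \<Rightarrow> 'k) set set
    \<Rightarrow> ('k, 'w) s2_rep \<Rightarrow> ('w tree \<Rightarrow> 'k) set set
    \<Rightarrow> (nat \<Rightarrow> (('v \<times> 'w \<Rightarrow> 'k) set tree \<Rightarrow> 'k) set set
             \<Rightarrow> (('v tree \<Rightarrow> 'k) set set \<times> ('w tree \<Rightarrow> 'k) set set \<Rightarrow> 'k) set) \<Rightarrow> bool"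
  where "canonical_morphism K V R W S f \<longleftrightarrow>
    (let P = quadratic_operad K V R; Q = quadratic_operad K W S in
      operad_hom K (white_product K V R W S) (hadamard K P Q) f \<and>
      (\<forall>v\<in>carrier V. \<forall>w\<in>carrier W.
        f 2 (generator K (tensor_s2 K V W) (white_rel K V R W S) (tens K V W v w)) =
          tens K (space P 2) (space Q 2) (generator K V R v) (generator K W S w)))"


section \<open>The operad of two totally compatible commutative associative products\<close>

datatype colour = White | Black

text \<open>The two generating operations are symmetric, so the transposition acts trivially.\<close>

definition com2_gens :: "('k, 'm) ring_scheme \<Rightarrow> ('k, colour \<Rightarrow> 'k) s2_rep"
  where "com2_gens K = module.extend (free_module K UNIV) (s2_rep.fields (\<lambda>x. x))"

text \<open>The three trees \<open>c(d(1, 2), 3)\<close>, \<open>c(d(2, 3), 1)\<close>, \<open>c(d(3, 1), 2)\<close>.\<close>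

definition com2_trees ::
  "('k, 'm) ring_scheme \<Rightarrow> colour \<Rightarrow> colour \<Rightarrow> ((colour \<Rightarrow> 'k) tree \<Rightarrow> 'k) set set"
  where "com2_trees K c d = (\<lambda>(i, j, k). comb K (com2_gens K) (single K c) (single K d) i j k) `
    {(1, 2, 3), (2, 3, 1), (3, 1, 2)}"

definition com2_rels :: "('k, 'm) ring_scheme \<Rightarrow> ((colour \<Rightarrow> 'k) tree \<Rightarrow> 'k) set set"
  where "com2_rels K =
    {x \<ominus>\<^bsub>space (free_operad K (com2_gens K)) 3\<^esub> y | x y.
      (x \<in> com2_trees K White White \<and> y \<in> com2_trees K White White) \<or>
      (x \<in> com2_trees K Black Black \<and> y \<in> com2_trees K Black Black) \<or>
      (x \<in> com2_trees K Black White \<union> com2_trees K White Black \<and>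
       y \<in> com2_trees K Black White \<union> com2_trees K White Black)}"

definition com2 :: "('k, 'm) ring_scheme \<Rightarrow> ('k, ((colour \<Rightarrow> 'k) tree \<Rightarrow> 'k) set set) operad"
  where "com2 K = quadratic_operad K (com2_gens K) (com2_rels K)"

end

(* Put a second "colour" on the vertices. By the relations of 2Com, the class of a tree with
   vertices coloured white or black depends only on its number of leaves and on its number k of
   black vertices, and the classes for different k are linearly independent: sending white to 1
   and black to t maps 2Com(n) to polynomials, with images 1, t, ..., t^(n-1).

   Trees decorated by V and coloured span the white product. The tensor of the class of a
   V-tree s in O with the k-th class in 2Com is the image of s with any k of its vertices black,
   which gives surjectivity. For injectivity, the equality of any two colourings of s with the
   same k holds already in the white product, since in arity 3 their difference lies in the
   preimage of F(V) (x) S. So there is a well-defined section sigma_k sending s to s with k black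
   vertices. The z in the free operad on V with sigma_k z = 0 for all k form an operadic ideal,
   because colouring a composite amounts to distributing the k black vertices over its factors;
   in arity 3 this ideal contains R by the definition of the white product, so it contains the
   kernel of the map to O. If f x = 0, extracting the coefficient of t^k shows that the part of
   x with k black vertices vanishes in O once colours are forgotten, so its image under sigma_k,
   and hence x, is zero. *)
theory Submission
  imports Defs "HOL-Algebra.UnivPoly"
begin

section \<open>Linear maps, quotients, free modules and tensor products with explicit
  carriers\<close>

section \<open>Linear algebra\<close>

subsection \<open>Linear maps and submodules\<close>

text \<open>Rewriting inside a tree is the main obstacle: a subtree carries an arbitrary set of
  labels, while the spaces of the tree operad contain only trees labelled by an initial interval.
  \<open>tree_val\<close> evaluates a morphism after standardizing the labels, and
  \<open>tree_val_plug\<close> shows that the result depends on the plugged-in trees only through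
  their leaf sets and values. Identities in arity 3 thereby apply at any two adjacent vertices. A
  second obstacle is that decorations in the tensor product need not be elementary; expanding every
  vertex into a white and a black part (\<open>redecorate\<close> along \<open>colour_split\<close>)
  yields both the map to the Hadamard product and the map \<open>\<Phi>\<close>. Finally, the
  colouring with a fixed number of black vertices need not be a morphism: colouring a composite uses
  other numbers on its factors, so the ideal has to ask for all numbers below the arity at once. A
  tree with n leaves has n - 1 vertices, and such numbers can be distributed over a composite as
  long as no factor has arity 0, where the space of trees is zero.\<close>

lemma lin_hom_iff:
  "f \<in> lin_hom K M N \<longleftrightarrow>
    (\<forall>x\<in>carrier M. f x \<in> carrier N) \<and>
    (\<forall>x\<in>carrier M. \<forall>y\<in>carrier M. f (x \<oplus>\<^bsub>M\<^esub> y) = f x \<oplus>\<^bsub>N\<^esub> f y) \<and>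
    (\<forall>a\<in>carrier K. \<forall>x\<in>carrier M. f (a \<odot>\<^bsub>M\<^esub> x) = a \<odot>\<^bsub>N\<^esub> f x)"
  unfolding lin_hom_def hom_def by auto

lemma lin_homI:
  assumes "\<And>x. x \<in> carrier M \<Longrightarrow> f x \<in> carrier N"
    and "\<And>x y. x \<in> carrier M \<Longrightarrow> y \<in> carrier M \<Longrightarrow> f (x \<oplus>\<^bsub>M\<^esub> y) = f x \<oplus>\<^bsub>N\<^esub> f y"
    and "\<And>a x. a \<in> carrier K \<Longrightarrow> x \<in> carrier M \<Longrightarrow> f (a \<odot>\<^bsub>M\<^esub> x) = a \<odot>\<^bsub>N\<^esub> f x"
  shows "f \<in> lin_hom K M N"
  using assms by (simp add: lin_hom_iff)

lemma lin_hom_closed: "f \<in> lin_hom K M N \<Longrightarrow> x \<in> carrier M \<Longrightarrow> f x \<in> carrier N"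
  and lin_hom_add: "f \<in> lin_hom K M N \<Longrightarrow> x \<in> carrier M \<Longrightarrow> y \<in> carrier M \<Longrightarrow>
    f (x \<oplus>\<^bsub>M\<^esub> y) = f x \<oplus>\<^bsub>N\<^esub> f y"
  and lin_hom_smult: "f \<in> lin_hom K M N \<Longrightarrow> a \<in> carrier K \<Longrightarrow> x \<in> carrier M \<Longrightarrow>
    f (a \<odot>\<^bsub>M\<^esub> x) = a \<odot>\<^bsub>N\<^esub> f x"
  by (simp_all add: lin_hom_iff)

lemma lin_hom_cong:
  assumes "module K M" "f \<in> lin_hom K M N" "\<And>x. x \<in> carrier M \<Longrightarrow> f x = g x"
  shows "g \<in> lin_hom K M N"
proof -
  interpret module K M by fact
  show ?thesis
  proof (rule lin_homI)
    fix x y a assume x: "x \<in> carrier M"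
    show "g x \<in> carrier N" using lin_hom_closed[OF assms(2) x] assms(3)[OF x] by simp
    show "g (x \<oplus>\<^bsub>M\<^esub> y) = g x \<oplus>\<^bsub>N\<^esub> g y" if y: "y \<in> carrier M"
      using lin_hom_add[OF assms(2) x y] assms(3)[OF x] assms(3)[OF y] assms(3)[OF M.a_closed[OF x y]]
      by simp
    show "g (a \<odot>\<^bsub>M\<^esub> x) = a \<odot>\<^bsub>N\<^esub> g x" if a: "a \<in> carrier K"
      using lin_hom_smult[OF assms(2) a x] assms(3)[OF x] assms(3)[OF smult_closed[OF a x]]
      by simp
  qed
qed

lemma lin_hom_compose:
  assumes "f \<in> lin_hom K M N" "g \<in> lin_hom K N L"
  shows "(\<lambda>x. g (f x)) \<in> lin_hom K M L"
  using assms by (simp add: lin_hom_iff)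

lemma lin_hom_zero:
  assumes "module K M" "module K N" "f \<in> lin_hom K M N"
  shows "f \<zero>\<^bsub>M\<^esub> = \<zero>\<^bsub>N\<^esub>"
proof -
  interpret M: module K M by fact
  interpret N: module K N by fact
  have "f (\<zero>\<^bsub>K\<^esub> \<odot>\<^bsub>M\<^esub> \<zero>\<^bsub>M\<^esub>) = \<zero>\<^bsub>K\<^esub> \<odot>\<^bsub>N\<^esub> f \<zero>\<^bsub>M\<^esub>"
    using assms(3) by (intro lin_hom_smult) auto
  then show ?thesis using lin_hom_closed[OF assms(3)] by simp
qed

lemma (in module) a_inv_smult: "x \<in> carrier M \<Longrightarrow> \<ominus>\<^bsub>M\<^esub> x = (\<ominus> \<one>) \<odot>\<^bsub>M\<^esub> x"
  by (simp add: smult_l_minus)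

lemma lin_hom_diff:
  assumes "module K M" "module K N" "f \<in> lin_hom K M N" "x \<in> carrier M" "y \<in> carrier M"
  shows "f (x \<ominus>\<^bsub>M\<^esub> y) = f x \<ominus>\<^bsub>N\<^esub> f y"
proof -
  interpret M: module K M by fact
  interpret N: module K N by fact
  note [simp] = lin_hom_closed[OF assms(3)] lin_hom_add[OF assms(3)] lin_hom_smult[OF assms(3)]
  show ?thesis using assms(4,5)
    by (simp add: M.minus_eq N.minus_eq M.a_inv_smult N.a_inv_smult)
qed

lemma (in module) diff_zero_iff:
  assumes "x \<in> carrier M" "y \<in> carrier M"
  shows "x \<ominus>\<^bsub>M\<^esub> y = \<zero>\<^bsub>M\<^esub> \<longleftrightarrow> x = y"
proof
  assume "x \<ominus>\<^bsub>M\<^esub> y = \<zero>\<^bsub>M\<^esub>"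
  then have "\<ominus>\<^bsub>M\<^esub> y = \<ominus>\<^bsub>M\<^esub> x"
    using assms by (metis M.a_comm M.a_inv_closed M.minus_equality M.minus_eq)
  then show "x = y" using assms by (metis M.minus_minus)
qed (use assms in \<open>simp add: M.minus_eq M.r_neg\<close>)

lemma (in module) submodule_iff:
  "submodule H R M \<longleftrightarrow> H \<subseteq> carrier M \<and> \<zero>\<^bsub>M\<^esub> \<in> H \<and>
    (\<forall>x\<in>H. \<forall>y\<in>H. x \<oplus>\<^bsub>M\<^esub> y \<in> H) \<and> (\<forall>a\<in>carrier R. \<forall>x\<in>H. a \<odot>\<^bsub>M\<^esub> x \<in> H)"
proof
  assume H: "submodule H R M"
  then have "\<zero>\<^bsub>M\<^esub> \<in> H"
    using submodule.axioms(1) subgroup.one_closed by fastforce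
  then show "H \<subseteq> carrier M \<and> \<zero>\<^bsub>M\<^esub> \<in> H \<and>
    (\<forall>x\<in>H. \<forall>y\<in>H. x \<oplus>\<^bsub>M\<^esub> y \<in> H) \<and> (\<forall>a\<in>carrier R. \<forall>x\<in>H. a \<odot>\<^bsub>M\<^esub> x \<in> H)"
    using submoduleE[OF H] by auto
next
  assume H: "H \<subseteq> carrier M \<and> \<zero>\<^bsub>M\<^esub> \<in> H \<and>
    (\<forall>x\<in>H. \<forall>y\<in>H. x \<oplus>\<^bsub>M\<^esub> y \<in> H) \<and> (\<forall>a\<in>carrier R. \<forall>x\<in>H. a \<odot>\<^bsub>M\<^esub> x \<in> H)"
  then show "submodule H R M"
    by (intro submoduleI) (auto simp: a_inv_smult subset_iff)
qed

lemma submodule_vimage: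
  assumes "module K M" "module K N" "f \<in> lin_hom K M N" "submodule H K N"
  shows "submodule {x \<in> carrier M. f x \<in> H} K M"
proof -
  interpret M: module K M by fact
  interpret N: module K N by fact
  show ?thesis using assms(3,4) lin_hom_zero[OF assms(1-3)]
    unfolding M.submodule_iff N.submodule_iff
    by (auto simp: lin_hom_iff)
qed

lemma submodule_equaliser:
  assumes "module K M" "module K N" "f \<in> lin_hom K M N" "g \<in> lin_hom K M N"
  shows "submodule {x \<in> carrier M. f x = g x} K M"
proof -
  interpret M: module K M by fact
  interpret N: module K N by fact
  show ?thesis using assms(3,4) lin_hom_zero[OF assms(1-3)] lin_hom_zero[OF assms(1,2,4)]
    unfolding M.submodule_iff by (auto simp: lin_hom_iff)
qed

lemma zero_lin_hom:
  assumes "module K M" "module K N"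
  shows "(\<lambda>x. \<zero>\<^bsub>N\<^esub>) \<in> lin_hom K M N"
proof -
  interpret N: module K N by fact
  show ?thesis by (simp add: lin_hom_iff)
qed

lemma submodule_kernel:
  assumes "module K M" "module K N" "f \<in> lin_hom K M N"
  shows "submodule {x \<in> carrier M. f x = \<zero>\<^bsub>N\<^esub>} K M"
  using submodule_equaliser[OF assms zero_lin_hom[OF assms(1,2)]] .

lemma submodule_Inter:
  assumes "module K M" "\<H> \<noteq> {}" "\<And>H. H \<in> \<H> \<Longrightarrow> submodule H K M"
  shows "submodule (\<Inter>\<H>) K M"
proof -
  interpret module K M by fact
  show ?thesis using assms(2,3) unfolding submodule_iff by blast
qed

lemma submodule_image:
  assumes "module K M" "module K N" "f \<in> lin_hom K M N" "submodule H K M"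
  shows "submodule (f ` H) K N"
proof -
  interpret M: module K M by fact
  interpret N: module K N by fact
  have H: "H \<subseteq> carrier M" "\<zero>\<^bsub>M\<^esub> \<in> H" "\<And>x y. x \<in> H \<Longrightarrow> y \<in> H \<Longrightarrow> x \<oplus>\<^bsub>M\<^esub> y \<in> H"
    "\<And>a x. a \<in> carrier K \<Longrightarrow> x \<in> H \<Longrightarrow> a \<odot>\<^bsub>M\<^esub> x \<in> H"
    using assms(4) unfolding M.submodule_iff by auto
  note hom = lin_hom_closed[OF assms(3)] lin_hom_add[OF assms(3), symmetric]
    lin_hom_smult[OF assms(3), symmetric]
  show ?thesis unfolding N.submodule_iff
  proof (intro conjI ballI)
    show "\<zero>\<^bsub>N\<^esub> \<in> f ` H" using H(2) lin_hom_zero[OF assms(1-3)] by (metis imageI)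
    show "f ` H \<subseteq> carrier N" using H(1) hom(1) by blast
    show "x \<oplus>\<^bsub>N\<^esub> y \<in> f ` H" if "x \<in> f ` H" "y \<in> f ` H" for x y
      using that H hom(2) by (auto simp: subset_iff)
    show "a \<odot>\<^bsub>N\<^esub> x \<in> f ` H" if "a \<in> carrier K" "x \<in> f ` H" for a x
      using that H hom(3) by (auto simp: subset_iff)
  qed
qed

lemma submodule_lin_span:
  assumes "module K M" "G \<subseteq> carrier M"
  shows "submodule (lin_span K M G) K M"
  unfolding lin_span_def
  using assms module.carrier_is_submodule[OF assms(1)] by (intro submodule_Inter) auto

lemma lin_span_superset: "G \<subseteq> lin_span K M G"
  unfolding lin_span_def by auto

lemma lin_span_least: "submodule H K M \<Longrightarrow> G \<subseteq> H \<Longrightarrow> lin_span K M G \<subseteq> H"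
  unfolding lin_span_def by auto

lemma lin_span_carrier:
  assumes "module K M" "G \<subseteq> carrier M"
  shows "lin_span K M G \<subseteq> carrier M"
  using lin_span_least[OF module.carrier_is_submodule[OF assms(1)] assms(2)] .

lemma lin_hom_eq_on_span:
  assumes "module K M" "module K N" "f \<in> lin_hom K M N" "g \<in> lin_hom K M N"
    and "G \<subseteq> carrier M" "\<And>x. x \<in> G \<Longrightarrow> f x = g x" "x \<in> lin_span K M G"
  shows "f x = g x"
  using lin_span_least[OF submodule_equaliser[OF assms(1-4)], of G] assms(5-7) by blast

lemma submodule_abelian_subgroup:
  assumes "module K M" "submodule N K M"
  shows "abelian_subgroup N M"
proof -
  interpret module K M by fact
  show ?thesis
    by (rule abelian_subgroupI3)
      (use assms(2) in \<open>auto simp: additive_subgroup_def submodule_def M.abelian_group_axioms\<close>)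
qed

subsection \<open>Quotient modules\<close>

context
  fixes K :: "('k, 'm) ring_scheme" and M :: "('k, 'a, 'p) module_scheme" and N :: "'a set"
  assumes M: "module K M" and N: "submodule N K M"
begin

interpretation M: module K M by (rule M)
interpretation N: abelian_subgroup N M by (rule submodule_abelian_subgroup[OF M N])

lemma coset_eq_iff:
  assumes "x \<in> carrier M" "y \<in> carrier M"
  shows "N +>\<^bsub>M\<^esub> x = N +>\<^bsub>M\<^esub> y \<longleftrightarrow> x \<ominus>\<^bsub>M\<^esub> y \<in> N"
proof
  assume "N +>\<^bsub>M\<^esub> x = N +>\<^bsub>M\<^esub> y"
  then have "x \<in> N +>\<^bsub>M\<^esub> y" using N.a_rcos_self[OF assms(1)] by simp
  then show "x \<ominus>\<^bsub>M\<^esub> y \<in> N" using N.a_rcos_module_imp[OF assms(2)] by (simp add: M.minus_eq)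
next
  assume "x \<ominus>\<^bsub>M\<^esub> y \<in> N"
  then have "x \<in> N +>\<^bsub>M\<^esub> y" using N.a_rcos_module_rev[OF assms(2,1)] by (simp add: M.minus_eq)
  then show "N +>\<^bsub>M\<^esub> x = N +>\<^bsub>M\<^esub> y"
    using N.a_repr_independence'[of x y] assms by simp
qed

lemma coset_zero: "N +>\<^bsub>M\<^esub> \<zero>\<^bsub>M\<^esub> = N"
  by (simp add: N.a_subset)

lemma coset_eq_zero_iff:
  assumes "x \<in> carrier M"
  shows "N +>\<^bsub>M\<^esub> x = N \<longleftrightarrow> x \<in> N"
  using coset_eq_iff[OF assms M.zero_closed] assms
    by (simp add: coset_zero M.minus_eq M.a_inv_smult)

lemma quot_module_simps:
  "carrier (quot_module M N) = (\<lambda>x. N +>\<^bsub>M\<^esub> x) ` carrier M"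
  "\<zero>\<^bsub>quot_module M N\<^esub> = N"
  by (auto simp: quot_module_def A_RCOSETS_def')

lemma mem_coset_iff:
  assumes "x \<in> carrier M"
  shows "y \<in> N +>\<^bsub>M\<^esub> x \<longleftrightarrow> y \<in> carrier M \<and> N +>\<^bsub>M\<^esub> y = N +>\<^bsub>M\<^esub> x"
  using N.a_elemrcos_carrier[OF assms] N.a_repr_independence'[OF _ assms] N.a_rcos_self
  by metis

lemma coset_self: "x \<in> carrier M \<Longrightarrow> x \<in> N +>\<^bsub>M\<^esub> x"
  by (rule N.a_rcos_self)

lemma quot_module_add:
  assumes "x \<in> carrier M" "y \<in> carrier M"
  shows "(N +>\<^bsub>M\<^esub> x) \<oplus>\<^bsub>quot_module M N\<^esub> (N +>\<^bsub>M\<^esub> y) = N +>\<^bsub>M\<^esub> (x \<oplus>\<^bsub>M\<^esub> y)"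
  using N.a_rcos_sum[OF assms] by (simp add: quot_module_def)

text \<open>The operations of a quotient are encoded as unions over all representatives. Such a
  union collapses to one of its members because the coset is nonempty and all members agree.\<close>

lemma UN_coset_cong:
  assumes "\<And>y. y \<in> carrier M \<Longrightarrow> y \<ominus>\<^bsub>M\<^esub> x \<in> N \<Longrightarrow> h y = h x" "x \<in> carrier M"
  shows "(\<Union>y\<in>N +>\<^bsub>M\<^esub> x. h y) = h x"
proof -
  have "h y = h x" if "y \<in> N +>\<^bsub>M\<^esub> x" for y
  proof -
    have "y \<in> carrier M" "N +>\<^bsub>M\<^esub> y = N +>\<^bsub>M\<^esub> x"
      using that mem_coset_iff[OF assms(2)] by simp_all
    then show ?thesis using coset_eq_iff[of y x] assms by simp
  qed
  moreover have "N +>\<^bsub>M\<^esub> x \<noteq> {}" using coset_self[OF assms(2)] by force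
  ultimately show ?thesis by simp
qed

lemma UN_coset:
  assumes "module K M'" "submodule N' K M'" "f \<in> lin_hom K M M'"
    and "\<And>x. x \<in> N \<Longrightarrow> f x \<in> N'" "x \<in> carrier M"
  shows "(\<Union>y\<in>N +>\<^bsub>M\<^esub> x. N' +>\<^bsub>M'\<^esub> f y) = N' +>\<^bsub>M'\<^esub> f x"
proof (rule UN_coset_cong[OF _ assms(5)])
  fix y assume y: "y \<in> carrier M" "y \<ominus>\<^bsub>M\<^esub> x \<in> N"
  interpret M': module K M' by fact
  interpret N': abelian_subgroup N' M' by (rule submodule_abelian_subgroup[OF assms(1,2)])
  have "f y \<ominus>\<^bsub>M'\<^esub> f x \<in> N'"
    using assms(4)[OF y(2)] lin_hom_diff[OF M assms(1,3) y(1) assms(5)] by simp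
  then have "f y \<in> N' +>\<^bsub>M'\<^esub> f x"
    using N'.a_rcos_module_rev lin_hom_closed[OF assms(3)] y(1) assms(5) by (simp add: M'.minus_eq)
  then show "N' +>\<^bsub>M'\<^esub> f y = N' +>\<^bsub>M'\<^esub> f x"
    using N'.a_repr_independence' lin_hom_closed[OF assms(3)] assms(5) by metis
qed

lemma smult_lin_hom:
  assumes "a \<in> carrier K"
  shows "(\<lambda>x. a \<odot>\<^bsub>M\<^esub> x) \<in> lin_hom K M M"
  using assms by (auto simp: lin_hom_iff M.smult_r_distr M.smult_assoc1[symmetric] M.R.m_comm)

lemma quot_module_smult:
  assumes "a \<in> carrier K" "x \<in> carrier M"
  shows "a \<odot>\<^bsub>quot_module M N\<^esub> (N +>\<^bsub>M\<^esub> x) = N +>\<^bsub>M\<^esub> (a \<odot>\<^bsub>M\<^esub> x)"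
  unfolding quot_module_def module.select_convs
  using N assms by (intro UN_coset[OF M N smult_lin_hom]) (auto simp: M.submodule_iff)

lemma module_quot: "module K (quot_module M N)"
proof (rule moduleI)
  show "abelian_group (quot_module M N)"
  proof (rule abelian_groupI)
    fix x assume "x \<in> carrier (quot_module M N)"
    then obtain y where "y \<in> carrier M" "x = N +>\<^bsub>M\<^esub> y" by (auto simp: quot_module_simps)
    then have "(N +>\<^bsub>M\<^esub> (\<ominus>\<^bsub>M\<^esub> y)) \<oplus>\<^bsub>quot_module M N\<^esub> x = \<zero>\<^bsub>quot_module M N\<^esub>"
      using coset_zero by (simp add: quot_module_add quot_module_simps M.l_neg)
    then show "\<exists>y\<in>carrier (quot_module M N). y \<oplus>\<^bsub>quot_module M N\<^esub> x = \<zero>\<^bsub>quot_module M N\<^esub>"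
      using \<open>y \<in> carrier M\<close> by (auto simp: quot_module_simps)
  next
    show "\<zero>\<^bsub>quot_module M N\<^esub> \<in> carrier (quot_module M N)"
      using coset_zero by (force simp: quot_module_simps)
    fix x assume "x \<in> carrier (quot_module M N)"
    then obtain y where y: "y \<in> carrier M" "x = N +>\<^bsub>M\<^esub> y" by (auto simp: quot_module_simps)
    then have "(N +>\<^bsub>M\<^esub> \<zero>\<^bsub>M\<^esub>) \<oplus>\<^bsub>quot_module M N\<^esub> x = x"
      by (simp add: quot_module_add del: M.a_coset_add_zero)
    then show "\<zero>\<^bsub>quot_module M N\<^esub> \<oplus>\<^bsub>quot_module M N\<^esub> x = x"
      using coset_zero by (simp add: quot_module_simps)
  qed (auto simp: quot_module_simps quot_module_add M.a_ac)
qed (auto simp: quot_module_simps quot_module_add quot_module_smult M.R.cring_axioms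
      M.smult_l_distr M.smult_r_distr M.smult_assoc1)

lemma coset_lin_hom: "(\<lambda>x. N +>\<^bsub>M\<^esub> x) \<in> lin_hom K M (quot_module M N)"
  by (auto simp: lin_hom_iff quot_module_simps quot_module_add quot_module_smult)

text \<open>The lift evaluates \<open>f\<close> at an arbitrary representative; two representatives
  differ by an element of \<open>N\<close>, which \<open>f\<close> kills.\<close>

lemma quot_module_lift:
  assumes "module K L" "f \<in> lin_hom K M L" "\<And>x. x \<in> N \<Longrightarrow> f x = \<zero>\<^bsub>L\<^esub>"
  obtains g where "g \<in> lin_hom K (quot_module M N) L" "\<And>x. x \<in> carrier M \<Longrightarrow> g (N +>\<^bsub>M\<^esub> x) = f x"
proof -
  interpret L: module K L by fact
  define g where "g X = f (SOME x. x \<in> X)" for X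
  have g: "g (N +>\<^bsub>M\<^esub> x) = f x" if x: "x \<in> carrier M" for x
  proof -
    define y where "y = (SOME y. y \<in> N +>\<^bsub>M\<^esub> x)"
    have "y \<in> N +>\<^bsub>M\<^esub> x" unfolding y_def using someI_ex coset_self[OF x] by metis
    then have y: "y \<in> carrier M" "y \<ominus>\<^bsub>M\<^esub> x \<in> N" using mem_coset_iff[OF x] coset_eq_iff[OF _ x] by auto
    have "f y \<ominus>\<^bsub>L\<^esub> f x = \<zero>\<^bsub>L\<^esub>"
      using assms(3)[OF y(2)] lin_hom_diff[OF M assms(1,2) y(1) x] by simp
    then show ?thesis unfolding g_def y_def[symmetric]
      using L.diff_zero_iff lin_hom_closed[OF assms(2)] x y(1) by simp
  qed
  moreover have "g \<in> lin_hom K (quot_module M N) L"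
    using assms(2) g by (auto simp: lin_hom_iff quot_module_simps quot_module_add quot_module_smult)
  ultimately show ?thesis using that by blast
qed

end

subsection \<open>Free modules\<close>

lemma free_module_simps:
  "f \<in> carrier (free_module K X) \<longleftrightarrow> range f \<subseteq> carrier K \<and> finite (supp K f) \<and> supp K f \<subseteq> X"
  "\<zero>\<^bsub>free_module K X\<^esub> = (\<lambda>x. \<zero>\<^bsub>K\<^esub>)"
  "f \<oplus>\<^bsub>free_module K X\<^esub> g = (\<lambda>x. f x \<oplus>\<^bsub>K\<^esub> g x)"
  "a \<odot>\<^bsub>free_module K X\<^esub> f = (\<lambda>x. a \<otimes>\<^bsub>K\<^esub> f x)"
  by (simp_all add: free_module_def)

context
  fixes K :: "('k, 'm) ring_scheme"
  assumes K: "cring K"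
begin

interpretation K: cring K by (rule K)

lemma supp_add_subset:
  assumes "f \<in> carrier (free_module K X)" "g \<in> carrier (free_module K X)"
  shows "supp K (\<lambda>x. f x \<oplus>\<^bsub>K\<^esub> g x) \<subseteq> supp K f \<union> supp K g"
  using assms by (auto simp: supp_def)

lemma supp_smult_subset:
  assumes "a \<in> carrier K" "f \<in> carrier (free_module K X)"
  shows "supp K (\<lambda>x. a \<otimes>\<^bsub>K\<^esub> f x) \<subseteq> supp K f"
  using assms by (auto simp: supp_def)

lemma module_free: "module K (free_module K X)"
proof (rule moduleI)
  let ?F = "free_module K X"
  have r: "f x \<in> carrier K" if "f \<in> carrier ?F" for f x
    using that by (auto simp: free_module_simps)
  have add: "f \<oplus>\<^bsub>?F\<^esub> g \<in> carrier ?F" if fg: "f \<in> carrier ?F" "g \<in> carrier ?F" for f g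
    using fg supp_add_subset[OF fg] r[OF fg(1)] r[OF fg(2)] unfolding free_module_simps
    by (auto intro: finite_subset intro!: K.a_closed)
  have smult: "a \<odot>\<^bsub>?F\<^esub> f \<in> carrier ?F" if af: "a \<in> carrier K" "f \<in> carrier ?F" for a f
    using af supp_smult_subset[OF af] r[OF af(2)] unfolding free_module_simps
    by (auto intro: finite_subset intro!: K.m_closed)
  show "abelian_group ?F"
  proof (rule abelian_groupI)
    fix f assume f: "f \<in> carrier ?F"
    then have "((\<ominus>\<^bsub>K\<^esub> \<one>\<^bsub>K\<^esub>) \<odot>\<^bsub>?F\<^esub> f) \<oplus>\<^bsub>?F\<^esub> f = \<zero>\<^bsub>?F\<^esub>"
      using r[OF f] by (auto simp: free_module_simps K.l_minus K.l_neg)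
    then show "\<exists>g\<in>carrier ?F. g \<oplus>\<^bsub>?F\<^esub> f = \<zero>\<^bsub>?F\<^esub>"
      using smult[OF _ f] by blast
  next
    show "\<zero>\<^bsub>?F\<^esub> \<in> carrier ?F" by (auto simp: free_module_simps supp_def)
  qed (use add r in \<open>auto simp: free_module_simps(2,3) K.a_ac\<close>)
  show "a \<odot>\<^bsub>?F\<^esub> f \<in> carrier ?F" if "a \<in> carrier K" "f \<in> carrier ?F" for a f
    using smult that by blast
qed (auto simp: free_module_simps K.cring_axioms K.l_distr K.r_distr K.m_assoc subset_iff)

lemma single_closed: "x \<in> X \<Longrightarrow> single K x \<in> carrier (free_module K X)"
proof -
  assume "x \<in> X"
  moreover have "supp K (single K x) \<subseteq> {x}" by (auto simp: supp_def single_def)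
  ultimately show ?thesis
    by (auto simp: free_module_simps single_def intro: finite_subset)
qed

text \<open>Induction on a finite set that contains the support: erasing the value at one point
  \<open>a\<close> leaves a function supported on the rest, and the erased part is
  \<open>f a\<close> times \<open>single K a\<close>.\<close>

lemma free_module_span: "lin_span K (free_module K X) (single K ` X) = carrier (free_module K X)"
proof
  let ?F = "free_module K X" and ?L = "lin_span K (free_module K X) (single K ` X)"
  interpret F: module K ?F by (rule module_free)
  have S: "single K ` X \<subseteq> carrier ?F" using single_closed by auto
  show "?L \<subseteq> carrier ?F" using lin_span_carrier[OF module_free S] .
  have L: "submodule ?L K ?F" using submodule_lin_span[OF module_free S] .
  have "f \<in> ?L" if "finite A" "f \<in> carrier ?F" "supp K f \<subseteq> A" for f A
    using that
  proof (induction A arbitrary: f rule: finite_induct)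
    case empty
    then have "f = \<zero>\<^bsub>?F\<^esub>" by (auto simp: supp_def free_module_simps)
    then show ?case using L unfolding F.submodule_iff by simp
  next
    case (insert a A)
    show ?case
    proof (cases "a \<in> supp K f")
      case False
      then have "supp K f \<subseteq> A" using insert by auto
      then show ?thesis using insert by blast
    next
      case True
      then have a: "a \<in> X" using insert(4) by (auto simp: free_module_simps)
      have fr: "f x \<in> carrier K" for x using insert(4) by (auto simp: free_module_simps)
      define g where "g = (\<lambda>x. if x = a then \<zero>\<^bsub>K\<^esub> else f x)"
      have sg: "supp K g \<subseteq> supp K f - {a}" by (auto simp: g_def supp_def)
      have g: "g \<in> carrier ?F" using insert(4) fr sg
        by (auto simp: free_module_simps g_def[THEN fun_cong] intro: finite_subset)
      have "g \<in> ?L" using insert sg g by blast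
      moreover have "single K a \<in> ?L" using a lin_span_superset by fast
      moreover have "f = (f a \<odot>\<^bsub>?F\<^esub> single K a) \<oplus>\<^bsub>?F\<^esub> g"
        using fr by (auto simp: free_module_simps single_def g_def)
      ultimately show ?thesis using L fr unfolding F.submodule_iff by metis
    qed
  qed
  then show "carrier ?F \<subseteq> ?L" by (auto simp: free_module_simps)
qed

lemma free_module_hom_eqI:
  assumes "module K N" "f \<in> lin_hom K (free_module K X) N" "g \<in> lin_hom K (free_module K X) N"
    and "\<And>x. x \<in> X \<Longrightarrow> f (single K x) = g (single K x)" "z \<in> carrier (free_module K X)"
  shows "f z = g z"
  by (rule lin_hom_eq_on_span[OF module_free assms(1-3), of "single K ` X"])
    (use assms(4,5) single_closed in \<open>auto simp: free_module_span\<close>)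

lemma free_module_subsetI:
  assumes "submodule H K (free_module K X)" "\<And>x. x \<in> X \<Longrightarrow> single K x \<in> H"
  shows "carrier (free_module K X) \<subseteq> H"
  using lin_span_least[OF assms(1), of "single K ` X"] assms(2) free_module_span by blast

end

definition free_lift ::
  "('k, 'm) ring_scheme \<Rightarrow> ('k, 'a, 'p) module_scheme \<Rightarrow> ('x \<Rightarrow> 'a) \<Rightarrow> ('x \<Rightarrow> 'k) \<Rightarrow> 'a"
  where "free_lift K N u f = finsum N (\<lambda>x. f x \<odot>\<^bsub>N\<^esub> u x) (supp K f)"

context
  fixes K :: "('k, 'm) ring_scheme" and N :: "('k, 'a, 'p) module_scheme" and u :: "'x \<Rightarrow> 'a"
    and X :: "'x set"
  assumes N: "module K N" and u: "\<And>x. x \<in> X \<Longrightarrow> u x \<in> carrier N"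
begin

interpretation N: module K N by (rule N)

text \<open>Terms outside the support vanish, so two functions can be summed over the union of their
  supports; additivity of the lift is then a termwise identity.\<close>

lemma free_lift_superset:
  assumes "f \<in> carrier (free_module K X)" "finite S" "supp K f \<subseteq> S" "S \<subseteq> X"
  shows "free_lift K N u f = finsum N (\<lambda>x. f x \<odot>\<^bsub>N\<^esub> u x) S"
proof -
  have f: "f x \<in> carrier K" for x using assms(1) by (auto simp: free_module_simps)
  show ?thesis unfolding free_lift_def
    by (rule N.add.finprod_mono_neutral_cong_left)
      (use assms u f in \<open>auto simp: supp_def\<close>)
qed

lemma free_lift_hom: "free_lift K N u \<in> lin_hom K (free_module K X) N"
proof (rule lin_homI)
  note K = N.R.cring_axioms
  interpret F: module K "free_module K X" by (rule module_free[OF K])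
  have f: "f x \<in> carrier K" if "f \<in> carrier (free_module K X)" for f x
    using that by (auto simp: free_module_simps)
  have u': "u x \<in> carrier N" if "x \<in> supp K f" "f \<in> carrier (free_module K X)" for x f
    using that u by (auto simp: free_module_simps)
  fix f g a assume fg: "f \<in> carrier (free_module K X)" 
  show "free_lift K N u f \<in> carrier N"
    unfolding free_lift_def using u'[OF _ fg] f[OF fg] by (auto intro!: N.finsum_closed)
  have fin: "finite (supp K f)" using fg by (auto simp: free_module_simps)
  { assume gg: "g \<in> carrier (free_module K X)"
    define S where "S = supp K f \<union> supp K g"
    have S: "finite S" "S \<subseteq> X" using fg gg by (auto simp: S_def free_module_simps)
    have "free_lift K N u (f \<oplus>\<^bsub>free_module K X\<^esub> g) =
        finsum N (\<lambda>x. (f x \<oplus>\<^bsub>K\<^esub> g x) \<odot>\<^bsub>N\<^esub> u x) S"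
      using free_lift_superset[of "f \<oplus>\<^bsub>free_module K X\<^esub> g" S] F.a_closed[OF fg gg] S
        supp_add_subset[OF K fg gg] by (simp add: free_module_simps S_def)
    also have "\<dots> = finsum N (\<lambda>x. f x \<odot>\<^bsub>N\<^esub> u x \<oplus>\<^bsub>N\<^esub> g x \<odot>\<^bsub>N\<^esub> u x) S"
      by (rule N.finsum_cong') (use S u f fg gg in \<open>auto simp: N.smult_l_distr\<close>)
    also have "\<dots> = free_lift K N u f \<oplus>\<^bsub>N\<^esub> free_lift K N u g"
      using free_lift_superset[OF fg, of S] free_lift_superset[OF gg, of S] S u f fg gg
      by (subst N.finsum_addf) (auto simp: S_def)
    finally show "free_lift K N u (f \<oplus>\<^bsub>free_module K X\<^esub> g) = free_lift K N u f \<oplus>\<^bsub>N\<^esub> free_lift K N u g" .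
  }
  assume a: "a \<in> carrier K"
  have "free_lift K N u (a \<odot>\<^bsub>free_module K X\<^esub> f) = finsum N (\<lambda>x. (a \<otimes>\<^bsub>K\<^esub> f x) \<odot>\<^bsub>N\<^esub> u x) (supp K f)"
    using free_lift_superset[of "a \<odot>\<^bsub>free_module K X\<^esub> f" "supp K f"] F.smult_closed[OF a fg]
      supp_smult_subset[OF K a fg] fg by (simp add: free_module_simps)
  also have "\<dots> = finsum N (\<lambda>x. a \<odot>\<^bsub>N\<^esub> (f x \<odot>\<^bsub>N\<^esub> u x)) (supp K f)"
    by (rule N.finsum_cong') (use u'[OF _ fg] f[OF fg] a in \<open>auto simp: N.smult_assoc1\<close>)
  also have "\<dots> = a \<odot>\<^bsub>N\<^esub> free_lift K N u f"
    unfolding free_lift_def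
    by (rule N.finsum_smult_ldistr[symmetric]) (use u'[OF _ fg] f[OF fg] a fin in auto)
  finally show "free_lift K N u (a \<odot>\<^bsub>free_module K X\<^esub> f) = a \<odot>\<^bsub>N\<^esub> free_lift K N u f" .
qed

lemma free_lift_single:
  assumes "x \<in> X"
  shows "free_lift K N u (single K x) = u x"
proof -
  have "free_lift K N u (single K x) = finsum N (\<lambda>y. single K x y \<odot>\<^bsub>N\<^esub> u y) {x}"
    by (rule free_lift_superset) (use assms single_closed[OF N.R.cring_axioms] in
        \<open>auto simp: supp_def single_def\<close>)
  then show ?thesis using u[OF assms] by (simp add: single_def)
qed

end

lemma lin_ext_superset:
  assumes "cring K" "f \<in> carrier (free_module K X)" "finite S" "supp K f \<subseteq> S"
  shows "lin_ext K h f y = finsum K f {x \<in> S. h x = y}"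
proof -
  interpret K: cring K by fact
  have f: "f x \<in> carrier K" for x using assms(2) by (auto simp: free_module_simps)
  show ?thesis unfolding lin_ext_def
    by (rule K.add.finprod_mono_neutral_cong_left)
      (use assms f in \<open>auto simp: supp_def\<close>)
qed

lemma lin_ext_hom:
  assumes "cring K" "\<And>x. x \<in> X \<Longrightarrow> h x \<in> Y"
  shows "lin_ext K h \<in> lin_hom K (free_module K X) (free_module K Y)"
proof (rule lin_homI)
  interpret K: cring K by fact
  interpret F: module K "free_module K X" by (rule module_free[OF assms(1)])
  have f: "f x \<in> carrier K" if "f \<in> carrier (free_module K X)" for f x
    using that by (auto simp: free_module_simps)
  fix f g a assume fg: "f \<in> carrier (free_module K X)" 
  have fin: "finite (supp K f)" using fg by (auto simp: free_module_simps)
  have "supp K (lin_ext K h f) \<subseteq> h ` supp K f"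
  proof
    fix y assume y: "y \<in> supp K (lin_ext K h f)"
    show "y \<in> h ` supp K f"
    proof (rule ccontr)
      assume "y \<notin> h ` supp K f"
      then have "{x \<in> supp K f. h x = y} = {}" by auto
      then have "lin_ext K h f y = \<zero>\<^bsub>K\<^esub>" unfolding lin_ext_def by (simp only: K.finsum_empty)
      then show False using y by (simp add: supp_def)
    qed
  qed
  moreover have "h ` supp K f \<subseteq> Y" using assms(2) fg by (auto simp: free_module_simps)
  moreover have "lin_ext K h f y \<in> carrier K" for y
    unfolding lin_ext_def using f[OF fg] by (auto intro: K.finsum_closed)
  ultimately show "lin_ext K h f \<in> carrier (free_module K Y)"
    using fin by (auto simp: free_module_simps intro: finite_subset)
  { assume gg: "g \<in> carrier (free_module K X)"
    define S where "S = supp K f \<union> supp K g"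
    have S: "finite S" using fg gg by (auto simp: S_def free_module_simps)
    have "lin_ext K h (f \<oplus>\<^bsub>free_module K X\<^esub> g) y = lin_ext K h f y \<oplus>\<^bsub>K\<^esub> lin_ext K h g y" for y
      using lin_ext_superset[OF assms(1) F.a_closed[OF fg gg] S, of h y]
        lin_ext_superset[OF assms(1) fg S, of h y] lin_ext_superset[OF assms(1) gg S, of h y]
        supp_add_subset[OF assms(1) fg gg] S f[OF fg] f[OF gg]
      by (simp add: S_def free_module_simps K.finsum_addf)
    then show "lin_ext K h (f \<oplus>\<^bsub>free_module K X\<^esub> g) = lin_ext K h f \<oplus>\<^bsub>free_module K Y\<^esub> lin_ext K h g"
      by (auto simp: free_module_simps)
  }
  assume a: "a \<in> carrier K"
  have "lin_ext K h (a \<odot>\<^bsub>free_module K X\<^esub> f) y = a \<otimes>\<^bsub>K\<^esub> lin_ext K h f y" for y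
    using lin_ext_superset[OF assms(1) F.smult_closed[OF a fg] fin, of h y]
      lin_ext_superset[OF assms(1) fg fin, of h y]
      supp_smult_subset[OF assms(1) a fg] f[OF fg] a fin
    by (simp add: free_module_simps K.finsum_rdistr)
  then show "lin_ext K h (a \<odot>\<^bsub>free_module K X\<^esub> f) = a \<odot>\<^bsub>free_module K Y\<^esub> lin_ext K h f"
    by (auto simp: free_module_simps)
qed

lemma lin_ext_single:
  assumes "cring K"
  shows "lin_ext K h (single K x) = single K (h x)"
proof
  fix y
  interpret K: cring K by fact
  have "lin_ext K h (single K x) y = finsum K (single K x) {z \<in> {x}. h z = y}"
    by (rule lin_ext_superset[OF assms single_closed[OF assms, of x "{x}"]])
      (auto simp: supp_def single_def)
  also have "{z \<in> {x}. h z = y} = (if y = h x then {x} else {})" by auto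
  finally show "lin_ext K h (single K x) y = single K (h x) y" by (simp add: single_def)
qed

text \<open>The single identity has the shape of the generators of \<open>bilin_rel\<close> and
  \<open>decoration_rel\<close>. The scalar one gives additivity, additivity forces zero to go to
  zero, and \<open>y\<close> equal to zero then gives homogeneity.\<close>

lemma lin_hom_lin_combI:
  assumes "module K A" "module K B"
    and "\<And>x. x \<in> carrier A \<Longrightarrow> f x \<in> carrier B"
    and comb: "\<And>a x y. a \<in> carrier K \<Longrightarrow> x \<in> carrier A \<Longrightarrow> y \<in> carrier A \<Longrightarrow>
      f ((a \<odot>\<^bsub>A\<^esub> x) \<oplus>\<^bsub>A\<^esub> y) = (a \<odot>\<^bsub>B\<^esub> f x) \<oplus>\<^bsub>B\<^esub> f y"
  shows "f \<in> lin_hom K A B"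
proof -
  interpret A: module K A by fact
  interpret B: module K B by fact
  have 1: "f (x \<oplus>\<^bsub>A\<^esub> y) = f x \<oplus>\<^bsub>B\<^esub> f y" if "x \<in> carrier A" "y \<in> carrier A" for x y
    using comb[OF A.R.one_closed that] that assms(3) by simp
  have "f \<zero>\<^bsub>A\<^esub> = \<zero>\<^bsub>B\<^esub>"
  proof -
    have "f \<zero>\<^bsub>A\<^esub> \<oplus>\<^bsub>B\<^esub> f \<zero>\<^bsub>A\<^esub> = f \<zero>\<^bsub>A\<^esub>"
      using 1[of "\<zero>\<^bsub>A\<^esub>" "\<zero>\<^bsub>A\<^esub>", symmetric] by simp
    then show ?thesis using assms(3)[of "\<zero>\<^bsub>A\<^esub>"] B.M.add.r_cancel_one by blast
  qed
  then have "f (a \<odot>\<^bsub>A\<^esub> x) = a \<odot>\<^bsub>B\<^esub> f x" if "a \<in> carrier K" "x \<in> carrier A" for a x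
    using comb[OF that A.zero_closed] that assms(3) by simp
  with 1 assms(3) show ?thesis by (intro lin_homI) auto
qed

subsection \<open>Tensor products\<close>

context
  fixes K :: "('k, 'm) ring_scheme" and M :: "('k, 'a, 'p) module_scheme"
    and N :: "('k, 'b, 'q) module_scheme"
  assumes M: "module K M" and N: "module K N"
begin

interpretation M: module K M by (rule M)
interpretation N: module K N by (rule N)

private abbreviation (input) "pairs \<equiv> free_module K (carrier M \<times> carrier N)"

interpretation F: module K pairs by (rule module_free[OF M.R.cring_axioms])

definition bilin_gens :: "('a \<times> 'b \<Rightarrow> 'k) set" where
  "bilin_gens =
    {single K ((a \<odot>\<^bsub>M\<^esub> x) \<oplus>\<^bsub>M\<^esub> x', y)
        \<ominus>\<^bsub>pairs\<^esub> ((a \<odot>\<^bsub>pairs\<^esub> single K (x, y)) \<oplus>\<^bsub>pairs\<^esub> single K (x', y)) | a x x' y.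
        a \<in> carrier K \<and> x \<in> carrier M \<and> x' \<in> carrier M \<and> y \<in> carrier N} \<union>
     {single K (x, (a \<odot>\<^bsub>N\<^esub> y) \<oplus>\<^bsub>N\<^esub> y')
        \<ominus>\<^bsub>pairs\<^esub> ((a \<odot>\<^bsub>pairs\<^esub> single K (x, y)) \<oplus>\<^bsub>pairs\<^esub> single K (x, y')) | a x y y'.
        a \<in> carrier K \<and> x \<in> carrier M \<and> y \<in> carrier N \<and> y' \<in> carrier N}"

lemma bilin_rel_eq: "bilin_rel K M N = lin_span K pairs bilin_gens"
  by (simp add: bilin_rel_def bilin_gens_def Let_def)

lemma single_pair_closed: "x \<in> carrier M \<Longrightarrow> y \<in> carrier N \<Longrightarrow> single K (x, y) \<in> carrier pairs"
  by (simp add: single_closed[OF M.R.cring_axioms])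

lemma bilin_gens_carrier: "bilin_gens \<subseteq> carrier pairs"
  unfolding bilin_gens_def
    by (auto intro!: F.minus_closed F.a_closed F.smult_closed single_pair_closed)

lemma submodule_bilin_rel: "submodule (bilin_rel K M N) K pairs"
  unfolding bilin_rel_eq by (rule submodule_lin_span[OF F.module_axioms bilin_gens_carrier])

lemma module_tensor: "module K (tensor K M N)"
  unfolding tensor_def by (rule module_quot[OF F.module_axioms submodule_bilin_rel])

lemma tens_closed: "x \<in> carrier M \<Longrightarrow> y \<in> carrier N \<Longrightarrow> tens K M N x y \<in> carrier (tensor K M N)"
  unfolding tensor_def tens_def
  by (rule lin_hom_closed[OF coset_lin_hom[OF F.module_axioms submodule_bilin_rel] single_pair_closed])

lemma tens_lin_combl:
  assumes "a \<in> carrier K" "x \<in> carrier M" "x' \<in> carrier M" "y \<in> carrier N"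
  shows "tens K M N ((a \<odot>\<^bsub>M\<^esub> x) \<oplus>\<^bsub>M\<^esub> x') y =
    (a \<odot>\<^bsub>tensor K M N\<^esub> tens K M N x y) \<oplus>\<^bsub>tensor K M N\<^esub> tens K M N x' y"
proof -
  have "single K ((a \<odot>\<^bsub>M\<^esub> x) \<oplus>\<^bsub>M\<^esub> x', y)
        \<ominus>\<^bsub>pairs\<^esub> ((a \<odot>\<^bsub>pairs\<^esub> single K (x, y)) \<oplus>\<^bsub>pairs\<^esub> single K (x', y)) \<in> bilin_rel K M N"
    unfolding bilin_rel_eq using assms
    by (intro subsetD[OF lin_span_superset]) (auto simp: bilin_gens_def)
  then have "tens K M N ((a \<odot>\<^bsub>M\<^esub> x) \<oplus>\<^bsub>M\<^esub> x') y =
     bilin_rel K M N +>\<^bsub>pairs\<^esub> ((a \<odot>\<^bsub>pairs\<^esub> single K (x, y)) \<oplus>\<^bsub>pairs\<^esub> single K (x', y))"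
    unfolding tens_def using assms
    by (subst coset_eq_iff[OF F.module_axioms submodule_bilin_rel])
      (auto intro!: F.a_closed F.smult_closed single_pair_closed)
  then show ?thesis
    using assms
    by (simp add: tensor_def tens_def quot_module_add[OF F.module_axioms submodule_bilin_rel]
        quot_module_smult[OF F.module_axioms submodule_bilin_rel] single_pair_closed)
qed

lemma tens_lin_combr:
  assumes "a \<in> carrier K" "x \<in> carrier M" "y \<in> carrier N" "y' \<in> carrier N"
  shows "tens K M N x ((a \<odot>\<^bsub>N\<^esub> y) \<oplus>\<^bsub>N\<^esub> y') =
    (a \<odot>\<^bsub>tensor K M N\<^esub> tens K M N x y) \<oplus>\<^bsub>tensor K M N\<^esub> tens K M N x y'"
proof -
  have "single K (x, (a \<odot>\<^bsub>N\<^esub> y) \<oplus>\<^bsub>N\<^esub> y')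
        \<ominus>\<^bsub>pairs\<^esub> ((a \<odot>\<^bsub>pairs\<^esub> single K (x, y)) \<oplus>\<^bsub>pairs\<^esub> single K (x, y')) \<in> bilin_rel K M N"
    unfolding bilin_rel_eq using assms
    by (intro subsetD[OF lin_span_superset]) (auto simp: bilin_gens_def)
  then have "tens K M N x ((a \<odot>\<^bsub>N\<^esub> y) \<oplus>\<^bsub>N\<^esub> y') =
     bilin_rel K M N +>\<^bsub>pairs\<^esub> ((a \<odot>\<^bsub>pairs\<^esub> single K (x, y)) \<oplus>\<^bsub>pairs\<^esub> single K (x, y'))"
    unfolding tens_def using assms
    by (subst coset_eq_iff[OF F.module_axioms submodule_bilin_rel])
      (auto intro!: F.a_closed F.smult_closed single_pair_closed)
  then show ?thesis
    using assms
    by (simp add: tensor_def tens_def quot_module_add[OF F.module_axioms submodule_bilin_rel]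
        quot_module_smult[OF F.module_axioms submodule_bilin_rel] single_pair_closed)
qed

lemma tens_homl: "y \<in> carrier N \<Longrightarrow> (\<lambda>x. tens K M N x y) \<in> lin_hom K M (tensor K M N)"
  by (rule lin_hom_lin_combI[OF M module_tensor]) (auto simp: tens_closed tens_lin_combl)

lemma tens_homr: "x \<in> carrier M \<Longrightarrow> (\<lambda>y. tens K M N x y) \<in> lin_hom K N (tensor K M N)"
  by (rule lin_hom_lin_combI[OF N module_tensor]) (auto simp: tens_closed tens_lin_combr)

lemma tens_image: "(\<lambda>(x, y). tens K M N x y) ` (carrier M \<times> carrier N) \<subseteq> carrier (tensor K M N)"
  using tens_closed by auto

lemma tensor_span:
  "lin_span K (tensor K M N) ((\<lambda>(x, y). tens K M N x y) ` (carrier M \<times> carrier N)) =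
    carrier (tensor K M N)" (is "?L = _")
proof
  show "?L \<subseteq> carrier (tensor K M N)"
    using lin_span_carrier[OF module_tensor tens_image] .
  have L: "submodule ?L K (tensor K M N)" by (rule submodule_lin_span[OF module_tensor tens_image])
  let ?c = "\<lambda>f. bilin_rel K M N +>\<^bsub>pairs\<^esub> f"
  have "submodule {f \<in> carrier pairs. ?c f \<in> ?L} K pairs"
    using submodule_vimage[OF F.module_axioms module_tensor _ L]
      coset_lin_hom[OF F.module_axioms submodule_bilin_rel] unfolding tensor_def by blast
  moreover have "?c (single K p) \<in> ?L" if "p \<in> carrier M \<times> carrier N" for p
    using that by (intro subsetD[OF lin_span_superset]) (auto simp: tens_def intro!: image_eqI[of _ _ p])
  ultimately have "carrier pairs \<subseteq> {f \<in> carrier pairs. ?c f \<in> ?L}"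
    by (intro free_module_subsetI[OF M.R.cring_axioms])
      (auto intro: single_closed[OF M.R.cring_axioms])
  then show "carrier (tensor K M N) \<subseteq> ?L"
    unfolding tensor_def quot_module_simps[OF F.module_axioms submodule_bilin_rel] by auto
qed

lemma tensor_hom_eqI:
  assumes "module K L" "f \<in> lin_hom K (tensor K M N) L" "g \<in> lin_hom K (tensor K M N) L"
    and "\<And>x y. x \<in> carrier M \<Longrightarrow> y \<in> carrier N \<Longrightarrow> f (tens K M N x y) = g (tens K M N x y)"
    and "z \<in> carrier (tensor K M N)"
  shows "f z = g z"
  by (rule lin_hom_eq_on_span[OF module_tensor assms(1-3) tens_image])
    (use assms(4,5) tensor_span in auto)

text \<open>Linearity of \<open>b\<close> in each variable is exactly the vanishing on
  \<open>bilin_gens\<close> of its linear extension to the free module on pairs; the extension then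
  vanishes on the span and descends.\<close>

lemma tensor_lift:
  assumes L: "module K L"
    and l: "\<And>y. y \<in> carrier N \<Longrightarrow> (\<lambda>x. b x y) \<in> lin_hom K M L"
    and r: "\<And>x. x \<in> carrier M \<Longrightarrow> b x \<in> lin_hom K N L"
  obtains f where "f \<in> lin_hom K (tensor K M N) L"
    "\<And>x y. x \<in> carrier M \<Longrightarrow> y \<in> carrier N \<Longrightarrow> f (tens K M N x y) = b x y"
proof -
  interpret L: module K L by fact
  let ?u = "\<lambda>(x, y). b x y"
  define h where "h = free_lift K L ?u"
  have cl: "b x y \<in> carrier L" if "x \<in> carrier M" "y \<in> carrier N" for x y
    using lin_hom_closed[OF l] that by blast
  have u: "?u p \<in> carrier L" if "p \<in> carrier M \<times> carrier N" for p using cl that by auto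
  have h: "h \<in> lin_hom K pairs L"
    unfolding h_def by (rule free_lift_hom[OF L]) (use u in auto)
  have hs: "h (single K (x, y)) = b x y" if "x \<in> carrier M" "y \<in> carrier N" for x y
    unfolding h_def using free_lift_single[OF L, of "carrier M \<times> carrier N" ?u "(x, y)"] u that
      by auto
  have "h z = \<zero>\<^bsub>L\<^esub>" if "z \<in> bilin_gens" for z
    using that unfolding bilin_gens_def
    by (auto simp: lin_hom_diff[OF F.module_axioms L h] lin_hom_add[OF h] lin_hom_smult[OF h]
        single_pair_closed hs lin_hom_add[OF l] lin_hom_smult[OF l] lin_hom_add[OF r]
        lin_hom_smult[OF r] cl L.diff_zero_iff)
  then have "h z = \<zero>\<^bsub>L\<^esub>" if "z \<in> bilin_rel K M N" for z
    using lin_hom_eq_on_span[OF F.module_axioms L h zero_lin_hom[OF F.module_axioms L] bilin_gens_carrier, of z]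
      that unfolding bilin_rel_eq by auto
  then obtain f where "f \<in> lin_hom K (quot_module pairs (bilin_rel K M N)) L"
    "\<And>x. x \<in> carrier pairs \<Longrightarrow> f (bilin_rel K M N +>\<^bsub>pairs\<^esub> x) = h x"
    using quot_module_lift[OF F.module_axioms submodule_bilin_rel L h] by blast
  then show ?thesis using that hs single_pair_closed unfolding tensor_def tens_def by metis
qed

end

section \<open>Multilinear operads, their ideals, quotients and Hadamard products\<close>

section \<open>Operads\<close>

subsection \<open>Multilinear compositions\<close>

lemma in_listset_iff:
  "xs \<in> listset As \<longleftrightarrow> length xs = length As \<and> (\<forall>i<length As. xs ! i \<in> As ! i)"
proof (induction As arbitrary: xs)
  case (Cons A As)
  show ?case
  proof (cases xs)
    case (Cons y ys)
    then show ?thesis using Cons.IH[of ys]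
      by (auto simp: set_Cons_def nth_Cons less_Suc_eq_0_disj split: nat.splits)
  qed (auto simp: set_Cons_def)
qed auto

lemma finite_listset: "(\<And>A. A \<in> set As \<Longrightarrow> finite A) \<Longrightarrow> finite (listset As)"
proof (induction As)
  case (Cons A As)
  have "set_Cons A (listset As) = (\<lambda>(x, xs). x # xs) ` (A \<times> listset As)"
    by (auto simp: set_Cons_def)
  then show ?case using Cons by simp
qed auto

lemma composable_iff:
  "composable P ns e es \<longleftrightarrow> e \<in> carrier (space P (length ns)) \<and> length es = length ns \<and>
    (\<forall>i<length ns. es ! i \<in> carrier (space P (ns ! i)))"
  by (auto simp: composable_def in_listset_iff)

text \<open>The part of the operad axioms that is needed: all operations are (multi)linear.\<close>

definition pre_operad :: "('k, 'm) ring_scheme \<Rightarrow> ('k, 'a) operad \<Rightarrow> bool" where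
  "pre_operad K P \<longleftrightarrow>
    (\<forall>n. module K (space P n)) \<and>
    (\<forall>n \<sigma>. \<sigma> permutes {1..n} \<longrightarrow> act P n \<sigma> \<in> lin_hom K (space P n) (space P n)) \<and>
    ident P \<in> carrier (space P 1) \<and>
    (\<forall>ns e es. composable P ns e es \<longrightarrow>
      (\<lambda>x. comp P ns x es) \<in> lin_hom K (space P (length ns)) (space P (sum_list ns)) \<and>
      (\<forall>i<length ns. (\<lambda>x. comp P ns e (es[i := x])) \<in>
        lin_hom K (space P (ns ! i)) (space P (sum_list ns))))"

context
  fixes K :: "('k, 'm) ring_scheme" and P :: "('k, 'a) operad"
  assumes P: "pre_operad K P"
begin

lemma pre_operad_module: "module K (space P n)"
  and pre_operad_act: "\<sigma> permutes {1..n} \<Longrightarrow> act P n \<sigma> \<in> lin_hom K (space P n) (space P n)"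
  and pre_operad_ident: "ident P \<in> carrier (space P 1)"
  and pre_operad_root: "composable P ns e es \<Longrightarrow>
      (\<lambda>x. comp P ns x es) \<in> lin_hom K (space P (length ns)) (space P (sum_list ns))"
  and pre_operad_arg: "composable P ns e es \<Longrightarrow> i < length ns \<Longrightarrow>
      (\<lambda>x. comp P ns e (es[i := x])) \<in> lin_hom K (space P (ns ! i)) (space P (sum_list ns))"
  using P unfolding pre_operad_def by blast+

lemma pre_operad_cring: "cring K"
  using module.axioms(1)[OF pre_operad_module] .

lemma comp_closed: "composable P ns e es \<Longrightarrow> comp P ns e es \<in> carrier (space P (sum_list ns))"
  using lin_hom_closed[OF pre_operad_root] by (auto simp: composable_iff)

lemma act_closed: "\<sigma> permutes {1..n} \<Longrightarrow> x \<in> carrier (space P n) \<Longrightarrow> act P n \<sigma> x \<in> carrier (space P n)"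
  using lin_hom_closed[OF pre_operad_act] by auto

lemma composable_update:
  "composable P ns e es \<Longrightarrow> i < length ns \<Longrightarrow> x \<in> carrier (space P (ns ! i)) \<Longrightarrow>
    composable P ns e (es[i := x])"
  by (auto simp: composable_iff nth_list_update)

lemma comp_zero_root:
  assumes "composable P ns e es" "e = \<zero>\<^bsub>space P (length ns)\<^esub>"
  shows "comp P ns e es = \<zero>\<^bsub>space P (sum_list ns)\<^esub>"
  using lin_hom_zero[OF pre_operad_module pre_operad_module pre_operad_root[OF assms(1)]] assms(2)
    by simp

lemma comp_zero_arg:
  assumes "composable P ns e es" "i < length ns" "es ! i = \<zero>\<^bsub>space P (ns ! i)\<^esub>"
  shows "comp P ns e es = \<zero>\<^bsub>space P (sum_list ns)\<^esub>"
  using lin_hom_zero[OF pre_operad_module pre_operad_module pre_operad_arg[OF assms(1,2)]] assms(3)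
  by (metis list_update_id)

text \<open>Span induction in several variables: a property that cuts out a submodule in each slot
  passes from generators to spans one slot at a time. Each slot has its own generating set
  \<open>G i\<close>, so that one slot may run over a whole ideal while the others run over basis
  elements.\<close>

lemma composable_span_induct:
  assumes E: "E \<subseteq> carrier (space P (length ns))"
    and G: "\<And>i. i < length ns \<Longrightarrow> G i \<subseteq> carrier (space P (ns ! i))"
    and root: "\<And>e es. composable P ns e es \<Longrightarrow>
      submodule {x \<in> carrier (space P (length ns)). Q x es} K (space P (length ns))"
    and arg: "\<And>e es i. composable P ns e es \<Longrightarrow> i < length ns \<Longrightarrow>
      submodule {x \<in> carrier (space P (ns ! i)). Q e (es[i := x])} K (space P (ns ! i))"
    and base: "\<And>e es. e \<in> E \<Longrightarrow> length es = length ns \<Longrightarrow> (\<And>i. i < length ns \<Longrightarrow> es ! i \<in> G i) \<Longrightarrow> Q e es"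
    and e: "e \<in> lin_span K (space P (length ns)) E"
    and es: "length es = length ns" "\<And>i. i < length ns \<Longrightarrow> es ! i \<in>
      lin_span K (space P (ns ! i)) (G i)"
  shows "Q e es"
proof -
  have cl: "lin_span K (space P (length ns)) E \<subseteq> carrier (space P (length ns))"
    "i < length ns \<Longrightarrow> lin_span K (space P (ns ! i)) (G i) \<subseteq> carrier (space P (ns ! i))" for i
    using lin_span_carrier[OF pre_operad_module] E G by auto
  \<comment> \<open>\<open>j\<close> counts the leading inputs that already range over their spans;
    the later ones are still generators, and the root is released last.\<close>
  have *: "Q e es" if "e \<in> E" "length es = length ns" "j \<le> length ns"
    "\<And>i. i < j \<Longrightarrow> es ! i \<in> lin_span K (space P (ns ! i)) (G i)"
    "\<And>i. j \<le> i \<Longrightarrow> i < length ns \<Longrightarrow> es ! i \<in> G i" for e es j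
    using that
  proof (induction j arbitrary: es)
    case 0
    then show ?case by (intro base) auto
  next
    case (Suc j)
    have cm: "es ! i \<in> carrier (space P (ns ! i))" if "i < length ns" for i
      using Suc.prems(4)[of i] Suc.prems(5)[of i] cl(2)[OF that] G[OF that] that
      by (cases "i < Suc j") auto
    then have c: "composable P ns e es" using Suc.prems E by (auto simp: composable_iff)
    have j: "j < length ns" using Suc.prems by simp
    have "G j \<subseteq> {x \<in> carrier (space P (ns ! j)). Q e (es[j := x])}"
    proof (intro subsetI CollectI conjI)
      fix x assume x: "x \<in> G j"
      show "x \<in> carrier (space P (ns ! j))" using x G j by auto
      show "Q e (es[j := x])"
        using Suc.prems x j by (intro Suc.IH) (auto simp: nth_list_update)
    qed
    then have "es ! j \<in> {x \<in> carrier (space P (ns ! j)). Q e (es[j := x])}"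
      using lin_span_least[OF arg[OF c j]] Suc.prems(4)[of j] by blast
    then show ?case by simp
  qed
  have cm: "es ! i \<in> carrier (space P (ns ! i))" if "i < length ns" for i
    using es(2)[OF that] cl(2)[OF that] by auto
  then have c: "composable P ns e es" using e es(1) cl(1) by (auto simp: composable_iff)
  have "E \<subseteq> {x \<in> carrier (space P (length ns)). Q x es}"
    using *[of _ es "length ns"] es E by auto
  then show ?thesis using lin_span_least[OF root[OF c]] e by blast
qed

end

lemma operad_homD:
  assumes "operad_hom K P Q f"
  shows "f n \<in> lin_hom K (space P n) (space Q n)"
    and "\<sigma> permutes {1..n} \<Longrightarrow> x \<in> carrier (space P n) \<Longrightarrow> f n (act P n \<sigma> x) = act Q n \<sigma> (f n x)"
    and "f 1 (ident P) = ident Q"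
    and "composable P ns e es \<Longrightarrow>
      f (sum_list ns) (comp P ns e es) = comp Q ns (f (length ns) e) (map2 f ns es)"
  using assms unfolding operad_hom_def by blast+

lemma map2_update:
  "length es = length ns \<Longrightarrow> i < length ns \<Longrightarrow> map2 f ns (es[i := x]) =
    (map2 f ns es)[i := f (ns ! i) x]"
  by (rule nth_equalityI) (auto simp: nth_list_update)

lemma map2_composable:
  assumes "\<And>n. f n \<in> lin_hom K (space P n) (space Q n)" "composable P ns e es"
  shows "composable Q ns (f (length ns) e) (map2 f ns es)"
  using assms(2) lin_hom_closed[OF assms(1)] by (auto simp: composable_iff)

lemma operad_hom_compose:
  assumes "operad_hom K P Q f" "operad_hom K Q R g"
  shows "operad_hom K P R (\<lambda>n x. g n (f n x))"
  unfolding operad_hom_def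
proof (intro conjI allI impI ballI)
  note f = operad_homD[OF assms(1)] and g = operad_homD[OF assms(2)]
  show "(\<lambda>x. g n (f n x)) \<in> lin_hom K (space P n) (space R n)" for n
    using lin_hom_compose[OF f(1) g(1)] .
  show "g n (f n (act P n \<sigma> x)) = act R n \<sigma> (g n (f n x))"
    if "\<sigma> permutes {1..n}" "x \<in> carrier (space P n)" for n \<sigma> x
    using f(2)[OF that] g(2)[OF that(1)] lin_hom_closed[OF f(1) that(2)] by simp
  show "g 1 (f 1 (ident P)) = ident R" using f(3) g(3) by simp
  show "g (sum_list ns) (f (sum_list ns) (comp P ns e es)) =
    comp R ns (g (length ns) (f (length ns) e)) (map2 (\<lambda>n x. g n (f n x)) ns es)"
    if c: "composable P ns e es" for ns e es
  proof -
    have "map2 g ns (map2 f ns es) = map2 (\<lambda>n x. g n (f n x)) ns es"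
      using c by (intro nth_equalityI) (auto simp: composable_iff)
    then show ?thesis using f(4)[OF c] g(4)[OF map2_composable[OF f(1) c]] by simp
  qed
qed

lemma comp_compat_span:
  assumes P: "pre_operad K P" and Q: "pre_operad K Q"
    and f: "\<And>n. f n \<in> lin_hom K (space P n) (space Q n)"
    and G: "\<And>n. G n \<subseteq> carrier (space P n)" "\<And>n. lin_span K (space P n) (G n) = carrier (space P n)"
    and base: "\<And>ns e es. e \<in> G (length ns) \<Longrightarrow> length es = length ns \<Longrightarrow>
      (\<And>i. i < length ns \<Longrightarrow> es ! i \<in> G (ns ! i)) \<Longrightarrow>
      f (sum_list ns) (comp P ns e es) = comp Q ns (f (length ns) e) (map2 f ns es)"
    and c: "composable P ns e es"
  shows "f (sum_list ns) (comp P ns e es) = comp Q ns (f (length ns) e) (map2 f ns es)"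
proof (rule composable_span_induct[OF P, of "G (length ns)" ns "\<lambda>i. G (ns ! i)"])
  show "submodule {x \<in> carrier (space P (length ns)).
      f (sum_list ns) (comp P ns x es) =
        comp Q ns (f (length ns) x) (map2 f ns es)} K (space P (length ns))"
    if c: "composable P ns e es" for e es
    by (rule submodule_equaliser[OF pre_operad_module[OF P] pre_operad_module[OF Q]
          lin_hom_compose[OF pre_operad_root[OF P c] f]
          lin_hom_compose[OF f pre_operad_root[OF Q map2_composable[OF f c]]]])
  show "submodule {x \<in> carrier (space P (ns ! i)).
      f (sum_list ns) (comp P ns e (es[i := x])) =
        comp Q ns (f (length ns) e) (map2 f ns (es[i := x]))}
      K (space P (ns ! i))" if c: "composable P ns e es" and i: "i < length ns" for e es i
  proof -
    have "map2 f ns (es[i := x]) = (map2 f ns es)[i := f (ns ! i) x]" for x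
      using c i by (intro map2_update) (auto simp: composable_iff)
    then show ?thesis
      using submodule_equaliser[OF pre_operad_module[OF P] pre_operad_module[OF Q]
          lin_hom_compose[OF pre_operad_arg[OF P c i] f]
          lin_hom_compose[OF f pre_operad_arg[OF Q map2_composable[OF f c] i]]] by simp
  qed
qed (use G base c in \<open>auto simp: composable_iff\<close>)

text \<open>Both sides of the action and composition conditions are linear in every slot, so that
  agreement on spanning sets suffices.\<close>

lemma operad_homI_span:
  assumes P: "pre_operad K P" and Q: "pre_operad K Q"
    and f: "\<And>n. f n \<in> lin_hom K (space P n) (space Q n)"
    and G: "\<And>n. G n \<subseteq> carrier (space P n)" "\<And>n. lin_span K (space P n) (G n) = carrier (space P n)"
    and act: "\<And>n \<sigma> x. \<sigma> permutes {1..n} \<Longrightarrow> x \<in> G n \<Longrightarrow> f n (act P n \<sigma> x) = act Q n \<sigma> (f n x)"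
    and ident: "f 1 (ident P) = ident Q"
    and base: "\<And>ns e es. e \<in> G (length ns) \<Longrightarrow> length es = length ns \<Longrightarrow>
      (\<And>i. i < length ns \<Longrightarrow> es ! i \<in> G (ns ! i)) \<Longrightarrow>
      f (sum_list ns) (comp P ns e es) = comp Q ns (f (length ns) e) (map2 f ns es)"
  shows "operad_hom K P Q f"
  unfolding operad_hom_def
proof (intro conjI allI impI ballI)
  show "f n (act P n \<sigma> x) = act Q n \<sigma> (f n x)"
    if s: "\<sigma> permutes {1..n}" and x: "x \<in> carrier (space P n)" for n \<sigma> x
    by (rule lin_hom_eq_on_span[OF pre_operad_module[OF P] pre_operad_module[OF Q]
          lin_hom_compose[OF pre_operad_act[OF P s] f] lin_hom_compose[OF f pre_operad_act[OF Q s]] G(1)])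
      (use act s x G(2) in auto)
  show "f (sum_list ns) (comp P ns e es) = comp Q ns (f (length ns) e) (map2 f ns es)"
    if "composable P ns e es" for ns e es
    by (rule comp_compat_span[OF P Q f G _ that]) (rule base)
qed (use f ident in blast)+

subsection \<open>Ideals and quotients\<close>

lemma operad_idealD:
  assumes "operad_ideal K P I"
  shows "submodule (I n) K (space P n)"
    and "\<sigma> permutes {1..n} \<Longrightarrow> x \<in> I n \<Longrightarrow> act P n \<sigma> x \<in> I n"
    and "composable P ns e es \<Longrightarrow> e \<in> I (length ns) \<Longrightarrow> comp P ns e es \<in> I (sum_list ns)"
    and "composable P ns e es \<Longrightarrow> i < length ns \<Longrightarrow> es ! i \<in> I (ns ! i) \<Longrightarrow> comp P ns e es \<in>
      I (sum_list ns)"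
  using assms unfolding operad_ideal_def S_submodule_def by blast+

lemma operad_ideal_carrier:
  assumes "pre_operad K P"
  shows "operad_ideal K P (\<lambda>n. carrier (space P n))"
  unfolding operad_ideal_def S_submodule_def
  using module.carrier_is_submodule[OF pre_operad_module[OF assms]] act_closed[OF assms]
    comp_closed[OF assms] by auto

lemma gen_ideal_least:
  "operad_ideal K P I \<Longrightarrow> (\<And>m. G m \<subseteq> I m) \<Longrightarrow> gen_ideal K P G n \<subseteq> I n"
  unfolding gen_ideal_def by blast

lemma gen_ideal_superset: "G n \<subseteq> gen_ideal K P G n"
  unfolding gen_ideal_def by blast

text \<open>The family intersected in \<open>gen_ideal\<close> is nonempty, since the full carriers
  form an ideal that contains \<open>G\<close>. An argument in the intersection lies in every
  member, hence so does the composite.\<close>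

lemma operad_ideal_gen_ideal:
  assumes P: "pre_operad K P" and G: "\<And>n. G n \<subseteq> carrier (space P n)"
  shows "operad_ideal K P (gen_ideal K P G)"
  unfolding operad_ideal_def S_submodule_def
proof (intro conjI allI impI ballI)
  show "submodule (gen_ideal K P G n) K (space P n)" for n
    unfolding gen_ideal_def
    using operad_idealD(1) operad_ideal_carrier[OF P] G
    by (intro submodule_Inter[OF pre_operad_module[OF P]]) blast+
  show "act P n \<sigma> x \<in> gen_ideal K P G n" if "\<sigma> permutes {1..n}" "x \<in> gen_ideal K P G n" for n \<sigma> x
    unfolding gen_ideal_def
  proof (rule InterI)
    fix H assume H: "H \<in> {I n |I. operad_ideal K P I \<and> (\<forall>m. G m \<subseteq> I m)}"
    then obtain I where I: "operad_ideal K P I" "H = I n" by blast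
    have "x \<in> I n" using that(2) H unfolding gen_ideal_def I(2) by blast
    then show "act P n \<sigma> x \<in> H" using operad_idealD(2)[OF I(1) that(1)] I(2) by simp
  qed
  fix ns e es
  assume "composable P ns e es \<and> (e \<in> gen_ideal K P G (length ns) \<or>
    (\<exists>i<length ns. es ! i \<in> gen_ideal K P G (ns ! i)))"
  then have c: "composable P ns e es"
    and mem: "e \<in> gen_ideal K P G (length ns) \<or> (\<exists>i<length ns. es ! i \<in> gen_ideal K P G (ns ! i))"
    by auto
  show "comp P ns e es \<in> gen_ideal K P G (sum_list ns)"
    unfolding gen_ideal_def
  proof (rule InterI)
    fix H assume "H \<in> {I (sum_list ns) |I. operad_ideal K P I \<and> (\<forall>m. G m \<subseteq> I m)}"
    then obtain I where I: "operad_ideal K P I" "H = I (sum_list ns)" "\<And>m. G m \<subseteq> I m" by blast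
    have "gen_ideal K P G n \<subseteq> I n" for n by (rule gen_ideal_least[OF I(1,3)])
    then have "e \<in> I (length ns) \<or> (\<exists>i<length ns. es ! i \<in> I (ns ! i))" using mem by blast
    then show "comp P ns e es \<in> H" using operad_idealD(3,4)[OF I(1) c] I(2) by blast
  qed
qed

lemma operad_ideal_kernel:
  assumes P: "pre_operad K P" and Q: "pre_operad K Q" and f: "operad_hom K P Q f"
  shows "operad_ideal K P (\<lambda>n. {x \<in> carrier (space P n). f n x = \<zero>\<^bsub>space Q n\<^esub>})"
  unfolding operad_ideal_def S_submodule_def
proof (intro conjI allI impI ballI)
  note f = operad_homD[OF f]
  show "submodule {x \<in> carrier (space P n). f n x = \<zero>\<^bsub>space Q n\<^esub>} K (space P n)" for n
    by (rule submodule_kernel[OF pre_operad_module[OF P] pre_operad_module[OF Q] f(1)])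
  show "act P n \<sigma> x \<in> {x \<in> carrier (space P n). f n x = \<zero>\<^bsub>space Q n\<^esub>}"
    if "\<sigma> permutes {1..n}" "x \<in> {x \<in> carrier (space P n). f n x = \<zero>\<^bsub>space Q n\<^esub>}" for n \<sigma> x
    using that f(2) act_closed[OF P]
      lin_hom_zero[OF pre_operad_module[OF Q] pre_operad_module[OF Q] pre_operad_act[OF Q]] by auto
  fix ns e es
  assume c: "composable P ns e es \<and> (e \<in> {x \<in> carrier (space P (length ns)). f (length ns) x =
    \<zero>\<^bsub>space Q (length ns)\<^esub>} \<or>
    (\<exists>i<length ns. es ! i \<in> {x \<in> carrier (space P (ns ! i)). f (ns ! i) x = \<zero>\<^bsub>space Q (ns ! i)\<^esub>}))"
  then have c': "composable Q ns (f (length ns) e) (map2 f ns es)" using map2_composable[OF f(1)]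
    by blast
  have "length es = length ns" using c by (auto simp: composable_iff)
  then have "comp Q ns (f (length ns) e) (map2 f ns es) = \<zero>\<^bsub>space Q (sum_list ns)\<^esub>"
    using c comp_zero_root[OF Q c'] comp_zero_arg[OF Q c'] by auto
  then show "comp P ns e es \<in> {x \<in> carrier (space P (sum_list ns)). f (sum_list ns) x =
    \<zero>\<^bsub>space Q (sum_list ns)\<^esub>}"
    using c f(4) comp_closed[OF P] by auto
qed

context
  fixes K :: "('k, 'm) ring_scheme" and P :: "('k, 'a) operad" and I
  assumes P: "pre_operad K P" and I: "operad_ideal K P I"
begin

definition quot_class :: "nat \<Rightarrow> 'a \<Rightarrow> 'a set" where
  "quot_class n x = I n +>\<^bsub>space P n\<^esub> x"

lemma quot_operad_space: "space (quot_operad P I) n = quot_module (space P n) (I n)"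
  by (simp add: quot_operad_def)

lemma quot_class_hom: "quot_class n \<in> lin_hom K (space P n) (space (quot_operad P I) n)"
  using coset_lin_hom[OF pre_operad_module[OF P] operad_idealD(1)[OF I]]
  unfolding quot_operad_space quot_class_def[abs_def] .

lemma quot_operad_carrier: "carrier (space (quot_operad P I) n) =
  quot_class n ` carrier (space P n)"
  by (auto simp: quot_operad_space quot_module_simps[OF pre_operad_module[OF P] operad_idealD(1)[OF I]]
      quot_class_def)

lemma quot_operad_zero: "\<zero>\<^bsub>space (quot_operad P I) n\<^esub> = I n"
  by (simp add: quot_operad_space quot_module_simps[OF pre_operad_module[OF P] operad_idealD(1)[OF I]])

lemma quot_class_eq_iff:
  "x \<in> carrier (space P n) \<Longrightarrow> y \<in> carrier (space P n) \<Longrightarrow>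
    quot_class n x = quot_class n y \<longleftrightarrow> x \<ominus>\<^bsub>space P n\<^esub> y \<in> I n"
  unfolding quot_class_def by (rule coset_eq_iff[OF pre_operad_module[OF P] operad_idealD(1)[OF I]])

lemma quot_class_eq_zero_iff:
  "x \<in> carrier (space P n) \<Longrightarrow> quot_class n x = \<zero>\<^bsub>space (quot_operad P I) n\<^esub> \<longleftrightarrow> x \<in> I n"
  unfolding quot_class_def quot_operad_zero
  by (rule coset_eq_zero_iff[OF pre_operad_module[OF P] operad_idealD(1)[OF I]])

lemma module_quot_operad: "module K (space (quot_operad P I) n)"
  unfolding quot_operad_space
    by (rule module_quot[OF pre_operad_module[OF P] operad_idealD(1)[OF I]])

text \<open>The root is replaced first and then the inputs from left to right; each replacement
  changes the result by a composite with one factor in \<open>I\<close>.\<close>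

lemma quot_class_comp_cong:
  assumes c: "composable P ns e es" "composable P ns x xs"
    and eq: "quot_class (length ns) x = quot_class (length ns) e"
      "\<And>i. i < length ns \<Longrightarrow> quot_class (ns ! i) (xs ! i) = quot_class (ns ! i) (es ! i)"
  shows "quot_class (sum_list ns) (comp P ns x xs) = quot_class (sum_list ns) (comp P ns e es)"
proof -
  note cD = c[unfolded composable_iff]
  have cong: "quot_class (sum_list ns) (f a) = quot_class (sum_list ns) (f b)"
    if f: "f \<in> lin_hom K (space P n) (space P (sum_list ns))"
      and I': "\<And>a. a \<in> carrier (space P n) \<Longrightarrow> a \<in> I n \<Longrightarrow> f a \<in> I (sum_list ns)"
      and ab: "a \<in> carrier (space P n)" "b \<in> carrier (space P n)" "quot_class n a =
        quot_class n b" for n f a b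
  proof -
    interpret Pn: module K "space P n" by (rule pre_operad_module[OF P])
    have "f a \<ominus>\<^bsub>space P (sum_list ns)\<^esub> f b \<in> I (sum_list ns)"
      using I'[of "a \<ominus>\<^bsub>space P n\<^esub> b"] ab quot_class_eq_iff[of a n b]
        lin_hom_diff[OF pre_operad_module[OF P] pre_operad_module[OF P] f ab(1,2)] by auto
    then show ?thesis using quot_class_eq_iff lin_hom_closed[OF f] ab by simp
  qed
  have "quot_class (sum_list ns) (comp P ns x xs) = quot_class (sum_list ns) (comp P ns e xs)"
  proof (rule cong[OF pre_operad_root[OF P c(2)]])
    fix a assume "a \<in> carrier (space P (length ns))" "a \<in> I (length ns)"
    then show "comp P ns a xs \<in> I (sum_list ns)"
      using cD by (intro operad_idealD(3)[OF I]) (auto simp: composable_iff)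
  qed (use cD eq in auto)
  also have "\<dots> = quot_class (sum_list ns) (comp P ns e (take j es @ drop j xs))" if "j \<le> length ns" for j
    using that
  proof (induction j)
    case (Suc j)
    let ?zs = "take j es @ drop j xs"
    have j: "j < length ns" using Suc by simp
    have zc: "composable P ns e ?zs"
      using cD j by (auto simp: composable_iff nth_append)
    have u: "?zs[j := y] = take j es @ y # drop (Suc j) xs" for y
      using cD j by (simp add: list_update_append Cons_nth_drop_Suc[symmetric])
    have "quot_class (sum_list ns) (comp P ns e (?zs[j := xs ! j])) =
      quot_class (sum_list ns) (comp P ns e (?zs[j := es ! j]))"
    proof (rule cong[OF pre_operad_arg[OF P zc j]])
      fix a assume "a \<in> carrier (space P (ns ! j))" "a \<in> I (ns ! j)"
      then show "comp P ns e (?zs[j := a]) \<in> I (sum_list ns)"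
        using j cD by (intro operad_idealD(4)[OF I composable_update[OF P zc j] j]) auto
    qed (use cD eq j in auto)
    moreover have "?zs[j := xs ! j] = ?zs"
      using cD j by (simp add: u Cons_nth_drop_Suc)
    moreover have "?zs[j := es ! j] = take (Suc j) es @ drop (Suc j) xs"
      using cD j by (simp add: u take_Suc_conv_app_nth)
    ultimately show ?case using Suc by simp
  qed simp
  from this[of "length ns"] have "quot_class (sum_list ns) (comp P ns e xs) =
    quot_class (sum_list ns) (comp P ns e es)"
    using cD by simp
  finally show ?thesis .
qed

lemma mem_quot_class_iff:
  "x \<in> carrier (space P n) \<Longrightarrow> y \<in> quot_class n x \<longleftrightarrow> y \<in> carrier (space P n) \<and> quot_class n y =
    quot_class n x"
  unfolding quot_class_def
    by (rule mem_coset_iff[OF pre_operad_module[OF P] operad_idealD(1)[OF I]])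

lemma quot_operad_comp:
  assumes c: "composable P ns e es"
  shows "comp (quot_operad P I) ns (quot_class (length ns) e) (map2 quot_class ns es) =
    quot_class (sum_list ns) (comp P ns e es)"
proof -
  let ?X = "quot_class (length ns) e" and ?Xs = "map2 quot_class ns es"
  note cD = c[unfolded composable_iff]
  have mem: "composable P ns x xs \<and> quot_class (length ns) x = quot_class (length ns) e \<and>
    (\<forall>i<length ns. quot_class (ns ! i) (xs ! i) = quot_class (ns ! i) (es ! i))"
    if "x \<in> ?X" "xs \<in> listset ?Xs" for x xs
    using that cD mem_quot_class_iff by (auto simp: composable_iff in_listset_iff)
  have const: "quot_class (sum_list ns) (comp P ns x xs) =
    quot_class (sum_list ns) (comp P ns e es)"
    if "x \<in> ?X" "xs \<in> listset ?Xs" for x xs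
    using quot_class_comp_cong[OF c] mem[OF that] by blast
  have "e \<in> ?X" "es \<in> listset ?Xs"
    using cD mem_quot_class_iff by (auto simp: in_listset_iff)
  then have "(\<Union>x\<in>?X. \<Union>xs\<in>listset ?Xs. quot_class (sum_list ns) (comp P ns x xs)) =
    quot_class (sum_list ns) (comp P ns e es)"
    using const by blast
  then show ?thesis by (simp add: quot_operad_def quot_class_def)
qed

lemma quot_operad_act:
  assumes "\<sigma> permutes {1..n}" "x \<in> carrier (space P n)"
  shows "act (quot_operad P I) n \<sigma> (quot_class n x) = quot_class n (act P n \<sigma> x)"
  using UN_coset[OF pre_operad_module[OF P] operad_idealD(1)[OF I] pre_operad_module[OF P]
      operad_idealD(1)[OF I] pre_operad_act[OF P assms(1)] operad_idealD(2)[OF I assms(1)] assms(2)]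
  by (simp add: quot_operad_def quot_class_def)

lemma quot_operad_hom: "operad_hom K P (quot_operad P I) quot_class"
  unfolding operad_hom_def
proof (intro conjI allI impI ballI)
  show "quot_class 1 (ident P) = ident (quot_operad P I)"
    by (simp add: quot_operad_def quot_class_def)
qed (simp_all only: quot_class_hom quot_operad_act quot_operad_comp)

lemma quot_composableE:
  assumes "composable (quot_operad P I) ns X Xs"
  obtains e es where "composable P ns e es" "X = quot_class (length ns) e" "Xs =
    map2 quot_class ns es"
proof -
  obtain e where e: "e \<in> carrier (space P (length ns))" "X = quot_class (length ns) e"
    using assms by (auto simp: composable_iff quot_operad_carrier)
  have "\<forall>i<length ns. \<exists>x. x \<in> carrier (space P (ns ! i)) \<and> Xs ! i = quot_class (ns ! i) x"
    using assms by (auto simp: composable_iff quot_operad_carrier)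
  then obtain u where u: "\<And>i. i < length ns \<Longrightarrow> u i \<in> carrier (space P (ns ! i)) \<and> Xs ! i =
    quot_class (ns ! i) (u i)"
    by metis
  have "composable P ns e (map u [0..<length ns])" using e u by (auto simp: composable_iff)
  moreover have "Xs = map2 quot_class ns (map u [0..<length ns])"
    using assms u by (intro nth_equalityI) (auto simp: composable_iff)
  ultimately show ?thesis using that e by blast
qed

lemma quot_lin_homI:
  assumes "f \<in> lin_hom K (space P n) (space (quot_operad P I) m)"
    and "\<And>x. x \<in> carrier (space P n) \<Longrightarrow> g (quot_class n x) = f x"
  shows "g \<in> lin_hom K (space (quot_operad P I) n) (space (quot_operad P I) m)"
proof -
  interpret Pn: module K "space P n" by (rule pre_operad_module[OF P])
  note [simp] = lin_hom_add[OF quot_class_hom, symmetric] lin_hom_smult[OF quot_class_hom,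
    symmetric]
  show ?thesis using assms by (auto simp: lin_hom_iff quot_operad_carrier)
qed

lemma pre_operad_quot: "pre_operad K (quot_operad P I)"
  unfolding pre_operad_def
proof (intro conjI allI impI)
  show "module K (space (quot_operad P I) n)" for n by (rule module_quot_operad)
  show "act (quot_operad P I) n \<sigma> \<in>
    lin_hom K (space (quot_operad P I) n) (space (quot_operad P I) n)"
    if "\<sigma> permutes {1..n}" for n \<sigma>
    by (rule quot_lin_homI[OF lin_hom_compose[OF pre_operad_act[OF P that] quot_class_hom]])
      (simp add: quot_operad_act[OF that])
  show "ident (quot_operad P I) \<in> carrier (space (quot_operad P I) 1)"
    using pre_operad_ident[OF P] operad_homD(3)[OF quot_operad_hom] unfolding quot_operad_carrier
      by auto
  fix ns X Xs assume "composable (quot_operad P I) ns X Xs"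
  then obtain e es where c: "composable P ns e es" and X: "X = quot_class (length ns) e"
    and Xs: "Xs = map2 quot_class ns es" by (rule quot_composableE)
  note cD = c[unfolded composable_iff]
  show "(\<lambda>x. comp (quot_operad P I) ns x Xs) \<in>
    lin_hom K (space (quot_operad P I) (length ns)) (space (quot_operad P I) (sum_list ns))"
    by (rule quot_lin_homI[OF lin_hom_compose[OF pre_operad_root[OF P c] quot_class_hom]])
      (use cD in \<open>simp add: Xs quot_operad_comp composable_iff\<close>)
  fix i assume i: "i < length ns"
  show "(\<lambda>x. comp (quot_operad P I) ns X (Xs[i := x])) \<in>
    lin_hom K (space (quot_operad P I) (ns ! i)) (space (quot_operad P I) (sum_list ns))"
    by (rule quot_lin_homI[OF lin_hom_compose[OF pre_operad_arg[OF P c i] quot_class_hom]])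
      (use cD i in \<open>simp add: X Xs quot_operad_comp[OF composable_update[OF P c i],
        symmetric] map2_update\<close>)
qed

lemma quot_operad_lift:
  assumes Q: "pre_operad K Q" and f: "operad_hom K P Q f"
    and ker: "\<And>n x. x \<in> I n \<Longrightarrow> f n x = \<zero>\<^bsub>space Q n\<^esub>"
  obtains g where "operad_hom K (quot_operad P I) Q g"
    "\<And>n x. x \<in> carrier (space P n) \<Longrightarrow> g n (quot_class n x) = f n x"
proof -
  note f = operad_homD[OF f]
  have "\<exists>g. g \<in> lin_hom K (space (quot_operad P I) n) (space Q n) \<and>
    (\<forall>x\<in>carrier (space P n). g (quot_class n x) = f n x)" for n
    using quot_module_lift[OF pre_operad_module[OF P] operad_idealD(1)[OF I] pre_operad_module[OF Q] f(1) ker, of n]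
    unfolding quot_operad_space quot_class_def by metis
  then obtain g where g: "\<And>n. g n \<in> lin_hom K (space (quot_operad P I) n) (space Q n)"
    "\<And>n x. x \<in> carrier (space P n) \<Longrightarrow> g n (quot_class n x) = f n x" by metis
  have "operad_hom K (quot_operad P I) Q g"
    unfolding operad_hom_def
  proof (intro conjI allI impI ballI)
    show "g n \<in> lin_hom K (space (quot_operad P I) n) (space Q n)" for n by (rule g(1))
    show "g n (act (quot_operad P I) n \<sigma> X) = act Q n \<sigma> (g n X)"
      if s: "\<sigma> permutes {1..n}" and X: "X \<in> carrier (space (quot_operad P I) n)" for n \<sigma> X
      using X f(2)[OF s] g(2) act_closed[OF P s]
        by (auto simp: quot_operad_carrier quot_operad_act[OF s])
    show "g 1 (ident (quot_operad P I)) = ident Q"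
      using operad_homD(3)[OF quot_operad_hom] g(2)[OF pre_operad_ident[OF P]] f(3) by simp
    fix ns X Xs assume "composable (quot_operad P I) ns X Xs"
    then obtain e es where c: "composable P ns e es" and X: "X = quot_class (length ns) e"
      and Xs: "Xs = map2 quot_class ns es" by (rule quot_composableE)
    have "map2 g ns Xs = map2 f ns es"
      using c g(2) unfolding Xs by (intro nth_equalityI) (auto simp: composable_iff)
    then show "g (sum_list ns) (comp (quot_operad P I) ns X Xs) =
      comp Q ns (g (length ns) X) (map2 g ns Xs)"
      using f(4)[OF c] g(2) comp_closed[OF P c] c
      by (simp add: X Xs quot_operad_comp[OF c] composable_iff)
  qed
  then show ?thesis using that g(2) by blast
qed

text \<open>As \<open>I n\<close> is contained in \<open>J n\<close>, the ideal \<open>J\<close> is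
  the full preimage of its image in the quotient. That image is an ideal containing
  \<open>G\<close>, hence contains the ideal generated by \<open>G\<close>. An ideal generated
  inside a quotient is thus bounded by an ideal upstairs.\<close>

lemma quot_gen_ideal_vimage:
  assumes J: "operad_ideal K P J" and IJ: "\<And>n. I n \<subseteq> J n"
    and G: "\<And>n. G n \<subseteq> quot_class n ` J n"
    and x: "x \<in> carrier (space P n)" "quot_class n x \<in> gen_ideal K (quot_operad P I) G n"
  shows "x \<in> J n"
proof -
  have Jc: "J n \<subseteq> carrier (space P n)" for n
    using operad_idealD(1)[OF J] module.submoduleE(1)[OF pre_operad_module[OF P]] by blast
  have sat: "x \<in> J n" if "quot_class n x \<in> quot_class n ` J n" "x \<in> carrier (space P n)" for n x
  proof -
    interpret Pn: module K "space P n" by (rule pre_operad_module[OF P])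
    obtain y where y: "y \<in> J n" "quot_class n x = quot_class n y" using \<open>quot_class n x \<in> _\<close> by auto
    then have "x \<ominus>\<^bsub>space P n\<^esub> y \<in> J n" using quot_class_eq_iff[OF that(2)] Jc IJ by blast
    moreover have "x = (x \<ominus>\<^bsub>space P n\<^esub> y) \<oplus>\<^bsub>space P n\<^esub> y"
      using that(2) y(1) Jc by (auto simp: Pn.M.minus_eq Pn.M.a_assoc Pn.M.l_neg subset_iff)
    ultimately show ?thesis
      using y(1) operad_idealD(1)[OF J, of n] unfolding Pn.submodule_iff by metis
  qed
  have "operad_ideal K (quot_operad P I) (\<lambda>n. quot_class n ` J n)"
    unfolding operad_ideal_def S_submodule_def
  proof (intro conjI allI impI ballI)
    show "submodule (quot_class n ` J n) K (space (quot_operad P I) n)" for n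
      by (rule submodule_image[OF pre_operad_module[OF P] module_quot_operad quot_class_hom operad_idealD(1)[OF J]])
    show "act (quot_operad P I) n \<sigma> X \<in> quot_class n ` J n"
      if s: "\<sigma> permutes {1..n}" and X: "X \<in> quot_class n ` J n" for n \<sigma> X
      using X Jc operad_idealD(2)[OF J s] by (auto simp: quot_operad_act[OF s] subset_iff)
    fix ns X Xs
    assume a: "composable (quot_operad P I) ns X Xs \<and> (X \<in> quot_class (length ns) ` J (length ns) \<or>
      (\<exists>i<length ns. Xs ! i \<in> quot_class (ns ! i) ` J (ns ! i)))"
    from a have "composable (quot_operad P I) ns X Xs" by simp
    then obtain e es where c: "composable P ns e es" and X: "X = quot_class (length ns) e"
      and Xs: "Xs = map2 quot_class ns es" by (rule quot_composableE)
    note cD = c[unfolded composable_iff]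
    have "X \<in> quot_class (length ns) ` J (length ns) \<Longrightarrow> e \<in> J (length ns)"
      using sat[of "length ns" e] cD X by simp
    moreover have "es ! i \<in> J (ns ! i)" if "i < length ns" "Xs ! i \<in>
      quot_class (ns ! i) ` J (ns ! i)" for i
      using sat[of "ns ! i" "es ! i"] cD that Xs by simp
    ultimately have "e \<in> J (length ns) \<or> (\<exists>i<length ns. es ! i \<in> J (ns ! i))"
      using a by blast
    then have "comp P ns e es \<in> J (sum_list ns)" using operad_idealD(3,4)[OF J c] by blast
    then show "comp (quot_operad P I) ns X Xs \<in> quot_class (sum_list ns) ` J (sum_list ns)"
      by (simp add: X Xs quot_operad_comp[OF c])
  qed
  then have "gen_ideal K (quot_operad P I) G n \<subseteq> quot_class n ` J n"
    using G by (rule gen_ideal_least)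
  then show ?thesis using x sat by blast
qed

end

subsection \<open>Linearized set operads\<close>

definition prod_eval :: "('k, 'm) ring_scheme \<Rightarrow> ('x \<Rightarrow> 'k) list \<Rightarrow> 'x list \<Rightarrow> 'k" where
  "prod_eval K fs xs = foldr (\<otimes>\<^bsub>K\<^esub>) (map2 (\<lambda>g y. g y) fs xs) \<one>\<^bsub>K\<^esub>"

context
  fixes K :: "('k, 'm) ring_scheme"
  assumes K: "cring K"
begin

interpretation K: cring K by (rule K)

lemma prod_eval_closed:
  "(\<And>f. f \<in> set fs \<Longrightarrow> range f \<subseteq> carrier K) \<Longrightarrow> prod_eval K fs xs \<in> carrier K"
proof (induction fs arbitrary: xs)
  case (Cons f fs)
  then have "range f \<subseteq> carrier K" "prod_eval K fs ys \<in> carrier K" for ys by auto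
  then show ?case by (cases xs) (auto simp: prod_eval_def)
qed (simp add: prod_eval_def)

text \<open>The constant function one is a placeholder in slot \<open>i\<close>: it leaves the
  product of the other factors, which makes the dependence on slot \<open>i\<close> visibly
  linear.\<close>

lemma prod_eval_update:
  assumes "\<And>f. f \<in> set fs \<Longrightarrow> range f \<subseteq> carrier K" "range g \<subseteq> carrier K"
    and "length xs = length fs" "i < length fs"
  shows "prod_eval K (fs[i := g]) xs = g (xs ! i) \<otimes>\<^bsub>K\<^esub> prod_eval K (fs[i := \<lambda>_. \<one>\<^bsub>K\<^esub>]) xs"
  using assms(1,3,4)
proof (induction fs arbitrary: xs i)
  case (Cons f fs)
  obtain y ys where xs: "xs = y # ys" "length ys = length fs" using Cons.prems(2) by (cases xs) auto
  have f: "range f \<subseteq> carrier K" and fs: "\<And>f. f \<in> set fs \<Longrightarrow> range f \<subseteq> carrier K"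
    using Cons.prems(1) by auto
  show ?case
  proof (cases i)
    case 0
    have "prod_eval K fs ys \<in> carrier K" by (rule prod_eval_closed) (use fs in auto)
    then show ?thesis using 0 xs f assms(2) by (auto simp: prod_eval_def)
  next
    case (Suc j)
    then have j: "j < length fs" using Cons.prems by simp
    let ?p = "prod_eval K (fs[j := \<lambda>_. \<one>\<^bsub>K\<^esub>]) ys"
    have p: "?p \<in> carrier K"
    proof (rule prod_eval_closed)
      fix h assume "h \<in> set (fs[j := \<lambda>_. \<one>\<^bsub>K\<^esub>])"
      then have "h \<in> set fs \<or> h = (\<lambda>_. \<one>\<^bsub>K\<^esub>)" using set_update_subset_insert[of fs j] by auto
      then show "range h \<subseteq> carrier K" using fs by auto
    qed
    have g: "g (ys ! j) \<in> carrier K" "f y \<in> carrier K" using f assms(2) by auto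
    have "prod_eval K ((f # fs)[i := g]) xs = f y \<otimes>\<^bsub>K\<^esub> prod_eval K (fs[j := g]) ys"
      using Suc xs by (simp add: prod_eval_def)
    also have "\<dots> = f y \<otimes>\<^bsub>K\<^esub> (g (ys ! j) \<otimes>\<^bsub>K\<^esub> ?p)"
      using Cons.IH[OF fs xs(2) j] by simp
    also have "\<dots> = g (ys ! j) \<otimes>\<^bsub>K\<^esub> (f y \<otimes>\<^bsub>K\<^esub> ?p)"
      using p g by (simp add: K.m_lcomm)
    finally show ?thesis using Suc xs by (simp add: prod_eval_def)
  qed
qed simp

lemma multilin_ext_superset:
  assumes "\<And>f. f \<in> set (g # fs) \<Longrightarrow> range f \<subseteq> carrier K"
    and "finite S" "supp K g \<subseteq> S" "length Ss = length fs"
    and "\<And>i. i < length fs \<Longrightarrow> finite (Ss ! i) \<and> supp K (fs ! i) \<subseteq> Ss ! i"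
  shows "multilin_ext K c g fs z =
    finsum K (\<lambda>(x, xs). g x \<otimes>\<^bsub>K\<^esub> prod_eval K fs xs) {(x, xs). x \<in> S \<and> xs \<in> listset Ss \<and> c x xs = z}"
proof -
  let ?A = "{(x, xs). x \<in> supp K g \<and> xs \<in> listset (map (supp K) fs) \<and> c x xs = z}"
  let ?B = "{(x, xs). x \<in> S \<and> xs \<in> listset Ss \<and> c x xs = z}"
  let ?h = "\<lambda>(x, xs). g x \<otimes>\<^bsub>K\<^esub> prod_eval K fs xs"
  have "finite (listset Ss)"
    by (rule finite_listset) (use assms(4,5) in \<open>auto simp: in_set_conv_nth\<close>)
  then have "finite (S \<times> listset Ss)" using assms(2) by simp
  then have finB: "finite ?B" by (rule finite_subset[rotated]) auto
  have g: "range g \<subseteq> carrier K" and fs: "\<And>f. f \<in> set fs \<Longrightarrow> range f \<subseteq> carrier K"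
    using assms(1) by auto
  have cl: "?h p \<in> carrier K" for p
    using g prod_eval_closed[OF fs] by (cases p) auto
  have sub: "?A \<subseteq> ?B" using assms(3-5) by (auto simp: in_listset_iff)
  have zero: "?h p = \<zero>\<^bsub>K\<^esub>" if pB: "p \<in> ?B - ?A" for p
  proof -
    obtain x xs where p: "p = (x, xs)" by (cases p)
    have len: "length xs = length fs" using pB p assms(4) by (auto simp: in_listset_iff)
    have gx: "g x \<in> carrier K" using g by auto
    show ?thesis
    proof (cases "g x = \<zero>\<^bsub>K\<^esub>")
      case True
      then show ?thesis using p prod_eval_closed[OF fs] by simp
    next
      case False
      \<comment> \<open>A list outside the product of the supports has some entry outside its
        support, and this zero factor kills the whole product.\<close>
      then obtain i where i: "i < length fs" "(fs ! i) (xs ! i) = \<zero>\<^bsub>K\<^esub>"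
        using pB p len by (auto simp: in_listset_iff supp_def)
      have "range (fs ! i) \<subseteq> carrier K" using fs i by auto
      then have "prod_eval K (fs[i := fs ! i]) xs =
        (fs ! i) (xs ! i) \<otimes>\<^bsub>K\<^esub> prod_eval K (fs[i := \<lambda>_. \<one>\<^bsub>K\<^esub>]) xs"
        using prod_eval_update[of fs, OF fs _ len i(1)] by blast
      moreover have "prod_eval K (fs[i := \<lambda>_. \<one>\<^bsub>K\<^esub>]) xs \<in> carrier K"
      proof (rule prod_eval_closed)
        fix h assume "h \<in> set (fs[i := \<lambda>_. \<one>\<^bsub>K\<^esub>])"
        then have "h \<in> set fs \<or> h = (\<lambda>_. \<one>\<^bsub>K\<^esub>)" using set_update_subset_insert[of fs i] by auto
        then show "range h \<subseteq> carrier K" using fs by auto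
      qed
      ultimately have "prod_eval K fs xs = \<zero>\<^bsub>K\<^esub>" using i(2) by simp
      then show ?thesis using p gx by simp
    qed
  qed
  have "multilin_ext K c g fs z = finsum K ?h ?A"
    by (simp add: multilin_ext_def prod_eval_def)
  also have "\<dots> = finsum K ?h ?B"
    by (rule K.add.finprod_mono_neutral_cong_left[OF finB sub]) (use zero cl in auto)
  finally show ?thesis .
qed

end

context
  fixes K :: "('k, 'm) ring_scheme" and X :: "nat \<Rightarrow> 'x set" and a u c
  assumes K: "cring K"
    and a_closed: "\<And>n \<sigma> x. \<sigma> permutes {1..n} \<Longrightarrow> x \<in> X n \<Longrightarrow> a n \<sigma> x \<in> X n"
    and u_closed: "u \<in> X 1"
    and c_closed: "\<And>ns x xs. x \<in> X (length ns) \<Longrightarrow> length xs = length ns \<Longrightarrow>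
      (\<And>i. i < length ns \<Longrightarrow> xs ! i \<in> X (ns ! i)) \<Longrightarrow> c ns x xs \<in> X (sum_list ns)"
begin

interpretation K: cring K by (rule K)

private abbreviation (input) "L \<equiv> lin_operad K X a u c"

lemma lin_operad_space: "space L n = free_module K (X n)"
  by (simp add: lin_operad_def)

lemma multilin_ext_closed:
  assumes "composable L ns g fs"
  shows "multilin_ext K (c ns) g fs \<in> carrier (free_module K (X (sum_list ns)))"
proof -
  have g: "range g \<subseteq> carrier K" "finite (supp K g)" "supp K g \<subseteq> X (length ns)"
    and len: "length fs = length ns"
    and fs: "\<And>i. i < length ns \<Longrightarrow> range (fs ! i) \<subseteq> carrier K \<and> finite (supp K (fs ! i)) \<and>
      supp K (fs ! i) \<subseteq> X (ns ! i)"
    using assms by (auto simp: composable_iff lin_operad_space free_module_simps)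
  have fs': "range f \<subseteq> carrier K" if "f \<in> set fs" for f
    using that fs len by (auto simp: in_set_conv_nth)
  let ?S = "supp K g \<times> listset (map (supp K) fs)"
  have "finite (listset (map (supp K) fs))"
    by (rule finite_listset) (use fs len in \<open>auto simp: in_set_conv_nth\<close>)
  then have fin: "finite ?S" using g by simp
  have "supp K (multilin_ext K (c ns) g fs) \<subseteq> (\<lambda>(x, xs). c ns x xs) ` ?S"
  proof
    fix z assume z: "z \<in> supp K (multilin_ext K (c ns) g fs)"
    show "z \<in> (\<lambda>(x, xs). c ns x xs) ` ?S"
    proof (rule ccontr)
      assume "z \<notin> (\<lambda>(x, xs). c ns x xs) ` ?S"
      then have e: "{(x, xs). x \<in> supp K g \<and> xs \<in> listset (map (supp K) fs) \<and> c ns x xs = z} = {}"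
        by auto
      have "multilin_ext K (c ns) g fs z = \<zero>\<^bsub>K\<^esub>"
        unfolding multilin_ext_def e by simp
      then show False using z by (simp add: supp_def)
    qed
  qed
  moreover have "(\<lambda>(x, xs). c ns x xs) ` ?S \<subseteq> X (sum_list ns)"
    using g(3) fs len by (force simp: in_listset_iff intro!: c_closed)
  moreover have "multilin_ext K (c ns) g fs z \<in> carrier K" for z
    unfolding multilin_ext_def
    using g(1) prod_eval_closed[OF K fs'] by (auto intro!: K.finsum_closed simp: prod_eval_def)
  ultimately show ?thesis using fin
    by (auto simp: free_module_simps intro: finite_subset[OF _ finite_imageI])
qed

lemma multilin_ext_lin_root:
  assumes c: "composable L ns g fs"
  shows "(\<lambda>x. multilin_ext K (c ns) x fs) \<in>
    lin_hom K (free_module K (X (length ns))) (free_module K (X (sum_list ns)))"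
proof (rule lin_hom_lin_combI[OF module_free[OF K] module_free[OF K]])
  let ?M = "free_module K (X (length ns))" and ?N = "free_module K (X (sum_list ns))"
  interpret F: module K ?M by (rule module_free[OF K])
  have cl: "composable L ns h fs" if "h \<in> carrier ?M" for h
    using c that by (auto simp: composable_iff lin_operad_space)
  show "multilin_ext K (c ns) h fs \<in> carrier ?N" if "h \<in> carrier ?M" for h
    using multilin_ext_closed[OF cl[OF that]] .
  fix b x y assume b: "b \<in> carrier K" and xy: "x \<in> carrier ?M" "y \<in> carrier ?M"
  have len: "length fs = length ns"
    and fs: "\<And>i. i < length ns \<Longrightarrow> range (fs ! i) \<subseteq> carrier K \<and> finite (supp K (fs ! i))"
    using c by (auto simp: composable_iff lin_operad_space free_module_simps)
  have fs': "range f \<subseteq> carrier K" if "f \<in> set fs" for f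
    using that fs len by (auto simp: in_set_conv_nth)
  define S where "S = supp K x \<union> supp K y"
  define w where "w = (b \<odot>\<^bsub>?M\<^esub> x) \<oplus>\<^bsub>?M\<^esub> y"
  have w: "w \<in> carrier ?M" using b xy by (simp add: w_def)
  have S: "finite S" "supp K x \<subseteq> S" "supp K y \<subseteq> S" "supp K w \<subseteq> S"
    using xy b by (auto simp: S_def w_def free_module_simps supp_def)
  have r: "range h \<subseteq> carrier K" if "h \<in> carrier ?M" for h
    using that by (auto simp: free_module_simps)
  have r': "h z \<in> carrier K" if "h \<in> carrier ?M" for h z
    using r[OF that] by auto
  have ext: "multilin_ext K (c ns) h fs z = finsum K (\<lambda>(x, xs). h x \<otimes>\<^bsub>K\<^esub> prod_eval K fs xs)
      {(x, xs). x \<in> S \<and> xs \<in> listset (map (supp K) fs) \<and> c ns x xs = z}"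
    if "h \<in> carrier ?M" "supp K h \<subseteq> S" for h z
    by (rule multilin_ext_superset[OF K]) (use fs' fs len S r[OF that(1)] that(2) in auto)
  have "finite (listset (map (supp K) fs))"
    by (rule finite_listset) (use fs len in \<open>auto simp: in_set_conv_nth\<close>)
  then have "finite (S \<times> listset (map (supp K) fs))" using S by simp
  then have fin: "finite {(x, xs). x \<in> S \<and> xs \<in> listset (map (supp K) fs) \<and> c ns x xs = z}" for z
    by (rule finite_subset[rotated]) auto
  have p: "prod_eval K fs xs \<in> carrier K" for xs using prod_eval_closed[OF K fs'] .
  have "multilin_ext K (c ns) w fs z =
    b \<otimes>\<^bsub>K\<^esub> multilin_ext K (c ns) x fs z \<oplus>\<^bsub>K\<^esub> multilin_ext K (c ns) y fs z" for z
  proof -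
    let ?A = "{(x, xs). x \<in> S \<and> xs \<in> listset (map (supp K) fs) \<and> c ns x xs = z}"
    let ?t = "\<lambda>h (x, xs). h x \<otimes>\<^bsub>K\<^esub> prod_eval K fs xs"
    have t: "?t h \<in> ?A \<rightarrow> carrier K" if "h \<in> carrier ?M" for h
      using r'[OF that] p by auto
    have "multilin_ext K (c ns) w fs z = finsum K (?t w) ?A" using ext[OF w S(4)] .
    also have "\<dots> = finsum K (\<lambda>q. b \<otimes>\<^bsub>K\<^esub> ?t x q \<oplus>\<^bsub>K\<^esub> ?t y q) ?A"
      using r'[OF xy(1)] r'[OF xy(2)] b p
      by (intro K.finsum_cong') (auto simp: w_def free_module_simps K.l_distr K.m_assoc)
    also have "\<dots> = finsum K (\<lambda>q. b \<otimes>\<^bsub>K\<^esub> ?t x q) ?A \<oplus>\<^bsub>K\<^esub> finsum K (?t y) ?A"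
      using r'[OF xy(1)] r'[OF xy(2)] p b by (intro K.finsum_addf) auto
    also have "finsum K (\<lambda>q. b \<otimes>\<^bsub>K\<^esub> ?t x q) ?A = b \<otimes>\<^bsub>K\<^esub> finsum K (?t x) ?A"
      using fin t[OF xy(1)] b by (intro K.finsum_rdistr[symmetric]) auto
    finally show ?thesis using ext[OF xy(1) S(2)] ext[OF xy(2) S(3)] by simp
  qed
  then show "multilin_ext K (c ns) ((b \<odot>\<^bsub>?M\<^esub> x) \<oplus>\<^bsub>?M\<^esub> y) fs =
    (b \<odot>\<^bsub>?N\<^esub> multilin_ext K (c ns) x fs) \<oplus>\<^bsub>?N\<^esub> multilin_ext K (c ns) y fs"
    unfolding w_def[symmetric] by (auto simp: free_module_simps)
qed

lemma multilin_ext_lin_arg: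
  assumes c: "composable L ns g fs" and i: "i < length ns"
  shows "(\<lambda>x. multilin_ext K (c ns) g (fs[i := x])) \<in>
    lin_hom K (free_module K (X (ns ! i))) (free_module K (X (sum_list ns)))"
proof (rule lin_hom_lin_combI[OF module_free[OF K] module_free[OF K]])
  let ?M = "free_module K (X (ns ! i))" and ?N = "free_module K (X (sum_list ns))"
  interpret F: module K ?M by (rule module_free[OF K])
  have cl: "composable L ns g (fs[i := h])" if "h \<in> carrier ?M" for h
    using c that i by (auto simp: composable_iff lin_operad_space nth_list_update)
  show "multilin_ext K (c ns) g (fs[i := h]) \<in> carrier ?N" if "h \<in> carrier ?M" for h
    using multilin_ext_closed[OF cl[OF that]] .
  fix b x y assume b: "b \<in> carrier K" and xy: "x \<in> carrier ?M" "y \<in> carrier ?M"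
  have len: "length fs = length ns" and g: "range g \<subseteq> carrier K" "finite (supp K g)"
    and fs: "\<And>i. i < length ns \<Longrightarrow> range (fs ! i) \<subseteq> carrier K \<and> finite (supp K (fs ! i))"
    using c by (auto simp: composable_iff lin_operad_space free_module_simps)
  have fs': "range f \<subseteq> carrier K" if "f \<in> set fs" for f
    using that fs len by (auto simp: in_set_conv_nth)
  define S where "S = supp K x \<union> supp K y"
  \<comment> \<open>Only slot \<open>i\<close> varies, so only its support is enlarged; the sums for
    \<open>x\<close>, \<open>y\<close> and \<open>w\<close> then run over one index set.\<close>
  define Ss where "Ss = (map (supp K) fs)[i := S]"
  define w where "w = (b \<odot>\<^bsub>?M\<^esub> x) \<oplus>\<^bsub>?M\<^esub> y"
  have w: "w \<in> carrier ?M" using b xy by (simp add: w_def)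
  have S: "finite S" "supp K x \<subseteq> S" "supp K y \<subseteq> S" "supp K w \<subseteq> S"
    using xy b by (auto simp: S_def w_def free_module_simps supp_def)
  have r: "range h \<subseteq> carrier K" if "h \<in> carrier ?M" for h
    using that by (auto simp: free_module_simps)
  have r': "h z \<in> carrier K" if "h \<in> carrier ?M" for h z
    using r[OF that] by auto
  have Ss: "length Ss = length fs" "\<And>j. j < length fs \<Longrightarrow> finite (Ss ! j)"
    using fs len S(1) i by (auto simp: Ss_def nth_list_update)
  have p: "prod_eval K (fs[i := \<lambda>_. \<one>\<^bsub>K\<^esub>]) xs \<in> carrier K" for xs
  proof (rule prod_eval_closed[OF K])
    fix h assume "h \<in> set (fs[i := \<lambda>_. \<one>\<^bsub>K\<^esub>])"
    then have "h \<in> set fs \<or> h = (\<lambda>_. \<one>\<^bsub>K\<^esub>)" using set_update_subset_insert[of fs i] by auto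
    then show "range h \<subseteq> carrier K" using fs' by auto
  qed
  have gx: "g z \<in> carrier K" for z using g(1) by auto
  have ext: "multilin_ext K (c ns) g (fs[i := h]) z =
      finsum K (\<lambda>(x, xs). g x \<otimes>\<^bsub>K\<^esub> (h (xs ! i) \<otimes>\<^bsub>K\<^esub> prod_eval K (fs[i := \<lambda>_. \<one>\<^bsub>K\<^esub>]) xs))
      {(x, xs). x \<in> supp K g \<and> xs \<in> listset Ss \<and> c ns x xs = z}" (is "_ = finsum K ?t ?A")
    if h: "h \<in> carrier ?M" "supp K h \<subseteq> S" for h z
  proof -
    have "f \<in> set (fs[i := h]) \<Longrightarrow> range f \<subseteq> carrier K" for f
      using set_update_subset_insert[of fs i h] fs' r[OF h(1)] by blast
    then have r2: "f \<in> set (g # fs[i := h]) \<Longrightarrow> range f \<subseteq> carrier K" for f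
      using g(1) by auto
    have "multilin_ext K (c ns) g (fs[i := h]) z =
      finsum K (\<lambda>(x, xs). g x \<otimes>\<^bsub>K\<^esub> prod_eval K (fs[i := h]) xs) ?A"
      by (rule multilin_ext_superset[OF K r2])
        (use fs len S g Ss h i in \<open>auto simp: nth_list_update Ss_def\<close>)
    moreover have "prod_eval K (fs[i := h]) xs = h (xs ! i) \<otimes>\<^bsub>K\<^esub> prod_eval K (fs[i := \<lambda>_. \<one>\<^bsub>K\<^esub>]) xs"
      if "xs \<in> listset Ss" for xs
      using that i len Ss(1) fs' r[OF h(1)]
        by (intro prod_eval_update[OF K]) (auto simp: in_listset_iff)
    moreover have "finsum K (\<lambda>(x, xs). g x \<otimes>\<^bsub>K\<^esub> prod_eval K (fs[i := h]) xs) ?A = finsum K ?t ?A"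
      using calculation(2) p gx r'[OF h(1)] by (intro K.finsum_cong') auto
    ultimately show ?thesis by simp
  qed
  have "finite (listset Ss)"
    by (rule finite_listset) (use Ss in \<open>auto simp: in_set_conv_nth\<close>)
  then have "finite (supp K g \<times> listset Ss)" using g by simp
  then have fin: "finite {(x, xs). x \<in> supp K g \<and> xs \<in> listset Ss \<and> c ns x xs = z}" for z
    by (rule finite_subset[rotated]) auto
  have "multilin_ext K (c ns) g (fs[i := w]) z =
    b \<otimes>\<^bsub>K\<^esub> multilin_ext K (c ns) g (fs[i := x]) z \<oplus>\<^bsub>K\<^esub> multilin_ext K (c ns) g (fs[i := y]) z" for z
  proof -
    let ?A = "{(x, xs). x \<in> supp K g \<and> xs \<in> listset Ss \<and> c ns x xs = z}"
    let ?t = "\<lambda>h (x, xs). g x \<otimes>\<^bsub>K\<^esub> (h (xs ! i) \<otimes>\<^bsub>K\<^esub> prod_eval K (fs[i := \<lambda>_. \<one>\<^bsub>K\<^esub>]) xs)"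
    have t: "?t h \<in> ?A \<rightarrow> carrier K" if "h \<in> carrier ?M" for h
      using r'[OF that] p gx by auto
    have "multilin_ext K (c ns) g (fs[i := w]) z = finsum K (?t w) ?A" using ext[OF w S(4)] .
    also have "\<dots> = finsum K (\<lambda>q. b \<otimes>\<^bsub>K\<^esub> ?t x q \<oplus>\<^bsub>K\<^esub> ?t y q) ?A"
      using r'[OF xy(1)] r'[OF xy(2)] b p gx
      by (intro K.finsum_cong')
        (auto simp: w_def free_module_simps K.l_distr K.r_distr K.m_assoc K.m_lcomm)
    also have "\<dots> = finsum K (\<lambda>q. b \<otimes>\<^bsub>K\<^esub> ?t x q) ?A \<oplus>\<^bsub>K\<^esub> finsum K (?t y) ?A"
      using r'[OF xy(1)] r'[OF xy(2)] p gx b by (intro K.finsum_addf) auto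
    also have "finsum K (\<lambda>q. b \<otimes>\<^bsub>K\<^esub> ?t x q) ?A = b \<otimes>\<^bsub>K\<^esub> finsum K (?t x) ?A"
      using fin t[OF xy(1)] b by (intro K.finsum_rdistr[symmetric]) auto
    finally show ?thesis using ext[OF xy(1) S(2)] ext[OF xy(2) S(3)] by simp
  qed
  then show "multilin_ext K (c ns) g (fs[i := (b \<odot>\<^bsub>?M\<^esub> x) \<oplus>\<^bsub>?M\<^esub> y]) =
    (b \<odot>\<^bsub>?N\<^esub> multilin_ext K (c ns) g (fs[i := x])) \<oplus>\<^bsub>?N\<^esub> multilin_ext K (c ns) g (fs[i := y])"
    unfolding w_def[symmetric] by (auto simp: free_module_simps)
qed

lemma pre_operad_lin: "pre_operad K L"
  unfolding pre_operad_def
proof (intro conjI allI impI)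
  show "module K (space L n)" for n using module_free[OF K] by (simp add: lin_operad_space)
  show "act L n \<sigma> \<in> lin_hom K (space L n) (space L n)" if "\<sigma> permutes {1..n}" for n \<sigma>
    using lin_ext_hom[OF K, of "X n" "a n \<sigma>" "X n"] a_closed[OF that]
    by (simp add: lin_operad_def)
  show "ident L \<in> carrier (space L 1)"
    using single_closed[OF K u_closed] by (simp add: lin_operad_def)
qed (use multilin_ext_lin_root multilin_ext_lin_arg in \<open>auto simp: lin_operad_def\<close>)

lemma lin_operad_act_single: "act L n \<sigma> (single K x) = single K (a n \<sigma> x)"
  using lin_ext_single[OF K] by (simp add: lin_operad_def)

lemma lin_operad_ident: "ident L = single K u"
  by (simp add: lin_operad_def)

text \<open>Injectivity leaves each composite with exactly one decomposition, so its coefficient is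
  a product of ones and not a multiplicity, which could vanish in positive characteristic.\<close>

lemma multilin_ext_indicator:
  assumes inj: "inj_on (\<lambda>(x, xs). c ns x xs) (S \<times> listset Ss)" and fin: "finite S" "\<And>S. S \<in> set Ss
    \<Longrightarrow> finite S"
  shows "multilin_ext K (c ns) (\<lambda>x. if x \<in> S then \<one>\<^bsub>K\<^esub> else \<zero>\<^bsub>K\<^esub>) (map (\<lambda>S x. if x \<in>
    S then \<one>\<^bsub>K\<^esub> else \<zero>\<^bsub>K\<^esub>) Ss) =
    (\<lambda>z. if z \<in> (\<lambda>(x, xs). c ns x xs) ` (S \<times> listset Ss) then \<one>\<^bsub>K\<^esub> else \<zero>\<^bsub>K\<^esub>)"
proof
  fix z
  let ?i = "\<lambda>S x. if x \<in> S then \<one>\<^bsub>K\<^esub> else \<zero>\<^bsub>K\<^esub>"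
  let ?A = "{(x, xs). x \<in> S \<and> xs \<in> listset Ss \<and> c ns x xs = z}"
  have "multilin_ext K (c ns) (?i S) (map ?i Ss) z =
    finsum K (\<lambda>(x, xs). ?i S x \<otimes>\<^bsub>K\<^esub> prod_eval K (map ?i Ss) xs) ?A"
    by (rule multilin_ext_superset[OF K]) (use fin in \<open>auto simp: supp_def\<close>)
  also have "\<dots> = finsum K (\<lambda>p. \<one>\<^bsub>K\<^esub>) ?A"
  proof (rule K.finsum_cong')
    have "prod_eval K (map ?i Ss) xs = \<one>\<^bsub>K\<^esub>" if "xs \<in> listset Ss" for xs
      using that
    proof (induction Ss arbitrary: xs)
      case (Cons A Ss)
      then show ?case by (auto simp: set_Cons_def prod_eval_def)
    qed (simp add: prod_eval_def)
    then show "\<And>p. p \<in> ?A \<Longrightarrow> (case p of (x, xs) \<Rightarrow> ?i S x \<otimes>\<^bsub>K\<^esub> prod_eval K (map ?i Ss) xs) = \<one>\<^bsub>K\<^esub>"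
      by auto
  qed auto
  also have "\<dots> = ?i ((\<lambda>(x, xs). c ns x xs) ` (S \<times> listset Ss)) z"
  proof (cases "z \<in> (\<lambda>(x, xs). c ns x xs) ` (S \<times> listset Ss)")
    case True
    then obtain x xs where x: "x \<in> S" "xs \<in> listset Ss" "c ns x xs = z" by auto
    then have "?A = {(x, xs)}" using inj by (auto simp: inj_on_def)
    then show ?thesis using True by simp
  next
    case False
    then have e: "?A = {}" by auto
    show ?thesis unfolding e using False by simp
  qed
  finally show "multilin_ext K (c ns) (?i S) (map ?i Ss) z = ?i ((\<lambda>(x,
    xs). c ns x xs) ` (S \<times> listset Ss)) z" .
qed

lemma lin_operad_comp_single:
  "comp L ns (single K x) (map (single K) xs) = single K (c ns x xs)"
proof -
  have [simp]: "listset (map (\<lambda>x. {x}) xs) = {xs}" for xs :: "'x list"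
    by (induction xs) (auto simp: set_Cons_def)
  have s: "single K = (\<lambda>x y. if y \<in> {x} then \<one>\<^bsub>K\<^esub> else \<zero>\<^bsub>K\<^esub>)"
    by (auto simp: single_def fun_eq_iff)
  have fin: "finite S" if "S \<in> set (map (\<lambda>x. {x}) xs)" for S using that by auto
  have "multilin_ext K (c ns) (\<lambda>y. if y \<in> {x} then \<one>\<^bsub>K\<^esub> else \<zero>\<^bsub>K\<^esub>)
      (map (\<lambda>S y. if y \<in> S then \<one>\<^bsub>K\<^esub> else \<zero>\<^bsub>K\<^esub>) (map (\<lambda>x. {x}) xs)) =
    (\<lambda>z. if z \<in> (\<lambda>(x, xs). c ns x xs) ` ({x} \<times> listset (map (\<lambda>x. {x}) xs)) then \<one>\<^bsub>K\<^esub> else \<zero>\<^bsub>K\<^esub>)"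
    by (rule multilin_ext_indicator[OF _ _ fin]) auto
  then show ?thesis by (simp add: lin_operad_def s o_def)
qed

lemma lin_operad_homI:
  assumes Q: "pre_operad K Q"
    and f: "\<And>n. f n \<in> lin_hom K (space L n) (space Q n)"
    and act: "\<And>n \<sigma> x. \<sigma> permutes {1..n} \<Longrightarrow> x \<in> X n \<Longrightarrow>
      f n (single K (a n \<sigma> x)) = act Q n \<sigma> (f n (single K x))"
    and ident: "f 1 (single K u) = ident Q"
    and base: "\<And>ns x xs. x \<in> X (length ns) \<Longrightarrow> length xs = length ns \<Longrightarrow>
      (\<And>i. i < length ns \<Longrightarrow> xs ! i \<in> X (ns ! i)) \<Longrightarrow>
      f (sum_list ns) (single K (c ns x xs)) =
        comp Q ns (f (length ns) (single K x)) (map2 (\<lambda>n x. f n (single K x)) ns xs)"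
  shows "operad_hom K L Q f"
proof (rule operad_homI_span[OF pre_operad_lin Q f, of "\<lambda>n. single K ` X n"])
  show "single K ` X n \<subseteq> carrier (space L n)" for n
    using single_closed[OF K] by (auto simp: lin_operad_space)
  show "lin_span K (space L n) (single K ` X n) = carrier (space L n)" for n
    using free_module_span[OF K] by (simp add: lin_operad_space)
  show "f n (act L n \<sigma> x) = act Q n \<sigma> (f n x)" if "\<sigma> permutes {1..n}" "x \<in> single K ` X n" for n \<sigma> x
    using that act by (auto simp: lin_operad_act_single)
  show "f 1 (ident L) = ident Q" using ident by (simp add: lin_operad_ident)
  fix ns e es
  assume e: "e \<in> single K ` X (length ns)" and es: "length es = length ns"
    "\<And>i. i < length ns \<Longrightarrow> es ! i \<in> single K ` X (ns ! i)"
  obtain x where x: "x \<in> X (length ns)" "e = single K x" using e by auto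
  obtain u where u: "\<And>i. i < length ns \<Longrightarrow> u i \<in> X (ns ! i) \<and> es ! i = single K (u i)"
    using es(2) unfolding image_iff by metis
  define xs where "xs = map u [0..<length ns]"
  have xs: "length xs = length ns" "\<And>i. i < length ns \<Longrightarrow> xs ! i \<in> X (ns ! i)"
    and es': "es = map (single K) xs"
    using u es(1) by (auto simp: xs_def intro!: nth_equalityI)
  have "map2 f ns es = map2 (\<lambda>n x. f n (single K x)) ns xs"
    using xs(1) by (auto simp: es' intro!: nth_equalityI)
  then show "f (sum_list ns) (comp L ns e es) = comp Q ns (f (length ns) e) (map2 f ns es)"
    unfolding x(2) es' lin_operad_comp_single using base[OF x(1) xs] es' by simp
qed

end

subsection \<open>Hadamard products\<close>

text \<open>Applying the linear maps \<open>f\<close> and \<open>g\<close> inside a bilinearity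
  generator gives another such generator. This one fact covers the symmetric actions, compositions
  in a single slot, and the twist of a tensor product.\<close>

lemma bilin_rel_map:
  assumes M: "module K M" "module K N" and M': "module K M'" "module K N'"
    and F: "F \<in> lin_hom K (free_module K (carrier M \<times> carrier N)) (free_module K (carrier M' \<times> carrier N'))"
    and f: "f \<in> lin_hom K M M'" and g: "g \<in> lin_hom K N N'"
    and s: "\<And>x y. x \<in> carrier M \<Longrightarrow> y \<in> carrier N \<Longrightarrow> F (single K (x, y)) = single K (f x, g y)"
    and z: "z \<in> bilin_rel K M N"
  shows "F z \<in> bilin_rel K M' N'"
proof -
  interpret M: module K M by fact
  interpret N: module K N by fact
  let ?P = "free_module K (carrier M \<times> carrier N)" and ?P' =
    "free_module K (carrier M' \<times> carrier N')"
  interpret P: module K ?P by (rule module_free[OF M.R.cring_axioms])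
  note mod = module_free[OF M.R.cring_axioms]
  have sub: "submodule {z \<in> carrier ?P. F z \<in> bilin_rel K M' N'} K ?P"
    by (rule submodule_vimage[OF mod mod F submodule_bilin_rel[OF M']])
  have cl: "single K (x, y) \<in> carrier ?P" if "x \<in> carrier M" "y \<in> carrier N" for x y
    using single_pair_closed[OF M that] .
  note lin = lin_hom_diff[OF mod mod F] lin_hom_add[OF F] lin_hom_smult[OF F]
    lin_hom_add[OF f] lin_hom_smult[OF f] lin_hom_add[OF g] lin_hom_smult[OF g]
  have "bilin_gens K M N \<subseteq> {z \<in> carrier ?P. F z \<in> bilin_rel K M' N'}"
  proof
    fix z assume z: "z \<in> bilin_gens K M N"
    have "F z \<in> bilin_gens K M' N'"
      using z unfolding bilin_gens_def[OF M]
    proof (elim UnE CollectE exE conjE)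
      fix a x x' y assume *: "a \<in> carrier K" "x \<in> carrier M" "x' \<in> carrier M" "y \<in> carrier N"
        and z: "z = single K (a \<odot>\<^bsub>M\<^esub> x \<oplus>\<^bsub>M\<^esub> x', y) \<ominus>\<^bsub>?P\<^esub> (a \<odot>\<^bsub>?P\<^esub> single K (x, y) \<oplus>\<^bsub>?P\<^esub> single K (x', y))"
      have "F z = single K (a \<odot>\<^bsub>M'\<^esub> f x \<oplus>\<^bsub>M'\<^esub> f x', g y) \<ominus>\<^bsub>?P'\<^esub>
        (a \<odot>\<^bsub>?P'\<^esub> single K (f x, g y) \<oplus>\<^bsub>?P'\<^esub> single K (f x', g y))"
        unfolding z using * by (simp add: lin cl s)
      then show "F z \<in> bilin_gens K M' N'"
        unfolding bilin_gens_def[OF M'] using * lin_hom_closed[OF f] lin_hom_closed[OF g] by blast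
    next
      fix a x y y' assume *: "a \<in> carrier K" "x \<in> carrier M" "y \<in> carrier N" "y' \<in> carrier N"
        and z: "z = single K (x, a \<odot>\<^bsub>N\<^esub> y \<oplus>\<^bsub>N\<^esub> y') \<ominus>\<^bsub>?P\<^esub> (a \<odot>\<^bsub>?P\<^esub> single K (x, y) \<oplus>\<^bsub>?P\<^esub> single K (x, y'))"
      have "F z = single K (f x, a \<odot>\<^bsub>N'\<^esub> g y \<oplus>\<^bsub>N'\<^esub> g y') \<ominus>\<^bsub>?P'\<^esub>
        (a \<odot>\<^bsub>?P'\<^esub> single K (f x, g y) \<oplus>\<^bsub>?P'\<^esub> single K (f x, g y'))"
        unfolding z using * by (simp add: lin cl s)
      then show "F z \<in> bilin_gens K M' N'"
        unfolding bilin_gens_def[OF M'] using * lin_hom_closed[OF f] lin_hom_closed[OF g] by blast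
    qed
    then have "F z \<in> bilin_rel K M' N'"
      unfolding bilin_rel_eq[OF M'] by (rule subsetD[OF lin_span_superset])
    then show "z \<in> {z \<in> carrier ?P. F z \<in> bilin_rel K M' N'}"
      using subsetD[OF bilin_gens_carrier[OF M] z] by simp
  qed
  then show ?thesis using lin_span_least[OF sub] z unfolding bilin_rel_eq[OF M] by blast
qed

context
  fixes K :: "('k, 'm) ring_scheme" and P :: "('k, 'a) operad" and Q :: "('k, 'b) operad"
  assumes P: "pre_operad K P" and Q: "pre_operad K Q"
begin

private abbreviation (input) "hpairs n \<equiv> carrier (space P n) \<times> carrier (space Q n)"
private abbreviation (input) "hact \<equiv> \<lambda>n \<sigma> (x, y). (act P n \<sigma> x, act Q n \<sigma> y)"
private abbreviation (input) "hcomp \<equiv> \<lambda>ns (x, y) zs. (comp P ns x (map fst zs),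
  comp Q ns y (map snd zs))"

private abbreviation (input) "pair_operad \<equiv>
  lin_operad K (\<lambda>n. carrier (space P n) \<times> carrier (space Q n))
    (\<lambda>n \<sigma> (x, y). (act P n \<sigma> x, act Q n \<sigma> y)) (ident P, ident Q)
    (\<lambda>ns (x, y) zs. (comp P ns x (map fst zs), comp Q ns y (map snd zs)))"

lemma hact_closed: "\<sigma> permutes {1..n} \<Longrightarrow> p \<in> hpairs n \<Longrightarrow> hact n \<sigma> p \<in> hpairs n"
  by (auto simp: act_closed[OF P] act_closed[OF Q])

lemma hident_closed: "(ident P, ident Q) \<in> hpairs 1"
  using pre_operad_ident[OF P] pre_operad_ident[OF Q] by auto

lemma pairs_composable:
  assumes "p \<in> hpairs (length ns)" "length ps = length ns" "\<And>i. i < length ns \<Longrightarrow> ps ! i \<in>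
    hpairs (ns ! i)"
  shows "composable P ns (fst p) (map fst ps)" "composable Q ns (snd p) (map snd ps)"
proof -
  have "fst (ps ! i) \<in> carrier (space P (ns ! i)) \<and> snd (ps ! i) \<in> carrier (space Q (ns ! i))"
    if "i < length ns" for i using assms(3)[OF that] by auto
  then show "composable P ns (fst p) (map fst ps)" "composable Q ns (snd p) (map snd ps)"
    using assms(1,2) by (auto simp: composable_iff)
qed

lemma hcomp_closed:
  assumes "p \<in> hpairs (length ns)" "length ps = length ns" "\<And>i. i < length ns \<Longrightarrow> ps ! i \<in>
    hpairs (ns ! i)"
  shows "hcomp ns p ps \<in> hpairs (sum_list ns)"
  using pairs_composable[OF assms] comp_closed[OF P] comp_closed[OF Q]
    by (auto simp: case_prod_beta)

private lemmas pair_facts = pre_operad_cring[OF P] hact_closed hident_closed hcomp_closed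

lemma pre_operad_pairs: "pre_operad K pair_operad"
  by (rule pre_operad_lin) (assumption | rule pair_facts | blast)+

lemma pair_space: "space pair_operad n = free_module K (hpairs n)"
  by (simp add: lin_operad_def)

lemma pair_ident: "ident pair_operad = single K (ident P, ident Q)"
  by (simp add: lin_operad_def)

lemma pair_comp_single:
  "comp pair_operad ns (single K p) (map (single K) ps) =
    single K (comp P ns (fst p) (map fst ps), comp Q ns (snd p) (map snd ps))"
proof -
  have "comp pair_operad ns (single K p) (map (single K) ps) = single K (hcomp ns p ps)"
    by (rule lin_operad_comp_single) (assumption | rule pair_facts | blast)+
  then show ?thesis by (simp add: case_prod_beta)
qed

lemma pair_act_single: "act pair_operad n \<sigma> (single K p) = single K (hact n \<sigma> p)"
  by (rule lin_operad_act_single) (assumption | rule pair_facts | blast)+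

text \<open>By multilinearity every slot except the one that holds the relation may be taken to
  contain a basis pair. Composition is then a pair of linear maps in the remaining slot, and
  \<open>bilin_rel_map\<close> applies.\<close>

lemma operad_ideal_bilin_rel:
  "operad_ideal K pair_operad (\<lambda>n. bilin_rel K (space P n) (space Q n))"
  unfolding operad_ideal_def S_submodule_def
proof (intro conjI allI impI ballI)
  let ?B = "\<lambda>n. bilin_rel K (space P n) (space Q n)"
  note mP = pre_operad_module[OF P] and mQ = pre_operad_module[OF Q]
  note K = pre_operad_cring[OF P]
  show sub: "submodule (?B n) K (space pair_operad n)" for n
    unfolding pair_space by (rule submodule_bilin_rel[OF mP mQ])
  have Bc: "?B n \<subseteq> carrier (space pair_operad n)" for n
    using sub module.submoduleE(1)[OF pre_operad_module[OF pre_operad_pairs]] by blast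
  show "act pair_operad n \<sigma> x \<in> ?B n" if s: "\<sigma> permutes {1..n}" and x: "x \<in> ?B n" for n \<sigma> x
  proof (rule bilin_rel_map[OF mP mQ mP mQ _ pre_operad_act[OF P s] pre_operad_act[OF Q s] _ x])
    show "act pair_operad n \<sigma> \<in> lin_hom K (free_module K (hpairs n)) (free_module K (hpairs n))"
      using pre_operad_act[OF pre_operad_pairs s] unfolding pair_space .
    show "act pair_operad n \<sigma> (single K (x, y)) = single K (act P n \<sigma> x, act Q n \<sigma> y)" for x y
      unfolding pair_act_single by simp
  qed
  have root: "submodule {x \<in> carrier (space pair_operad (length ns)). comp pair_operad ns x es \<in>
    ?B (sum_list ns)}
      K (space pair_operad (length ns))" if "composable pair_operad ns e es" for ns e es
    by (rule submodule_vimage[OF pre_operad_module[OF pre_operad_pairs] pre_operad_module[OF pre_operad_pairs]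
      pre_operad_root[OF pre_operad_pairs that] sub])
  have arg: "submodule {x \<in>
    carrier (space pair_operad (ns ! i)). comp pair_operad ns e (es[i := x]) \<in> ?B (sum_list ns)}
      K (space pair_operad (ns ! i))" if "composable pair_operad ns e es"
        "i < length ns" for ns e es i
    by (rule submodule_vimage[OF pre_operad_module[OF pre_operad_pairs] pre_operad_module[OF pre_operad_pairs]
      pre_operad_arg[OF pre_operad_pairs that] sub])
  have singles: "single K ` hpairs n \<subseteq> carrier (space pair_operad n)" for n
    using single_closed[OF K, of _ "hpairs n"] unfolding pair_space by auto
  have span: "lin_span K (space pair_operad n) (single K ` hpairs n) =
    carrier (space pair_operad n)" for n
    using free_module_span[OF K] unfolding pair_space .
  fix ns e es
  assume c: "composable pair_operad ns e es \<and>
    (e \<in> ?B (length ns) \<or> (\<exists>i<length ns. es ! i \<in> ?B (ns ! i)))"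
  then have len: "length es = length ns" by (auto simp: composable_iff)
  from c show "comp pair_operad ns e es \<in> ?B (sum_list ns)"
  proof (elim conjE disjE exE)
    assume c: "composable pair_operad ns e es" and e: "e \<in> ?B (length ns)"
    show ?thesis
    proof (rule composable_span_induct[OF pre_operad_pairs, where E = "?B (length ns)" and ns = ns
        and G = "\<lambda>i. single K ` hpairs (ns ! i)" and Q = "\<lambda>e es. comp pair_operad ns e es \<in>
          ?B (sum_list ns)"])
      fix e es assume e: "e \<in> ?B (length ns)" and es: "length es = length ns"
        "\<And>i. i < length ns \<Longrightarrow> es ! i \<in> single K ` hpairs (ns ! i)"
      obtain u where u: "\<And>i. i < length ns \<Longrightarrow> u i \<in> hpairs (ns ! i) \<and> es ! i = single K (u i)"
        using es(2) unfolding image_iff by metis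
      define ps where "ps = map u [0..<length ns]"
      have ps: "length ps = length ns" "\<And>i. i < length ns \<Longrightarrow> ps ! i \<in> hpairs (ns ! i)"
        and es': "es = map (single K) ps"
        using u es(1) by (auto simp: ps_def intro!: nth_equalityI)
      \<comment> \<open>The zero pair is a placeholder: \<open>pairs_composable\<close> asks for
        some root, while the two linear maps extracted from it vary in exactly that slot.\<close>
      have p0: "(\<zero>\<^bsub>space P (length ns)\<^esub>, \<zero>\<^bsub>space Q (length ns)\<^esub>) \<in> hpairs (length ns)"
        using mP[THEN module.axioms(2)] mQ[THEN module.axioms(2)]
          by (auto simp: abelian_group_def abelian_monoid.zero_closed)
      have pc: "composable pair_operad ns e es"
        using e Bc es ps by (auto simp: composable_iff es' pair_space intro!: single_closed[OF K])
      show "comp pair_operad ns e es \<in> ?B (sum_list ns)"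
      proof (rule bilin_rel_map[OF mP mQ mP mQ _ pre_operad_root[OF P pairs_composable(1)[OF p0 ps]]
            pre_operad_root[OF Q pairs_composable(2)[OF p0 ps]] _ e])
        show "(\<lambda>x. comp pair_operad ns x es) \<in>
          lin_hom K (free_module K (hpairs (length ns))) (free_module K (hpairs (sum_list ns)))"
          using pre_operad_root[OF pre_operad_pairs pc] unfolding pair_space .
        show "comp pair_operad ns (single K (x, y)) es = single K (comp P ns x (map fst ps),
          comp Q ns y (map snd ps))" for x y
          unfolding es' pair_comp_single by simp
      qed
    next
      show "e \<in> lin_span K (space pair_operad (length ns)) (?B (length ns))"
        by (rule subsetD[OF lin_span_superset e])
      show "es ! i \<in> lin_span K (space pair_operad (ns ! i)) (single K ` hpairs (ns ! i))" if "i < length ns" for i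
        using c that by (simp add: composable_iff span)
    next
      show "submodule {x \<in> carrier (space pair_operad (length ns)). comp pair_operad ns x es \<in>
        ?B (sum_list ns)}
          K (space pair_operad (length ns))" if "composable pair_operad ns e es" for e es
        by (rule root[OF that])
      show "submodule {x \<in>
        carrier (space pair_operad (ns ! i)). comp pair_operad ns e (es[i := x]) \<in> ?B (sum_list ns)}
          K (space pair_operad (ns ! i))" if "composable pair_operad ns e es"
            "i < length ns" for e es i
        by (rule arg[OF that])
    qed (rule Bc singles len)+
  next
    fix i assume c: "composable pair_operad ns e es" and i: "i < length ns" "es ! i \<in> ?B (ns ! i)"
    let ?G = "\<lambda>j. if j = i then ?B (ns ! i) else single K ` hpairs (ns ! j)"
    show ?thesis
    proof (rule composable_span_induct[OF pre_operad_pairs, where E =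
      "single K ` hpairs (length ns)" and ns = ns
        and G = ?G and Q = "\<lambda>e es. comp pair_operad ns e es \<in> ?B (sum_list ns)"])
      fix e es assume e: "e \<in> single K ` hpairs (length ns)" and es: "length es = length ns"
        "\<And>j. j < length ns \<Longrightarrow> es ! j \<in> ?G j"
      obtain p where p: "p \<in> hpairs (length ns)" "e = single K p" using e by auto
      \<comment> \<open>Slot \<open>i\<close> holds an element of the ideal rather than a basis
        pair; a dummy zero pair fills it until the list update overwrites it.\<close>
      have "\<exists>q. q \<in> hpairs (ns ! j) \<and> (j \<noteq> i \<longrightarrow> es ! j = single K q)" if "j < length ns" for j
      proof (cases "j = i")
        case True
        have "(\<zero>\<^bsub>space P (ns ! j)\<^esub>, \<zero>\<^bsub>space Q (ns ! j)\<^esub>) \<in> hpairs (ns ! j)"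
          using mP[THEN module.axioms(2)] mQ[THEN module.axioms(2)]
            by (auto simp: abelian_group_def abelian_monoid.zero_closed)
        then show ?thesis using True by blast
      qed (use es(2)[OF that] in auto)
      then obtain u where u: "\<And>j. j < length ns \<Longrightarrow> u j \<in> hpairs (ns ! j) \<and> (j \<noteq> i \<longrightarrow> es ! j =
        single K (u j))"
        by metis
      define ps where "ps = map u [0..<length ns]"
      have ps: "length ps = length ns" "\<And>j. j < length ns \<Longrightarrow> ps ! j \<in> hpairs (ns ! j)"
        using u by (auto simp: ps_def)
      have es': "es[i := single K q] = map (single K) (ps[i := q])" for q
      proof (rule nth_equalityI)
        fix j assume "j < length (es[i := single K q])"
        then show "es[i := single K q] ! j = map (single K) (ps[i := q]) ! j"
          using u es(1) by (cases "j = i") (auto simp: ps_def)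
      qed (use es(1) in \<open>simp add: ps_def\<close>)
      have pc: "composable pair_operad ns e es"
        unfolding composable_iff
      proof (intro conjI allI impI)
        show "es ! j \<in> carrier (space pair_operad (ns ! j))" if "j < length ns" for j
          using es(2)[OF that] Bc[of "ns ! i"] singles[of "ns ! j"] by (auto split: if_splits)
      qed (use e singles es(1) in auto)
      have esi: "es ! i \<in> ?B (ns ! i)" using es(2)[OF i(1)] by simp
      have "comp pair_operad ns e (es[i := es ! i]) \<in> ?B (sum_list ns)"
      proof (rule bilin_rel_map[OF mP mQ mP mQ _ pre_operad_arg[OF P pairs_composable(1)[OF p(1) ps] i(1)]
            pre_operad_arg[OF Q pairs_composable(2)[OF p(1) ps] i(1)] _ esi])
        show "(\<lambda>x. comp pair_operad ns e (es[i := x])) \<in>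
          lin_hom K (free_module K (hpairs (ns ! i))) (free_module K (hpairs (sum_list ns)))"
          using pre_operad_arg[OF pre_operad_pairs pc i(1)] unfolding pair_space .
        show "comp pair_operad ns e (es[i := single K (x, y)]) =
          single K (comp P ns (fst p) ((map fst ps)[i := x]),
            comp Q ns (snd p) ((map snd ps)[i := y]))" for x y
          unfolding es' p(2) pair_comp_single by (simp add: map_update)
      qed
      then show "comp pair_operad ns e es \<in> ?B (sum_list ns)" by simp
    next
      show "es ! j \<in> lin_span K (space pair_operad (ns ! j)) (?G j)" if "j < length ns" for j
      proof (cases "j = i")
        case True
        then show ?thesis using subsetD[OF lin_span_superset i(2)] by simp
      next
        case False
        then show ?thesis using c that by (simp add: composable_iff span)
      qed
      show "?G j \<subseteq> carrier (space pair_operad (ns ! j))" if "j < length ns" for j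
        using Bc singles by auto
    next
      show "e \<in> lin_span K (space pair_operad (length ns)) (single K ` hpairs (length ns))"
        using c by (simp add: composable_iff span)
    next
      show "submodule {x \<in> carrier (space pair_operad (length ns)). comp pair_operad ns x es \<in>
        ?B (sum_list ns)}
          K (space pair_operad (length ns))" if "composable pair_operad ns e es" for e es
        by (rule root[OF that])
      show "submodule {x \<in>
        carrier (space pair_operad (ns ! i)). comp pair_operad ns e (es[i := x]) \<in> ?B (sum_list ns)}
          K (space pair_operad (ns ! i))" if "composable pair_operad ns e es"
            "i < length ns" for e es i
        by (rule arg[OF that])
    qed (rule singles len)+
  qed
qed

lemma hadamard_eq: "hadamard K P Q =
  quot_operad pair_operad (\<lambda>n. bilin_rel K (space P n) (space Q n))"
  by (simp add: hadamard_def)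

lemma pre_operad_hadamard: "pre_operad K (hadamard K P Q)"
  unfolding hadamard_eq by (rule pre_operad_quot[OF pre_operad_pairs operad_ideal_bilin_rel])

lemma hadamard_space: "space (hadamard K P Q) n = tensor K (space P n) (space Q n)"
  unfolding hadamard_eq quot_operad_space[OF pre_operad_pairs operad_ideal_bilin_rel] pair_space tensor_def ..

lemma hadamard_class:
  "quot_class pair_operad (\<lambda>n. bilin_rel K (space P n) (space Q n)) n (single K p) =
    tens K (space P n) (space Q n) (fst p) (snd p)"
  unfolding quot_class_def[OF pre_operad_pairs operad_ideal_bilin_rel] tens_def pair_space by simp

lemma hadamard_act:
  assumes "\<sigma> permutes {1..n}" "x \<in> carrier (space P n)" "y \<in> carrier (space Q n)"
  shows "act (hadamard K P Q) n \<sigma> (tens K (space P n) (space Q n) x y) =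
    tens K (space P n) (space Q n) (act P n \<sigma> x) (act Q n \<sigma> y)"
  using quot_operad_act[OF pre_operad_pairs operad_ideal_bilin_rel assms(1), of "single K (x, y)"]
    single_closed[OF pre_operad_cring[OF P], of "(x, y)" "hpairs n"] assms(2,3)
  unfolding hadamard_eq pair_space pair_act_single by (simp add: hadamard_class)

lemma hadamard_ident:
  "ident (hadamard K P Q) = tens K (space P 1) (space Q 1) (ident P) (ident Q)"
  using operad_homD(3)[OF quot_operad_hom[OF pre_operad_pairs operad_ideal_bilin_rel]]
  unfolding hadamard_eq pair_ident hadamard_class by simp

lemma hadamard_comp:
  assumes "p \<in> hpairs (length ns)" "length ps = length ns" "\<And>i. i < length ns \<Longrightarrow> ps ! i \<in>
    hpairs (ns ! i)"
  shows "comp (hadamard K P Q) ns (tens K (space P (length ns)) (space Q (length ns)) (fst p) (snd p))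
      (map2 (\<lambda>n q. tens K (space P n) (space Q n) (fst q) (snd q)) ns ps) =
    tens K (space P (sum_list ns)) (space Q (sum_list ns))
      (comp P ns (fst p) (map fst ps)) (comp Q ns (snd p) (map snd ps))"
proof -
  let ?c = "quot_class pair_operad (\<lambda>n. bilin_rel K (space P n) (space Q n))"
  have "composable pair_operad ns (single K p) (map (single K) ps)"
    using assms by (auto simp: composable_iff pair_space intro!: single_closed[OF pre_operad_cring[OF P]])
  from quot_operad_comp[OF pre_operad_pairs operad_ideal_bilin_rel this]
  have "comp (hadamard K P Q) ns (?c (length ns) (single K p)) (map2 ?c ns (map (single K) ps)) =
    ?c (sum_list ns) (single K (comp P ns (fst p) (map fst ps), comp Q ns (snd p) (map snd ps)))"
    unfolding hadamard_eq pair_comp_single .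
  moreover have "map2 ?c ns (map (single K) ps) =
    map2 (\<lambda>n q. tens K (space P n) (space Q n) (fst q) (snd q)) ns ps"
    using assms(2) by (intro nth_equalityI) (auto simp: hadamard_class)
  ultimately show ?thesis by (simp add: hadamard_class)
qed

end

section \<open>The operad of labelled trees, and the evaluation of its morphisms on subtrees\<close>

section \<open>Trees\<close>

subsection \<open>The tree operad\<close>

lemma decorations_eq: "decorations t = set_tree t"
  by (induction t) auto

lemma leaves_relabel [simp]: "leaves (relabel h t) = map h (leaves t)"
  by (induction t) auto

lemma decorations_relabel [simp]: "decorations (relabel h t) = decorations t"
  by (induction t) auto

lemma leaves_map_tree [simp]: "leaves (map_tree f t) = leaves t"
  by (induction t) auto

lemma decorations_map_tree [simp]: "decorations (map_tree f t) = f ` decorations t"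
  by (simp add: decorations_eq tree.set_map)

lemma relabel_map_tree: "relabel h (map_tree f t) = map_tree f (relabel h t)"
  by (induction t) auto

lemma relabel_relabel: "relabel h (relabel h' t) = relabel (\<lambda>i. h (h' i)) t"
  by (induction t) auto

lemma relabel_cong: "(\<And>i. i \<in> set (leaves t) \<Longrightarrow> h i = h' i) \<Longrightarrow> relabel h t = relabel h' t"
  by (induction t) auto

lemma relabel_id: "(\<And>i. i \<in> set (leaves t) \<Longrightarrow> h i = i) \<Longrightarrow> relabel h t = t"
  by (induction t) auto

lemma relabel_inj: "inj h \<Longrightarrow> relabel h t = relabel h t' \<Longrightarrow> t = t'"
proof (induction t arbitrary: t')
  case (Leaf i)
  then show ?case by (cases t') (auto dest: injD)
next
  case (Node v l r)
  then show ?case by (cases t') auto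
qed

lemma map_tree_graft:
  assumes "\<And>i. i \<in> set (leaves t) \<Longrightarrow> 1 \<le> i \<and> i \<le> length ts"
  shows "map_tree f (graft ns t ts) = graft ns (map_tree f t) (map (map_tree f) ts)"
  using assms
proof (induction t)
  case (Leaf i)
  have "i - 1 < length ts" using Leaf[of i] by auto
  then show ?case by (simp add: relabel_map_tree)
qed auto

lemma treesD:
  assumes "t \<in> trees D n"
  shows "decorations t \<subseteq> D" "distinct (leaves t)" "set (leaves t) = {1..n}" "length (leaves t) = n"
proof -
  show *: "decorations t \<subseteq> D" "distinct (leaves t)" "set (leaves t) = {1..n}"
    using assms by (auto simp: trees_def)
  show "length (leaves t) = n" using distinct_card[OF *(2)] *(3) by simp
qed

lemma trees_map_tree: "t \<in> trees D n \<Longrightarrow> (\<And>d. d \<in> D \<Longrightarrow> f d \<in> D') \<Longrightarrow> map_tree f t \<in> trees D' n"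
  by (auto simp: trees_def)

lemma trees_relabel:
  assumes "\<sigma> permutes {1..n}" "t \<in> trees D n"
  shows "relabel \<sigma> t \<in> trees D n"
  using assms permutes_image[OF assms(1)] permutes_inj_on[OF assms(1)]
  by (auto simp: trees_def distinct_map)

lemma trees_relabel_inv:
  assumes "\<sigma> permutes {1..n}" "t \<in> trees D n"
  shows "relabel (inv_into UNIV \<sigma>) t \<in> trees D n"
  using trees_relabel[OF permutes_inv[OF assms(1)] assms(2)] .

lemma Leaf_trees: "Leaf 1 \<in> trees D 1"
  by (auto simp: trees_def)

lemma corolla_trees: "d \<in> D \<Longrightarrow> Node d (Leaf 1) (Leaf 2) \<in> trees D 2"
  by (auto simp: trees_def)

lemma block_union:
  fixes ns :: "nat list"
  shows "(\<Union>i<length ns. (\<lambda>j. sum_list (take i ns) + j) ` {1..ns ! i}) = {1..sum_list ns}"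
proof (induction ns rule: rev_induct)
  case (snoc n ns)
  have "(\<Union>i<length (ns @ [n]). (\<lambda>j. sum_list (take i (ns @ [n])) + j) ` {1..(ns @ [n]) ! i}) =
    (\<Union>i<length ns. (\<lambda>j. sum_list (take i ns) + j) ` {1..ns ! i}) \<union> (\<lambda>j. sum_list ns + j) ` {1..n}"
    by (simp add: lessThan_Suc nth_append Un_commute)
  also have "\<dots> = {1..sum_list ns} \<union> {sum_list ns + 1..sum_list ns + n}"
    using image_add_atLeastAtMost[of "sum_list ns" 1 n] snoc.IH by (simp add: add.commute)
  also have "\<dots> = {1..sum_list (ns @ [n])}" by auto
  finally show ?case .
qed simp

lemma leaves_graft:
  "leaves (graft ns t ts) =
    concat (map (\<lambda>i. map (\<lambda>j. sum_list (take (i - 1) ns) + j) (leaves (ts ! (i - 1)))) (leaves t))"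
  by (induction t) auto

lemma decorations_graft:
  "decorations (graft ns t ts) = decorations t \<union> (\<Union>i\<in>set (leaves t). decorations (ts ! (i - 1)))"
  by (induction t) auto

lemma sum_list_labels:
  assumes "distinct xs" "set xs = {1..length ns}"
  shows "sum_list (map (\<lambda>i. ns ! (i - 1)) xs) = sum_list (ns :: nat list)"
proof -
  have "sum_list (map (\<lambda>i. ns ! (i - 1)) xs) = (\<Sum>i\<in>{1..length ns}. ns ! (i - 1))"
    using sum_list_distinct_conv_sum_set[OF assms(1)] assms(2) by simp
  also have "\<dots> = (\<Sum>i<length ns. ns ! i)"
    by (rule sum.reindex_bij_witness[of _ Suc "\<lambda>i. i - 1"]) auto
  finally show ?thesis by (simp add: sum_list_sum_nth atLeast0LessThan)
qed

lemma trees_graft: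
  assumes t: "t \<in> trees D (length ns)" and len: "length ts = length ns"
    and ts: "\<And>i. i < length ns \<Longrightarrow> ts ! i \<in> trees D (ns ! i)"
  shows "graft ns t ts \<in> trees D (sum_list ns)"
proof -
  note t = treesD[OF t]
  have lab: "{1..length ns} = Suc ` {..<length ns}" by (simp add: image_Suc_lessThan)
  have "set (leaves (graft ns t ts)) =
    (\<Union>i<length ns. (\<lambda>j. sum_list (take i ns) + j) ` set (leaves (ts ! i)))"
    by (simp add: leaves_graft t(3)[unfolded lab] del: image_Suc_lessThan)
  also have "\<dots> = (\<Union>i<length ns. (\<lambda>j. sum_list (take i ns) + j) ` {1..ns ! i})"
    using treesD(3)[OF ts] by (intro SUP_cong) auto
  also have "\<dots> = {1..sum_list ns}" by (rule block_union)
  finally have set: "set (leaves (graft ns t ts)) = {1..sum_list ns}" .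
  have "length (leaves (graft ns t ts)) =
    sum_list (map (\<lambda>i. length (leaves (ts ! (i - 1)))) (leaves t))"
    by (simp add: leaves_graft length_concat o_def)
  also have "map (\<lambda>i. length (leaves (ts ! (i - 1)))) (leaves t) =
    map (\<lambda>i. ns ! (i - 1)) (leaves t)"
    using treesD(4)[OF ts] t(3) by (intro map_cong) auto
  also have "sum_list \<dots> = sum_list ns" by (rule sum_list_labels[OF t(2,3)])
  \<comment> \<open>Distinctness by counting: a list that is only as long as the set of its entries
    is large has no repetition.\<close>
  finally have "distinct (leaves (graft ns t ts))"
    using set by (intro card_distinct) simp
  moreover have "decorations (ts ! (i - 1)) \<subseteq> D" if "i \<in> set (leaves t)" for i
  proof (rule treesD(1)[OF ts])
    show "i - 1 < length ns" using that t(3) by auto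
  qed
  then have "decorations (graft ns t ts) \<subseteq> D"
    using t(1) unfolding decorations_graft by blast
  ultimately show ?thesis using set by (simp add: trees_def)
qed

context
  fixes K :: "('k, 'm) ring_scheme"
  assumes K: "cring K"
begin

private lemmas tree_facts = K trees_relabel_inv Leaf_trees trees_graft

lemma pre_operad_tree: "pre_operad K (tree_operad K D)"
  unfolding tree_operad_def by (rule pre_operad_lin) (assumption | rule tree_facts | blast)+

lemma tree_space: "space (tree_operad K D) n = free_module K (trees D n)"
  by (simp add: tree_operad_def lin_operad_def)

lemma tree_act_single: "act (tree_operad K D) n \<sigma> (single K t) =
  single K (relabel (inv_into UNIV \<sigma>) t)"
  using lin_ext_single[OF K] by (simp add: tree_operad_def lin_operad_def)

lemma tree_ident: "ident (tree_operad K D) = single K (Leaf 1)"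
  by (simp add: tree_operad_def lin_operad_def)

lemma tree_comp_single: "comp (tree_operad K D) ns (single K t) (map (single K) ts) =
  single K (graft ns t ts)"
proof -
  have "comp (lin_operad K (trees D) (\<lambda>n \<sigma>. relabel (inv_into UNIV \<sigma>)) (Leaf 1) graft) ns (single K t) (map (single K) ts) =
    single K (graft ns t ts)"
    by (rule lin_operad_comp_single) (assumption | rule tree_facts | blast)+
  then show ?thesis by (simp add: tree_operad_def)
qed

lemma tree_single_closed: "t \<in> trees D n \<Longrightarrow> single K t \<in> carrier (space (tree_operad K D) n)"
  by (simp add: tree_space single_closed[OF K])

lemma tree_composable:
  assumes "t \<in> trees D (length ns)" "length ts = length ns" "\<And>i. i < length ns \<Longrightarrow> ts ! i \<in>
    trees D (ns ! i)"
  shows "composable (tree_operad K D) ns (single K t) (map (single K) ts)"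
  using assms tree_single_closed by (auto simp: composable_iff)

lemma tree_hom_graft:
  assumes f: "operad_hom K (tree_operad K D) Q f"
    and t: "t \<in> trees D (length ns)" "length ts = length ns" "\<And>i. i < length ns \<Longrightarrow> ts ! i \<in>
      trees D (ns ! i)"
  shows "f (sum_list ns) (single K (graft ns t ts)) =
    comp Q ns (f (length ns) (single K t)) (map2 (\<lambda>n t. f n (single K t)) ns ts)"
proof -
  have "map2 f ns (map (single K) ts) = map2 (\<lambda>n t. f n (single K t)) ns ts"
    by (intro nth_equalityI) auto
  then show ?thesis
    using operad_homD(4)[OF f tree_composable[OF t]] by (simp add: tree_comp_single)
qed

lemma tree_hom_relabel:
  assumes f: "operad_hom K (tree_operad K D) Q f" and s: "\<sigma> permutes {1..n}" and t: "t \<in> trees D n"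
  shows "f n (single K (relabel (inv_into UNIV \<sigma>) t)) = act Q n \<sigma> (f n (single K t))"
  using operad_homD(2)[OF f s tree_single_closed[OF t]] by (simp add: tree_act_single)

lemma tree_homI:
  assumes Q: "pre_operad K Q"
    and f: "\<And>n. f n \<in> lin_hom K (space (tree_operad K D) n) (space Q n)"
    and act: "\<And>n \<sigma> t. \<sigma> permutes {1..n} \<Longrightarrow> t \<in> trees D n \<Longrightarrow>
      f n (single K (relabel (inv_into UNIV \<sigma>) t)) = act Q n \<sigma> (f n (single K t))"
    and ident: "f 1 (single K (Leaf 1)) = ident Q"
    and base: "\<And>ns t ts. t \<in> trees D (length ns) \<Longrightarrow> length ts = length ns \<Longrightarrow>
      (\<And>i. i < length ns \<Longrightarrow> ts ! i \<in> trees D (ns ! i)) \<Longrightarrow>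
      f (sum_list ns) (single K (graft ns t ts)) =
        comp Q ns (f (length ns) (single K t)) (map2 (\<lambda>n t. f n (single K t)) ns ts)"
  shows "operad_hom K (tree_operad K D) Q f"
proof -
  note td = tree_operad_def[symmetric]
  have "operad_hom K (lin_operad K (trees D) (\<lambda>n \<sigma>. relabel (inv_into UNIV \<sigma>)) (Leaf 1) graft) Q f"
  proof (rule lin_operad_homI)
    show "f n \<in> lin_hom K (space (lin_operad K (trees D) (\<lambda>n \<sigma>. relabel (inv_into UNIV \<sigma>)) (Leaf 1) graft) n) (space Q n)" for n
      unfolding td by (rule f)
  qed (assumption | rule Q tree_facts act ident base | blast)+
  then show ?thesis unfolding td .
qed

lemma tree_hom_eqI:
  assumes "module K N" "f \<in> lin_hom K (space (tree_operad K D) n) N"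
    "g \<in> lin_hom K (space (tree_operad K D) n) N"
    and "\<And>t. t \<in> trees D n \<Longrightarrow> f (single K t) = g (single K t)" "z \<in>
      carrier (space (tree_operad K D) n)"
  shows "f z = g z"
  using free_module_hom_eqI[OF K assms(1)] assms(2-5) unfolding tree_space by blast

end

subsection \<open>Trees with arbitrary leaf labels\<close>

text \<open>On an initial interval the enumeration must be the identity, so that standardizing does
  nothing to an element of \<open>trees D n\<close>. Elsewhere any bijection will do, as long as it
  depends on the label set alone.\<close>

definition enum_labels :: "nat set \<Rightarrow> nat \<Rightarrow> nat" where
  "enum_labels A = (if A = {1..card A} then id else SOME h. bij_betw h A {1..card A})"

lemma bij_betw_enum_labels:
  assumes "finite A"
  shows "bij_betw (enum_labels A) A {1..card A}"
proof (cases "A = {1..card A}")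
  case True
  then have "enum_labels A = id" by (simp add: enum_labels_def)
  then show ?thesis using True by (metis bij_betw_id)
next
  case False
  have "\<exists>h. bij_betw h A {1..card A}"
    using assms by (intro finite_same_card_bij) auto
  then show ?thesis using False someI_ex[of "\<lambda>h. bij_betw h A {1..card A}"]
    by (simp add: enum_labels_def)
qed

lemma enum_labels_interval: "enum_labels {1..n} = id"
  by (simp add: enum_labels_def)

definition standardize :: "'v tree \<Rightarrow> 'v tree" where
  "standardize t = relabel (enum_labels (set (leaves t))) t"

definition ltrees :: "'v set \<Rightarrow> 'v tree set" where
  "ltrees D = {t. decorations t \<subseteq> D \<and> distinct (leaves t)}"

lemma trees_ltrees: "t \<in> trees D n \<Longrightarrow> t \<in> ltrees D"
  by (simp add: ltrees_def trees_def)

lemma ltrees_Node: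
  "Node v l r \<in> ltrees D \<longleftrightarrow> v \<in> D \<and> l \<in> ltrees D \<and> r \<in> ltrees D \<and> set (leaves l) \<inter> set (leaves r) =
    {}"
  by (auto simp: ltrees_def)

lemma standardize_trees:
  assumes "t \<in> ltrees D"
  shows "standardize t \<in> trees D (length (leaves t))"
proof -
  have c: "card (set (leaves t)) = length (leaves t)"
    using assms by (simp add: ltrees_def distinct_card)
  note b = bij_betw_enum_labels[of "set (leaves t)", unfolded c]
  show ?thesis using assms b
    by (auto simp: trees_def standardize_def ltrees_def distinct_map bij_betw_def)
qed

lemma standardize_id: "t \<in> trees D n \<Longrightarrow> standardize t = t"
  using treesD(3)[of t D n] unfolding standardize_def
  by (intro relabel_id) (simp add: enum_labels_interval del: One_nat_def)

text \<open>Unlike \<open>graft\<close>, \<open>plug\<close> does not shift the labels of the substituted trees, so that subtrees can be cut off literally.\<close>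

primrec plug :: "'v tree \<Rightarrow> 'v tree list \<Rightarrow> 'v tree" where
  "plug (Leaf i) ts = ts ! (i - 1)"
| "plug (Node v l r) ts = Node v (plug l ts) (plug r ts)"

lemma leaves_plug: "leaves (plug t ts) = concat (map (\<lambda>i. leaves (ts ! (i - 1))) (leaves t))"
  by (induction t) auto

text \<open>Grafting standardized trees labels the leaf \<open>a\<close> of tree \<open>i\<close> by
  its number within \<open>As ! i\<close>, shifted past the earlier blocks; standardizing the
  plugged tree labels it by its number in the union. A merge carries the first labelling to the
  second.\<close>

definition is_merge :: "nat set list \<Rightarrow> (nat \<Rightarrow> nat) \<Rightarrow> bool" where
  "is_merge As \<rho> \<longleftrightarrow> \<rho> permutes {1..sum_list (map card As)} \<and>
    (\<forall>i<length As. \<forall>a\<in>As ! i.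
      \<rho> (sum_list (take i (map card As)) + enum_labels (As ! i) a) = enum_labels (\<Union>(set As)) a)"

definition merge :: "nat set list \<Rightarrow> nat \<Rightarrow> nat" where
  "merge As = (SOME \<rho>. is_merge As \<rho>)"

text \<open>Both labellings, \<open>u\<close> and \<open>v\<close>, are bijections from pairs of a
  block and a label onto the interval: \<open>u\<close> is onto because shifted blocks tile it,
  hence injective by counting, and \<open>v\<close> is bijective because the blocks are disjoint.
  The permutation is \<open>v\<close> after the inverse of \<open>u\<close>, extended by the
  identity as \<open>permutes\<close> demands.\<close>

lemma is_merge_merge:
  assumes fin: "\<And>i. i < length As \<Longrightarrow> finite (As ! i)"
    and disj: "\<And>i j. i < length As \<Longrightarrow> j < length As \<Longrightarrow> i \<noteq> j \<Longrightarrow> As ! i \<inter> As ! j = {}"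
  shows "is_merge As (merge As)"
proof -
  define ns where "ns = map card As"
  define U where "U = \<Union>(set As)"
  define S where "S = Sigma {..<length As} (\<lambda>i. As ! i)"
  define u where "u = (\<lambda>(i, a). sum_list (take i ns) + enum_labels (As ! i) a)"
  define v where "v = (\<lambda>(i::nat, a). enum_labels U a)"
  let ?n = "sum_list ns"
  have finS: "finite S" unfolding S_def using fin by auto
  have cS: "card S = ?n"
    unfolding S_def ns_def using fin
    by (subst card_SigmaI) (auto simp: sum_list_sum_nth atLeast0LessThan)
  have "u ` S = (\<Union>i<length As. (\<lambda>j. sum_list (take i ns) + j) ` enum_labels (As ! i) ` (As ! i))"
    unfolding S_def u_def by force
  also have "\<dots> = (\<Union>i<length As. (\<lambda>j. sum_list (take i ns) + j) ` {1..ns ! i})"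
    using bij_betw_enum_labels[OF fin] unfolding ns_def bij_betw_def by (intro SUP_cong) auto
  also have "\<dots> = {1..?n}" using block_union[of ns] unfolding ns_def by simp
  finally have uS: "u ` S = {1..?n}" .
  then have "inj_on u S" using finS cS by (intro eq_card_imp_inj_on) auto
  then have u: "bij_betw u S {1..?n}" using uS by (simp add: bij_betw_def)
  have "set As = (!) As ` {..<length As}" by (auto simp: set_conv_nth)
  then have U: "snd ` S = U" by (simp add: S_def U_def snd_image_Sigma)
  have snd: "inj_on snd S"
  proof (rule inj_onI)
    fix p q assume pq: "p \<in> S" "q \<in> S" "snd p = snd q"
    have "fst p = fst q"
    proof (rule ccontr)
      assume "fst p \<noteq> fst q"
      then have "As ! fst p \<inter> As ! fst q = {}" using pq by (intro disj) (auto simp: S_def)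
      then show False using pq by (auto simp: S_def)
    qed
    then show "p = q" using pq by (simp add: prod_eq_iff)
  qed
  have "card U = ?n" using card_image[OF snd] U cS by simp
  moreover have "finite U" using finS U by (metis finite_imageI)
  ultimately have "bij_betw (enum_labels U) U {1..?n}" using bij_betw_enum_labels by metis
  moreover have "bij_betw snd S U" using snd U by (simp add: bij_betw_def)
  ultimately have v: "bij_betw v S {1..?n}"
    using bij_betw_trans[of snd S U "enum_labels U" "{1..?n}"]
      by (simp add: v_def o_def case_prod_unfold)
  define \<rho> where "\<rho> s = (if s \<in> {1..?n} then v (inv_into S u s) else s)" for s
  have "bij_betw (\<lambda>s. v (inv_into S u s)) {1..?n} {1..?n}"
    using bij_betw_trans[OF bij_betw_inv_into[OF u] v] by (simp add: o_def)
  then have "bij_betw \<rho> {1..?n} {1..?n}"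
    by (rule bij_betw_cong[THEN iffD1, rotated]) (simp add: \<rho>_def)
  then have "\<rho> permutes {1..?n}" by (rule bij_imp_permutes) (simp only: \<rho>_def if_False)
  moreover have "\<rho> (sum_list (take i ns) + enum_labels (As ! i) a) = enum_labels U a"
    if "i < length As" "a \<in> As ! i" for i a
  proof -
    have m: "(i, a) \<in> S" using that by (simp add: S_def)
    then have "u (i, a) \<in> {1..?n}" using uS by blast
    moreover have "inv_into S u (u (i, a)) = (i, a)" using \<open>inj_on u S\<close> m by (rule inv_into_f_f)
    ultimately have "\<rho> (u (i, a)) = v (i, a)" by (simp add: \<rho>_def)
    then show ?thesis by (simp add: u_def v_def)
  qed
  ultimately have "is_merge As \<rho>" unfolding is_merge_def ns_def U_def by blast
  then show ?thesis unfolding merge_def by (rule someI[of "is_merge As"])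
qed

lemma relabel_merge_graft:
  assumes \<rho>: "is_merge As \<rho>" and As: "As = map (\<lambda>t. set (leaves t)) ts"
    and t: "set (leaves t) \<subseteq> {1..length ts}"
  shows "relabel \<rho> (graft (map card As) t (map standardize ts)) =
    relabel (enum_labels (\<Union>(set As))) (plug t ts)"
  using t
proof (induction t)
  case (Leaf i)
  then have i: "i - 1 < length ts" by auto
  have "\<rho> (sum_list (take (i - 1) (map card As)) + enum_labels (As ! (i - 1)) a) =
    enum_labels (\<Union>(set As)) a"
    if "a \<in> set (leaves (ts ! (i - 1)))" for a
    using \<rho> i that unfolding is_merge_def by (auto simp: As)
  then show ?case using i
    by (auto simp: relabel_relabel standardize_def As intro!: relabel_cong)
qed simp

text \<open>The branches of a tree in \<open>trees D n\<close> are in general not labelled by an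
  initial interval, so that a morphism cannot be applied to them directly. Standardizing first makes
  recursion over branches possible.\<close>

definition tree_val :: "('k, 'm) ring_scheme \<Rightarrow> (nat \<Rightarrow> ('v tree \<Rightarrow> 'k) \<Rightarrow> 'a) \<Rightarrow> 'v tree \<Rightarrow> 'a" where
  "tree_val K f t = f (length (leaves t)) (single K (standardize t))"

lemma tree_val_trees: "t \<in> trees D n \<Longrightarrow> tree_val K f t = f n (single K t)"
  by (simp add: tree_val_def standardize_id treesD(4))

definition disjoint_leaves :: "'v tree list \<Rightarrow> bool" where
  "disjoint_leaves ts \<longleftrightarrow> (\<forall>i<length ts. \<forall>j<length ts. i \<noteq> j \<longrightarrow>
    set (leaves (ts ! i)) \<inter> set (leaves (ts ! j)) = {})"

context
  fixes K :: "('k, 'm) ring_scheme" and D :: "'v set"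
  assumes K: "cring K"
begin

text \<open>The permutation depends only on the leaf sets of the substituted trees.\<close>

lemma tree_val_plug:
  assumes f: "operad_hom K (tree_operad K D) Q f"
    and t: "t \<in> trees D (length ts)" and ts: "set ts \<subseteq> ltrees D" and disj: "disjoint_leaves ts"
  shows "tree_val K f (plug t ts) =
    act Q (sum_list (map (\<lambda>t. length (leaves t)) ts)) (inv_into UNIV (merge (map (\<lambda>t. set (leaves t)) ts)))
      (comp Q (map (\<lambda>t. length (leaves t)) ts) (f (length ts) (single K t)) (map (tree_val K f) ts))"
proof -
  define As where "As = map (\<lambda>t. set (leaves t)) ts"
  define ns where "ns = map (\<lambda>t. length (leaves t)) ts"
  have ns: "map card As = ns" "length ns = length ts"
    unfolding As_def ns_def using ts by (auto simp: ltrees_def distinct_card)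
  have m: "is_merge As (merge As)"
    by (rule is_merge_merge) (use disj in \<open>auto simp: As_def disjoint_leaves_def\<close>)
  then have perm: "merge As permutes {1..sum_list ns}" unfolding is_merge_def ns by blast
  define n where "n = sum_list ns"
  note t' = treesD[OF t]
  have std: "standardize (ts ! i) \<in> trees D (ns ! i)" if "i < length ts" for i
    using standardize_trees[OF subsetD[OF ts nth_mem[OF that]]] that by (simp add: ns_def)
  have gr: "graft ns t (map standardize ts) \<in> trees D n"
    unfolding n_def using t std ns(2) by (intro trees_graft) auto
  have lab: "{1..length ts} = Suc ` {..<length ts}" by (simp add: image_Suc_lessThan)
  have sl: "set (leaves (plug t ts)) = \<Union>(set As)"
  proof -
    have "set ts = (!) ts ` {..<length ts}" by (auto simp: set_conv_nth)
    then show ?thesis by (simp add: leaves_plug As_def t'(3)[unfolded lab] del: image_Suc_lessThan)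
  qed
  have ll: "length (leaves (plug t ts)) = n"
  proof -
    have "length (leaves (plug t ts)) = sum_list (map (\<lambda>i. ns ! (i - 1)) (leaves t))"
      using t'(3) by (auto simp: leaves_plug length_concat ns_def o_def intro!: arg_cong[of _ _ sum_list])
    then show ?thesis using sum_list_labels[OF t'(2), of ns] t'(3) ns(2) by (simp add: n_def)
  qed
  have "relabel (merge As) (graft ns t (map standardize ts)) = standardize (plug t ts)"
    using relabel_merge_graft[OF m As_def, of t] t'(3) unfolding ns standardize_def sl by simp
  then have "tree_val K f (plug t ts) =
    f n (single K (relabel (merge As) (graft ns t (map standardize ts))))"
    by (simp add: tree_val_def ll)
  also have "\<dots> = act Q n (inv_into UNIV (merge As)) (f n (single K (graft ns t (map standardize ts))))"
    using tree_hom_relabel[OF K f permutes_inv[OF perm[folded n_def]] gr] permutes_inv_inv[OF perm] by simp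
  also have "f n (single K (graft ns t (map standardize ts))) =
    comp Q ns (f (length ns) (single K t)) (map2 (\<lambda>n t. f n (single K t)) ns (map standardize ts))"
    unfolding n_def using t std ns(2) by (intro tree_hom_graft[OF K f]) auto
  also have "map2 (\<lambda>n t. f n (single K t)) ns (map standardize ts) = map (tree_val K f) ts"
    using ns(2) by (intro nth_equalityI) (auto simp: tree_val_def ns_def)
  finally show ?thesis by (simp add: ns(2) n_def As_def ns_def)
qed

text \<open>A node is the corolla with two branches plugged in. The formula sees a branch only
  through its leaf set and its value, and this is what makes replacement inside a tree
  legitimate.\<close>

lemma tree_val_Node:
  assumes f: "operad_hom K (tree_operad K D) Q f" and t: "Node v l r \<in> ltrees D"
  shows "tree_val K f (Node v l r) =
    act Q (length (leaves l) + length (leaves r)) (inv_into UNIV (merge [set (leaves l),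
      set (leaves r)]))
      (comp Q [length (leaves l), length (leaves r)] (f 2 (single K (Node v (Leaf 1) (Leaf 2))))
        [tree_val K f l, tree_val K f r])"
proof -
  have d: "disjoint_leaves [l, r]"
    using t unfolding ltrees_Node disjoint_leaves_def by (auto simp: less_Suc_eq numeral_2_eq_2)
  have "Node v (Leaf 1) (Leaf 2) \<in> trees D (length [l, r])"
    using t corolla_trees[of v D] by (simp add: ltrees_Node numeral_2_eq_2)
  from tree_val_plug[OF f this _ d] t show ?thesis by (simp add: ltrees_Node numeral_2_eq_2)
qed

lemma tree_val_Leaf:
  assumes f: "operad_hom K (tree_operad K D) Q f"
  shows "tree_val K f (Leaf i) = ident Q"
proof -
  have "enum_labels {i} i = 1" using bij_betw_enum_labels[of "{i}"] by (auto simp: bij_betw_def)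
  then show ?thesis using operad_homD(3)[OF f]
    by (simp add: tree_val_def standardize_def tree_ident[OF K])
qed

text \<open>Induction by \<open>tree_val_Node\<close> over trees with arbitrary labels; the trees
  labelled by initial intervals span, and on them \<open>tree_val\<close> is the morphism
  itself.\<close>

lemma tree_hom_unique:
  assumes Q: "pre_operad K Q"
    and f: "operad_hom K (tree_operad K D) Q f" and g: "operad_hom K (tree_operad K D) Q g"
    and gen: "\<And>d. d \<in> D \<Longrightarrow> f 2 (single K (Node d (Leaf 1) (Leaf 2))) =
      g 2 (single K (Node d (Leaf 1) (Leaf 2)))"
    and x: "x \<in> carrier (space (tree_operad K D) n)"
  shows "f n x = g n x"
proof (rule tree_hom_eqI[OF K pre_operad_module[OF Q] operad_homD(1)[OF f] operad_homD(1)[OF g] _ x])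
  have "tree_val K f t = tree_val K g t" if "t \<in> ltrees D" for t
    using that
  proof (induction t)
    case (Node v l r)
    then show ?case using gen by (simp add: tree_val_Node[OF f] tree_val_Node[OF g] ltrees_Node)
  qed (simp add: tree_val_Leaf[OF f] tree_val_Leaf[OF g])
  then show "f n (single K t) = g n (single K t)" if "t \<in> trees D n" for t
    using tree_val_trees[OF that] trees_ltrees[OF that] by metis
qed

text \<open>The image of \<open>g\<close> is closed under unit, action and composition, so the
  recursion of \<open>tree_val_Node\<close> never leaves it; being a submodule, it then contains the
  values of all linear combinations of trees.\<close>

lemma tree_hom_range:
  assumes P: "pre_operad K P" and Q: "pre_operad K Q"
    and f: "operad_hom K (tree_operad K D) Q f" and g: "operad_hom K P Q g"
    and gen: "\<And>d. d \<in> D \<Longrightarrow> f 2 (single K (Node d (Leaf 1) (Leaf 2))) \<in> g 2 ` carrier (space P 2)"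
    and x: "x \<in> carrier (space (tree_operad K D) n)"
  shows "f n x \<in> g n ` carrier (space P n)"
proof -
  note g' = operad_homD[OF g]
  have *: "tree_val K f t \<in> g (length (leaves t)) ` carrier (space P (length (leaves t)))" if "t \<in>
    ltrees D" for t
    using that
  proof (induction t)
    case (Leaf i)
    show ?case unfolding tree_val_Leaf[OF f] g'(3)[symmetric]
      using pre_operad_ident[OF P] by simp
  next
    case (Node v l r)
    let ?a = "length (leaves l)" and ?b = "length (leaves r)"
    have lr: "v \<in> D" "l \<in> ltrees D" "r \<in> ltrees D" "set (leaves l) \<inter> set (leaves r) = {}"
      using Node.prems by (auto simp: ltrees_Node)
    obtain y where y: "y \<in> carrier (space P ?a)" "tree_val K f l = g ?a y"
      using Node.IH(1)[OF lr(2)] by blast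
    obtain z where z: "z \<in> carrier (space P ?b)" "tree_val K f r = g ?b z"
      using Node.IH(2)[OF lr(3)] by blast
    obtain w where w: "w \<in> carrier (space P 2)" "f 2 (single K (Node v (Leaf 1) (Leaf 2))) = g 2 w"
      using gen[OF lr(1)] by blast
    have c: "composable P [?a, ?b] w [y, z]"
      using w y z by (auto simp: composable_iff less_Suc_eq numeral_2_eq_2)
    let ?As = "[set (leaves l), set (leaves r)]"
    have "is_merge ?As (merge ?As)"
      by (rule is_merge_merge) (use lr(4) in \<open>auto simp: less_Suc_eq\<close>)
    moreover have "card (set (leaves l)) = ?a" "card (set (leaves r)) = ?b"
      using lr(2,3) by (auto simp: ltrees_def distinct_card)
    ultimately have p: "inv_into UNIV (merge ?As) permutes {1..?a + ?b}"
      unfolding is_merge_def by (auto intro: permutes_inv)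
    have "comp P [?a, ?b] w [y, z] \<in> carrier (space P (?a + ?b))"
      using comp_closed[OF P c] by simp
    moreover have "tree_val K f (Node v l r) =
      g (?a + ?b) (act P (?a + ?b) (inv_into UNIV (merge ?As)) (comp P [?a, ?b] w [y, z]))"
      using g'(4)[OF c] g'(2)[OF p] calculation w(2)
      by (simp add: tree_val_Node[OF f Node.prems] y(2) z(2) numeral_2_eq_2)
    ultimately show ?case using act_closed[OF P p] by auto
  qed
  note mP = pre_operad_module[OF P, of n] and mQ = pre_operad_module[OF Q, of n]
  have "submodule (g n ` carrier (space P n)) K (space Q n)"
    by (rule submodule_image[OF mP mQ g'(1) module.carrier_is_submodule[OF mP]])
  then have "submodule {x \<in> carrier (space (tree_operad K D) n). f n x \<in>
    g n ` carrier (space P n)} K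
    (space (tree_operad K D) n)"
    by (rule submodule_vimage[OF pre_operad_module[OF pre_operad_tree[OF K]] mQ operad_homD(1)[OF f]])
  moreover have "single K t \<in> {x \<in> carrier (space (tree_operad K D) n). f n x \<in>
    g n ` carrier (space P n)}"
    if "t \<in> trees D n" for t
    using *[OF trees_ltrees[OF that]] tree_val_trees[OF that,
      of K f] treesD(4)[OF that] tree_single_closed[OF K that] by simp
  ultimately have "carrier (space (tree_operad K D) n) \<subseteq>
    {x \<in> carrier (space (tree_operad K D) n). f n x \<in> g n ` carrier (space P n)}"
    unfolding tree_space[OF K] by (rule free_module_subsetI[OF K])
  then show ?thesis using x by blast
qed

end

subsection \<open>Changing decorations\<close>

context
  fixes K :: "('k, 'm) ring_scheme"
  assumes K: "cring K"
begin

interpretation K: cring K by (rule K)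

lemma map2_single: "length ts = length ns \<Longrightarrow> map2 (\<lambda>n t. single K (h t)) ns ts =
  map (single K) (map h ts)"
  by (intro nth_equalityI) auto

lemma map_tree_hom:
  assumes "\<And>d. d \<in> D \<Longrightarrow> h d \<in> D'"
  shows "operad_hom K (tree_operad K D) (tree_operad K D') (\<lambda>n. lin_ext K (map_tree h))"
proof (rule tree_homI[OF K pre_operad_tree[OF K]])
  show "lin_ext K (map_tree h) \<in>
    lin_hom K (space (tree_operad K D) n) (space (tree_operad K D') n)" for n
    unfolding tree_space[OF K] by (rule lin_ext_hom[OF K]) (rule trees_map_tree[OF _ assms])
  fix ns :: "nat list" and t ts
  assume t: "t \<in> trees D (length ns)" "length ts = length ns" "\<And>i. i < length ns \<Longrightarrow> ts ! i \<in>
    trees D (ns ! i)"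
  have "map_tree h (graft ns t ts) = graft ns (map_tree h t) (map (map_tree h) ts)"
    by (rule map_tree_graft) (use treesD(3)[OF t(1)] t(2) in auto)
  then show "lin_ext K (map_tree h) (single K (graft ns t ts)) =
    comp (tree_operad K D') ns (lin_ext K (map_tree h) (single K t))
      (map2 (\<lambda>n t. lin_ext K (map_tree h) (single K t)) ns ts)"
    by (simp add: lin_ext_single[OF K] map2_single[OF t(2)] tree_comp_single[OF K] del: map_map)
qed (simp_all add: lin_ext_single[OF K] tree_act_single[OF K] tree_ident[OF K] relabel_map_tree)

definition indicator_sum :: "'x set \<Rightarrow> 'x \<Rightarrow> 'k" where
  "indicator_sum S = (\<lambda>x. if x \<in> S then \<one>\<^bsub>K\<^esub> else \<zero>\<^bsub>K\<^esub>)"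

lemma indicator_sum_closed: "finite S \<Longrightarrow> S \<subseteq> X \<Longrightarrow> indicator_sum S \<in> carrier (free_module K X)"
proof -
  assume "finite S" "S \<subseteq> X"
  moreover have "supp K (indicator_sum S) \<subseteq> S" by (auto simp: supp_def indicator_sum_def)
  ultimately show ?thesis
    by (auto simp: free_module_simps indicator_sum_def intro: finite_subset)
qed

lemma lin_ext_indicator:
  assumes "finite S" "inj_on h S"
  shows "lin_ext K h (indicator_sum S) = indicator_sum (h ` S)"
proof
  fix y
  have "lin_ext K h (indicator_sum S) y = finsum K (indicator_sum S) {x \<in> S. h x = y}"
    by (rule lin_ext_superset[OF K indicator_sum_closed[OF assms(1) subset_refl] assms(1)])
      (auto simp: supp_def indicator_sum_def)
  also have "\<dots> = indicator_sum (h ` S) y"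
  proof (cases "y \<in> h ` S")
    case True
    then obtain x where x: "x \<in> S" "y = h x" by auto
    then have "{z \<in> S. h z = y} = {x}" using assms(2) by (auto dest: inj_onD)
    then show ?thesis using x by (simp add: indicator_sum_def)
  next
    case False
    then have e: "{z \<in> S. h z = y} = {}" by auto
    show ?thesis unfolding e using False by (simp add: indicator_sum_def)
  qed
  finally show "lin_ext K h (indicator_sum S) y = indicator_sum (h ` S) y" .
qed

end

text \<open>These are the trees in the expansion of a tree in which the vertex \<open>v\<close>
  stands for the sum of the decorations in \<open>\<delta> v\<close>. A set is enough, since
  different choices of decorations give different trees.\<close>

primrec redecorations :: "('v \<Rightarrow> 'w set) \<Rightarrow> 'v tree \<Rightarrow> 'w tree set" where
  "redecorations \<delta> (Leaf i) = {Leaf i}"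
| "redecorations \<delta> (Node v l r) =
    (\<lambda>(d, l', r'). Node d l' r') ` (\<delta> v \<times> redecorations \<delta> l \<times> redecorations \<delta> r)"

lemma leaves_redecorations: "t' \<in> redecorations \<delta> t \<Longrightarrow> leaves t' = leaves t"
  by (induction t arbitrary: t') auto

lemma decorations_redecorations: "t' \<in> redecorations \<delta> t \<Longrightarrow> decorations t' \<subseteq> (\<Union>v\<in>decorations t. \<delta> v)"
  by (induction t arbitrary: t') force+

lemma finite_redecorations: "(\<And>v. v \<in> decorations t \<Longrightarrow> finite (\<delta> v)) \<Longrightarrow> finite (redecorations \<delta> t)"
  by (induction t) auto

lemma redecorations_relabel: "redecorations \<delta> (relabel h t) = relabel h ` redecorations \<delta> t"
  by (induction t) force+

lemma redecorations_inj_relabel: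
  "t \<in> redecorations \<delta> T \<Longrightarrow> t' \<in> redecorations \<delta> T \<Longrightarrow> relabel h t = relabel h t' \<Longrightarrow> t = t'"
  by (induction T arbitrary: t t') auto

text \<open>Two redecorations of \<open>T\<close> have the same shape and the same leaves, so the
  graft is cut at the same places in both cases. Inputs can be recovered only for labels that occur
  in \<open>T\<close>.\<close>

lemma redecorations_graft_inj:
  assumes "graft ns t ts = graft ns t' ts'" "t \<in> redecorations \<delta> T" "t' \<in> redecorations \<delta> T"
  shows "t = t' \<and> (\<forall>i\<in>set (leaves T). ts ! (i - 1) = ts' ! (i - 1))"
  using assms
proof (induction T arbitrary: t t')
  case (Leaf i)
  then show ?case by (auto dest!: relabel_inj[rotated])
next
  case (Node v l r)
  obtain d l1 r1 where t: "t = Node d l1 r1" "l1 \<in> redecorations \<delta> l" "r1 \<in> redecorations \<delta> r"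
    using Node.prems(2) by auto
  obtain d' l2 r2 where t': "t' = Node d' l2 r2" "l2 \<in> redecorations \<delta> l" "r2 \<in> redecorations \<delta> r"
    using Node.prems(3) by auto
  have eq: "d = d'" "graft ns l1 ts = graft ns l2 ts'" "graft ns r1 ts = graft ns r2 ts'"
    using Node.prems(1) by (simp_all add: t t')
  show ?case using Node.IH(1)[OF eq(2) t(2) t'(2)] Node.IH(2)[OF eq(3) t(3) t'(3)] eq(1) t t'
    by auto
qed

lemma graft_cong: "(\<And>i. i \<in> set (leaves t) \<Longrightarrow> ts ! (i - 1) = ts' ! (i - 1)) \<Longrightarrow> graft ns t ts =
  graft ns t ts'"
  by (induction t) auto

lemma graft_in_redecorations:
  assumes "t \<in> redecorations \<delta> T" "\<And>i. i \<in> set (leaves T) \<Longrightarrow> ts ! (i - 1) \<in>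
    redecorations \<delta> (Ts ! (i - 1))"
  shows "graft ns t ts \<in> redecorations \<delta> (graft ns T Ts)"
  using assms
proof (induction T arbitrary: t)
  case (Node v l r)
  then obtain d l' r' where "t = Node d l' r'" "d \<in> \<delta> v" "l' \<in> redecorations \<delta> l" "r' \<in>
    redecorations \<delta> r"
    by auto
  then show ?case using Node.IH(1)[of l'] Node.IH(2)[of r'] Node.prems(2)
    by (auto intro!: image_eqI[of _ _ "(d, graft ns l' ts, graft ns r' ts)"])
qed (simp add: redecorations_relabel)

lemma redecorations_graftE:
  assumes "z \<in> redecorations \<delta> (graft ns T Ts)" "distinct (leaves T)" "set (leaves T) \<subseteq> {1..m}"
    and "\<And>i. i < m \<Longrightarrow> redecorations \<delta> (Ts ! i) \<noteq> {}"
  shows "\<exists>t ts. t \<in> redecorations \<delta> T \<and> length ts = m \<and> (\<forall>i<m. ts ! i \<in> redecorations \<delta> (Ts ! i)) \<and>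
    z = graft ns t ts"
  using assms(1-3)
proof (induction T arbitrary: z)
  case (Leaf i)
  define u where "u i = (SOME t. t \<in> redecorations \<delta> (Ts ! i))" for i
  have u: "u i \<in> redecorations \<delta> (Ts ! i)" if "i < m" for i
    unfolding u_def some_in_eq by (rule assms(4)[OF that])
  obtain t' where t': "t' \<in> redecorations \<delta> (Ts ! (i - 1))"
    "z = relabel (\<lambda>j. sum_list (take (i - 1) ns) + j) t'"
    using Leaf.prems(1) by (auto simp: redecorations_relabel)
  define ts where "ts = (map u [0..<m])[i - 1 := t']"
  have "i - 1 < m" using Leaf.prems(3) by auto
  then have "\<forall>j<m. ts ! j \<in> redecorations \<delta> (Ts ! j)" "ts ! (i - 1) = t'" "length ts = m"
    using u t' by (auto simp: ts_def nth_list_update)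
  then show ?case using t' by (intro exI[of _ "Leaf i"] exI[of _ ts]) auto
next
  case (Node v l r)
  then obtain d zl zr where z: "z = Node d zl zr" "d \<in> \<delta> v"
    "zl \<in> redecorations \<delta> (graft ns l Ts)" "zr \<in> redecorations \<delta> (graft ns r Ts)" by auto
  obtain l' ls where l: "l' \<in> redecorations \<delta> l" "length ls = m" "\<forall>i<m. ls ! i \<in>
    redecorations \<delta> (Ts ! i)"
    "zl = graft ns l' ls" using Node.IH(1)[OF z(3)] Node.prems by auto
  obtain r' rs where r: "r' \<in> redecorations \<delta> r" "length rs = m" "\<forall>i<m. rs ! i \<in>
    redecorations \<delta> (Ts ! i)"
    "zr = graft ns r' rs" using Node.IH(2)[OF z(4)] Node.prems by auto
  \<comment> \<open>The inputs found for the two branches are glued: a slot belongs to the branch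
    that contains its leaf, which is \<open>Suc i\<close> because slots count from 0 and labels from
    1. Distinct leaves exclude a conflict.\<close>
  define ts where "ts = map (\<lambda>i. if Suc i \<in> set (leaves l) then ls ! i else rs ! i) [0..<m]"
  have lab: "1 \<le> i \<and> i \<le> m" if "i \<in> set (leaves l) \<union> set (leaves r)" for i
    using Node.prems(3) that by auto
  have "graft ns l' ts = zl" unfolding l(4)
  proof (rule graft_cong)
    fix i assume i: "i \<in> set (leaves l')"
    then have "i \<in> set (leaves l)" using leaves_redecorations[OF l(1)] by simp
    then show "ts ! (i - 1) = ls ! (i - 1)" using lab[of i] by (auto simp: ts_def)
  qed
  moreover have "graft ns r' ts = zr" unfolding r(4)
  proof (rule graft_cong)
    fix i assume i: "i \<in> set (leaves r')"
    then have "i \<in> set (leaves r)" using leaves_redecorations[OF r(1)] by simp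
    then show "ts ! (i - 1) = rs ! (i - 1)" using lab[of i] Node.prems(2) by (auto simp: ts_def)
  qed
  ultimately have "z = graft ns (Node d l' r') ts" using z by simp
  moreover have "length ts = m" "\<forall>i<m. ts ! i \<in> redecorations \<delta> (Ts ! i)" using l r
    by (auto simp: ts_def)
  moreover have "Node d l' r' \<in> redecorations \<delta> (Node v l r)"
    using z(2) l(1) r(1) by (auto intro!: image_eqI[of _ _ "(d, l', r')"])
  ultimately show ?case by blast
qed

lemma redecorations_trees:
  assumes "t \<in> trees D n" "\<And>d. d \<in> D \<Longrightarrow> \<delta> d \<subseteq> D'"
  shows "redecorations \<delta> t \<subseteq> trees D' n"
proof
  fix t' assume t': "t' \<in> redecorations \<delta> t"
  have "decorations t' \<subseteq> D'" using decorations_redecorations[OF t'] assms treesD(1)[OF assms(1)]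
    by blast
  then show "t' \<in> trees D' n" using assms(1) leaves_redecorations[OF t'] by (simp add: trees_def)
qed

context
  fixes K :: "('k, 'm) ring_scheme" and D :: "'v set" and D' :: "'w set" and \<delta> :: "'v \<Rightarrow> 'w set"
  assumes K: "cring K" and \<delta>: "\<And>d. d \<in> D \<Longrightarrow> finite (\<delta> d)" "\<And>d. d \<in> D \<Longrightarrow> \<delta> d \<subseteq> D'"
    and \<delta>_nonempty: "\<And>d. d \<in> D \<Longrightarrow> \<delta> d \<noteq> {}"
begin

definition redecorate :: "nat \<Rightarrow> ('v tree \<Rightarrow> 'k) \<Rightarrow> 'w tree \<Rightarrow> 'k" where
  "redecorate n = free_lift K (space (tree_operad K D') n) (\<lambda>t. indicator_sum K (redecorations \<delta> t))"

lemma redecorations_fin: "t \<in> trees D n \<Longrightarrow> finite (redecorations \<delta> t)"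
  using \<delta>(1) by (intro finite_redecorations) (auto simp: trees_def)

lemma redecorations_nonempty: "decorations t \<subseteq> D \<Longrightarrow> redecorations \<delta> t \<noteq> {}"
  using \<delta>_nonempty by (induction t) auto

lemma indicator_redecorations:
  "t \<in> trees D n \<Longrightarrow> indicator_sum K (redecorations \<delta> t) \<in> carrier (space (tree_operad K D') n)"
  unfolding tree_space[OF K]
  by (rule indicator_sum_closed[OF K redecorations_fin redecorations_trees[OF _ \<delta>(2)]])

lemma redecorate_lin: "redecorate n \<in>
  lin_hom K (space (tree_operad K D) n) (space (tree_operad K D') n)"
  unfolding redecorate_def tree_space[OF K, of D]
  by (rule free_lift_hom[OF pre_operad_module[OF pre_operad_tree[OF K]] indicator_redecorations])

lemma redecorate_single:
  "t \<in> trees D n \<Longrightarrow> redecorate n (single K t) = indicator_sum K (redecorations \<delta> t)"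
  unfolding redecorate_def
  by (rule free_lift_single[OF pre_operad_module[OF pre_operad_tree[OF K]] indicator_redecorations])

text \<open>Redecorations of a graft correspond bijectively to a redecoration of the root tree
  together with one of each input. By \<open>multilin_ext_indicator\<close> the composite of the
  indicator sums is therefore again an indicator sum.\<close>

lemma redecorate_hom: "operad_hom K (tree_operad K D) (tree_operad K D') redecorate"
proof (rule tree_homI[OF K pre_operad_tree[OF K] redecorate_lin])
  show "redecorate n (single K (relabel (inv_into UNIV \<sigma>) t)) =
    act (tree_operad K D') n \<sigma> (redecorate n (single K t))"
    if s: "\<sigma> permutes {1..n}" and t: "t \<in> trees D n" for n \<sigma> t
  proof -
    have "act (tree_operad K D') n \<sigma> (indicator_sum K (redecorations \<delta> t)) =
      indicator_sum K (relabel (inv_into UNIV \<sigma>) ` redecorations \<delta> t)"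
    proof -
      have "inj_on (relabel (inv_into UNIV \<sigma>)) (redecorations \<delta> t)"
        by (rule inj_onI) (rule redecorations_inj_relabel)
      then show ?thesis
        using lin_ext_indicator[OF K redecorations_fin[OF t]]
          by (simp add: tree_operad_def lin_operad_def)
    qed
    then show ?thesis
      by (simp add: redecorate_single[OF t] redecorate_single[OF trees_relabel_inv[OF s t]] redecorations_relabel)
  qed
  show "redecorate 1 (single K (Leaf 1)) = ident (tree_operad K D')"
    unfolding redecorate_single[OF Leaf_trees] tree_ident[OF K]
    by (auto simp: indicator_sum_def[OF K] single_def)
  fix ns :: "nat list" and t ts
  assume t: "t \<in> trees D (length ns)" "length ts = length ns" "\<And>i. i < length ns \<Longrightarrow> ts ! i \<in>
    trees D (ns ! i)"
  let ?R = "redecorations \<delta>"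
  let ?Ss = "map ?R ts"
  note tD = treesD[OF t(1)]
  have m2: "map2 (\<lambda>n t. redecorate n (single K t)) ns ts = map (indicator_sum K) ?Ss"
    using t(2,3) by (intro nth_equalityI) (auto simp: redecorate_single)
  have inj: "inj_on (\<lambda>(x, xs). graft ns x xs) (?R t \<times> listset ?Ss)"
  proof (rule inj_onI, clarify)
    fix x xs y ys assume *: "x \<in> ?R t" "xs \<in> listset ?Ss" "y \<in> ?R t" "ys \<in> listset ?Ss"
      "graft ns x xs = graft ns y ys"
    have eq: "x = y \<and> (\<forall>i\<in>set (leaves t). xs ! (i - 1) = ys ! (i - 1))"
      by (rule redecorations_graft_inj[OF *(5,1,3)])
    moreover have "xs = ys"
    proof (rule nth_equalityI)
      show "length xs = length ys" using * by (auto simp: in_listset_iff)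
      fix i assume "i < length xs"
      then have "Suc i \<in> set (leaves t)" using tD(3) *(2) t(2) by (auto simp: in_listset_iff)
      then show "xs ! i = ys ! i" using eq by fastforce
    qed
    ultimately show "x = y \<and> xs = ys" by blast
  qed
  have "(\<lambda>(x, xs). graft ns x xs) ` (?R t \<times> listset ?Ss) = ?R (graft ns t ts)"
  proof (intro equalityI subsetI)
    fix z assume "z \<in> (\<lambda>(x, xs). graft ns x xs) ` (?R t \<times> listset ?Ss)"
    then obtain x xs where x: "x \<in> ?R t" "xs \<in> listset ?Ss" "z = graft ns x xs" by auto
    show "z \<in> ?R (graft ns t ts)"
      unfolding x(3) using x(1,2) tD(3) t(2)
        by (intro graft_in_redecorations) (auto simp: in_listset_iff)
  next
    fix z assume z: "z \<in> ?R (graft ns t ts)"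
    have "?R (ts ! i) \<noteq> {}" if "i < length ns" for i
      using redecorations_nonempty treesD(1)[OF t(3)[OF that]] .
    then show "z \<in> (\<lambda>(x, xs). graft ns x xs) ` (?R t \<times> listset ?Ss)"
      using redecorations_graftE[OF z tD(2), of "length ns"] tD(3) t(2)
        by (force simp: in_listset_iff)
  qed
  moreover have "multilin_ext K (graft ns) (indicator_sum K (?R t)) (map (indicator_sum K) ?Ss) =
    indicator_sum K ((\<lambda>(x, xs). graft ns x xs) ` (?R t \<times> listset ?Ss))"
    unfolding indicator_sum_def[OF K, abs_def]
  proof (rule multilin_ext_indicator[OF K, where X = "trees D'" and a =
    "\<lambda>n \<sigma>. relabel (inv_into UNIV \<sigma>)" and u = "Leaf 1"])
    show "finite (?R t)" using redecorations_fin[OF t(1)] .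
    show "finite S" if "S \<in> set ?Ss" for S
      using that t(2) redecorations_fin[OF t(3)] by (auto simp: in_set_conv_nth)
  qed (assumption | rule inj trees_relabel_inv Leaf_trees trees_graft | blast)+
  moreover have "comp (tree_operad K D') ns = multilin_ext K (graft ns)"
    by (simp add: tree_operad_def lin_operad_def)
  ultimately show "redecorate (sum_list ns) (single K (graft ns t ts)) =
    comp (tree_operad K D') ns (redecorate (length ns) (single K t)) (map2 (\<lambda>n t. redecorate n (single K t)) ns ts)"
    using redecorate_single[OF trees_graft[OF t(1,2) t(3)]] redecorate_single[OF t(1)] m2 by simp
qed

end

section \<open>Free operads on representations of the symmetric group on two letters, and morphisms
  out of them\<close>

section \<open>Free operads on representations\<close>

lemma module_cong:
  assumes "module K M" "carrier M' = carrier M" "\<zero>\<^bsub>M'\<^esub> = \<zero>\<^bsub>M\<^esub>"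
    "\<And>x y. x \<oplus>\<^bsub>M'\<^esub> y = x \<oplus>\<^bsub>M\<^esub> y" "\<And>a x. a \<odot>\<^bsub>M'\<^esub> x = a \<odot>\<^bsub>M\<^esub> x"
  shows "module K M'"
proof -
  interpret M: module K M by fact
  show ?thesis
  proof (rule moduleI)
    show "abelian_group M'"
    proof (rule abelian_groupI)
      fix x assume "x \<in> carrier M'"
      then show "\<exists>y\<in>carrier M'. y \<oplus>\<^bsub>M'\<^esub> x = \<zero>\<^bsub>M'\<^esub>"
        by (intro bexI[of _ "\<ominus>\<^bsub>M\<^esub> x"]) (simp_all add: assms M.l_neg)
    qed (auto simp: assms M.a_assoc intro: M.a_comm)
  qed (auto simp: assms M.R.cring_axioms M.smult_l_distr M.smult_r_distr M.smult_assoc1)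
qed

lemma extend_simps [simp]:
  "carrier (module.extend M f) = carrier M" "\<zero>\<^bsub>module.extend M f\<^esub> = \<zero>\<^bsub>M\<^esub>"
  "x \<oplus>\<^bsub>module.extend M f\<^esub> y = x \<oplus>\<^bsub>M\<^esub> y" "a \<odot>\<^bsub>module.extend M f\<^esub> x = a \<odot>\<^bsub>M\<^esub> x"
  "twist (module.extend M (s2_rep.fields h)) = h"
  by (simp_all add: module.defs s2_rep.defs)

lemma module_extend: "module K M \<Longrightarrow> module K (module.extend M f)"
  by (rule module_cong) auto

lemma s2_moduleD:
  assumes "s2_module K V"
  shows "module K V" "twist V \<in> lin_hom K V V" "v \<in> carrier V \<Longrightarrow> twist V (twist V v) = v"
    "v \<in> carrier V \<Longrightarrow> twist V v \<in> carrier V" "cring K"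
  using assms lin_hom_closed unfolding s2_module_def by (fast intro: module.axioms(1))+

lemma s2_module_com2:
  assumes "cring K"
  shows "s2_module K (com2_gens K)"
  using module_extend[OF module_free[OF assms]]
  by (auto simp: s2_module_def com2_gens_def lin_hom_iff module.smult_closed abelian_group.axioms)

subsection \<open>The tensor product of representations\<close>

lemma tensor_s2_simps:
  "carrier (tensor_s2 K V W) = carrier (tensor K V W)"
  "\<zero>\<^bsub>tensor_s2 K V W\<^esub> = \<zero>\<^bsub>tensor K V W\<^esub>"
  "x \<oplus>\<^bsub>tensor_s2 K V W\<^esub> y = x \<oplus>\<^bsub>tensor K V W\<^esub> y"
  "a \<odot>\<^bsub>tensor_s2 K V W\<^esub> x = a \<odot>\<^bsub>tensor K V W\<^esub> x"
  by (simp_all add: tensor_s2_def)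

lemma lin_hom_tensor_s2:
  "lin_hom K (tensor_s2 K V W) N = lin_hom K (tensor K V W) N"
  "lin_hom K N (tensor_s2 K V W) = lin_hom K N (tensor K V W)"
  by (auto simp: lin_hom_iff tensor_s2_simps)

context
  fixes K :: "('k, 'm) ring_scheme" and V :: "('k, 'v) s2_rep" and W :: "('k, 'w) s2_rep"
  assumes V: "s2_module K V" and W: "s2_module K W"
begin

private abbreviation (input) "twist_pair \<equiv> lin_ext K (\<lambda>(v, w). (twist V v, twist W w))"

lemma twist_pair_hom:
  "twist_pair \<in> lin_hom K (free_module K (carrier V \<times> carrier W)) (free_module K (carrier V \<times> carrier W))"
  by (rule lin_ext_hom[OF s2_moduleD(5)[OF V]]) (auto simp: s2_moduleD(4)[OF V] s2_moduleD(4)[OF W])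

lemma twist_tensor_coset:
  assumes "f \<in> carrier (free_module K (carrier V \<times> carrier W))"
  shows "twist (tensor_s2 K V W) (bilin_rel K V W +>\<^bsub>free_module K (carrier V \<times> carrier W)\<^esub> f) =
    bilin_rel K V W +>\<^bsub>free_module K (carrier V \<times> carrier W)\<^esub> twist_pair f"
proof -
  note m = s2_moduleD(1)[OF V] s2_moduleD(1)[OF W]
  note F = module_free[OF s2_moduleD(5)[OF V]]
  have "z \<in> bilin_rel K V W \<Longrightarrow> twist_pair z \<in> bilin_rel K V W" for z
    by (rule bilin_rel_map[OF m m twist_pair_hom s2_moduleD(2)[OF V] s2_moduleD(2)[OF W]])
      (auto simp: lin_ext_single[OF s2_moduleD(5)[OF V]])
  from UN_coset[OF F submodule_bilin_rel[OF m] F submodule_bilin_rel[OF m] twist_pair_hom this assms]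
  show ?thesis by (simp add: tensor_s2_def)
qed

lemma twist_tens:
  assumes "v \<in> carrier V" "w \<in> carrier W"
  shows "twist (tensor_s2 K V W) (tens K V W v w) = tens K V W (twist V v) (twist W w)"
  using twist_tensor_coset[of "single K (v,
    w)"] single_pair_closed[OF s2_moduleD(1)[OF V] s2_moduleD(1)[OF W] assms]
  by (simp add: tens_def lin_ext_single[OF s2_moduleD(5)[OF V]])

lemma twist_tensor_hom: "twist (tensor_s2 K V W) \<in> lin_hom K (tensor K V W) (tensor K V W)"
proof -
  note m = s2_moduleD(1)[OF V] s2_moduleD(1)[OF W]
  note F = module_free[OF s2_moduleD(5)[OF V]]
  interpret F: module K "free_module K (carrier V \<times> carrier W)" by (rule F)
  note q = quot_module_simps(1)[OF F submodule_bilin_rel[OF m]] quot_module_add[OF F submodule_bilin_rel[OF m]]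
    quot_module_smult[OF F submodule_bilin_rel[OF m]]
  show ?thesis
    unfolding tensor_def lin_hom_iff
    by (auto simp: q twist_tensor_coset lin_hom_closed[OF twist_pair_hom] lin_hom_add[OF twist_pair_hom]
        lin_hom_smult[OF twist_pair_hom])
qed

lemma s2_module_tensor: "s2_module K (tensor_s2 K V W)"
  unfolding s2_module_def lin_hom_tensor_s2
proof (intro conjI ballI)
  note m = s2_moduleD(1)[OF V] s2_moduleD(1)[OF W]
  let ?t = "twist (tensor_s2 K V W)"
  show "module K (tensor_s2 K V W)"
    unfolding tensor_s2_def by (rule module_extend[OF module_tensor[OF m]])
  show "?t \<in> lin_hom K (tensor K V W) (tensor K V W)" by (rule twist_tensor_hom)
  fix x assume x: "x \<in> carrier (tensor_s2 K V W)"
  have id: "(\<lambda>x. x) \<in> lin_hom K (tensor K V W) (tensor K V W)" by (auto simp: lin_hom_iff)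
  show "?t (?t x) = x"
    by (rule tensor_hom_eqI[OF m module_tensor[OF m] lin_hom_compose[OF twist_tensor_hom twist_tensor_hom] id])
      (use x in \<open>auto simp: tensor_s2_simps twist_tens s2_moduleD[OF V] s2_moduleD[OF W]\<close>)
qed

end

subsection \<open>The universal property of the free operad\<close>

definition corolla :: "('k, 'm) ring_scheme \<Rightarrow> 'v \<Rightarrow> 'v tree \<Rightarrow> 'k" where
  "corolla K v = single K (Node v (Leaf 1) (Leaf 2))"

definition op_corolla :: "('k, 'm) ring_scheme \<Rightarrow> 'v \<Rightarrow> 'v tree \<Rightarrow> 'k" where
  "op_corolla K v = single K (Node v (Leaf 2) (Leaf 1))"

text \<open>Morphisms from the free operad on the set \<open>carrier V\<close> that factor through the free operad on \<open>V\<close>.\<close>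

definition rep_hom ::
  "('k, 'm) ring_scheme \<Rightarrow> ('k, 'v) s2_rep \<Rightarrow> ('k, 'a) operad \<Rightarrow> (nat \<Rightarrow> ('v tree \<Rightarrow> 'k) \<Rightarrow> 'a) \<Rightarrow> bool"
  where "rep_hom K V P p \<longleftrightarrow> operad_hom K (tree_operad K (carrier V)) P p \<and>
    (\<lambda>v. p 2 (corolla K v)) \<in> lin_hom K V (space P 2) \<and>
    (\<forall>v\<in>carrier V. p 2 (op_corolla K v) = p 2 (corolla K (twist V v)))"

lemma rep_homD:
  assumes "rep_hom K V P p"
  shows "operad_hom K (tree_operad K (carrier V)) P p"
    "(\<lambda>v. p 2 (corolla K v)) \<in> lin_hom K V (space P 2)"
    "v \<in> carrier V \<Longrightarrow> p 2 (op_corolla K v) = p 2 (corolla K (twist V v))"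
  using assms unfolding rep_hom_def by blast+

context
  fixes K :: "('k, 'm) ring_scheme" and V :: "('k, 'v) s2_rep"
  assumes V: "s2_module K V"
begin

interpretation V: module K V by (rule s2_moduleD(1)[OF V])

private abbreviation (input) "TreeV \<equiv> tree_operad K (carrier V)"

private lemmas cring_K = s2_moduleD(5)[OF V]

lemma pre_operad_TV: "pre_operad K TreeV" by (rule pre_operad_tree[OF cring_K])

lemma corolla_closed: "v \<in> carrier V \<Longrightarrow> corolla K v \<in> carrier (space TreeV 2)"
  unfolding corolla_def by (rule tree_single_closed[OF cring_K corolla_trees])

lemma op_corolla_closed: "v \<in> carrier V \<Longrightarrow> op_corolla K v \<in> carrier (space TreeV 2)"
  unfolding op_corolla_def by (rule tree_single_closed[OF cring_K]) (auto simp: trees_def)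

lemma decoration_rel_eq:
  "decoration_rel K V =
    {corolla K ((a \<odot>\<^bsub>V\<^esub> v) \<oplus>\<^bsub>V\<^esub> v') \<ominus>\<^bsub>space TreeV 2\<^esub> ((a \<odot>\<^bsub>space TreeV 2\<^esub> corolla K v) \<oplus>\<^bsub>space TreeV 2\<^esub> corolla K v') | a v v'.
      a \<in> carrier K \<and> v \<in> carrier V \<and> v' \<in> carrier V} \<union>
    {op_corolla K v \<ominus>\<^bsub>space TreeV 2\<^esub> corolla K (twist V v) | v. v \<in> carrier V}"
  by (simp add: decoration_rel_def Let_def corolla_def op_corolla_def)

lemma decoration_rel_carrier: "decoration_rel K V \<subseteq> carrier (space TreeV 2)"
proof -
  interpret T: module K "space TreeV 2" by (rule pre_operad_module[OF pre_operad_TV])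
  show ?thesis unfolding decoration_rel_eq
    using corolla_closed op_corolla_closed s2_moduleD(4)[OF V]
    by (auto intro!: T.minus_closed T.a_closed T.smult_closed)
qed

lemma operad_ideal_decoration: "operad_ideal K TreeV (decoration_ideal K V)"
  unfolding decoration_ideal_def
  by (rule operad_ideal_gen_ideal[OF pre_operad_TV]) (use decoration_rel_carrier in auto)

lemma decoration_ideal_least:
  assumes "operad_ideal K TreeV I" "decoration_rel K V \<subseteq> I 2"
  shows "decoration_ideal K V n \<subseteq> I n"
  unfolding decoration_ideal_def by (rule gen_ideal_least[OF assms(1)]) (use assms(2) in auto)

text \<open>The two families of relations spell out linearity in the decoration and compatibility
  with the twist. An arbitrary linear map on arity 2 is allowed, because the colourings with a fixed
  number of black vertices, to which this is applied later, are only shown to be linear.\<close>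

lemma decoration_rel_kernel_iff:
  assumes N: "module K N" and f: "f \<in> lin_hom K (space TreeV 2) N"
  shows "(\<forall>r\<in>decoration_rel K V. f r = \<zero>\<^bsub>N\<^esub>) \<longleftrightarrow>
    (\<lambda>v. f (corolla K v)) \<in> lin_hom K V N \<and> (\<forall>v\<in>carrier V. f (op_corolla K v) =
      f (corolla K (twist V v)))"
proof -
  let ?T = "space TreeV 2"
  interpret T: module K ?T by (rule pre_operad_module[OF pre_operad_TV])
  interpret P: module K N by (rule N)
  note lin = lin_hom_diff[OF T.module_axioms P.module_axioms f] lin_hom_add[OF f] lin_hom_smult[OF f]
  have cl: "f (corolla K v) \<in> carrier N" "f (op_corolla K v) \<in> carrier N" if "v \<in> carrier V" for v
    using lin_hom_closed[OF f] corolla_closed[OF that] op_corolla_closed[OF that] by auto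
  have 1: "f (corolla K ((a \<odot>\<^bsub>V\<^esub> v) \<oplus>\<^bsub>V\<^esub> v') \<ominus>\<^bsub>?T\<^esub> ((a \<odot>\<^bsub>?T\<^esub> corolla K v) \<oplus>\<^bsub>?T\<^esub> corolla K v')) = \<zero>\<^bsub>N\<^esub> \<longleftrightarrow>
    f (corolla K ((a \<odot>\<^bsub>V\<^esub> v) \<oplus>\<^bsub>V\<^esub> v')) = (a \<odot>\<^bsub>N\<^esub> f (corolla K v)) \<oplus>\<^bsub>N\<^esub> f (corolla K v')"
    if "a \<in> carrier K" "v \<in> carrier V" "v' \<in> carrier V" for a v v'
    using that by (simp add: lin corolla_closed cl P.diff_zero_iff)
  have 2: "f (op_corolla K v \<ominus>\<^bsub>?T\<^esub> corolla K (twist V v)) = \<zero>\<^bsub>N\<^esub> \<longleftrightarrow>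
    f (op_corolla K v) = f (corolla K (twist V v))" if "v \<in> carrier V" for v
    using that s2_moduleD(4)[OF V that]
      by (simp add: lin corolla_closed op_corolla_closed cl P.diff_zero_iff)
  have L: "(\<lambda>v. f (corolla K v)) \<in> lin_hom K V N \<longleftrightarrow>
    (\<forall>a\<in>carrier K. \<forall>v\<in>carrier V. \<forall>v'\<in>carrier V.
      f (corolla K ((a \<odot>\<^bsub>V\<^esub> v) \<oplus>\<^bsub>V\<^esub> v')) = (a \<odot>\<^bsub>N\<^esub> f (corolla K v)) \<oplus>\<^bsub>N\<^esub> f (corolla K v'))"
    (is "?l \<longleftrightarrow> ?r")
  proof
    assume ?l
    then show ?r using lin_hom_add[OF \<open>?l\<close>] lin_hom_smult[OF \<open>?l\<close>] by simp
  next
    assume ?r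
    then show ?l by (intro lin_hom_lin_combI[OF V.module_axioms P.module_axioms]) (auto simp: cl)
  qed
  have R: "(\<forall>r\<in>decoration_rel K V. f r = \<zero>\<^bsub>N\<^esub>) \<longleftrightarrow>
    (\<forall>a\<in>carrier K. \<forall>v\<in>carrier V. \<forall>v'\<in>carrier V.
      f (corolla K ((a \<odot>\<^bsub>V\<^esub> v) \<oplus>\<^bsub>V\<^esub> v')) = (a \<odot>\<^bsub>N\<^esub> f (corolla K v)) \<oplus>\<^bsub>N\<^esub> f (corolla K v')) \<and>
    (\<forall>v\<in>carrier V. f (op_corolla K v) = f (corolla K (twist V v)))" (is "?A \<longleftrightarrow> ?B \<and> ?C")
  proof
    assume A: ?A
    have ?B
    proof (intro ballI)
      fix a v v' assume *: "a \<in> carrier K" "v \<in> carrier V" "v' \<in> carrier V"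
      then have "corolla K ((a \<odot>\<^bsub>V\<^esub> v) \<oplus>\<^bsub>V\<^esub> v') \<ominus>\<^bsub>?T\<^esub> ((a \<odot>\<^bsub>?T\<^esub> corolla K v) \<oplus>\<^bsub>?T\<^esub> corolla K v') \<in>
        decoration_rel K V"
        unfolding decoration_rel_eq by blast
      then show "f (corolla K ((a \<odot>\<^bsub>V\<^esub> v) \<oplus>\<^bsub>V\<^esub> v')) = (a \<odot>\<^bsub>N\<^esub> f (corolla K v)) \<oplus>\<^bsub>N\<^esub> f (corolla K v')"
        using A 1[OF *] by blast
    qed
    moreover have ?C
    proof
      fix v assume *: "v \<in> carrier V"
      then have "op_corolla K v \<ominus>\<^bsub>?T\<^esub> corolla K (twist V v) \<in> decoration_rel K V"
        unfolding decoration_rel_eq by blast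
      then show "f (op_corolla K v) = f (corolla K (twist V v))" using A 2[OF *] by blast
    qed
    ultimately show "?B \<and> ?C" ..
  next
    assume BC: "?B \<and> ?C"
    show ?A
    proof
      fix r assume "r \<in> decoration_rel K V"
      then show "f r = \<zero>\<^bsub>N\<^esub>"
        unfolding decoration_rel_eq
      proof (elim UnE CollectE exE conjE)
        fix a v v' assume "r =
          corolla K ((a \<odot>\<^bsub>V\<^esub> v) \<oplus>\<^bsub>V\<^esub> v') \<ominus>\<^bsub>?T\<^esub> ((a \<odot>\<^bsub>?T\<^esub> corolla K v) \<oplus>\<^bsub>?T\<^esub> corolla K v')"
          and *: "a \<in> carrier K" "v \<in> carrier V" "v' \<in> carrier V"
        then show ?thesis using BC 1[OF *] by blast
      next
        fix v assume "r = op_corolla K v \<ominus>\<^bsub>?T\<^esub> corolla K (twist V v)" and *: "v \<in> carrier V"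
        then show ?thesis using BC 2[OF *] by blast
      qed
    qed
  qed
  show ?thesis using L R by blast
qed

lemma rep_hom_iff:
  assumes P: "pre_operad K P" and p: "operad_hom K TreeV P p"
  shows "rep_hom K V P p \<longleftrightarrow> (\<forall>r\<in>decoration_rel K V. p 2 r = \<zero>\<^bsub>space P 2\<^esub>)"
  unfolding decoration_rel_kernel_iff[OF pre_operad_module[OF P] operad_homD(1)[OF p]] rep_hom_def
  using p by blast

lemma rep_hom_kills:
  assumes P: "pre_operad K P" and p: "rep_hom K V P p" and x: "x \<in> decoration_ideal K V n"
  shows "p n x = \<zero>\<^bsub>space P n\<^esub>"
proof -
  note h = rep_homD(1)[OF p]
  have "decoration_rel K V \<subseteq> {x \<in> carrier (space TreeV 2). p 2 x = \<zero>\<^bsub>space P 2\<^esub>}"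
    using decoration_rel_carrier rep_hom_iff[OF P h] p by blast
  from subsetD[OF decoration_ideal_least[OF operad_ideal_kernel[OF pre_operad_TV P h] this] x]
  show ?thesis by simp
qed

definition free_class :: "nat \<Rightarrow> ('v tree \<Rightarrow> 'k) \<Rightarrow> ('v tree \<Rightarrow> 'k) set" where
  "free_class = quot_class TreeV (decoration_ideal K V)"

lemma free_operad_eq: "free_operad K V = quot_operad TreeV (decoration_ideal K V)"
  by (simp add: free_operad_def)

lemma pre_operad_free: "pre_operad K (free_operad K V)"
  unfolding free_operad_eq by (rule pre_operad_quot[OF pre_operad_TV operad_ideal_decoration])

lemma free_class_hom: "operad_hom K TreeV (free_operad K V) free_class"
  unfolding free_operad_eq free_class_def
    by (rule quot_operad_hom[OF pre_operad_TV operad_ideal_decoration])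

lemma tree_class_eq: "tree_class K V n t = free_class n (single K t)"
  by (simp add: tree_class_def free_class_def quot_class_def[OF pre_operad_TV operad_ideal_decoration])

lemma free_operad_carrier: "carrier (space (free_operad K V) n) =
  free_class n ` carrier (space TreeV n)"
  unfolding free_operad_eq free_class_def
    by (rule quot_operad_carrier[OF pre_operad_TV operad_ideal_decoration])

lemma free_class_zero_iff:
  "x \<in> carrier (space TreeV n) \<Longrightarrow> free_class n x = \<zero>\<^bsub>space (free_operad K V) n\<^esub> \<longleftrightarrow> x \<in>
    decoration_ideal K V n"
  unfolding free_operad_eq free_class_def
    by (rule quot_class_eq_zero_iff[OF pre_operad_TV operad_ideal_decoration])

lemma free_class_rep_hom: "rep_hom K V (free_operad K V) free_class"
proof -
  have "r \<in> decoration_ideal K V 2" if "r \<in> decoration_rel K V" for r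
    using gen_ideal_superset[of "\<lambda>n. if n = 2 then decoration_rel K V else {}" 2] that
    unfolding decoration_ideal_def by auto
  then show ?thesis
    unfolding rep_hom_iff[OF pre_operad_free free_class_hom]
    using free_class_zero_iff decoration_rel_carrier by blast
qed

lemma rep_hom_compose:
  assumes "rep_hom K V P p" "operad_hom K P Q f"
  shows "rep_hom K V Q (\<lambda>n x. f n (p n x))"
  unfolding rep_hom_def
  using operad_hom_compose[OF rep_homD(1)[OF assms(1)] assms(2)] rep_homD(3)[OF assms(1)]
    lin_hom_compose[OF rep_homD(2)[OF assms(1)] operad_homD(1)[OF assms(2)]] by simp

lemma free_operad_lift:
  assumes P: "pre_operad K P" and p: "rep_hom K V P p"
  obtains g where "operad_hom K (free_operad K V) P g"
    "\<And>n x. x \<in> carrier (space TreeV n) \<Longrightarrow> g n (free_class n x) = p n x"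
  using quot_operad_lift[OF pre_operad_TV operad_ideal_decoration P rep_homD(1)[OF p] rep_hom_kills[OF P p]]
  unfolding free_operad_eq free_class_def by blast

text \<open>Both trees arise by plugging \<open>[r, l]\<close> into a tree with two leaves, once
  with reversed labels and once with twisted decoration. The permutation and the inputs coincide, so
  the relation in arity 2 decides.\<close>

lemma rep_hom_swap:
  assumes p: "rep_hom K V P p" and t: "Node v l r \<in> ltrees (carrier V)"
  shows "tree_val K p (Node v l r) = tree_val K p (Node (twist V v) r l)"
proof -
  have d: "disjoint_leaves [r, l]"
    using t unfolding ltrees_Node disjoint_leaves_def by (auto simp: less_Suc_eq numeral_2_eq_2)
  have v: "v \<in> carrier V" "twist V v \<in> carrier V" and s: "set [r, l] \<subseteq> ltrees (carrier V)"
    using t s2_moduleD(4)[OF V] by (auto simp: ltrees_Node)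
  have 1: "Node v (Leaf 2) (Leaf 1) \<in> trees (carrier V) (length [r, l])"
    using v by (auto simp: trees_def numeral_2_eq_2)
  have 2: "Node (twist V v) (Leaf 1) (Leaf 2) \<in> trees (carrier V) (length [r, l])"
    using v by (auto simp: trees_def numeral_2_eq_2)
  have "p (length [r, l]) (single K (Node v (Leaf 2) (Leaf 1))) =
    p (length [r, l]) (single K (Node (twist V v) (Leaf 1) (Leaf 2)))"
    using rep_homD(3)[OF p v(1)] by (simp add: corolla_def op_corolla_def numeral_2_eq_2)
  with tree_val_plug[OF cring_K rep_homD(1)[OF p] 1 s d] tree_val_plug[OF cring_K rep_homD(1)[OF p] 2 s d]
  show ?thesis by simp
qed

lemma submodule_relation_ideal:
  assumes "R \<subseteq> carrier (space (free_operad K V) 3)"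
  shows "operad_ideal K (free_operad K V) (relation_ideal K V R)"
  unfolding relation_ideal_def
  by (rule operad_ideal_gen_ideal[OF pre_operad_free]) (use assms in auto)

end

subsection \<open>Morphisms to Hadamard products\<close>

context
  fixes K :: "('k, 'm) ring_scheme" and D :: "'v set" and D' :: "'w set"
    and P :: "('k, 'a) operad" and Q :: "('k, 'b) operad" and p q
  assumes P: "pre_operad K P" and Q: "pre_operad K Q"
    and p: "operad_hom K (tree_operad K D) P p" and q: "operad_hom K (tree_operad K D') Q q"
begin

definition pair_val :: "nat \<Rightarrow> ('v \<times> 'w) tree \<Rightarrow> ('a \<times> 'b \<Rightarrow> 'k) set" where
  "pair_val n t = tens K (space P n) (space Q n)
    (p n (single K (map_tree fst t))) (q n (single K (map_tree snd t)))"

definition pair_hom :: "nat \<Rightarrow> (('v \<times> 'w) tree \<Rightarrow> 'k) \<Rightarrow> ('a \<times> 'b \<Rightarrow> 'k) set" where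
  "pair_hom n = free_lift K (space (hadamard K P Q) n) (pair_val n)"

lemma pair_components:
  assumes "t \<in> trees (D \<times> D') n"
  shows "map_tree fst t \<in> trees D n" "map_tree snd t \<in> trees D' n"
    "p n (single K (map_tree fst t)) \<in> carrier (space P n)"
    "q n (single K (map_tree snd t)) \<in> carrier (space Q n)"
proof -
  show *: "map_tree fst t \<in> trees D n" "map_tree snd t \<in> trees D' n"
    using assms by (auto intro!: trees_map_tree)
  show "p n (single K (map_tree fst t)) \<in> carrier (space P n)"
    "q n (single K (map_tree snd t)) \<in> carrier (space Q n)"
    using lin_hom_closed[OF operad_homD(1)[OF p] tree_single_closed[OF pre_operad_cring[OF P] *(1)]]
      lin_hom_closed[OF operad_homD(1)[OF q] tree_single_closed[OF pre_operad_cring[OF P] *(2)]] .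
qed

lemma pair_val_closed: "t \<in> trees (D \<times> D') n \<Longrightarrow> pair_val n t \<in> carrier (space (hadamard K P Q) n)"
  unfolding pair_val_def hadamard_space[OF P Q]
  by (rule tens_closed[OF pre_operad_module[OF P] pre_operad_module[OF Q]]) (auto simp: pair_components)

lemma pair_hom_lin: "pair_hom n \<in>
  lin_hom K (space (tree_operad K (D \<times> D')) n) (space (hadamard K P Q) n)"
  unfolding pair_hom_def tree_space[OF pre_operad_cring[OF P]]
  by (rule free_lift_hom[OF pre_operad_module[OF pre_operad_hadamard[OF P Q]] pair_val_closed])

lemma pair_hom_single: "t \<in> trees (D \<times> D') n \<Longrightarrow> pair_hom n (single K t) = pair_val n t"
  unfolding pair_hom_def
  by (rule free_lift_single[OF pre_operad_module[OF pre_operad_hadamard[OF P Q]] pair_val_closed])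

text \<open>The two projections of a tree decorated by pairs share its shape, so grafting and
  relabelling act componentwise, just as the Hadamard product composes elementary tensors.\<close>

lemma pair_hom_hom: "operad_hom K (tree_operad K (D \<times> D')) (hadamard K P Q) pair_hom"
proof (rule tree_homI[OF pre_operad_cring[OF P] pre_operad_hadamard[OF P Q] pair_hom_lin])
  note K = pre_operad_cring[OF P]
  show "pair_hom n (single K (relabel (inv_into UNIV \<sigma>) t)) =
    act (hadamard K P Q) n \<sigma> (pair_hom n (single K t))"
    if s: "\<sigma> permutes {1..n}" and t: "t \<in> trees (D \<times> D') n" for n \<sigma> t
    unfolding pair_hom_single[OF trees_relabel_inv[OF s t]] pair_hom_single[OF t] pair_val_def
    using hadamard_act[OF P Q s pair_components(3,4)[OF t]]
      tree_hom_relabel[OF K p s pair_components(1)[OF t]] tree_hom_relabel[OF K q s pair_components(2)[OF t]]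
    by (simp add: relabel_map_tree)
  show "pair_hom 1 (single K (Leaf 1)) = ident (hadamard K P Q)"
    unfolding pair_hom_single[OF Leaf_trees] pair_val_def hadamard_ident[OF P Q]
    using operad_homD(3)[OF p] operad_homD(3)[OF q] by (simp add: tree_ident[OF K])
  fix ns :: "nat list" and t ts
  assume t: "t \<in> trees (D \<times> D') (length ns)" "length ts = length ns"
    "\<And>i. i < length ns \<Longrightarrow> ts ! i \<in> trees (D \<times> D') (ns ! i)"
  have lab: "1 \<le> i \<and> i \<le> length ts" if "i \<in> set (leaves t)" for i
    using treesD(3)[OF t(1)] t(2) that by auto
  define pr where "pr n t = (p n (single K (map_tree fst t)),
    q n (single K (map_tree snd t)))" for n t
  have pr: "pr n t \<in> carrier (space P n) \<times> carrier (space Q n)" if "t \<in> trees (D \<times> D') n" for n t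
    using pair_components[OF that] by (simp add: pr_def)
  have "p (sum_list ns) (single K (map_tree fst (graft ns t ts))) =
    comp P ns (fst (pr (length ns) t)) (map fst (map2 pr ns ts))"
  proof -
    have "map2 (\<lambda>n t. p n (single K t)) ns (map (map_tree fst) ts) = map fst (map2 pr ns ts)"
      using t(2) by (intro nth_equalityI) (auto simp: pr_def)
    then show ?thesis
      using tree_hom_graft[OF K p pair_components(1)[OF t(1)], of "map (map_tree fst) ts"] t(2)
        pair_components(1)[OF t(3)] map_tree_graft[OF lab, where f = fst and ns = ns]
          by (simp add: pr_def)
  qed
  moreover have "q (sum_list ns) (single K (map_tree snd (graft ns t ts))) =
    comp Q ns (snd (pr (length ns) t)) (map snd (map2 pr ns ts))"
  proof -
    have "map2 (\<lambda>n t. q n (single K t)) ns (map (map_tree snd) ts) = map snd (map2 pr ns ts)"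
      using t(2) by (intro nth_equalityI) (auto simp: pr_def)
    then show ?thesis
      using tree_hom_graft[OF K q pair_components(2)[OF t(1)], of "map (map_tree snd) ts"] t(2)
        pair_components(2)[OF t(3)] map_tree_graft[OF lab, where f = snd and ns = ns]
          by (simp add: pr_def)
  qed
  moreover have "map2 (\<lambda>n t. pair_hom n (single K t)) ns ts =
    map2 (\<lambda>n q. tens K (space P n) (space Q n) (fst q) (snd q)) ns (map2 pr ns ts)"
    using t(2,3) by (intro nth_equalityI) (auto simp: pr_def pair_hom_single pair_val_def)
  moreover have "comp (hadamard K P Q) ns (tens K (space P (length ns)) (space Q (length ns))
      (fst (pr (length ns) t)) (snd (pr (length ns) t)))
      (map2 (\<lambda>n q. tens K (space P n) (space Q n) (fst q) (snd q)) ns (map2 pr ns ts)) =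
    tens K (space P (sum_list ns)) (space Q (sum_list ns))
      (comp P ns (fst (pr (length ns) t)) (map fst (map2 pr ns ts)))
      (comp Q ns (snd (pr (length ns) t)) (map snd (map2 pr ns ts)))"
    by (rule hadamard_comp[OF P Q]) (use pr t in auto)
  ultimately show "pair_hom (sum_list ns) (single K (graft ns t ts)) =
    comp (hadamard K P Q) ns (pair_hom (length ns) (single K t)) (map2 (\<lambda>n t. pair_hom n (single K t)) ns ts)"
    using pair_hom_single[OF trees_graft[OF t(1,2) t(3)]] pair_hom_single[OF t(1)]
    by (simp add: pair_val_def pr_def)
qed

end

lemma lin_hom_sum:
  assumes "module K M" "module K N" "f \<in> lin_hom K M N" "g \<in> lin_hom K M N"
  shows "(\<lambda>x. f x \<oplus>\<^bsub>N\<^esub> g x) \<in> lin_hom K M N"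
proof (rule lin_homI)
  interpret N: module K N by fact
  note f = lin_hom_closed[OF assms(3)] lin_hom_add[OF assms(3)] lin_hom_smult[OF assms(3)]
    lin_hom_closed[OF assms(4)] lin_hom_add[OF assms(4)] lin_hom_smult[OF assms(4)]
  show "f x \<oplus>\<^bsub>N\<^esub> g x \<in> carrier N" if "x \<in> carrier M" for x using that by (simp add: f)
  show "f (x \<oplus>\<^bsub>M\<^esub> y) \<oplus>\<^bsub>N\<^esub> g (x \<oplus>\<^bsub>M\<^esub> y) = (f x \<oplus>\<^bsub>N\<^esub> g x) \<oplus>\<^bsub>N\<^esub> (f y \<oplus>\<^bsub>N\<^esub> g y)"
    if "x \<in> carrier M" "y \<in> carrier M" for x y using that by (simp add: f N.a_ac)
  show "f (a \<odot>\<^bsub>M\<^esub> x) \<oplus>\<^bsub>N\<^esub> g (a \<odot>\<^bsub>M\<^esub> x) = a \<odot>\<^bsub>N\<^esub> (f x \<oplus>\<^bsub>N\<^esub> g x)"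
    if "a \<in> carrier K" "x \<in> carrier M" for a x using that by (simp add: f N.smult_r_distr)
qed

section \<open>Splitting decorations by colour, the map to the Hadamard product, and
  \<open>\<Phi>\<close>\<close>

section \<open>The canonical morphism on trees\<close>

lemma com2_gens_simps:
  "carrier (com2_gens K) = carrier (free_module K UNIV)" "x \<oplus>\<^bsub>com2_gens K\<^esub> y =
    x \<oplus>\<^bsub>free_module K UNIV\<^esub> y"
  "a \<odot>\<^bsub>com2_gens K\<^esub> x = a \<odot>\<^bsub>free_module K UNIV\<^esub> x" "twist (com2_gens K) x = x"
  by (simp_all add: com2_gens_def)

lemma com2_single_closed: "cring K \<Longrightarrow> single K c \<in> carrier (com2_gens K)"
  unfolding com2_gens_simps by (rule single_closed[OF _ UNIV_I])

lemma free_class_swap: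
  assumes V': "s2_module K V'" and t: "Node v l r \<in> trees (carrier V') n"
  shows "tree_class K V' n (Node v l r) = tree_class K V' n (Node (twist V' v) r l)"
proof -
  have t': "Node (twist V' v) r l \<in> trees (carrier V') n"
    using t s2_moduleD(4)[OF V'] by (auto simp: trees_def)
  show ?thesis
    using rep_hom_swap[OF V' free_class_rep_hom[OF V'] trees_ltrees[OF t]]
    unfolding tree_class_eq[OF V'] tree_val_trees[OF t] tree_val_trees[OF t'] .
qed

lemma trees_3_cases:
  assumes "t \<in> trees D 3"
  obtains (left) u v i j k where "t = Node u (Node v (Leaf i) (Leaf j)) (Leaf k)" "u \<in> D" "v \<in> D"
      "distinct [i, j, k]" "{i, j, k} = {1..3}"
    | (right) u v i j k where "t = Node u (Leaf k) (Node v (Leaf i) (Leaf j))" "u \<in> D" "v \<in> D"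
      "distinct [i, j, k]" "{i, j, k} = {1..3}"
proof -
  have pos: "length (leaves s) \<ge> 1" for s :: "'z tree" by (induction s) auto
  have one: "\<exists>i. s = Leaf i" if "length (leaves s) = 1" for s :: "'z tree"
  proof (cases s)
    case (Node v l r)
    then show ?thesis using that pos[of l] pos[of r] by simp
  qed auto
  have two: "\<exists>v i j. s = Node v (Leaf i) (Leaf j)" if "length (leaves s) = 2" for s :: "'z tree"
  proof (cases s)
    case (Node v l r)
    then have "length (leaves l) = 1" "length (leaves r) = 1" using that pos[of l] pos[of r] by auto
    then show ?thesis using one Node by blast
  qed (use that in auto)
  note t = treesD[OF assms]
  obtain u l r where n: "t = Node u l r" using t(4) by (cases t) auto
  have "length (leaves l) = 2 \<and> length (leaves r) = 1 \<or> length (leaves l) =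
    1 \<and> length (leaves r) = 2"
    using t(4) n pos[of l] pos[of r] by auto
  then show ?thesis
  proof (elim disjE conjE)
    assume "length (leaves l) = 2" "length (leaves r) = 1"
    then obtain v i j k where "l = Node v (Leaf i) (Leaf j)" "r = Leaf k" using one two by metis
    then show ?thesis using left n t by auto
  next
    assume "length (leaves l) = 1" "length (leaves r) = 2"
    then obtain v i j k where "r = Node v (Leaf i) (Leaf j)" "l = Leaf k" using one two by metis
    then show ?thesis using right[of u k v i j] n t by auto
  qed
qed

context
  fixes K :: "('k, 'm) ring_scheme" and V :: "('k, 'v) s2_rep"
  assumes field: "field K" and V: "s2_module K V"
begin

interpretation K: field K by (rule field)
interpretation V: module K V by (rule s2_moduleD(1)[OF V])

private abbreviation (input) "com2K \<equiv> com2_gens K"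
private abbreviation (input) "VW \<equiv> tensor_s2 K V com2K"
private abbreviation (input) "tensVW \<equiv> tens K V com2K"

private lemmas s2_com2 = s2_module_com2[OF K.cring_axioms]
private lemmas s2_VW = s2_module_tensor[OF V s2_com2]
private lemmas module_V = s2_moduleD(1)[OF V]
private lemmas module_com2 = s2_moduleD(1)[OF s2_com2]
private lemmas module_VW = module_tensor[OF module_V module_com2]

private lemmas single_colour_closed = com2_single_closed[OF K.cring_axioms]

lemma colour_coeff_closed: "w \<in> carrier com2K \<Longrightarrow> w c \<in> carrier K"
  by (auto simp: com2_gens_simps free_module_simps)

lemma colour_decomp:
  assumes "w \<in> carrier com2K"
  shows "w = (w White \<odot>\<^bsub>com2K\<^esub> single K White) \<oplus>\<^bsub>com2K\<^esub> (w Black \<odot>\<^bsub>com2K\<^esub> single K Black)"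
proof
  fix c
  show "w c = ((w White \<odot>\<^bsub>com2K\<^esub> single K White) \<oplus>\<^bsub>com2K\<^esub> (w Black \<odot>\<^bsub>com2K\<^esub> single K Black)) c"
    using colour_coeff_closed[OF assms]
    by (cases c) (simp_all add: com2_gens_simps free_module_simps single_def)
qed

lemma colour_part_exists:
  "\<exists>f. f \<in> lin_hom K (tensor K V com2K) V \<and>
    (\<forall>v\<in>carrier V. \<forall>w\<in>carrier com2K. f (tensVW v w) = w c \<odot>\<^bsub>V\<^esub> v)"
proof -
  have 1: "(\<lambda>v. w c \<odot>\<^bsub>V\<^esub> v) \<in> lin_hom K V V" if "w \<in> carrier com2K" for w
    by (rule smult_lin_hom[OF module_V V.carrier_is_submodule colour_coeff_closed[OF that]])
  have 2: "(\<lambda>w. w c \<odot>\<^bsub>V\<^esub> v) \<in> lin_hom K com2K V" if "v \<in> carrier V" for v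
    using that by (intro lin_homI)
      (auto simp: colour_coeff_closed com2_gens_simps(2,3) free_module_simps(3,4) V.smult_l_distr V.smult_assoc1)
  show ?thesis
    by (rule tensor_lift[OF module_V module_com2 module_V, where b =
      "\<lambda>v w. w c \<odot>\<^bsub>V\<^esub> v"]) (use 1 2 in blast)+
qed

text \<open>Since \<open>com2_gens K\<close> has the basis White, Black, its tensor product with
  \<open>V\<close> is a sum of two copies of \<open>V\<close>; this is the projection to the copy of
  colour \<open>c\<close>.\<close>

definition colour_part :: "colour \<Rightarrow> ('v \<times> (colour \<Rightarrow> 'k) \<Rightarrow> 'k) set \<Rightarrow> 'v" where
  "colour_part c = (SOME f. f \<in> lin_hom K (tensor K V com2K) V \<and>
    (\<forall>v\<in>carrier V. \<forall>w\<in>carrier com2K. f (tensVW v w) = w c \<odot>\<^bsub>V\<^esub> v))"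

lemma colour_part_hom: "colour_part c \<in> lin_hom K (tensor K V com2K) V"
  and colour_part_tens: "v \<in> carrier V \<Longrightarrow> w \<in> carrier com2K \<Longrightarrow> colour_part c (tensVW v w) = w c \<odot>\<^bsub>V\<^esub> v"
  using someI_ex[OF colour_part_exists[of c]] unfolding colour_part_def by blast+

lemma tens_smult:
  assumes "a \<in> carrier K" "v \<in> carrier V" "w \<in> carrier com2K"
  shows "tensVW (a \<odot>\<^bsub>V\<^esub> v) w = tensVW v (a \<odot>\<^bsub>com2K\<^esub> w)"
  using lin_hom_smult[OF tens_homl[OF module_V module_com2 assms(3)] assms(1,2)]
    lin_hom_smult[OF tens_homr[OF module_V module_com2 assms(2)] assms(1,3)] by simp

lemma smult_colour_closed: "w \<in> carrier com2K \<Longrightarrow> w c \<odot>\<^bsub>com2K\<^esub> single K c \<in> carrier com2K"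
  by (rule module.smult_closed[OF module_com2 colour_coeff_closed single_colour_closed])

text \<open>Both sides are linear, and on an elementary tensor the second factor is expanded in the
  colour basis with its coefficients moved across the tensor sign.\<close>

lemma tensor_decomp:
  assumes "x \<in> carrier (tensor K V com2K)"
  shows "x = tensVW (colour_part White x) (single K White) \<oplus>\<^bsub>tensor K V com2K\<^esub> tensVW (colour_part Black x) (single K Black)"
proof -
  note part = lin_hom_compose[OF colour_part_hom tens_homl[OF module_V module_com2 single_colour_closed]]
  have id: "(\<lambda>x. x) \<in> lin_hom K (tensor K V com2K) (tensor K V com2K)" by (auto simp: lin_hom_iff)
  show ?thesis
  proof (rule tensor_hom_eqI[OF module_V module_com2 module_VW id lin_hom_sum[OF module_VW module_VW part part] _ assms])
    fix v w assume vw: "v \<in> carrier V" "w \<in> carrier com2K"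
    have "tensVW v w =
      tensVW v ((w White \<odot>\<^bsub>com2K\<^esub> single K White) \<oplus>\<^bsub>com2K\<^esub> (w Black \<odot>\<^bsub>com2K\<^esub> single K Black))"
      using colour_decomp[OF vw(2)] by simp
    also have "\<dots> = tensVW v (w White \<odot>\<^bsub>com2K\<^esub> single K White) \<oplus>\<^bsub>tensor K V com2K\<^esub> tensVW v (w Black \<odot>\<^bsub>com2K\<^esub> single K Black)"
      by (rule lin_hom_add[OF tens_homr[OF module_V module_com2 vw(1)]]) (rule smult_colour_closed[OF vw(2)])+
    moreover have e: "tensVW (colour_part c (tensVW v w)) (single K c) =
      tensVW v (w c \<odot>\<^bsub>com2K\<^esub> single K c)" for c
      unfolding colour_part_tens[OF vw]
      by (rule tens_smult[OF colour_coeff_closed[OF vw(2)] vw(1) single_colour_closed])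
    ultimately show "tensVW v w =
      tensVW (colour_part White (tensVW v w)) (single K White) \<oplus>\<^bsub>tensor K V com2K\<^esub>
      tensVW (colour_part Black (tensVW v w)) (single K Black)"
      unfolding e by simp
  qed
qed

lemma colour_part_twist:
  assumes "x \<in> carrier (tensor K V com2K)"
  shows "colour_part c (twist VW x) = twist V (colour_part c x)"
proof (rule tensor_hom_eqI[OF module_V module_com2 module_V lin_hom_compose[OF twist_tensor_hom[OF V s2_com2] colour_part_hom]
      lin_hom_compose[OF colour_part_hom s2_moduleD(2)[OF V]] _ assms])
  fix v w assume vw: "v \<in> carrier V" "w \<in> carrier com2K"
  then show "colour_part c (twist VW (tensVW v w)) = twist V (colour_part c (tensVW v w))"
    using s2_moduleD(4)[OF V vw(1)]
    by (simp add: twist_tens[OF V s2_com2 vw] com2_gens_simps(4) colour_part_tens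
        lin_hom_smult[OF s2_moduleD(2)[OF V]] colour_coeff_closed)
qed

text \<open>The pairs stand for the two elementary tensors that add up to \<open>x\<close>. Their
  second components keep them distinct even when the two parts of \<open>x\<close> coincide, so no
  summand is lost by using a set.\<close>

definition colour_split :: "('v \<times> (colour \<Rightarrow> 'k) \<Rightarrow> 'k) set \<Rightarrow> ('v \<times> (colour \<Rightarrow> 'k)) set" where
  "colour_split x = {(colour_part White x, single K White), (colour_part Black x, single K Black)}"

lemma colour_split_facts:
  assumes "x \<in> carrier VW"
  shows "finite (colour_split x)" "colour_split x \<subseteq> carrier V \<times> carrier com2K" "colour_split x \<noteq> {}"
  using assms lin_hom_closed[OF colour_part_hom] single_colour_closed
  by (auto simp: colour_split_def tensor_s2_simps)

private abbreviation (input) "split \<equiv> redecorate K (carrier V \<times> carrier com2K) colour_split"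

lemma split_hom: "operad_hom K (tree_operad K (carrier VW)) (tree_operad K (carrier V \<times> carrier com2K)) split"
  by (rule redecorate_hom[OF K.cring_axioms colour_split_facts])

lemma single_White_neq: "single K White \<noteq> single K Black"
proof
  assume "single K White = single K Black"
  then have "single K White White = single K Black White" by simp
  then show False by (simp add: single_def)
qed

lemma indicator_sum_pair:
  assumes "a \<noteq> b"
  shows "indicator_sum K {a, b} = single K a \<oplus>\<^bsub>free_module K Y\<^esub> single K b"
  using assms by (auto simp: indicator_sum_def[OF K.cring_axioms] free_module_simps single_def)

context
  fixes P :: "('k, 'a) operad" and Q :: "('k, 'b) operad" and p q
  assumes P: "pre_operad K P" and Q: "pre_operad K Q"
    and p: "rep_hom K V P p" and q: "rep_hom K com2K Q q"
begin

private abbreviation (input) "hadPQ \<equiv> hadamard K P Q"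
private abbreviation (input) "tensPQ n \<equiv> tens K (space P n) (space Q n)"

text \<open>A decoration in the tensor product need not be elementary. Each vertex is therefore
  expanded into its white and its black part first, and the resulting trees decorated by pairs are
  evaluated in the two factors.\<close>

definition tensor_hom where
  "tensor_hom n x = pair_hom K P Q p q n (split n x)"

lemma tensor_hom_hom: "operad_hom K (tree_operad K (carrier VW)) hadPQ tensor_hom"
  unfolding tensor_hom_def
  by (rule operad_hom_compose[OF split_hom pair_hom_hom[OF P Q rep_homD(1)[OF p] rep_homD(1)[OF q]]])

lemma tensor_hom_binary:
  assumes x: "x \<in> carrier VW" and ij: "i = 1 \<and> j = 2 \<or> i = 2 \<and> j = (1 :: nat)"
  shows "tensor_hom 2 (single K (Node x (Leaf i) (Leaf j))) =
    tensPQ 2 (p 2 (single K (Node (colour_part White x) (Leaf i) (Leaf j)))) (q 2 (single K (Node (single K White) (Leaf i) (Leaf j))))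
    \<oplus>\<^bsub>space hadPQ 2\<^esub>
    tensPQ 2 (p 2 (single K (Node (colour_part Black x) (Leaf i) (Leaf j)))) (q 2 (single K (Node (single K Black) (Leaf i) (Leaf j))))"
proof -
  note ph = pair_hom_hom[OF P Q rep_homD(1)[OF p] rep_homD(1)[OF q]]
  let ?N = "\<lambda>c. Node (colour_part c x, single K c) (Leaf i) (Leaf j)"
  have s12: "{1..2 :: nat} = {1, 2}" by auto
  have t: "Node x (Leaf i) (Leaf j) \<in> trees (carrier VW) 2"
    using x ij by (auto simp: trees_def s12)
  have "(colour_part c x, single K c) \<in> carrier V \<times> carrier com2K" for c
    using x lin_hom_closed[OF colour_part_hom] single_colour_closed by (simp add: tensor_s2_simps)
  then have N: "?N c \<in> trees (carrier V \<times> carrier com2K) 2" for c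
    using ij by (auto simp: trees_def s12)
  have "split 2 (single K (Node x (Leaf i) (Leaf j))) =
    indicator_sum K (redecorations colour_split (Node x (Leaf i) (Leaf j)))"
    by (rule redecorate_single[OF K.cring_axioms _ _ _ t]) (rule colour_split_facts, assumption)+
  also have "\<dots> = indicator_sum K {?N White, ?N Black}" by (simp add: colour_split_def)
  also have "\<dots> = single K (?N White) \<oplus>\<^bsub>space (tree_operad K (carrier V \<times> carrier com2K)) 2\<^esub> single K (?N Black)"
    unfolding tree_space[OF K.cring_axioms] using single_White_neq
      by (intro indicator_sum_pair) auto
  finally have "tensor_hom 2 (single K (Node x (Leaf i) (Leaf j))) =
    pair_hom K P Q p q 2 (single K (?N White)) \<oplus>\<^bsub>space hadPQ 2\<^esub> pair_hom K P Q p q 2 (single K (?N Black))"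
    using lin_hom_add[OF operad_homD(1)[OF ph] tree_single_closed[OF K.cring_axioms N] tree_single_closed[OF K.cring_axioms N]]
    by (simp add: tensor_hom_def)
  then show ?thesis
    by (simp add: pair_hom_single[OF P Q rep_homD(1)[OF p] rep_homD(1)[OF q] N]
        pair_val_def[OF P Q rep_homD(1)[OF p] rep_homD(1)[OF q]])
qed

private lemmas mP = pre_operad_module[OF P]
private lemmas mQ = pre_operad_module[OF Q]
private lemmas mH = pre_operad_module[OF pre_operad_hadamard[OF P Q]]

lemma p_corolla: "v \<in> carrier V \<Longrightarrow> p 2 (corolla K v) \<in> carrier (space P 2)"
  using lin_hom_closed[OF rep_homD(2)[OF p]] .

lemma q_corolla: "w \<in> carrier com2K \<Longrightarrow> q 2 (corolla K w) \<in> carrier (space Q 2)"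
  using lin_hom_closed[OF rep_homD(2)[OF q]] .

lemma tensor_hom_corolla:
  assumes "x \<in> carrier VW"
  shows "tensor_hom 2 (corolla K x) =
    tensPQ 2 (p 2 (corolla K (colour_part White x))) (q 2 (corolla K (single K White)))
    \<oplus>\<^bsub>space hadPQ 2\<^esub> tensPQ 2 (p 2 (corolla K (colour_part Black x))) (q 2 (corolla K (single K Black)))"
  unfolding corolla_def by (rule tensor_hom_binary[OF assms]) auto

text \<open>Linearity in the decoration is inherited from \<open>colour_part\<close>. The twist acts
  trivially on the colours, so it commutes with the splitting and the twist relation of
  \<open>p\<close> can be applied to each part.\<close>

lemma tensor_hom_rep_hom: "rep_hom K VW hadPQ tensor_hom"
  unfolding rep_hom_def
proof (intro conjI ballI)
  show "operad_hom K (tree_operad K (carrier VW)) hadPQ tensor_hom" by (rule tensor_hom_hom)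
  have "(\<lambda>x. tensPQ 2 (p 2 (corolla K (colour_part c x))) (q 2 (corolla K (single K c)))) \<in>
    lin_hom K VW (space hadPQ 2)" for c
    unfolding lin_hom_tensor_s2 hadamard_space[OF P Q]
    by (rule lin_hom_compose[OF lin_hom_compose[OF colour_part_hom rep_homD(2)[OF p]]
          tens_homl[OF mP mQ q_corolla[OF single_colour_closed]]])
  from lin_hom_sum[OF s2_moduleD(1)[OF s2_VW] mH this[of White] this[of Black]]
  show "(\<lambda>x. tensor_hom 2 (corolla K x)) \<in> lin_hom K VW (space hadPQ 2)"
    by (rule lin_hom_cong[OF s2_moduleD(1)[OF s2_VW]]) (simp add: tensor_hom_corolla)
  fix x assume x: "x \<in> carrier VW"
  have part: "colour_part c x \<in> carrier V" for c
    using x lin_hom_closed[OF colour_part_hom] by (simp add: tensor_s2_simps)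
  have tx: "twist VW x \<in> carrier VW" by (rule s2_moduleD(4)[OF s2_VW x])
  have "tensor_hom 2 (op_corolla K x) =
    tensPQ 2 (p 2 (op_corolla K (colour_part White x))) (q 2 (op_corolla K (single K White)))
    \<oplus>\<^bsub>space hadPQ 2\<^esub> tensPQ 2 (p 2 (op_corolla K (colour_part Black x))) (q 2 (op_corolla K (single K Black)))"
    unfolding op_corolla_def by (rule tensor_hom_binary[OF x]) auto
  then show "tensor_hom 2 (op_corolla K x) = tensor_hom 2 (corolla K (twist VW x))"
    using x by (simp add: tensor_hom_corolla[OF tx] rep_homD(3)[OF p part] rep_homD(3)[OF q single_colour_closed]
        com2_gens_simps(4) colour_part_twist tensor_s2_simps)
qed

text \<open>The coefficient \<open>w c\<close> is moved from the left to the right factor, after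
  which the two colours add up to \<open>w\<close>.\<close>

lemma tensor_hom_corolla_tens:
  assumes v: "v \<in> carrier V" and w: "w \<in> carrier com2K"
  shows "tensor_hom 2 (corolla K (tensVW v w)) = tensPQ 2 (p 2 (corolla K v)) (q 2 (corolla K w))"
proof -
  have x: "tensVW v w \<in> carrier VW" unfolding tensor_s2_simps
    by (rule tens_closed[OF module_V module_com2 v w])
  let ?s = "\<lambda>c. w c \<odot>\<^bsub>com2K\<^esub> single K c"
  have 1: "tensPQ 2 (p 2 (corolla K (colour_part c (tensVW v w)))) (q 2 (corolla K (single K c))) =
    tensPQ 2 (p 2 (corolla K v)) (q 2 (corolla K (?s c)))" for c
  proof -
    have c: "w c \<in> carrier K" by (rule colour_coeff_closed[OF w])
    have "tensPQ 2 (p 2 (corolla K (w c \<odot>\<^bsub>V\<^esub> v))) (q 2 (corolla K (single K c))) =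
      w c \<odot>\<^bsub>tensor K (space P 2) (space Q 2)\<^esub> tensPQ 2 (p 2 (corolla K v)) (q 2 (corolla K (single K c)))"
      using lin_hom_smult[OF lin_hom_compose[OF rep_homD(2)[OF p] tens_homl[OF mP mQ q_corolla[OF single_colour_closed]]] c v] .
    also have "\<dots> = tensPQ 2 (p 2 (corolla K v)) (q 2 (corolla K (?s c)))"
      using lin_hom_smult[OF lin_hom_compose[OF rep_homD(2)[OF q] tens_homr[OF mP mQ p_corolla[OF v]]] c single_colour_closed]
      by simp
    finally show ?thesis by (simp add: colour_part_tens[OF v w])
  qed
  have "q 2 (corolla K w) = q 2 (corolla K (?s White \<oplus>\<^bsub>com2K\<^esub> ?s Black))"
    using colour_decomp[OF w] by simp
  then show ?thesis
    unfolding tensor_hom_corolla[OF x] 1 hadamard_space[OF P Q]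
    using lin_hom_add[OF lin_hom_compose[OF rep_homD(2)[OF q] tens_homr[OF mP mQ p_corolla[OF v]]]
        smult_colour_closed[OF w, of White] smult_colour_closed[OF w, of Black]] by simp
qed

text \<open>No expansion over the vertices is carried out: both sides are morphisms on trees
  decorated by pairs and agree on corollas, so \<open>tree_hom_unique\<close> applies.\<close>

lemma tensor_hom_tens_tree:
  assumes t: "t \<in> trees (carrier V \<times> carrier com2K) n"
  shows "tensor_hom n (single K (map_tree (\<lambda>(v, w). tensVW v w) t)) =
    tensPQ n (p n (single K (map_tree fst t))) (q n (single K (map_tree snd t)))"
proof -
  note ph = pair_hom_hom[OF P Q rep_homD(1)[OF p] rep_homD(1)[OF q]]
  let ?\<tau> = "\<lambda>(v, w). tensVW v w"
  have \<tau>: "?\<tau> d \<in> carrier VW" if "d \<in> carrier V \<times> carrier com2K" for d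
    using that tens_closed[OF module_V module_com2] by (auto simp: tensor_s2_simps)
  note mh = map_tree_hom[OF K.cring_axioms, of "carrier V \<times> carrier com2K" ?\<tau> "carrier VW", OF \<tau>]
  have "tensor_hom n (lin_ext K (map_tree ?\<tau>) (single K t)) = pair_hom K P Q p q n (single K t)"
  proof (rule tree_hom_unique[OF K.cring_axioms pre_operad_hadamard[OF P Q] operad_hom_compose[OF mh tensor_hom_hom] ph])
    fix d assume d: "d \<in> carrier V \<times> carrier com2K"
    obtain v w where vw: "d = (v, w)" "v \<in> carrier V" "w \<in> carrier com2K" using d by auto
    show "tensor_hom 2 (lin_ext K (map_tree ?\<tau>) (single K (Node d (Leaf 1) (Leaf 2)))) =
      pair_hom K P Q p q 2 (single K (Node d (Leaf 1) (Leaf 2)))"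
      using tensor_hom_corolla_tens[OF vw(2,3)]
        pair_hom_single[OF P Q rep_homD(1)[OF p] rep_homD(1)[OF q] corolla_trees[OF d]]
      by (simp add: lin_ext_single[OF K.cring_axioms] vw(1) corolla_def pair_val_def[OF P Q rep_homD(1)[OF p] rep_homD(1)[OF q]])
  qed (assumption | rule tree_single_closed[OF K.cring_axioms t])+
  then show ?thesis
    by (simp add: lin_ext_single[OF K.cring_axioms] pair_hom_single[OF P Q rep_homD(1)[OF p] rep_homD(1)[OF q] t]
        pair_val_def[OF P Q rep_homD(1)[OF p] rep_homD(1)[OF q]])
qed

end

subsection \<open>Coloured trees\<close>

definition paint :: "'v \<times> colour \<Rightarrow> ('v \<times> (colour \<Rightarrow> 'k) \<Rightarrow> 'k) set" where
  "paint = (\<lambda>(v, c). tensVW v (single K c))"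

private abbreviation (input) "VCT n \<equiv> trees (carrier V \<times> (UNIV :: colour set)) n"
private abbreviation (input) "TCT \<equiv> tree_operad K (carrier V \<times> (UNIV :: colour set))"

lemma paint_closed: "d \<in> carrier V \<times> UNIV \<Longrightarrow> paint d \<in> carrier VW"
  using tens_closed[OF module_V module_com2 _ single_colour_closed]
    by (auto simp: tensor_s2_simps paint_def)

lemma paint_hom: "operad_hom K TCT (tree_operad K (carrier VW)) (\<lambda>n. lin_ext K (map_tree paint))"
  by (rule map_tree_hom[OF K.cring_axioms paint_closed])

lemma paint_tree: "t \<in> VCT n \<Longrightarrow> map_tree paint t \<in> trees (carrier VW) n"
  by (rule trees_map_tree[OF _ paint_closed])

text \<open>This reduces trees decorated in the tensor product to coloured \<open>V\<close>-trees:
  by \<open>tree_hom_range\<close> only corollas matter, and there \<open>tensor_decomp\<close>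
  writes the decoration as a white plus a black one.\<close>

lemma rep_hom_paint_range:
  assumes Q: "pre_operad K Q" and f: "rep_hom K VW Q f" and x: "x \<in>
    carrier (space (tree_operad K (carrier VW)) n)"
  obtains y where "y \<in> carrier (space TCT n)" "f n x = f n (lin_ext K (map_tree paint) y)"
proof -
  have "f n x \<in> (\<lambda>y. f n (lin_ext K (map_tree paint) y)) ` carrier (space TCT n)"
  proof (rule tree_hom_range[OF K.cring_axioms pre_operad_tree[OF K.cring_axioms] Q rep_homD(1)[OF f] operad_hom_compose[OF paint_hom rep_homD(1)[OF f]] _ x])
    fix d assume d: "d \<in> carrier VW"
    let ?N = "\<lambda>c. Node (colour_part c d, c) (Leaf 1) (Leaf 2)"
    interpret T: module K "space TCT 2"
      by (rule pre_operad_module[OF pre_operad_tree[OF K.cring_axioms]])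
    have part: "colour_part c d \<in> carrier V" for c
      using d lin_hom_closed[OF colour_part_hom] by (simp add: tensor_s2_simps)
    have N: "single K (?N c) \<in> carrier (space TCT 2)" for c
      by (rule tree_single_closed[OF K.cring_axioms corolla_trees]) (use part in auto)
    let ?y = "single K (?N White) \<oplus>\<^bsub>space TCT 2\<^esub> single K (?N Black)"
    have tp: "tensVW (colour_part c d) (single K c) \<in> carrier VW" for c
      unfolding tensor_s2_simps
        by (rule tens_closed[OF module_V module_com2 part single_colour_closed])
    note fp = operad_homD(1)[OF operad_hom_compose[OF paint_hom rep_homD(1)[OF f]], of 2]
    have "f 2 (lin_ext K (map_tree paint) ?y) =
      f 2 (corolla K (tensVW (colour_part White d) (single K White))) \<oplus>\<^bsub>space Q 2\<^esub> f 2 (corolla K (tensVW (colour_part Black d) (single K Black)))"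
      using lin_hom_add[OF fp N N]
        by (simp add: lin_ext_single[OF K.cring_axioms] corolla_def paint_def)
    also have "\<dots> = f 2 (corolla K d)"
    proof -
      have "tensVW (colour_part White d) (single K White) \<oplus>\<^bsub>VW\<^esub> tensVW (colour_part Black d) (single K Black) = d"
        using tensor_decomp[of d] d unfolding tensor_s2_simps by simp
      then show ?thesis using lin_hom_add[OF rep_homD(2)[OF f] tp[of White] tp[of Black]] by simp
    qed
    finally have "f 2 (corolla K d) = f 2 (lin_ext K (map_tree paint) ?y)" ..
    moreover have "?y \<in> carrier (space TCT 2)" using N by simp
    ultimately show "f 2 (single K (Node d (Leaf 1) (Leaf 2))) \<in>
      (\<lambda>y. f 2 (lin_ext K (map_tree paint) y)) ` carrier (space TCT 2)"
      unfolding corolla_def by (rule image_eqI)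
  qed
  then show ?thesis using that by blast
qed

subsection \<open>The map \<open>\<Phi>\<close>\<close>

text \<open>\<open>\<Phi>\<close> is the arity 3 component of a morphism of operads, from the free
  operad on the tensor product to the Hadamard product of the two free operads;
  \<open>tensor_hom\<close> induces it from the two maps \<open>free_class\<close>.\<close>

lemma white_map_exists:
  obtains \<phi> where "\<phi> \<in> lin_hom K (space (free_operad K VW) 3)
    (tensor K (space (free_operad K V) 3) (space (free_operad K com2K) 3))"
    "\<And>t. t \<in> trees (carrier V \<times> carrier com2K) 3 \<Longrightarrow>
      \<phi> (tree_class K VW 3 (map_tree (\<lambda>(v, w). tensVW v w) t)) =
        tens K (space (free_operad K V) 3) (space (free_operad K com2K) 3) (tree_class K V 3 (map_tree fst t)) (tree_class K com2K 3 (map_tree snd t))"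
proof -
  note PV = pre_operad_free[OF V] and PW = pre_operad_free[OF s2_com2]
  note rV = free_class_rep_hom[OF V] and rW = free_class_rep_hom[OF s2_com2]
  obtain \<phi> where \<phi>: "operad_hom K (free_operad K VW) (hadamard K (free_operad K V) (free_operad K com2K)) \<phi>"
    "\<And>n x. x \<in> carrier (space (tree_operad K (carrier VW)) n) \<Longrightarrow>
      \<phi> n (free_class K VW n x) =
        tensor_hom (free_operad K V) (free_operad K com2K) (free_class K V) (free_class K com2K) n x"
    using free_operad_lift[OF s2_VW pre_operad_hadamard[OF PV PW] tensor_hom_rep_hom[OF PV PW rV rW]] by blast
  show ?thesis
  proof (rule that)
    show "\<phi> 3 \<in> lin_hom K (space (free_operad K VW) 3)
      (tensor K (space (free_operad K V) 3) (space (free_operad K com2K) 3))"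
      using operad_homD(1)[OF \<phi>(1), of 3] unfolding hadamard_space[OF PV PW] .
    fix t assume t: "t \<in> trees (carrier V \<times> carrier com2K) 3"
    have "(\<lambda>(v, w). tensVW v w) d \<in> carrier VW" if "d \<in> carrier V \<times> carrier com2K" for d
      using that tens_closed[OF module_V module_com2] by (auto simp: tensor_s2_simps)
    from tree_single_closed[OF K.cring_axioms trees_map_tree[OF t this]]
    show "\<phi> 3 (tree_class K VW 3 (map_tree (\<lambda>(v, w). tensVW v w) t)) =
        tens K (space (free_operad K V) 3) (space (free_operad K com2K) 3) (tree_class K V 3 (map_tree fst t)) (tree_class K com2K 3 (map_tree snd t))"
      unfolding tree_class_eq[OF V] tree_class_eq[OF s2_com2] tree_class_eq[OF s2_VW]
      using \<phi>(2) tensor_hom_tens_tree[OF PV PW rV rW t] by simp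
  qed
qed

text \<open>\<open>white_map\<close> is a choice that is prescribed only on trees whose inner vertex
  is the first input of the root. It is compared with the map from \<open>white_map_exists\<close>,
  and the remaining trees are reached by the twist.\<close>

lemma white_map_spec:
  shows white_map_hom: "white_map K V com2K \<in> lin_hom K (space (free_operad K VW) 3)
    (tensor K (space (free_operad K V) 3) (space (free_operad K com2K) 3))"
    and white_map_tree: "\<And>t. t \<in> trees (carrier V \<times> carrier com2K) 3 \<Longrightarrow>
      white_map K V com2K (tree_class K VW 3 (map_tree (\<lambda>(v, w). tensVW v w) t)) =
        tens K (space (free_operad K V) 3) (space (free_operad K com2K) 3) (tree_class K V 3 (map_tree fst t)) (tree_class K com2K 3 (map_tree snd t))"
proof -
  obtain \<phi> where \<phi>: "\<phi> \<in> lin_hom K (space (free_operad K VW) 3)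
    (tensor K (space (free_operad K V) 3) (space (free_operad K com2K) 3))"
    and \<phi>t: "\<And>t. t \<in> trees (carrier V \<times> carrier com2K) 3 \<Longrightarrow>
      \<phi> (tree_class K VW 3 (map_tree (\<lambda>(v, w). tensVW v w) t)) =
        tens K (space (free_operad K V) 3) (space (free_operad K com2K) 3) (tree_class K V 3 (map_tree fst t)) (tree_class K com2K 3 (map_tree snd t))"
    using white_map_exists by blast
  define spec where "spec \<psi> \<longleftrightarrow> \<psi> \<in> lin_hom K (space (free_operad K VW) 3)
    (tensor K (space (free_operad K V) 3) (space (free_operad K com2K) 3)) \<and>
      (\<forall>v'\<in>carrier V. \<forall>w'\<in>carrier com2K. \<forall>v\<in>carrier V. \<forall>w\<in>carrier com2K.
       \<forall>i j k. distinct [i, j, k] \<and> {i, j, k} = {1..3} \<longrightarrow>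
        \<psi> (comb K VW (tensVW v' w') (tensVW v w) i j k) =
          tens K (space (free_operad K V) 3) (space (free_operad K com2K) 3) (comb K V v' v i j k) (comb K com2K w' w i j k))" for \<psi>
  have comb: "\<phi> (comb K VW (tensVW v' w') (tensVW v w) i j k) =
      tens K (space (free_operad K V) 3) (space (free_operad K com2K) 3) (comb K V v' v i j k) (comb K com2K w' w i j k)"
    if "v' \<in> carrier V" "w' \<in> carrier com2K" "v \<in> carrier V" "w \<in> carrier com2K"
      "distinct [i, j, k]" "{i, j, k} = {1..3}" for v' w' v w i j k
  proof -
    have "Node (v', w') (Node (v, w) (Leaf i) (Leaf j)) (Leaf k) \<in>
      trees (carrier V \<times> carrier com2K) 3"
      using that by (auto simp: trees_def)
    from \<phi>t[OF this] show ?thesis by (simp add: comb_def)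
  qed
  have "spec \<phi>" unfolding spec_def
  proof (intro conjI ballI allI impI)
    show "\<phi> \<in> lin_hom K (space (free_operad K VW) 3)
      (tensor K (space (free_operad K V) 3) (space (free_operad K com2K) 3))" by (rule \<phi>)
  qed (rule comb, auto)
  moreover have wm: "white_map K V com2K = (SOME \<psi>. spec \<psi>)"
    by (simp add: white_map_def spec_def Let_def)
  ultimately have s: "spec (white_map K V com2K)" using someI[of spec \<phi>] by simp
  then show hom: "white_map K V com2K \<in> lin_hom K (space (free_operad K VW) 3)
    (tensor K (space (free_operad K V) 3) (space (free_operad K com2K) 3))" by (simp add: spec_def)
  fix t assume t: "t \<in> trees (carrier V \<times> carrier com2K) 3"
  have eq: "white_map K V com2K (comb K VW (tensVW v' w') (tensVW v w) i j k) =
    \<phi> (comb K VW (tensVW v' w') (tensVW v w) i j k)"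
    if "v' \<in> carrier V" "w' \<in> carrier com2K" "v \<in> carrier V" "w \<in> carrier com2K"
      "distinct [i, j, k]" "{i, j, k} = {1..3}" for v' w' v w i j k
    using s comb[OF that] that unfolding spec_def by simp
  let ?m = "map_tree (\<lambda>(v, w). tensVW v w)"
  from t have "white_map K V com2K (tree_class K VW 3 (?m t)) = \<phi> (tree_class K VW 3 (?m t))"
  proof (cases rule: trees_3_cases)
    case (left u v i j k)
    then show ?thesis using eq[of "fst u" "snd u" "fst v" "snd v" i j k] by (auto simp: comb_def)
  next
    case (right u v i j k)
    have uv: "fst u \<in> carrier V" "snd u \<in> carrier com2K" "fst v \<in> carrier V" "snd v \<in>
      carrier com2K" using right by auto
    have "(\<lambda>(v, w). tensVW v w) d \<in> carrier VW" if "d \<in> carrier V \<times> carrier com2K" for d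
      using that tens_closed[OF module_V module_com2] by (auto simp: tensor_s2_simps)
    from trees_map_tree[OF t this]
    have "Node (tensVW (fst u) (snd u)) (Leaf k) (Node (tensVW (fst v) (snd v)) (Leaf i) (Leaf j)) \<in> trees (carrier VW) 3"
      by (simp add: right(1) case_prod_beta)
    \<comment> \<open>Exchanging the inputs of the root gives a tree of the prescribed shape; the
      colours are symmetric, so only the \<open>V\<close> part of the root decoration is
      twisted.\<close>
    from free_class_swap[OF s2_VW this]
    have "tree_class K VW 3 (?m t) =
      comb K VW (tensVW (twist V (fst u)) (snd u)) (tensVW (fst v) (snd v)) i j k"
      by (simp add: right(1) comb_def case_prod_beta twist_tens[OF V s2_com2 uv(1,2)] com2_gens_simps(4))
    then show ?thesis
      using eq[of "twist V (fst u)" "snd u" "fst v" "snd v" i j k] uv right s2_moduleD(4)[OF V]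
        by auto
  qed
  then show "white_map K V com2K (tree_class K VW 3 (?m t)) =
    tens K (space (free_operad K V) 3) (space (free_operad K com2K) 3) (tree_class K V 3 (map_tree fst t)) (tree_class K com2K 3 (map_tree snd t))"
    using \<phi>t[OF t] by simp
qed

end

section \<open>Kernel and universal property of the quotient by quadratic relations\<close>

section \<open>Quadratic operads\<close>

context
  fixes K :: "('k, 'm) ring_scheme" and V :: "('k, 'v) s2_rep" and R
  assumes V: "s2_module K V" and R: "R \<subseteq> carrier (space (free_operad K V) 3)"
begin

private lemmas oi = submodule_relation_ideal[OF V R]
private lemmas PF = pre_operad_free[OF V]

definition quad_class :: "nat \<Rightarrow> ('v tree \<Rightarrow> 'k) \<Rightarrow> ('v tree \<Rightarrow> 'k) set set" where
  "quad_class n x = quot_class (free_operad K V) (relation_ideal K V R) n (free_class K V n x)"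

lemma pre_operad_quadratic: "pre_operad K (quadratic_operad K V R)"
  unfolding quadratic_operad_def by (rule pre_operad_quot[OF PF oi])

lemma quot_class_quadratic: "operad_hom K (free_operad K V) (quadratic_operad K V R)
    (quot_class (free_operad K V) (relation_ideal K V R))"
  unfolding quadratic_operad_def by (rule quot_operad_hom[OF PF oi])

lemma quad_class_rep_hom: "rep_hom K V (quadratic_operad K V R) quad_class"
  unfolding quad_class_def[abs_def]
  by (rule rep_hom_compose[OF V free_class_rep_hom[OF V] quot_class_quadratic])

lemma quadratic_carrier:
  "carrier (space (quadratic_operad K V R) n) =
    quad_class n ` carrier (space (tree_operad K (carrier V)) n)"
  unfolding quadratic_operad_def quot_operad_carrier[OF PF oi] free_operad_carrier[OF V]
  by (simp add: image_image quad_class_def)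

lemma free_class_closed:
  "x \<in> carrier (space (tree_operad K (carrier V)) n) \<Longrightarrow> free_class K V n x \<in>
    carrier (space (free_operad K V) n)"
  by (auto simp: free_operad_carrier[OF V])

lemma quad_class_zero_iff:
  "x \<in> carrier (space (tree_operad K (carrier V)) n) \<Longrightarrow>
    quad_class n x = \<zero>\<^bsub>space (quadratic_operad K V R) n\<^esub> \<longleftrightarrow> free_class K V n x \<in>
      relation_ideal K V R n"
  unfolding quadratic_operad_def quad_class_def
  by (rule quot_class_eq_zero_iff[OF PF oi free_class_closed])

lemma generator_eq: "generator K V R v = quad_class 2 (corolla K v)"
  by (simp add: generator_def quad_class_def quot_class_def[OF PF oi] corolla_def tree_class_eq[OF V])

lemma relation_ideal_superset: "R \<subseteq> relation_ideal K V R 3"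
  using gen_ideal_superset[of "\<lambda>n. if n = 3 then R else {}" 3] by (simp add: relation_ideal_def)

lemma S_span_relation_ideal: "S_span K (free_operad K V) 3 R \<subseteq> relation_ideal K V R 3"
  unfolding S_span_def using oi relation_ideal_superset by (auto simp: operad_ideal_def)

lemma S_span_superset: "R \<subseteq> S_span K (free_operad K V) 3 R"
  unfolding S_span_def by auto

text \<open>The quotient is taken in two stages, by the decoration relations and then by
  \<open>R\<close>; \<open>quot_gen_ideal_vimage\<close> lets both be tested on a single ideal of
  the tree operad. The ideal of interest later is \<open>white_ideal\<close>.\<close>

lemma quad_class_kernel:
  assumes J: "operad_ideal K (tree_operad K (carrier V)) J" and dec: "decoration_rel K V \<subseteq> J 2"
    and rel: "\<And>x. x \<in> carrier (space (tree_operad K (carrier V)) 3) \<Longrightarrow> free_class K V 3 x \<in> R \<Longrightarrow> x \<in>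
      J 3"
    and x: "x \<in> carrier (space (tree_operad K (carrier V)) n)" "quad_class n x =
      \<zero>\<^bsub>space (quadratic_operad K V R) n\<^esub>"
  shows "x \<in> J n"
proof (rule quot_gen_ideal_vimage[OF pre_operad_TV[OF V] operad_ideal_decoration[OF V] J _ _ x(1)])
  show "decoration_ideal K V n \<subseteq> J n" for n by (rule decoration_ideal_least[OF V J dec])
  show "(if n = 3 then R else {}) \<subseteq> quot_class (tree_operad K (carrier V)) (decoration_ideal K V) n ` J n" for n
  proof (cases "n = 3")
    case True
    have "r \<in> free_class K V 3 ` J 3" if "r \<in> R" for r
    proof -
      have "r \<in> free_class K V 3 ` carrier (space (tree_operad K (carrier V)) 3)"
        using that R unfolding free_operad_carrier[OF V] by blast
      then show ?thesis using rel that by blast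
    qed
    then show ?thesis using True by (auto simp: free_class_def[OF V])
  qed simp
  show "quot_class (tree_operad K (carrier V)) (decoration_ideal K V) n x
    \<in> gen_ideal K (quot_operad (tree_operad K (carrier V)) (decoration_ideal K V)) (\<lambda>n. if n =
      3 then R else {}) n"
    using quad_class_zero_iff[OF x(1)] x(2)
    by (simp add: relation_ideal_def free_class_def[OF V] free_operad_eq[OF V])
qed

lemma quadratic_lift:
  assumes P: "pre_operad K P" and p: "rep_hom K V P p"
    and rel: "\<And>x. x \<in> carrier (space (tree_operad K (carrier V)) 3) \<Longrightarrow> free_class K V 3 x \<in> R \<Longrightarrow>
      p 3 x = \<zero>\<^bsub>space P 3\<^esub>"
  obtains g where "operad_hom K (quadratic_operad K V R) P g"
    "\<And>n x. x \<in> carrier (space (tree_operad K (carrier V)) n) \<Longrightarrow> g n (quad_class n x) = p n x"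
proof -
  obtain f where f: "operad_hom K (free_operad K V) P f"
    "\<And>n x. x \<in> carrier (space (tree_operad K (carrier V)) n) \<Longrightarrow> f n (free_class K V n x) = p n x"
    using free_operad_lift[OF V P p] by blast
  let ?ker = "\<lambda>n. {x \<in> carrier (space (free_operad K V) n). f n x = \<zero>\<^bsub>space P n\<^esub>}"
  have "r \<in> ?ker 3" if "r \<in> R" for r
  proof -
    have r: "r \<in> carrier (space (free_operad K V) 3)" using that R by blast
    then obtain x where "x \<in> carrier (space (tree_operad K (carrier V)) 3)" "r = free_class K V 3 x"
      unfolding free_operad_carrier[OF V] by blast
    then show ?thesis using f(2) rel that r by simp
  qed
  then have "relation_ideal K V R n \<subseteq> ?ker n" for n
    unfolding relation_ideal_def
    by (intro gen_ideal_least[OF operad_ideal_kernel[OF PF P f(1)]]) auto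
  then have "f n x = \<zero>\<^bsub>space P n\<^esub>" if "x \<in> relation_ideal K V R n" for n x using that by blast
  then obtain g where g: "operad_hom K (quot_operad (free_operad K V) (relation_ideal K V R)) P g"
    "\<And>n x. x \<in> carrier (space (free_operad K V) n) \<Longrightarrow>
      g n (quot_class (free_operad K V) (relation_ideal K V R) n x) = f n x"
    using quot_operad_lift[OF PF oi P f(1)] by blast
  have "g n (quad_class n x) = p n x" if "x \<in> carrier (space (tree_operad K (carrier V)) n)" for n x
    unfolding quad_class_def using g(2)[OF free_class_closed[OF that]] f(2)[OF that] by simp
  with g(1) show ?thesis using that unfolding quadratic_operad_def by blast
qed

end

section \<open>Normal forms and linear independence for trees with two colours\<close>

section \<open>The operad of two totally compatible products\<close>

subsection \<open>Shapes of coloured trees\<close>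

abbreviation single_tree :: "('k, 'm) ring_scheme \<Rightarrow> colour tree \<Rightarrow> (colour \<Rightarrow> 'k) tree" where
  "single_tree K \<equiv> map_tree (single K)"

primrec blacks :: "colour tree \<Rightarrow> nat" where
  "blacks (Leaf i) = 0"
| "blacks (Node c l r) = (if c = Black then 1 else 0) + blacks l + blacks r"

lemma atLeastAtMost_3: "{1..3 :: nat} = {1, 2, 3}"
  by auto

lemma disjoint_leaves_3:
  "set (leaves x) \<inter> set (leaves y) = {} \<Longrightarrow> set (leaves x) \<inter> set (leaves z) = {} \<Longrightarrow>
    set (leaves y) \<inter> set (leaves z) = {} \<Longrightarrow> disjoint_leaves [x, y, z]"
  by (auto simp: disjoint_leaves_def less_Suc_eq numeral_3_eq_3)

lemma leaves_not_Nil [simp]: "leaves t \<noteq> []"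
  by (induction t) auto

lemma blacks_less: "blacks s < length (leaves s)"
  by (induction s) auto

lemma blacks_relabel [simp]: "blacks (relabel h s) = blacks s"
  by (induction s) auto

lemma map_tree_plug:
  assumes "\<And>i. i \<in> set (leaves t) \<Longrightarrow> 1 \<le> i \<and> i \<le> length ts"
  shows "map_tree f (plug t ts) = plug (map_tree f t) (map (map_tree f) ts)"
  using assms
proof (induction t)
  case (Leaf i)
  have "i - 1 < length ts" using Leaf[of i] by auto
  then show ?case by simp
qed auto

text \<open>Distinct labels make the arity of a branch a function of its leaf set, so the arities
  and the permutation in \<open>tree_val_Node\<close> are the same on both sides.\<close>

lemma tree_val_Node_cong:
  assumes K: "cring K" and f: "operad_hom K (tree_operad K D) Q f"
    and t: "Node v l r \<in> ltrees D" "Node v l' r' \<in> ltrees D"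
    and eq: "set (leaves l') = set (leaves l)" "set (leaves r') = set (leaves r)"
      "tree_val K f l' = tree_val K f l" "tree_val K f r' = tree_val K f r"
  shows "tree_val K f (Node v l' r') = tree_val K f (Node v l r)"
proof -
  have len: "length (leaves s') = length (leaves s)"
    if "set (leaves s') = set (leaves s)" "s \<in> ltrees D" "s' \<in> ltrees D" for s s'
    using that distinct_card[of "leaves s"] distinct_card[of "leaves s'"] by (simp add: ltrees_def)
  have "length (leaves l') = length (leaves l)"
    by (rule len[OF eq(1)]) (use t in \<open>simp_all add: ltrees_Node\<close>)
  moreover have "length (leaves r') = length (leaves r)"
    by (rule len[OF eq(2)]) (use t in \<open>simp_all add: ltrees_Node\<close>)
  ultimately show ?thesis using eq
    by (simp add: tree_val_Node[OF K f t(1)] tree_val_Node[OF K f t(2)])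
qed

text \<open>The normal form of coloured trees modulo the relations: swaps push all black vertices to the root.\<close>

fun right_comb :: "nat \<Rightarrow> nat list \<Rightarrow> colour tree" where
  "right_comb k [] = Leaf 0"
| "right_comb k [a] = Leaf a"
| "right_comb k (a # b # xs) = Node (if k =
  0 then White else Black) (Leaf a) (right_comb (k - 1) (b # xs))"

lemma leaves_right_comb: "xs \<noteq> [] \<Longrightarrow> leaves (right_comb k xs) = xs"
  by (induction k xs rule: right_comb.induct) auto

lemma blacks_right_comb: "k < length xs \<Longrightarrow> blacks (right_comb k xs) = k"
  by (induction k xs rule: right_comb.induct) (auto simp: less_Suc_eq_0_disj)

lemma ltrees_UNIV: "s \<in> ltrees UNIV \<longleftrightarrow> distinct (leaves s)"
  by (simp add: ltrees_def)

context
  fixes K :: "('k, 'm) ring_scheme"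
  assumes field: "field K"
begin

interpretation K: field K by (rule field)

lemma col_ltrees: "s \<in> ltrees UNIV \<Longrightarrow> single_tree K s \<in> ltrees (carrier (com2_gens K))"
  using com2_single_closed[OF K.cring_axioms] by (auto simp: ltrees_def)

lemma col_trees: "s \<in> trees UNIV n \<Longrightarrow> single_tree K s \<in> trees (carrier (com2_gens K)) n"
  using com2_single_closed[OF K.cring_axioms] by (auto simp: trees_def)

context
  fixes Q :: "('k, 'b) operad" and q
  assumes Q: "pre_operad K Q" and q: "rep_hom K (com2_gens K) Q q"
begin

private abbreviation (input) "val s \<equiv> tree_val K q (single_tree K s)"

lemma val_swap: "Node c l r \<in> ltrees UNIV \<Longrightarrow> val (Node c l r) = val (Node c r l)"
  using rep_hom_swap[OF s2_module_com2[OF K.cring_axioms] q, of "single K c" "single_tree K l"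
    "single_tree K r"] col_ltrees[of "Node c l r"]
  by (simp add: com2_gens_simps(4))

lemma val_Node_cong:
  assumes "Node c l r \<in> ltrees UNIV" "Node c l' r' \<in> ltrees UNIV"
    and "set (leaves l') = set (leaves l)" "set (leaves r') = set (leaves r)"
    and "val l' = val l" "val r' = val r"
  shows "val (Node c l' r') = val (Node c l r)"
  using tree_val_Node_cong[OF K.cring_axioms rep_homD(1)[OF q], of "single K c" "single_tree K l"
    "single_tree K r" "single_tree K l'" "single_tree K r'"]
    col_ltrees[OF assms(1)] col_ltrees[OF assms(2)] assms(3-6) by simp

context
  assumes rel3: "\<And>s s'. s \<in> trees UNIV 3 \<Longrightarrow> s' \<in> trees UNIV 3 \<Longrightarrow> blacks s = blacks s' \<Longrightarrow>
    q 3 (single K (single_tree K s)) = q 3 (single K (single_tree K s'))"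
begin

text \<open>By \<open>tree_val_plug\<close> the two plugged trees have the same permutation and the
  same inputs; only the factor with three leaves differs, and \<open>rel3\<close> handles
  it.\<close>

lemma val_plug_cong:
  assumes s: "s \<in> trees UNIV 3" "s' \<in> trees UNIV 3" "blacks s = blacks s'"
    and ts: "length ts = 3" "set ts \<subseteq> ltrees UNIV" "disjoint_leaves ts"
  shows "val (plug s ts) = val (plug s' ts)"
proof -
  have d: "disjoint_leaves (map (single_tree K) ts)" using ts(3) by (auto simp: disjoint_leaves_def)
  have l: "set (map (single_tree K) ts) \<subseteq> ltrees (carrier (com2_gens K))" using ts(2) col_ltrees
    by auto
  have *: "val (plug s ts) = tree_val K q (plug (single_tree K s) (map (single_tree K) ts))"
    "single_tree K s \<in> trees (carrier (com2_gens K)) (length (map (single_tree K) ts))" if "s \<in>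
      trees UNIV 3" for s
    using map_tree_plug[of s ts "single K"] treesD(3)[OF that] ts(1) col_trees[OF that] by auto
  show ?thesis
    unfolding *(1)[OF s(1)] *(1)[OF s(2)]
    using tree_val_plug[OF K.cring_axioms rep_homD(1)[OF q] *(2)[OF s(1)] l d]
      tree_val_plug[OF K.cring_axioms rep_homD(1)[OF q] *(2)[OF s(2)] l d] rel3[OF s] ts(1) by simp
qed

text \<open>\<open>rel3\<close> sees only the number of black vertices, so a reassociation may
  exchange the two colours as well. This version keeps \<open>d\<close> attached to
  \<open>x\<close>, so that a leaf in front of a branch surfaces together with its vertex.\<close>

lemma val_rotate:
  assumes "Node c (Node d x y) z \<in> ltrees UNIV"
  shows "val (Node c (Node d x y) z) = val (Node d x (Node c y z))"
proof -
  let ?s = "Node c (Node d (Leaf 1) (Leaf 2)) (Leaf 3)" and ?s' =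
    "Node d (Leaf 1) (Node c (Leaf 2) (Leaf 3))"
  have "?s \<in> trees UNIV 3" "?s' \<in> trees UNIV 3" "blacks ?s = blacks ?s'"
    unfolding trees_def atLeastAtMost_3 by auto
  moreover have "set [x, y, z] \<subseteq> ltrees UNIV" using assms by (simp add: ltrees_Node)
  moreover have "disjoint_leaves [x, y, z]" using assms
    by (intro disjoint_leaves_3) (auto simp: ltrees_Node)
  ultimately have "val (plug ?s [x, y, z]) = val (plug ?s' [x, y, z])" by (intro val_plug_cong) auto
  then show ?thesis by simp
qed

lemma val_exchange:
  assumes "Node c x (Node d y z) \<in> ltrees UNIV"
  shows "val (Node c x (Node d y z)) = val (Node d x (Node c y z))"
proof -
  let ?s = "Node c (Leaf 1) (Node d (Leaf 2) (Leaf 3))" and ?s' =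
    "Node d (Leaf 1) (Node c (Leaf 2) (Leaf 3))"
  have "?s \<in> trees UNIV 3" "?s' \<in> trees UNIV 3" "blacks ?s = blacks ?s'"
    unfolding trees_def atLeastAtMost_3 by auto
  moreover have "set [x, y, z] \<subseteq> ltrees UNIV" using assms by (simp add: ltrees_Node)
  moreover have "disjoint_leaves [x, y, z]" using assms
    by (intro disjoint_leaves_3) (auto simp: ltrees_Node)
  ultimately have "val (plug ?s [x, y, z]) = val (plug ?s' [x, y, z])" by (intro val_plug_cong) auto
  then show ?thesis by simp
qed

text \<open>Rotations lift a leaf along its path to the root, and symmetry of the vertices lets each
  step assume that the path turns left.\<close>

lemma val_front:
  assumes "s \<in> ltrees UNIV" "a \<in> set (leaves s)" "s \<noteq> Leaf a"
  shows "\<exists>c u. Node c (Leaf a) u \<in> ltrees UNIV \<and> set (leaves (Node c (Leaf a) u)) = set (leaves s) \<and>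
    blacks (Node c (Leaf a) u) = blacks s \<and> val (Node c (Leaf a) u) = val s"
  using assms
proof (induction s)
  case (Node c l r)
  \<comment> \<open>Stated for arbitrary branches, so that a leaf in the right branch is covered
    after one \<open>val_swap\<close>.\<close>
  have *: "\<exists>c' u. Node c' (Leaf a) u \<in> ltrees UNIV \<and> set (leaves (Node c' (Leaf a) u)) =
    set (leaves (Node c l r)) \<and>
    blacks (Node c' (Leaf a) u) = blacks (Node c l r) \<and> val (Node c' (Leaf a) u) = val (Node c l r)"
    if N: "Node c l r \<in> ltrees UNIV" and a: "a \<in> set (leaves l)"
      and IH: "l \<in> ltrees UNIV \<Longrightarrow> a \<in> set (leaves l) \<Longrightarrow> l \<noteq> Leaf a \<Longrightarrow>
        \<exists>c u. Node c (Leaf a) u \<in> ltrees UNIV \<and> set (leaves (Node c (Leaf a) u)) = set (leaves l) \<and>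
        blacks (Node c (Leaf a) u) = blacks l \<and> val (Node c (Leaf a) u) = val l" for l r
  proof (cases "l = Leaf a")
    case True
    then show ?thesis using N by (intro exI[of _ c] exI[of _ r]) simp
  next
    case False
    obtain d u where u: "Node d (Leaf a) u \<in> ltrees UNIV" "set (leaves (Node d (Leaf a) u)) =
      set (leaves l)"
      "blacks (Node d (Leaf a) u) = blacks l" "val (Node d (Leaf a) u) = val l"
      using IH[OF _ a False] N by (auto simp: ltrees_Node)
    have N': "Node c (Node d (Leaf a) u) r \<in> ltrees UNIV"
      using N u(1) unfolding ltrees_Node[of c] u(2) by blast
    have "val (Node d (Leaf a) (Node c u r)) = val (Node c (Node d (Leaf a) u) r)"
      using val_rotate[OF N'] ..
    also have "\<dots> = val (Node c l r)" by (rule val_Node_cong[OF N N' u(2) refl u(4) refl])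
    finally show ?thesis
      using N' u(2,3) by (intro exI[of _ d] exI[of _ "Node c u r"]) (auto simp: ltrees_Node)
  qed
  from Node.prems(2) consider "a \<in> set (leaves l)" | "a \<in> set (leaves r)" by auto
  then show ?case
  proof cases
    case 1
    then show ?thesis using *[OF Node.prems(1) 1 Node.IH(1)] by blast
  next
    case 2
    have N: "Node c r l \<in> ltrees UNIV" using Node.prems(1) by (auto simp: ltrees_Node)
    have eq: "set (leaves (Node c r l)) = set (leaves (Node c l r))" "blacks (Node c r l) =
      blacks (Node c l r)"
      by auto
    show ?thesis using *[OF N 2 Node.IH(2)] unfolding eq val_swap[OF N] .
  qed
qed auto

text \<open>Pull the first label to the root and normalise the other branch by induction. If the
  root is white above a black vertex, exchange the two colours and normalise once more; the label
  list of the branch is unchanged, so the induction on the list still applies. The order of the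
  labels is free, which lets two trees be compared through one list.\<close>

lemma val_right_comb:
  assumes "s \<in> ltrees UNIV" "distinct xs" "set xs = set (leaves s)"
  shows "val s = val (right_comb (blacks s) xs)"
  using assms
proof (induction xs arbitrary: s)
  case Nil
  then show ?case by (cases s) auto
next
  case (Cons a xs)
  show ?case
  proof (cases "s = Leaf a")
    case True
    then have "xs = []" using Cons.prems by (cases xs) auto
    then show ?thesis using True by simp
  next
    case False
    obtain c u where u: "Node c (Leaf a) u \<in> ltrees UNIV" "set (leaves (Node c (Leaf a) u)) =
      set (leaves s)"
      "blacks (Node c (Leaf a) u) = blacks s" "val (Node c (Leaf a) u) = val s"
      using val_front[OF Cons.prems(1) _ False] Cons.prems(3) by auto
    have ul: "u \<in> ltrees UNIV" "a \<notin> set (leaves u)" using u(1) by (auto simp: ltrees_Node)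
    have xs: "distinct xs" "set xs = set (leaves u)" "a \<notin> set xs"
      using Cons.prems(2,3) u(2) ul(2) by auto
    obtain b ys where ys: "xs = b # ys" using xs(2) by (cases xs; cases u) auto
    have len: "length xs = length (leaves u)"
      using xs(1,2) ul(1) distinct_card[of xs] distinct_card[of "leaves u"]
        by (simp add: ltrees_UNIV)
    let ?R = "\<lambda>k. right_comb k xs"
    have R: "leaves (?R k) = xs" for k using ys by (intro leaves_right_comb) auto
    have NR: "Node e (Leaf a) (?R k) \<in> ltrees UNIV" for e k
      using xs by (simp add: ltrees_UNIV R)
    have val_u: "val (Node c (Leaf a) u) = val (Node c (Leaf a) (?R (blacks u)))"
      by (rule val_Node_cong[OF NR u(1)]) (use Cons.IH[OF ul(1) xs(1,2)] xs(2) R in auto)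
    show ?thesis
    proof (cases "c = Black \<or> blacks u = 0")
      case True
      then have "right_comb (blacks s) (a # xs) = Node c (Leaf a) (?R (blacks u))"
        using u(3)[symmetric] ys by (cases c) auto
      then show ?thesis using u(4) val_u by simp
    next
      case False
      \<comment> \<open>The branch \<open>u\<close> contains a black vertex, hence has at least two
        leaves, and its comb begins with a black vertex that can trade its colour with the white
        root.\<close>
      then have c: "c = White" and k: "blacks u > 0" by (cases c; auto)+
      then have "length xs > 1" using blacks_less[of u] len by linarith
      then obtain b' zs where zs: "xs = b # b' # zs" using ys by (cases ys) auto
      define T where "T = right_comb (blacks u - 1) (b' # zs)"
      have T: "leaves T = b' # zs" "blacks T = blacks u - 1"
        unfolding T_def using blacks_less[of u] len zs
          by (auto simp: leaves_right_comb blacks_right_comb)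
      have Ru: "?R (blacks u) = Node Black (Leaf b) T" using zs k by (simp add: T_def)
      have N1: "Node White (Leaf a) (Node Black (Leaf b) T) \<in> ltrees UNIV"
        using NR[of White "blacks u"] Ru by simp
      have WT: "Node White (Leaf b) T \<in> ltrees UNIV" "set xs = set (leaves (Node White (Leaf b) T))"
        "blacks (Node White (Leaf b) T) = blacks u - 1"
        using N1 T zs by (auto simp: ltrees_Node)
      have "val s = val (Node White (Leaf a) (Node Black (Leaf b) T))" using u(4) val_u c Ru by simp
      also have "\<dots> = val (Node Black (Leaf a) (Node White (Leaf b) T))"
        by (rule val_exchange[OF N1])
      also have "\<dots> = val (Node Black (Leaf a) (?R (blacks u - 1)))"
      proof (rule val_Node_cong[OF NR])
        show "Node Black (Leaf a) (Node White (Leaf b) T) \<in> ltrees UNIV" using N1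
          by (auto simp: ltrees_Node)
        show "val (Node White (Leaf b) T) = val (?R (blacks u - 1))"
          using Cons.IH[OF WT(1) xs(1) WT(2)] WT(3) by simp
      qed (use WT(2) R in auto)
      also have "Node Black (Leaf a) (?R (blacks u - 1)) = right_comb (blacks s) (a # xs)"
        using u(3) c k zs by simp
      finally show ?thesis .
    qed
  qed
qed

lemma val_cong:
  assumes "s \<in> trees UNIV n" "s' \<in> trees UNIV n" "blacks s = blacks s'"
  shows "q n (single K (single_tree K s)) = q n (single K (single_tree K s'))"
proof -
  have "distinct (leaves s)" "set (leaves s) = set (leaves s')"
    using treesD[OF assms(1)] treesD[OF assms(2)] by auto
  then have "val s = val s'"
    using val_right_comb[OF trees_ltrees[OF assms(1)], of "leaves s"]
      val_right_comb[OF trees_ltrees[OF assms(2)], of "leaves s"] assms(3) by simp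
  then show ?thesis
    by (simp add: tree_val_trees[OF col_trees[OF assms(1)]] tree_val_trees[OF col_trees[OF assms(2)]])
qed

end

end

subsection \<open>The relations of two totally compatible products\<close>

lemma com2_treesE:
  assumes "x \<in> com2_trees K c d"
  obtains s where "s \<in> trees UNIV 3" "x = tree_class K (com2_gens K) 3 (single_tree K s)"
    "blacks s = (if c = Black then 1 else 0) + (if d = Black then 1 else 0)"
proof -
  obtain i j k where ijk: "(i, j, k) \<in> {(1, 2, 3), (2, 3, 1), (3, 1, 2 :: nat)}"
    "x = comb K (com2_gens K) (single K c) (single K d) i j k"
    using assms unfolding com2_trees_def by auto
  let ?s = "Node c (Node d (Leaf i) (Leaf j)) (Leaf k)"
  have "?s \<in> trees UNIV 3" unfolding trees_def atLeastAtMost_3 using ijk(1) by auto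
  then show ?thesis by (rule that) (simp_all add: ijk(2) comb_def)
qed

text \<open>Symmetry of the inner generator yields the odd arrangements of the leaves from the three
  cyclic ones listed in \<open>com2_trees\<close>.\<close>

lemma comb_flip:
  assumes "distinct [i, j, k]" "{i, j, k} = {1..3}"
  shows "comb K (com2_gens K) (single K c) (single K d) i j k =
    comb K (com2_gens K) (single K c) (single K d) j i k"
proof -
  let ?s = "\<lambda>i j. Node c (Node d (Leaf i) (Leaf j)) (Leaf k)"
  have s: "?s i j \<in> trees UNIV 3" "?s j i \<in> trees UNIV 3"
    unfolding trees_def using assms by (auto simp: insert_commute)
  note r = free_class_rep_hom[OF s2_module_com2[OF K.cring_axioms]] and P =
    pre_operad_free[OF s2_module_com2[OF K.cring_axioms]]
  have d: "Node d (Leaf i) (Leaf j) \<in> ltrees UNIV" using assms(1) by (simp add: ltrees_UNIV)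
  have "tree_val K (free_class K (com2_gens K)) (single_tree K (?s j i)) =
    tree_val K (free_class K (com2_gens K)) (single_tree K (?s i j))"
    by (rule val_Node_cong[OF P r trees_ltrees[OF s(1)] trees_ltrees[OF s(2)] _ refl _ refl])
      (use val_swap[OF P r d] in auto)
  then show ?thesis
    unfolding tree_val_trees[OF col_trees[OF s(1)]] tree_val_trees[OF col_trees[OF s(2)]]
    by (simp add: comb_def tree_class_eq[OF s2_module_com2[OF K.cring_axioms]])
qed

lemma tree_class_com2_trees:
  assumes "s \<in> trees UNIV 3"
  shows "\<exists>c d. tree_class K (com2_gens K) 3 (single_tree K s) \<in> com2_trees K c d \<and>
    blacks s = (if c = Black then 1 else 0) + (if d = Black then 1 else 0)"
proof -
  have comb: "comb K (com2_gens K) (single K c) (single K d) i j k \<in> com2_trees K c d"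
    if ijk: "distinct [i, j, k]" "{i, j, k} = {1..3}" for c d i j k
  proof -
    have "i \<in> {1, 2, 3}" "j \<in> {1, 2, 3}" "k \<in> {1, 2, 3}" using ijk(2) unfolding atLeastAtMost_3
      by blast+
    then have "(i, j, k) \<in> {(1, 2, 3), (2, 3, 1), (3, 1, 2)} \<or> (j, i, k) \<in> {(1, 2, 3), (2, 3, 1),
      (3, 1, 2)}"
      using ijk(1) by auto
    then show ?thesis
    proof
      assume "(i, j, k) \<in> {(1, 2, 3), (2, 3, 1), (3, 1, 2)}"
      then show ?thesis unfolding com2_trees_def by (rule image_eqI[rotated]) simp
    next
      assume "(j, i, k) \<in> {(1, 2, 3), (2, 3, 1), (3, 1, 2)}"
      then show ?thesis unfolding com2_trees_def comb_flip[OF ijk] by (rule image_eqI[rotated]) simp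
    qed
  qed
  from assms show ?thesis
  proof (cases rule: trees_3_cases)
    case (left u v i j k)
    then show ?thesis using comb[of i j k u v]
      by (intro exI[of _ u] exI[of _ v]) (simp add: comb_def)
  next
    case (right u v i j k)
    have "Node (single K u) (Leaf k) (Node (single K v) (Leaf i) (Leaf j)) \<in>
      trees (carrier (com2_gens K)) 3"
      using col_trees[OF assms] right(1) by simp
    from free_class_swap[OF s2_module_com2[OF K.cring_axioms] this] show ?thesis
      using right comb[of i j k u v]
        by (intro exI[of _ u] exI[of _ v]) (simp add: comb_def com2_gens_simps(4))
  qed
qed

text \<open>The three families of relations belong to 0, 2 and 1 black vertices. Up to the symmetry
  of the generators, every tree with three leaves occurs in the family of its count.\<close>

lemma com2_rels_mem:
  assumes "s \<in> trees UNIV 3" "s' \<in> trees UNIV 3" "blacks s = blacks s'"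
  shows "tree_class K (com2_gens K) 3 (single_tree K s) \<ominus>\<^bsub>space (free_operad K (com2_gens K)) 3\<^esub> tree_class K (com2_gens K) 3 (single_tree K s') \<in> com2_rels K"
proof -
  obtain c d where c: "tree_class K (com2_gens K) 3 (single_tree K s) \<in> com2_trees K c d"
    "blacks s = (if c = Black then 1 else 0) + (if d = Black then 1 else 0)"
    using tree_class_com2_trees[OF assms(1)] by blast
  obtain c' d' where c': "tree_class K (com2_gens K) 3 (single_tree K s') \<in> com2_trees K c' d'"
    "blacks s' = (if c' = Black then 1 else 0) + (if d' = Black then 1 else 0)"
    using tree_class_com2_trees[OF assms(2)] by blast
  show ?thesis
    unfolding com2_rels_def
    using c c' assms(3) by (cases c; cases d; cases c'; cases d') auto
qed

lemma com2_relsE: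
  assumes "r \<in> com2_rels K"
  obtains s s' where "s \<in> trees UNIV 3" "s' \<in> trees UNIV 3" "blacks s = blacks s'"
    "r = tree_class K (com2_gens K) 3 (single_tree K s) \<ominus>\<^bsub>space (free_operad K (com2_gens K)) 3\<^esub> tree_class K (com2_gens K) 3 (single_tree K s')"
proof -
  obtain x y c d c' d' where xy: "r = x \<ominus>\<^bsub>space (free_operad K (com2_gens K)) 3\<^esub> y"
    "x \<in> com2_trees K c d" "y \<in> com2_trees K c' d'"
    "(if c = Black then 1 else 0) + (if d = Black then 1 else 0) =
      (if c' = Black then 1 else 0) + (if d' = Black then 1 else 0 :: nat)"
  proof -
    obtain x y where xy: "r = x \<ominus>\<^bsub>space (free_operad K (com2_gens K)) 3\<^esub> y" and
      cases: "x \<in> com2_trees K White White \<and> y \<in> com2_trees K White White \<or>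
        x \<in> com2_trees K Black Black \<and> y \<in> com2_trees K Black Black \<or>
        x \<in> com2_trees K Black White \<union> com2_trees K White Black \<and>
        y \<in> com2_trees K Black White \<union> com2_trees K White Black"
      using assms unfolding com2_rels_def by blast
    from cases show ?thesis
      by (elim disjE conjE UnE) (use that[OF xy] in fastforce)+
  qed
  obtain s where "s \<in> trees UNIV 3" "x = tree_class K (com2_gens K) 3 (single_tree K s)"
    "blacks s = (if c = Black then 1 else 0) + (if d = Black then 1 else 0)"
    using com2_treesE[OF xy(2)] .
  moreover obtain s' where "s' \<in> trees UNIV 3" "y = tree_class K (com2_gens K) 3 (single_tree K s')"
    "blacks s' = (if c' = Black then 1 else 0) + (if d' = Black then 1 else 0)"
    using com2_treesE[OF xy(3)] .
  ultimately show ?thesis using that xy(1,4) by simp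
qed

lemma com2_rels_carrier: "com2_rels K \<subseteq> carrier (space (free_operad K (com2_gens K)) 3)"
proof
  fix r assume "r \<in> com2_rels K"
  then obtain s s' where s: "s \<in> trees UNIV 3" "s' \<in> trees UNIV 3" "blacks s = blacks s'"
    "r = tree_class K (com2_gens K) 3 (single_tree K s) \<ominus>\<^bsub>space (free_operad K (com2_gens K)) 3\<^esub> tree_class K (com2_gens K) 3 (single_tree K s')"
    by (rule com2_relsE)
  interpret F: module K "space (free_operad K (com2_gens K)) 3"
    by (rule pre_operad_module[OF pre_operad_free[OF s2_module_com2[OF K.cring_axioms]]])
  have "tree_class K (com2_gens K) 3 (single_tree K s) \<in>
    carrier (space (free_operad K (com2_gens K)) 3)" if "s \<in> trees UNIV 3" for s
    unfolding tree_class_eq[OF s2_module_com2[OF K.cring_axioms]] free_operad_carrier[OF s2_module_com2[OF K.cring_axioms]] using tree_single_closed[OF K.cring_axioms col_trees[OF that]] by blast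
  then show "r \<in> carrier (space (free_operad K (com2_gens K)) 3)" using s by simp
qed

lemma com2_lift:
  assumes P: "pre_operad K P" and p: "rep_hom K (com2_gens K) P p"
    and rel: "\<And>s s'. s \<in> trees UNIV 3 \<Longrightarrow> s' \<in> trees UNIV 3 \<Longrightarrow> blacks s = blacks s' \<Longrightarrow>
      p 3 (single K (single_tree K s)) = p 3 (single K (single_tree K s'))"
  obtains g where "operad_hom K (com2 K) P g"
    "\<And>n x. x \<in> carrier (space (tree_operad K (carrier (com2_gens K))) n) \<Longrightarrow>
      g n (quad_class K (com2_gens K) (com2_rels K) n x) = p n x"
proof -
  have "p 3 x = \<zero>\<^bsub>space P 3\<^esub>"
    if x: "x \<in> carrier (space (tree_operad K (carrier (com2_gens K))) 3)"
      "free_class K (com2_gens K) 3 x \<in> com2_rels K" for x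
  proof -
    interpret T: module K "space (tree_operad K (carrier (com2_gens K))) 3"
      by (rule pre_operad_module[OF pre_operad_tree[OF K.cring_axioms]])
    interpret P: module K "space P 3" by (rule pre_operad_module[OF P])
    obtain f where f: "operad_hom K (free_operad K (com2_gens K)) P f"
      "\<And>n x. x \<in> carrier (space (tree_operad K (carrier (com2_gens K))) n) \<Longrightarrow>
        f n (free_class K (com2_gens K) n x) = p n x"
      using free_operad_lift[OF s2_module_com2[OF K.cring_axioms] P p] by blast
    obtain s s' where s: "s \<in> trees UNIV 3" "s' \<in> trees UNIV 3" "blacks s = blacks s'"
      "free_class K (com2_gens K) 3 x =
        tree_class K (com2_gens K) 3 (single_tree K s) \<ominus>\<^bsub>space (free_operad K (com2_gens K)) 3\<^esub> tree_class K (com2_gens K) 3 (single_tree K s')"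
      using com2_relsE[OF x(2)] .
    note ts = tree_single_closed[OF K.cring_axioms col_trees[OF s(1)]] tree_single_closed[OF K.cring_axioms col_trees[OF s(2)]]
    note h = operad_homD(1)[OF free_class_hom[OF s2_module_com2[OF K.cring_axioms]], of 3]
    have "p 3 x = f 3 (free_class K (com2_gens K) 3 x)" using f(2)[OF x(1)] by simp
    also have "\<dots> = f 3 (free_class K (com2_gens K) 3 (single K (single_tree K s) \<ominus>\<^bsub>space (tree_operad K (carrier (com2_gens K))) 3\<^esub> single K (single_tree K s')))"
      unfolding s(4) tree_class_eq[OF s2_module_com2[OF K.cring_axioms]]
      using lin_hom_diff[OF T.module_axioms pre_operad_module[OF pre_operad_free[OF s2_module_com2[OF K.cring_axioms]]] h ts] by simp
    also have "\<dots> = p 3 (single K (single_tree K s) \<ominus>\<^bsub>space (tree_operad K (carrier (com2_gens K))) 3\<^esub> single K (single_tree K s'))"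
      using ts by (intro f(2)) auto
    also have "\<dots> = p 3 (single K (single_tree K s)) \<ominus>\<^bsub>space P 3\<^esub> p 3 (single K (single_tree K s'))"
      using lin_hom_diff[OF T.module_axioms P.module_axioms operad_homD(1)[OF rep_homD(1)[OF p]] ts] .
    also have "\<dots> = \<zero>\<^bsub>space P 3\<^esub>"
      using rel[OF s(1-3)] P.diff_zero_iff lin_hom_closed[OF operad_homD(1)[OF rep_homD(1)[OF p]]] ts by simp
    finally show ?thesis .
  qed
  then show ?thesis
    using quadratic_lift[OF s2_module_com2[OF K.cring_axioms] com2_rels_carrier P p] that
      unfolding com2_def by blast
qed

text \<open>The defining relations give the case of arity 3, and \<open>val_cong\<close> spreads it
  to all arities.\<close>

lemma com2_class_cong:
  assumes "s \<in> trees UNIV n" "s' \<in> trees UNIV n" "blacks s = blacks s'"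
  shows "quad_class K (com2_gens K) (com2_rels K) n (single K (single_tree K s)) =
    quad_class K (com2_gens K) (com2_rels K) n (single K (single_tree K s'))"
proof (rule val_cong[OF pre_operad_quadratic[OF s2_module_com2[OF K.cring_axioms] com2_rels_carrier] quad_class_rep_hom[OF s2_module_com2[OF K.cring_axioms] com2_rels_carrier] _ assms])
  fix s s' assume s: "s \<in> trees UNIV 3" "s' \<in> trees UNIV 3" "blacks s = blacks s'"
  let ?F = "space (free_operad K (com2_gens K)) 3" and ?C =
    "space (quadratic_operad K (com2_gens K) (com2_rels K)) 3"
  interpret F: module K ?F
    by (rule pre_operad_module[OF pre_operad_free[OF s2_module_com2[OF K.cring_axioms]]])
  interpret C: module K ?C
    by (rule pre_operad_module[OF pre_operad_quadratic[OF s2_module_com2[OF K.cring_axioms] com2_rels_carrier]])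
  note oi = submodule_relation_ideal[OF s2_module_com2[OF K.cring_axioms] com2_rels_carrier] and PF = pre_operad_free[OF s2_module_com2[OF K.cring_axioms]]
  have cl: "tree_class K (com2_gens K) 3 (single_tree K s) \<in> carrier ?F" if "s \<in> trees UNIV 3" for s
    unfolding tree_class_eq[OF s2_module_com2[OF K.cring_axioms]] free_operad_carrier[OF s2_module_com2[OF K.cring_axioms]] using tree_single_closed[OF K.cring_axioms col_trees[OF that]] by blast
  have "tree_class K (com2_gens K) 3 (single_tree K s) \<ominus>\<^bsub>?F\<^esub> tree_class K (com2_gens K) 3 (single_tree K s') \<in> relation_ideal K (com2_gens K) (com2_rels K) 3"
    using com2_rels_mem[OF s] relation_ideal_superset[OF s2_module_com2[OF K.cring_axioms] com2_rels_carrier] by blast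
  then show "quad_class K (com2_gens K) (com2_rels K) 3 (single K (single_tree K s)) =
    quad_class K (com2_gens K) (com2_rels K) 3 (single K (single_tree K s'))"
    unfolding quad_class_def[OF s2_module_com2[OF K.cring_axioms] com2_rels_carrier]
    using quot_class_eq_iff[OF PF oi cl[OF s(1)] cl[OF s(2)]]
      by (simp add: tree_class_eq[OF s2_module_com2[OF K.cring_axioms]])
qed

end

subsection \<open>Counting black vertices by polynomials\<close>

text \<open>The record of \<open>UP K\<close> carries further fields beyond those of a module; this
  copy has the plain record type that \<open>space\<close> demands.\<close>

definition poly_module :: "('k, 'm) ring_scheme \<Rightarrow> ('k, nat \<Rightarrow> 'k) module" where
  "poly_module K = \<lparr>carrier = carrier (UP K), monoid.mult = monoid.mult (UP K), one = \<one>\<^bsub>UP K\<^esub>,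
    zero = \<zero>\<^bsub>UP K\<^esub>, add = ring.add (UP K), smult = module.smult (UP K)\<rparr>"

text \<open>A commutative algebra becomes an operad with itself in every arity, trivial actions, and
  multiplication as composition. Grafting adds numbers of black vertices, so sending a tree to the
  monomial of its count is compatible with composition.\<close>

definition poly_operad :: "('k, 'm) ring_scheme \<Rightarrow> ('k, nat \<Rightarrow> 'k) operad" where
  "poly_operad K = \<lparr>space = (\<lambda>n. poly_module K), act = (\<lambda>n \<sigma> x. x), ident = \<one>\<^bsub>UP K\<^esub>,
    comp = (\<lambda>ns e es. e \<otimes>\<^bsub>UP K\<^esub> finprod (UP K) (\<lambda>i. es ! i) {..<length ns})\<rparr>"

definition colour_poly :: "('k, 'm) ring_scheme \<Rightarrow> (colour \<Rightarrow> 'k) \<Rightarrow> nat \<Rightarrow> 'k" where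
  "colour_poly K w = monom (UP K) (w White) 0 \<oplus>\<^bsub>UP K\<^esub> monom (UP K) (w Black) 1"

primrec tree_poly :: "('k, 'm) ring_scheme \<Rightarrow> (colour \<Rightarrow> 'k) tree \<Rightarrow> nat \<Rightarrow> 'k" where
  "tree_poly K (Leaf i) = \<one>\<^bsub>UP K\<^esub>"
| "tree_poly K (Node w l r) = colour_poly K w \<otimes>\<^bsub>UP K\<^esub> (tree_poly K l \<otimes>\<^bsub>UP K\<^esub> tree_poly K r)"

context
  fixes K :: "('k, 'm) ring_scheme"
  assumes field: "field K"
begin

interpretation K: field K by (rule field)
interpretation U: UP_cring K "UP K" by unfold_locales simp_all

lemma poly_module_simps:
  "carrier (poly_module K) = carrier (UP K)" "\<zero>\<^bsub>poly_module K\<^esub> = \<zero>\<^bsub>UP K\<^esub>"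
  "x \<oplus>\<^bsub>poly_module K\<^esub> y = x \<oplus>\<^bsub>UP K\<^esub> y" "a \<odot>\<^bsub>poly_module K\<^esub> x = a \<odot>\<^bsub>UP K\<^esub> x"
  by (simp_all add: poly_module_def)

lemma module_poly: "module K (poly_module K)"
  by (rule module_cong[OF algebra.module[OF U.UP_algebra]]) (simp_all add: poly_module_simps)

lemma poly_mult_lin:
  assumes "p \<in> carrier (UP K)"
  shows "(\<lambda>x. x \<otimes>\<^bsub>UP K\<^esub> p) \<in> lin_hom K (poly_module K) (poly_module K)"
  using assms by (auto simp: lin_hom_iff poly_module_simps U.P.l_distr U.UP_smult_assoc2)

lemma pre_operad_poly: "pre_operad K (poly_operad K)"
  unfolding pre_operad_def
proof (intro conjI allI impI)
  show "module K (space (poly_operad K) n)" for n by (simp add: poly_operad_def module_poly)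
  show "act (poly_operad K) n \<sigma> \<in>
    lin_hom K (space (poly_operad K) n) (space (poly_operad K) n)" for n \<sigma>
    by (simp add: poly_operad_def lin_hom_iff)
  show "ident (poly_operad K) \<in> carrier (space (poly_operad K) 1)"
    by (simp add: poly_operad_def poly_module_simps)
  fix ns e es assume c: "composable (poly_operad K) ns e es"
  have e: "e \<in> carrier (UP K)" and len: "length es = length ns"
    and es: "\<And>i. i < length ns \<Longrightarrow> es ! i \<in> carrier (UP K)"
    using c by (auto simp: composable_iff poly_operad_def poly_module_simps)
  have "finprod (UP K) (\<lambda>i. es ! i) {..<length ns} \<in> carrier (UP K)"
    using es by (intro U.P.finprod_closed) auto
  then show "(\<lambda>x. comp (poly_operad K) ns x es) \<in>
    lin_hom K (space (poly_operad K) (length ns)) (space (poly_operad K) (sum_list ns))"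
    using poly_mult_lin by (simp add: poly_operad_def)
  fix i assume i: "i < length ns"
  \<comment> \<open>The product of all factors except the one in slot \<open>i\<close>; composition
    in that slot is multiplication by \<open>r\<close>, hence linear.\<close>
  define r where "r = e \<otimes>\<^bsub>UP K\<^esub> finprod (UP K) (\<lambda>j. es ! j) ({..<length ns} - {i})"
  have fp: "finprod (UP K) (\<lambda>j. es ! j) ({..<length ns} - {i}) \<in> carrier (UP K)"
    using es by (intro U.P.finprod_closed) auto
  have r: "r \<in> carrier (UP K)" unfolding r_def using e fp by simp
  have "e \<otimes>\<^bsub>UP K\<^esub> finprod (UP K) (\<lambda>j. es[i := x] ! j) {..<length ns} = x \<otimes>\<^bsub>UP K\<^esub> r"
    if x: "x \<in> carrier (UP K)" for x
  proof -
    have "finprod (UP K) (\<lambda>j. es[i := x] ! j) (insert i ({..<length ns} - {i})) =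
      es[i := x] ! i \<otimes>\<^bsub>UP K\<^esub> finprod (UP K) (\<lambda>j. es[i := x] ! j) ({..<length ns} - {i})"
      using es x len i by (intro U.P.finprod_insert) (auto simp: nth_list_update)
    moreover have "finprod (UP K) (\<lambda>j. es[i := x] ! j) ({..<length ns} - {i}) =
      finprod (UP K) (\<lambda>j. es ! j) ({..<length ns} - {i})"
      using es by (intro U.P.finprod_cong') auto
    moreover have "insert i ({..<length ns} - {i}) = {..<length ns}" using i by auto
    ultimately show ?thesis using x e fp len i by (simp add: r_def U.P.m_lcomm)
  qed
  then have "x \<in> carrier (poly_module K) \<Longrightarrow> x \<otimes>\<^bsub>UP K\<^esub> r = comp (poly_operad K) ns e (es[i := x])" for x
    by (simp add: poly_operad_def poly_module_simps)
  from lin_hom_cong[OF module_poly poly_mult_lin[OF r] this]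
  show "(\<lambda>x. comp (poly_operad K) ns e (es[i := x])) \<in>
    lin_hom K (space (poly_operad K) (ns ! i)) (space (poly_operad K) (sum_list ns))"
    by (simp add: poly_operad_def)
qed

lemma colour_poly_closed: "w \<in> carrier (com2_gens K) \<Longrightarrow> colour_poly K w \<in> carrier (UP K)"
  by (auto simp: colour_poly_def com2_gens_simps free_module_simps image_subset_iff)

lemma tree_poly_closed: "decorations t \<subseteq> carrier (com2_gens K) \<Longrightarrow> tree_poly K t \<in> carrier (UP K)"
  by (induction t) (auto simp: colour_poly_closed)

lemma tree_poly_relabel: "tree_poly K (relabel h t) = tree_poly K t"
  by (induction t) auto

text \<open>The leaf sets of the two branches are disjoint, so the product over all inputs splits
  into the products for the branches.\<close>

lemma tree_poly_graft:
  assumes "decorations t \<subseteq> carrier (com2_gens K)" "distinct (leaves t)"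
    and "\<And>i. i \<in> set (leaves t) \<Longrightarrow> decorations (ts ! (i - 1)) \<subseteq> carrier (com2_gens K)"
  shows "tree_poly K (graft ns t ts) =
    tree_poly K t \<otimes>\<^bsub>UP K\<^esub> finprod (UP K) (\<lambda>i. tree_poly K (ts ! (i - 1))) (set (leaves t))"
  using assms
proof (induction t)
  case (Leaf i)
  then show ?case using tree_poly_closed[of "ts ! (i - 1)"] by (simp add: tree_poly_relabel)
next
  case (Node w l r)
  let ?f = "\<lambda>i. tree_poly K (ts ! (i - 1))"
  have cl: "?f i \<in> carrier (UP K)" if "i \<in> set (leaves l) \<union> set (leaves r)" for i
    using tree_poly_closed Node.prems(3) that by auto
  have fl: "finprod (UP K) ?f (set (leaves l)) \<in> carrier (UP K)"
    "finprod (UP K) ?f (set (leaves r)) \<in> carrier (UP K)"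
    using cl by (auto intro!: U.P.finprod_closed)
  have p: "colour_poly K w \<in> carrier (UP K)" "tree_poly K l \<in> carrier (UP K)" "tree_poly K r \<in>
    carrier (UP K)"
    using Node.prems(1) by (auto intro: colour_poly_closed tree_poly_closed)
  have "finprod (UP K) ?f (set (leaves l) \<union> set (leaves r)) =
    finprod (UP K) ?f (set (leaves l)) \<otimes>\<^bsub>UP K\<^esub> finprod (UP K) ?f (set (leaves r))"
    using cl Node.prems(2) by (intro U.P.finprod_Un_disjoint) auto
  then show ?case using Node fl p by (simp add: U.P.m_ac)
qed

lemma tree_poly_col: "tree_poly K (single_tree K s) = monom (UP K) \<one>\<^bsub>K\<^esub> (blacks s)"
proof (induction s)
  case (Node c l r)
  have "colour_poly K (single K c) = monom (UP K) \<one>\<^bsub>K\<^esub> (if c = Black then 1 else 0)"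
    by (cases c) (simp_all add: colour_poly_def single_def)
  then show ?case using Node
    by (simp add: U.monom_mult[symmetric] U.monom_one_mult[symmetric] add.assoc)
qed simp

definition poly_hom :: "nat \<Rightarrow> ((colour \<Rightarrow> 'k) tree \<Rightarrow> 'k) \<Rightarrow> nat \<Rightarrow> 'k" where
  "poly_hom n = free_lift K (poly_module K) (tree_poly K)"

lemma tree_poly_trees: "t \<in> trees (carrier (com2_gens K)) n \<Longrightarrow> tree_poly K t \<in>
  carrier (poly_module K)"
  unfolding poly_module_simps by (rule tree_poly_closed[OF treesD(1)])

lemma poly_hom_lin: "poly_hom n \<in>
  lin_hom K (space (tree_operad K (carrier (com2_gens K))) n) (poly_module K)"
  unfolding poly_hom_def tree_space[OF K.cring_axioms]
    by (rule free_lift_hom[OF module_poly tree_poly_trees])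

lemma poly_hom_single: "t \<in> trees (carrier (com2_gens K)) n \<Longrightarrow> poly_hom n (single K t) =
  tree_poly K t"
  unfolding poly_hom_def by (rule free_lift_single[OF module_poly tree_poly_trees])

lemma poly_hom_hom: "operad_hom K (tree_operad K (carrier (com2_gens K))) (poly_operad K) poly_hom"
proof (rule tree_homI[OF K.cring_axioms pre_operad_poly])
  show "poly_hom n \<in>
    lin_hom K (space (tree_operad K (carrier (com2_gens K))) n) (space (poly_operad K) n)" for n
    using poly_hom_lin by (simp add: poly_operad_def)
  show "poly_hom n (single K (relabel (inv_into UNIV \<sigma>) t)) =
    act (poly_operad K) n \<sigma> (poly_hom n (single K t))"
    if s: "\<sigma> permutes {1..n}" and t: "t \<in> trees (carrier (com2_gens K)) n" for n \<sigma> t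
    by (simp add: poly_hom_single[OF t] poly_hom_single[OF trees_relabel_inv[OF s t]] tree_poly_relabel poly_operad_def)
  show "poly_hom 1 (single K (Leaf 1)) = ident (poly_operad K)"
    unfolding poly_hom_single[OF Leaf_trees] by (simp add: poly_operad_def)
  fix ns :: "nat list" and t ts
  assume t: "t \<in> trees (carrier (com2_gens K)) (length ns)" "length ts = length ns"
    "\<And>i. i < length ns \<Longrightarrow> ts ! i \<in> trees (carrier (com2_gens K)) (ns ! i)"
  note tD = treesD[OF t(1)]
  have cl: "tree_poly K (ts ! i) \<in> carrier (UP K)" if "i < length ns" for i
    using tree_poly_closed[OF treesD(1)[OF t(3)[OF that]]] .
  have lab: "{1..length ns} = Suc ` {..<length ns}" by (simp add: image_Suc_lessThan)
  have "finprod (UP K) (\<lambda>i. tree_poly K (ts ! (i - 1))) (Suc ` {..<length ns}) =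
    finprod (UP K) (\<lambda>i. tree_poly K (ts ! (Suc i - 1))) {..<length ns}"
    by (rule U.P.finprod_reindex) (use cl in auto)
  also have "\<dots> = finprod (UP K) (\<lambda>i. map2 (\<lambda>n t. poly_hom n (single K t)) ns ts ! i) {..<length ns}"
    by (rule U.P.finprod_cong') (use cl t(2) poly_hom_single[OF t(3)] in auto)
  finally have "finprod (UP K) (\<lambda>i. tree_poly K (ts ! (i - 1))) (set (leaves t)) =
    finprod (UP K) (\<lambda>i. map2 (\<lambda>n t. poly_hom n (single K t)) ns ts ! i) {..<length ns}"
    unfolding tD(3) lab .
  moreover have "decorations (ts ! (i - 1)) \<subseteq> carrier (com2_gens K)" if "i \<in> set (leaves t)" for i
  proof (rule treesD(1)[OF t(3)])
    show "i - 1 < length ns" using that tD(3) by auto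
  qed
  ultimately show "poly_hom (sum_list ns) (single K (graft ns t ts)) =
    comp (poly_operad K) ns (poly_hom (length ns) (single K t)) (map2 (\<lambda>n t. poly_hom n (single K t)) ns ts)"
    using poly_hom_single[OF trees_graft[OF t(1,2) t(3)]] poly_hom_single[OF t(1)] tree_poly_graft[OF tD(1,2)]
    by (simp add: poly_operad_def)
qed

lemma poly_hom_rep_hom: "rep_hom K (com2_gens K) (poly_operad K) poly_hom"
  unfolding rep_hom_def
proof (intro conjI ballI)
  show "operad_hom K (tree_operad K (carrier (com2_gens K))) (poly_operad K) poly_hom"
    by (rule poly_hom_hom)
  have c: "poly_hom 2 (corolla K w) = colour_poly K w" "poly_hom 2 (op_corolla K w) =
    colour_poly K w"
    if "w \<in> carrier (com2_gens K)" for w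
  proof -
    have "Node w (Leaf 1) (Leaf 2) \<in> trees (carrier (com2_gens K)) 2" "Node w (Leaf 2) (Leaf 1) \<in>
      trees (carrier (com2_gens K)) 2"
      using that by (auto simp: trees_def)
    from this[THEN poly_hom_single]
    show "poly_hom 2 (corolla K w) = colour_poly K w" "poly_hom 2 (op_corolla K w) =
      colour_poly K w"
      using colour_poly_closed[OF that] by (simp_all add: corolla_def op_corolla_def)
  qed
  have "colour_poly K \<in> lin_hom K (com2_gens K) (poly_module K)"
  proof (rule lin_homI)
    have wc: "w c \<in> carrier K" if "w \<in> carrier (com2_gens K)" for w c
      using that by (auto simp: com2_gens_simps free_module_simps)
    show "colour_poly K w \<in> carrier (poly_module K)" if "w \<in> carrier (com2_gens K)" for w
      using colour_poly_closed[OF that] by (simp add: poly_module_simps)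
    show "colour_poly K (w \<oplus>\<^bsub>com2_gens K\<^esub> w') = colour_poly K w \<oplus>\<^bsub>poly_module K\<^esub> colour_poly K w'"
      if "w \<in> carrier (com2_gens K)" "w' \<in> carrier (com2_gens K)" for w w'
      using wc[OF that(1)] wc[OF that(2)]
      by (simp add: colour_poly_def poly_module_simps com2_gens_simps(2) free_module_simps(3) U.P.a_ac)
    show "colour_poly K (a \<odot>\<^bsub>com2_gens K\<^esub> w) = a \<odot>\<^bsub>poly_module K\<^esub> colour_poly K w"
      if "a \<in> carrier K" "w \<in> carrier (com2_gens K)" for a w
      using wc[OF that(2)] that(1)
      by (simp add: colour_poly_def poly_module_simps com2_gens_simps(3) free_module_simps(4)
          U.monom_mult_smult U.UP_smult_r_distr)
  qed
  then show "(\<lambda>w. poly_hom 2 (corolla K w)) \<in> lin_hom K (com2_gens K) (space (poly_operad K) 2)"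
    using lin_hom_cong[OF s2_moduleD(1)[OF s2_module_com2[OF K.cring_axioms]], of "colour_poly K"
      "poly_module K"] c(1)
    by (simp add: poly_operad_def)
  show "poly_hom 2 (op_corolla K w) = poly_hom 2 (corolla K (twist (com2_gens K) w))" if "w \<in>
    carrier (com2_gens K)" for w
    using c[OF that] by (simp add: com2_gens_simps(4))
qed

text \<open>The relations preserve the number of black vertices, so the polynomial morphism descends
  to the quotient. Reading off one coefficient gives a functional \<open>\<gamma> n k\<close> dual
  to the classes of the different counts.\<close>

lemma com2_coeff:
  obtains \<gamma> where "\<And>n k y. y \<in> carrier (space (com2 K) n) \<Longrightarrow> \<gamma> n k y \<in> carrier K"
    "\<And>n k y z. y \<in> carrier (space (com2 K) n) \<Longrightarrow> z \<in> carrier (space (com2 K) n) \<Longrightarrow>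
      \<gamma> n k (y \<oplus>\<^bsub>space (com2 K) n\<^esub> z) = \<gamma> n k y \<oplus>\<^bsub>K\<^esub> \<gamma> n k z"
    "\<And>n k a y. a \<in> carrier K \<Longrightarrow> y \<in> carrier (space (com2 K) n) \<Longrightarrow>
      \<gamma> n k (a \<odot>\<^bsub>space (com2 K) n\<^esub> y) = a \<otimes>\<^bsub>K\<^esub> \<gamma> n k y"
    "\<And>n k s. s \<in> trees UNIV n \<Longrightarrow>
      \<gamma> n k (quad_class K (com2_gens K) (com2_rels K) n (single K (single_tree K s))) =
      (if blacks s = k then \<one>\<^bsub>K\<^esub> else \<zero>\<^bsub>K\<^esub>)"
proof -
  have "poly_hom 3 (single K (single_tree K s)) = poly_hom 3 (single K (single_tree K s'))"
    if "s \<in> trees UNIV 3" "s' \<in> trees UNIV 3" "blacks s = blacks s'" for s s'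
    using that poly_hom_single[OF col_trees[OF field]] by (simp add: tree_poly_col)
  then obtain g where g: "operad_hom K (com2 K) (poly_operad K) g"
    "\<And>n x. x \<in> carrier (space (tree_operad K (carrier (com2_gens K))) n) \<Longrightarrow>
      g n (quad_class K (com2_gens K) (com2_rels K) n x) = poly_hom n x"
    using com2_lift[OF field pre_operad_poly poly_hom_rep_hom] by blast
  have lin: "g n \<in> lin_hom K (space (com2 K) n) (poly_module K)" for n
    using operad_homD(1)[OF g(1), of n] by (simp add: poly_operad_def)
  note gl = lin_hom_closed[OF lin, unfolded poly_module_simps] lin_hom_add[OF lin,
    unfolded poly_module_simps]
    lin_hom_smult[OF lin, unfolded poly_module_simps]
  show ?thesis
  proof (rule that[of "\<lambda>n k y. coeff (UP K) (g n y) k"])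
    show "coeff (UP K) (g n (quad_class K (com2_gens K) (com2_rels K) n (single K (single_tree K s)))) k =
      (if blacks s = k then \<one>\<^bsub>K\<^esub> else \<zero>\<^bsub>K\<^esub>)" if "s \<in> trees UNIV n" for n k s
      using g(2)[OF tree_single_closed[OF K.cring_axioms col_trees[OF field that]]] poly_hom_single[OF col_trees[OF field that]]
      by (simp add: tree_poly_col)
  qed (simp_all add: gl)
qed

end

section \<open>Colourings in the white product, and the comparison with the Hadamard product\<close>

section \<open>The white product\<close>

lemma quad_class_eqI:
  assumes V: "s2_module K V" and R: "R \<subseteq> carrier (space (free_operad K V) 3)"
    and x: "x \<in> carrier (space (tree_operad K (carrier V)) 3)" and y: "y \<in>
      carrier (space (tree_operad K (carrier V)) 3)"
    and r: "free_class K V 3 x \<ominus>\<^bsub>space (free_operad K V) 3\<^esub> free_class K V 3 y \<in> R"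
  shows "quad_class K V R 3 x = quad_class K V R 3 y"
  unfolding quad_class_def[OF V R]
  using quot_class_eq_iff[OF pre_operad_free[OF V] submodule_relation_ideal[OF V R] free_class_closed[OF V R x]
      free_class_closed[OF V R y]] relation_ideal_superset[OF V R] r by blast

text \<open>The shape \<open>s\<close> with its first \<open>k\<close> vertices, in preorder, black.\<close>

primrec colour_fill :: "'v tree \<Rightarrow> nat \<Rightarrow> ('v \<times> colour) tree" where
  "colour_fill (Leaf i) k = Leaf i"
| "colour_fill (Node v l r) k = Node (v, if k = 0 then White else Black)
    (colour_fill l (min (k - 1) (length (leaves l) - 1)))
    (colour_fill r (k - 1 - min (k - 1) (length (leaves l) - 1)))"

lemma map_fst_colour_fill [simp]: "map_tree fst (colour_fill s k) = s"
  by (induction s arbitrary: k) auto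

lemma leaves_colour_fill [simp]: "leaves (colour_fill s k) = leaves s"
  by (induction s arbitrary: k) auto

lemma colour_fill_relabel: "colour_fill (relabel h s) k = relabel h (colour_fill s k)"
  by (induction s arbitrary: k) auto

lemma decorations_colour_fill: "decorations (colour_fill s k) \<subseteq> decorations s \<times> UNIV"
proof (induction s arbitrary: k)
  case (Node v l r)
  then show ?case by fastforce
qed simp

abbreviation black_count :: "('v \<times> colour) tree \<Rightarrow> nat" where
  "black_count t \<equiv> blacks (map_tree snd t)"

lemma black_count_less: "black_count t < length (leaves t)"
  using blacks_less[of "map_tree snd t"] by simp

text \<open>The number of vertices is one less than the number of leaves, so a count below the
  number of leaves fits: what exceeds the root and the left branch finds room in the right
  branch.\<close>

lemma black_count_fill: "k < length (leaves s) \<Longrightarrow> black_count (colour_fill s k) = k"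
proof (induction s arbitrary: k)
  case (Node v l r)
  have l: "length (leaves l) > 0" "length (leaves r) > 0" by auto
  let ?a = "min (k - 1) (length (leaves l) - 1)"
  have "?a < length (leaves l)" using l by linarith
  moreover have "k - 1 - ?a < length (leaves r)" using l Node.prems by (simp add: min_def) linarith
  ultimately show ?case using Node.IH by (auto simp: min_def)
qed simp

lemma colour_fill_trees: "s \<in> trees D n \<Longrightarrow> colour_fill s k \<in> trees (D \<times> UNIV) n"
  using decorations_colour_fill[of s k] by (auto simp: trees_def)

lemma colour_fill_ltrees: "s \<in> ltrees D \<Longrightarrow> colour_fill s k \<in> ltrees (D \<times> UNIV)"
  using decorations_colour_fill[of s k] by (auto simp: ltrees_def)

lemma blacks_graft:
  "blacks (graft ns s ss) = blacks s + sum_list (map (\<lambda>i. blacks (ss ! (i - 1))) (leaves s))"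
  by (induction s) auto

text \<open>The capacities are \<open>length ns - 1\<close> for the root factor and
  \<open>ns ! i - 1\<close> for the inputs; with all arities positive they add up to
  \<open>sum_list ns - 1\<close>. The distribution is greedy and serves the root factor
  first.\<close>

lemma black_distribution:
  assumes "\<And>i. i < length ns \<Longrightarrow> 0 < ns ! i" "ns \<noteq> []" "k < sum_list (ns :: nat list)"
  shows "\<exists>j \<kappa>. j < length ns \<and> length \<kappa> = length ns \<and> (\<forall>i<length ns. \<kappa> ! i < ns ! i) \<and> k =
    j + sum_list \<kappa>"
proof -
  \<comment> \<open>The bound says that \<open>m\<close> is at most the total capacity of the
    inputs, written without truncated subtraction.\<close>
  have *: "\<exists>\<kappa>. length \<kappa> = length ns \<and> (\<forall>i<length ns. \<kappa> ! i < ns ! i) \<and> m = sum_list \<kappa>"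
    if "\<And>i. i < length ns \<Longrightarrow> 0 < ns ! i" "m + length ns \<le> sum_list ns" for m and ns :: "nat list"
    using that
  proof (induction ns arbitrary: m)
    case (Cons n ns)
    have n: "0 < n" using Cons.prems(1)[of 0] by simp
    have ns: "0 < ns ! i" if "i < length ns" for i using Cons.prems(1)[of "Suc i"] that by simp
    let ?a = "min m (n - 1)"
    have len: "length ns \<le> sum_list ns"
      using ns
    proof (induction ns)
      case (Cons n ns)
      have "0 < n" using Cons.prems[of 0] by simp
      moreover have "length ns \<le> sum_list ns" using Cons.IH Cons.prems[of "Suc _"] by simp
      ultimately show ?case by simp
    qed simp
    have "m - ?a + length ns \<le> sum_list ns" using Cons.prems(2) n len by (auto simp: min_def)
    then obtain \<kappa> where \<kappa>: "length \<kappa> = length ns" "\<forall>i<length ns. \<kappa> ! i < ns ! i" "m - ?a =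
      sum_list \<kappa>"
      using Cons.IH[OF ns] by blast
    have a: "?a < n" using n by linarith
    have "(?a # \<kappa>) ! i < (n # ns) ! i" if "i < length (n # ns)" for i
      using that a \<kappa>(2) by (cases i) simp_all
    moreover have "m = sum_list (?a # \<kappa>)" using \<kappa>(3) by simp
    ultimately show ?case using \<kappa>(1) by (intro exI[of _ "?a # \<kappa>"]) simp
  qed simp
  let ?j = "min k (length ns - 1)"
  have len: "length ns > 0" using assms(2) by simp
  have nsum: "length ns \<le> sum_list ns"
  proof -
    have "sum_list (map (\<lambda>i. 1) [0..<length ns]) \<le> sum_list (map ((!) ns) [0..<length ns])"
      using assms(1) by (intro sum_list_mono) (auto simp: Suc_le_eq)
    then show ?thesis by (simp add: map_nth sum_list_triv)
  qed
  have "(k - ?j) + length ns \<le> sum_list ns" using assms(3) len nsum by (simp add: min_def) linarith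
  from *[OF assms(1) this] obtain \<kappa> where
    \<kappa>: "length \<kappa> = length ns" "\<forall>i<length ns. \<kappa> ! i < ns ! i" "k - ?j = sum_list \<kappa>" by blast
  moreover have "?j < length ns" using len by linarith
  moreover have "k = ?j + sum_list \<kappa>" using \<kappa>(3) by simp
  ultimately show ?thesis by blast
qed

lemma lin_hom_finsum_fun:
  assumes M: "module K M" and N: "module K N" and "finite A" "\<And>i. i \<in> A \<Longrightarrow> f i \<in> lin_hom K M N"
  shows "(\<lambda>x. finsum N (\<lambda>i. f i x) A) \<in> lin_hom K M N"
  using assms(3,4)
proof (induction A rule: finite_induct)
  case empty
  interpret N: module K N by (rule N)
  show ?case using zero_lin_hom[OF M N] by simp
next
  case (insert a A)
  interpret N: module K N by (rule N)
  have cl: "f i x \<in> carrier N" if "i \<in> insert a A" "x \<in> carrier M" for i x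
    using lin_hom_closed[OF insert.prems[OF that(1)] that(2)] .
  have "(\<lambda>x. f a x \<oplus>\<^bsub>N\<^esub> finsum N (\<lambda>i. f i x) A) \<in> lin_hom K M N"
    by (rule lin_hom_sum[OF M N]) (use insert in auto)
  then show ?case
    by (rule lin_hom_cong[OF M]) (use insert.hyps cl in \<open>auto intro!: N.finsum_insert[symmetric]\<close>)
qed

context
  fixes K :: "('k, 'm) ring_scheme" and V :: "('k, 'v) s2_rep" and R :: "('v tree \<Rightarrow> 'k) set set"
  assumes field: "field K" and V: "s2_module K V" and R: "R \<subseteq> carrier (space (free_operad K V) 3)"
begin

interpretation K: field K by (rule field)

private lemmas Kc = K.cring_axioms
private lemmas sW = s2_module_com2[OF Kc]
private lemmas sX = s2_module_tensor[OF V sW]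
private lemmas mV = s2_moduleD(1)[OF V]
private lemmas mW = s2_moduleD(1)[OF sW]
private lemmas S = com2_rels_carrier[OF field]

private abbreviation (input) "W \<equiv> com2_gens K"
private abbreviation (input) "X \<equiv> tensor_s2 K V W"
private abbreviation (input) "tns \<equiv> tens K V W"
private abbreviation (input) "pnt \<equiv> map_tree (paint K V)"
private abbreviation (input) "CT \<equiv> trees (carrier V \<times> (UNIV :: colour set))"
private abbreviation (input) "TV \<equiv> tree_operad K (carrier V)"
private abbreviation (input) "TX \<equiv> tree_operad K (carrier X)"
private abbreviation (input) "TC \<equiv> tree_operad K (carrier V \<times> (UNIV :: colour set))"
private abbreviation (input) "FV3 \<equiv> space (free_operad K V) 3"
private abbreviation (input) "FW3 \<equiv> space (free_operad K W) 3"
private abbreviation (input) "FX3 \<equiv> space (free_operad K X) 3"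
private abbreviation (input) "wr \<equiv> white_rel K V R W (com2_rels K)"
private abbreviation (input) "PX \<equiv> white_product K V R W (com2_rels K)"
private abbreviation (input) "\<rho> \<equiv> quad_class K X wr"

private abbreviation (input) "SP \<equiv> lin_span K (tensor K FV3 FW3)
        ({tens K FV3 FW3 r y | r y. r \<in> S_span K (free_operad K V) 3 R \<and> y \<in> carrier FW3} \<union>
         {tens K FV3 FW3 y s | y s. y \<in> carrier FV3 \<and> s \<in>
           S_span K (free_operad K W) 3 (com2_rels K)})"

lemma white_rel_iff: "x \<in> wr \<longleftrightarrow> x \<in> carrier FX3 \<and> white_map K V W x \<in> SP"
  by (simp add: white_rel_def Let_def)

lemma white_rel_carrier: "wr \<subseteq> carrier FX3"
  by (auto simp: white_rel_iff)

private lemmas mFV = pre_operad_module[OF pre_operad_free[OF V], of 3]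
private lemmas mFW = pre_operad_module[OF pre_operad_free[OF sW], of 3]
private lemmas mFX = pre_operad_module[OF pre_operad_free[OF sX], of 3]
private lemmas mT = module_tensor[OF mFV mFW]

lemma S_span_carrier:
  "S_span K (free_operad K V) 3 R \<subseteq> carrier FV3"
  "S_span K (free_operad K W) 3 (com2_rels K) \<subseteq> carrier FW3"
  using S_span_relation_ideal[OF V R] operad_idealD(1)[OF submodule_relation_ideal[OF V R], of 3]
    S_span_relation_ideal[OF sW S] operad_idealD(1)[OF submodule_relation_ideal[OF sW S], of 3]
    module.submoduleE(1)[OF mFV] module.submoduleE(1)[OF mFW] by blast+

lemma white_span_gens:
  "({tens K FV3 FW3 r y | r y. r \<in> S_span K (free_operad K V) 3 R \<and> y \<in> carrier FW3} \<union>
    {tens K FV3 FW3 y s | y s. y \<in> carrier FV3 \<and> s \<in> S_span K (free_operad K W) 3 (com2_rels K)}) \<subseteq>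
  carrier (tensor K FV3 FW3)"
  using S_span_carrier tens_closed[OF mFV mFW] by blast

lemma submodule_white_span: "submodule SP K (tensor K FV3 FW3)"
  by (rule submodule_lin_span[OF mT white_span_gens])

lemma white_span_left: "r \<in> R \<Longrightarrow> y \<in> carrier FW3 \<Longrightarrow> tens K FV3 FW3 r y \<in> SP"
  using S_span_superset[OF V R] by (intro subsetD[OF lin_span_superset]) blast

lemma white_span_right: "y \<in> carrier FV3 \<Longrightarrow> s \<in> com2_rels K \<Longrightarrow> tens K FV3 FW3 y s \<in> SP"
  using S_span_superset[OF sW S] by (intro subsetD[OF lin_span_superset]) blast

lemma free_class_single_closed:
  "t \<in> trees (carrier V) n \<Longrightarrow> free_class K V n (single K t) \<in> carrier (space (free_operad K V) n)"
  "s \<in> trees UNIV n \<Longrightarrow> free_class K W n (single K (single_tree K s)) \<in>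
    carrier (space (free_operad K W) n)"
  "u \<in> CT n \<Longrightarrow> free_class K X n (single K (pnt u)) \<in> carrier (space (free_operad K X) n)"
  using free_class_closed[OF V R tree_single_closed[OF Kc]]
    free_class_closed[OF sW S tree_single_closed[OF Kc col_trees[OF field]]]
    free_class_closed[OF sX white_rel_carrier tree_single_closed[OF Kc paint_tree[OF field V]]]
      by blast+

lemma coloured_components:
  "t \<in> CT n \<Longrightarrow> map_tree fst t \<in> trees (carrier V) n" "t \<in> CT n \<Longrightarrow> map_tree snd t \<in> trees UNIV n"
  by (auto intro!: trees_map_tree)

lemma tens_paint:
  "map_tree (\<lambda>(v, w). tns v w) (map_tree (\<lambda>(v, c). (v, single K c)) t) = pnt t"
  "map_tree fst (map_tree (\<lambda>(v, c). (v, single K c)) t) = map_tree fst t"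
  "map_tree snd (map_tree (\<lambda>(v, c). (v, single K c)) t) = single_tree K (map_tree snd t)"
  by (simp_all add: tree.map_comp o_def case_prod_unfold paint_def[OF field V])

lemma tens_colour_trees: "t \<in> CT n \<Longrightarrow> map_tree (\<lambda>(v, c). (v, single K c)) t \<in>
  trees (carrier V \<times> carrier W) n"
  using com2_single_closed[OF Kc] by (auto intro!: trees_map_tree)

lemma white_map_paint:
  assumes "t \<in> CT 3"
  shows "white_map K V W (free_class K X 3 (single K (pnt t))) =
    tens K FV3 FW3 (free_class K V 3 (single K (map_tree fst t))) (free_class K W 3 (single K (single_tree K (map_tree snd t))))"
  using white_map_tree[OF field V tens_colour_trees[OF assms]]
  unfolding tens_paint tree_class_eq[OF V] tree_class_eq[OF sW] tree_class_eq[OF sX] .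

private lemmas PPX = pre_operad_quadratic[OF sX white_rel_carrier, folded white_product_def]
private lemmas \<rho>_rep = quad_class_rep_hom[OF sX white_rel_carrier, folded white_product_def]
private lemmas \<rho>_hom = rep_homD(1)[OF \<rho>_rep]

subsection \<open>Independence of the colouring\<close>

text \<open>Under \<open>\<Phi>\<close> both colourings have the same first factor \<open>y\<close>,
  so their difference goes to \<open>y\<close> tensor a relation between coloured trees, which is a
  generator of \<open>SP\<close>.\<close>

lemma white_swap:
  assumes t: "t \<in> CT 3" "t' \<in> CT 3" "map_tree fst t = map_tree fst t'" "black_count t =
    black_count t'"
  shows "\<rho> 3 (single K (pnt t)) = \<rho> 3 (single K (pnt t'))"
proof (rule quad_class_eqI[OF sX white_rel_carrier])
  let ?a = "\<lambda>t. free_class K X 3 (single K (pnt t))" and ?u =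
    "\<lambda>t. free_class K W 3 (single K (single_tree K (map_tree snd t)))"
  let ?y = "free_class K V 3 (single K (map_tree fst t))"
  interpret FX: module K FX3 by (rule mFX)
  have y: "?y \<in> carrier FV3" using free_class_single_closed(1)[OF coloured_components(1)[OF t(1)]] .
  have u: "?u t \<in> carrier FW3" if "t \<in> CT 3" for t
    using free_class_single_closed(2)[OF coloured_components(2)[OF that]] .
  have a: "?a t \<in> carrier FX3" if "t \<in> CT 3" for t using free_class_single_closed(3)[OF that] .
  have "white_map K V W (?a t \<ominus>\<^bsub>FX3\<^esub> ?a t') =
    white_map K V W (?a t) \<ominus>\<^bsub>tensor K FV3 FW3\<^esub> white_map K V W (?a t')"
    by (rule lin_hom_diff[OF mFX mT white_map_hom[OF field V] a[OF t(1)] a[OF t(2)]])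
  also have "\<dots> = tens K FV3 FW3 ?y (?u t) \<ominus>\<^bsub>tensor K FV3 FW3\<^esub> tens K FV3 FW3 ?y (?u t')"
    unfolding white_map_paint[OF t(1)] white_map_paint[OF t(2)] t(3) ..
  also have "\<dots> = tens K FV3 FW3 ?y (?u t \<ominus>\<^bsub>FW3\<^esub> ?u t')"
    using lin_hom_diff[OF mFW mT tens_homr[OF mFV mFW y] u[OF t(1)] u[OF t(2)]] by simp
  also have "\<dots> \<in> SP"
    by (rule white_span_right[OF y])
      (use com2_rels_mem[OF field coloured_components(2)[OF t(1)] coloured_components(2)[OF t(2)] t(4)]
        in \<open>simp add: tree_class_eq[OF sW]\<close>)
  finally show "?a t \<ominus>\<^bsub>FX3\<^esub> ?a t' \<in> wr"
    using a[OF t(1)] a[OF t(2)] by (simp add: white_rel_iff)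
qed (rule tree_single_closed[OF Kc paint_tree[OF field V]], rule t)+

private abbreviation (input) "pv t \<equiv> tree_val K \<rho> (pnt t)"
private abbreviation (input) "LT \<equiv> ltrees (carrier V \<times> (UNIV :: colour set))"

lemma paint_ltrees: "t \<in> LT \<Longrightarrow> pnt t \<in> ltrees (carrier X)"
  using paint_closed[OF field V] by (auto simp: ltrees_def)

lemma paint_val_Node_cong:
  assumes "Node d l r \<in> LT" "Node d l' r' \<in> LT" "leaves l' = leaves l" "leaves r' = leaves r"
    "pv l' = pv l" "pv r' = pv r"
  shows "pv (Node d l' r') = pv (Node d l r)"
  using tree_val_Node_cong[OF Kc \<rho>_hom, of "paint K V d" "pnt l" "pnt r" "pnt l'" "pnt r'"]
    paint_ltrees[OF assms(1)] paint_ltrees[OF assms(2)] assms(3-6) by simp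

lemma paint_val_plug_cong:
  assumes t: "t \<in> CT 3" "t' \<in> CT 3" "map_tree fst t = map_tree fst t'" "black_count t =
    black_count t'"
    and ts: "length ts = 3" "set ts \<subseteq> LT" "disjoint_leaves ts"
  shows "pv (plug t ts) = pv (plug t' ts)"
proof -
  have d: "disjoint_leaves (map pnt ts)" using ts(3) by (auto simp: disjoint_leaves_def)
  have l: "set (map pnt ts) \<subseteq> ltrees (carrier X)" using ts(2) paint_ltrees by auto
  have *: "pv (plug t ts) = tree_val K \<rho> (plug (pnt t) (map pnt ts))"
    "pnt t \<in> trees (carrier X) (length (map pnt ts))" if "t \<in> CT 3" for t
    using map_tree_plug[of t ts "paint K V"] treesD(3)[OF that] ts(1) paint_tree[OF field V that]
      by auto
  show ?thesis
    unfolding *(1)[OF t(1)] *(1)[OF t(2)]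
    using tree_val_plug[OF Kc \<rho>_hom *(2)[OF t(1)] l d]
      tree_val_plug[OF Kc \<rho>_hom *(2)[OF t(2)] l d] white_swap[OF t] ts(1) by simp
qed

text \<open>Unlike in \<open>val_rotate\<close>, the shape and the decorations in \<open>V\<close>
  stay fixed, since nothing relates different \<open>V\<close>-trees here; only the colours of two
  adjacent vertices trade places.\<close>

lemma paint_val_exchange_left:
  assumes "Node (v, c) (Node (u, d) x y) z \<in> LT"
  shows "pv (Node (v, c) (Node (u, d) x y) z) = pv (Node (v, d) (Node (u, c) x y) z)"
proof -
  let ?s = "\<lambda>c d. Node (v, c) (Node (u, d) (Leaf 1) (Leaf 2)) (Leaf 3)"
  have "?s c d \<in> CT 3" "?s d c \<in> CT 3" "black_count (?s c d) = black_count (?s d c)"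
    unfolding trees_def atLeastAtMost_3 using assms by (auto simp: ltrees_Node)
  moreover have "set [x, y, z] \<subseteq> LT" using assms by (simp add: ltrees_Node)
  moreover have "disjoint_leaves [x, y, z]" using assms
    by (intro disjoint_leaves_3) (auto simp: ltrees_Node)
  ultimately have "pv (plug (?s c d) [x, y, z]) = pv (plug (?s d c) [x, y, z])"
    by (intro paint_val_plug_cong) auto
  then show ?thesis by simp
qed

lemma paint_val_exchange_right:
  assumes "Node (v, c) x (Node (u, d) y z) \<in> LT"
  shows "pv (Node (v, c) x (Node (u, d) y z)) = pv (Node (v, d) x (Node (u, c) y z))"
proof -
  let ?s = "\<lambda>c d. Node (v, c) (Leaf 1) (Node (u, d) (Leaf 2) (Leaf 3))"
  have "?s c d \<in> CT 3" "?s d c \<in> CT 3" "black_count (?s c d) = black_count (?s d c)"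
    unfolding trees_def atLeastAtMost_3 using assms by (auto simp: ltrees_Node)
  moreover have "set [x, y, z] \<subseteq> LT" using assms by (simp add: ltrees_Node)
  moreover have "disjoint_leaves [x, y, z]" using assms
    by (intro disjoint_leaves_3) (auto simp: ltrees_Node)
  ultimately have "pv (plug (?s c d) [x, y, z]) = pv (plug (?s d c) [x, y, z])"
    by (intro paint_val_plug_cong) auto
  then show ?thesis by simp
qed

text \<open>By induction both branches may be taken in filled form, so a colouring is described by
  its root colour and two counts. Exchanges along the two edges at the root move black vertices to
  the root and, through it, from the right to the left branch until the preorder filling is
  reached.\<close>

lemma paint_val_fill:
  assumes "t \<in> LT"
  shows "pv t = pv (colour_fill (map_tree fst t) (black_count t))"
  using assms
proof (induction "map_tree fst t" arbitrary: t)
  case (Leaf i)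
  then show ?case by (cases t) auto
next
  case (Node v l0 r0)
  obtain c l r where t: "t = Node (v, c) l r" "map_tree fst l = l0" "map_tree fst r = r0"
    using Node.hyps(3) by (cases t) auto
  have lv: "leaves l = leaves l0" "leaves r = leaves r0" using t(2,3) leaves_map_tree by metis+
  have LTt: "Node (v, c) l r \<in> LT" using Node.prems t(1) by simp
  have IHl: "pv l' = pv (colour_fill l0 (black_count l'))" if "l' \<in> LT" "map_tree fst l' =
    l0" for l'
    using Node.hyps(1)[of l'] that by simp
  have IHr: "pv r' = pv (colour_fill r0 (black_count r'))" if "r' \<in> LT" "map_tree fst r' =
    r0" for r'
    using Node.hyps(2)[of r'] that by simp
  have shape: "map_tree fst s \<in> ltrees (carrier V)" if "s \<in> LT" for s
    using that by (auto simp: ltrees_def)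
  have lr: "l \<in> LT" "r \<in> LT" and v: "v \<in> carrier V" and dj: "set (leaves l0) \<inter> set (leaves r0) = {}"
    using LTt unfolding ltrees_Node lv by auto
  have l0: "l0 \<in> ltrees (carrier V)" and r0: "r0 \<in> ltrees (carrier V)"
    using shape[OF lr(1)] shape[OF lr(2)] unfolding t(2,3) .
  let ?N = "\<lambda>c a b. Node (v, c) (colour_fill l0 a) (colour_fill r0 b)"
  have N: "?N c a b \<in> LT" for c a b
    using colour_fill_ltrees[OF l0] colour_fill_ltrees[OF r0] v dj by (simp add: ltrees_Node)
  \<comment> \<open>A filled branch with a positive count has a black top vertex. Trading its colour
    with the white root leaves one black vertex less in the branch, which the induction hypothesis
    brings back to filled form.\<close>
  have left: "pv (?N White (Suc a) b) =
    pv (?N Black a b)" if a: "Suc a < length (leaves l0)" for a b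
  proof -
    obtain u l1 l2 where u: "l0 = Node u l1 l2" using a by (cases l0) auto
    obtain A B where AB: "colour_fill l0 (Suc a) = Node (u, Black) A B" unfolding u by simp
    have N1: "Node (v, White) (Node (u, Black) A B) (colour_fill r0 b) \<in> LT"
      using N[of White "Suc a" b] AB by simp
    then have N2: "Node (v, Black) (Node (u, White) A B) (colour_fill r0 b) \<in> LT"
      by (auto simp: ltrees_Node)
    have m: "map_tree fst (Node (u, White) A B) = l0"
      using map_fst_colour_fill[of l0 "Suc a"] unfolding AB by simp
    have bc: "black_count (Node (u, White) A B) = a"
      using black_count_fill[OF a] unfolding AB by simp
    have "pv (?N White (Suc a) b) = pv (Node (v, Black) (Node (u, White) A B) (colour_fill r0 b))"
      unfolding AB by (rule paint_val_exchange_left[OF N1])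
    also have "\<dots> = pv (?N Black a b)"
    proof (rule paint_val_Node_cong[OF N N2 _ refl _ refl])
      show "leaves (Node (u, White) A B) = leaves (colour_fill l0 a)"
        using leaves_map_tree[of fst "Node (u, White) A B"] unfolding m by simp
      show "pv (Node (u, White) A B) = pv (colour_fill l0 a)"
        using IHl[OF _ m] N2 bc by (simp add: ltrees_Node)
    qed
    finally show ?thesis .
  qed
  have right: "pv (?N White a (Suc b)) =
    pv (?N Black a b)" if b: "Suc b < length (leaves r0)" for a b
  proof -
    obtain u l1 l2 where u: "r0 = Node u l1 l2" using b by (cases r0) auto
    obtain A B where AB: "colour_fill r0 (Suc b) = Node (u, Black) A B" unfolding u by simp
    have N1: "Node (v, White) (colour_fill l0 a) (Node (u, Black) A B) \<in> LT"
      using N[of White a "Suc b"] AB by simp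
    then have N2: "Node (v, Black) (colour_fill l0 a) (Node (u, White) A B) \<in> LT"
      by (auto simp: ltrees_Node)
    have m: "map_tree fst (Node (u, White) A B) = r0"
      using map_fst_colour_fill[of r0 "Suc b"] unfolding AB by simp
    have bc: "black_count (Node (u, White) A B) = b"
      using black_count_fill[OF b] unfolding AB by simp
    have "pv (?N White a (Suc b)) = pv (Node (v, Black) (colour_fill l0 a) (Node (u, White) A B))"
      unfolding AB by (rule paint_val_exchange_right[OF N1])
    also have "\<dots> = pv (?N Black a b)"
    proof (rule paint_val_Node_cong[OF N N2 refl _ refl])
      show "leaves (Node (u, White) A B) = leaves (colour_fill r0 b)"
        using leaves_map_tree[of fst "Node (u, White) A B"] unfolding m by simp
      show "pv (Node (u, White) A B) = pv (colour_fill r0 b)"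
        using IHr[OF _ m] N2 bc by (simp add: ltrees_Node)
    qed
    finally show ?thesis .
  qed
  define k where "k = black_count t"
  define m where "m = min (k - 1) (length (leaves l0) - 1)"
  \<comment> \<open>The root acts as a relay: it hands its black colour to the left branch
    (\<open>left\<close> read backwards) and takes one from the right branch (\<open>right\<close>).
    \<open>m\<close> is the count that \<open>colour_fill\<close> assigns to the left
    branch.\<close>
  have shift: "pv (?N Black a b) = pv (?N Black m (k - 1 - m))"
    if "a \<le> m" "a + b = k - 1" "b < length (leaves r0)" for a b
    using that
  proof (induction "m - a" arbitrary: a b)
    case 0
    then have "a = m" "b = k - 1 - m" by simp_all
    then show ?case by (simp only:)
  next
    case (Suc j)
    then have "a < m" by simp
    then obtain b' where b: "b = Suc b'" using Suc.prems(2) by (cases b) (auto simp: m_def)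
    have "Suc a < length (leaves l0)" using \<open>a < m\<close> by (auto simp: m_def)
    from left[OF this] have "pv (?N Black a b) = pv (?N White (Suc a) b)" by simp
    also have "\<dots> = pv (?N Black (Suc a) b')" unfolding b using Suc.prems(3) b by (intro right) simp
    also have "\<dots> = pv (?N Black m (k - 1 - m))"
      using Suc.hyps(2) Suc.prems \<open>a < m\<close> b by (intro Suc.hyps(1)) auto
    finally show ?case .
  qed
  let ?a = "black_count l" and ?b = "black_count r"
  have ab: "?a < length (leaves l0)" "?b < length (leaves r0)"
    using black_count_less[of l] black_count_less[of r] lv by auto
  have "pv (Node (v, c) l r) = pv (?N c ?a ?b)"
    by (rule paint_val_Node_cong[OF N LTt]) (use IHl[OF lr(1) t(2)] IHr[OF lr(2) t(3)] lv in simp_all)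
  also have "\<dots> = pv (colour_fill (Node v l0 r0) k)"
  proof (cases "k = 0")
    case True
    then have "c = White" "?a = 0" "?b = 0" unfolding k_def t(1) by (cases c; simp)+
    then show ?thesis using True by simp
  next
    case False
    then have fill: "colour_fill (Node v l0 r0) k = ?N Black m (k - 1 - m)" by (simp add: m_def)
    show ?thesis
    proof (cases c)
      case Black
      then have "?a + ?b = k - 1" by (simp add: k_def t(1))
      then show ?thesis unfolding fill Black using ab by (intro shift) (auto simp: m_def)
    next
      case White
      then have k: "?a + ?b = k" by (simp add: k_def t(1))
      show ?thesis
      proof (cases "?a")
        case (Suc a)
        then have "pv (?N White ?a ?b) = pv (?N Black a ?b)" using left[of a ?b] ab by simp
        also have "\<dots> = pv (?N Black m (k - 1 - m))" using ab k Suc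
          by (intro shift) (auto simp: m_def)
        finally show ?thesis unfolding fill White .
      next
        case 0
        then obtain b where b: "?b = Suc b" using k False by (cases ?b) auto
        then have "pv (?N White ?a ?b) = pv (?N Black ?a b)" using right[of b ?a] ab by simp
        also have "\<dots> = pv (?N Black m (k - 1 - m))" using ab k b 0
          by (intro shift) (auto simp: m_def)
        finally show ?thesis unfolding fill White .
      qed
    qed
  qed
  finally show ?case unfolding t(1)[symmetric] k_def Node.hyps(3) .
qed

lemma white_fill:
  assumes "t \<in> CT n"
  shows "\<rho> n (single K (pnt t)) =
    \<rho> n (single K (pnt (colour_fill (map_tree fst t) (black_count t))))"
proof -
  have "colour_fill (map_tree fst t) (black_count t) \<in> CT n"
    by (rule colour_fill_trees[OF coloured_components(1)[OF assms]])
  from tree_val_trees[OF paint_tree[OF field V this]] tree_val_trees[OF paint_tree[OF field V assms]]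
  show ?thesis using paint_val_fill[OF trees_ltrees[OF assms]] by metis
qed

subsection \<open>Canonical colourings of trees with \<open>V\<close>-decorations\<close>

private lemmas mPX = pre_operad_module[OF PPX]
private lemmas mTV = pre_operad_module[OF pre_operad_tree[OF Kc, of "carrier V"]]
private lemmas mTX = pre_operad_module[OF pre_operad_tree[OF Kc, of "carrier X"]]
private lemmas mTC = pre_operad_module[OF pre_operad_tree[OF Kc,
  of "carrier V \<times> (UNIV :: colour set)"]]

text \<open>The colouring with \<open>k\<close> black vertices at the level of trees; followed by
  \<open>\<rho>\<close> it becomes the map abbreviated \<open>sg\<close>, the section \<sigma> for
  the count \<open>k\<close>.\<close>

definition fill_hom :: "nat \<Rightarrow> nat \<Rightarrow> ('v tree \<Rightarrow> 'k) \<Rightarrow> ('v \<times> (colour \<Rightarrow> 'k) \<Rightarrow> 'k) set tree \<Rightarrow> 'k" where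
  "fill_hom k n = free_lift K (space TX n) (\<lambda>s. single K (pnt (colour_fill s k)))"

lemma fill_single_closed: "s \<in> trees (carrier V) n \<Longrightarrow> single K (pnt (colour_fill s k)) \<in>
  carrier (space TX n)"
  by (rule tree_single_closed[OF Kc paint_tree[OF field V colour_fill_trees]])

lemma fill_hom_lin: "fill_hom k n \<in> lin_hom K (space TV n) (space TX n)"
  unfolding fill_hom_def tree_space[OF Kc, of "carrier V"]
    by (rule free_lift_hom[OF mTX fill_single_closed])

lemma fill_hom_single: "s \<in> trees (carrier V) n \<Longrightarrow> fill_hom k n (single K s) =
  single K (pnt (colour_fill s k))"
  unfolding fill_hom_def by (rule free_lift_single[OF mTX fill_single_closed])

private abbreviation (input) "sg k n z \<equiv> \<rho> n (fill_hom k n z)"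

lemma sg_lin: "(\<lambda>z. sg k n z) \<in> lin_hom K (space TV n) (space PX n)"
  by (rule lin_hom_compose[OF fill_hom_lin operad_homD(1)[OF \<rho>_hom]])

lemma sg_act:
  assumes s: "\<sigma> permutes {1..n}" and z: "z \<in> carrier (space TV n)"
  shows "sg k n (act TV n \<sigma> z) = act PX n \<sigma> (sg k n z)"
proof (rule tree_hom_eqI[OF Kc mPX lin_hom_compose[OF pre_operad_act[OF pre_operad_tree[OF Kc] s] sg_lin]
      lin_hom_compose[OF sg_lin pre_operad_act[OF PPX s]] _ z])
  fix t assume t: "t \<in> trees (carrier V) n"
  have "pnt (colour_fill t k) \<in> trees (carrier X) n"
    by (rule paint_tree[OF field V colour_fill_trees[OF t]])
  from tree_hom_relabel[OF Kc \<rho>_hom s this]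
  show "sg k n (act TV n \<sigma> (single K t)) = act PX n \<sigma> (sg k n (single K t))"
    by (simp add: tree_act_single[OF Kc] fill_hom_single[OF t] fill_hom_single[OF trees_relabel_inv[OF s t]]
        colour_fill_relabel relabel_map_tree)
qed

text \<open>The graft of the filled pieces has \<open>j + sum_list \<kappa>\<close> black vertices
  but need not be the preorder filling of the graft; \<open>white_fill\<close> identifies the two in
  the white product. The bounds on \<open>j\<close> and \<open>\<kappa>\<close> ensure that every
  piece really has its prescribed count.\<close>

lemma sg_graft:
  assumes s: "s \<in> trees (carrier V) (length ns)" and ss: "length ss = length ns"
    "\<And>i. i < length ns \<Longrightarrow> ss ! i \<in> trees (carrier V) (ns ! i)"
    and j: "j < length ns" and \<kappa>: "length \<kappa> = length ns" "\<And>i. i < length ns \<Longrightarrow> \<kappa> ! i < ns ! i"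
  shows "sg (j + sum_list \<kappa>) (sum_list ns) (single K (graft ns s ss)) =
    comp PX ns (sg j (length ns) (single K s))
      (map (\<lambda>i. sg (\<kappa> ! i) (ns ! i) (single K (ss ! i))) [0..<length ns])"
proof -
  define us where "us = map (\<lambda>i. colour_fill (ss ! i) (\<kappa> ! i)) [0..<length ns]"
  define g where "g = graft ns (colour_fill s j) us"
  note sD = treesD[OF s]
  have us: "length us = length ns" "\<And>i. i < length ns \<Longrightarrow> us ! i \<in> CT (ns ! i)"
    using colour_fill_trees[OF ss(2)] by (auto simp: us_def)
  have sf: "colour_fill s j \<in> CT (length ns)" by (rule colour_fill_trees[OF s])
  have g: "g \<in> CT (sum_list ns)" unfolding g_def by (rule trees_graft[OF sf us])
  have lab: "1 \<le> i \<and> i \<le> length us" if "i \<in> set (leaves (colour_fill s j))" for i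
    using that sD(3) us(1) by auto
  have map_g: "map_tree fst g = graft ns (map_tree fst (colour_fill s j)) (map (map_tree fst) us)"
    "map_tree snd g = graft ns (map_tree snd (colour_fill s j)) (map (map_tree snd) us)"
    "pnt g = graft ns (pnt (colour_fill s j)) (map pnt us)"
    unfolding g_def by (rule map_tree_graft, rule lab, assumption)+
  have fst_g: "map_tree fst g = graft ns s ss"
  proof -
    have "map (map_tree fst) us = ss" using ss(1) by (auto simp: us_def intro!: nth_equalityI)
    then show ?thesis unfolding map_g by simp
  qed
  have "black_count g = black_count (colour_fill s j) +
    sum_list (map (\<lambda>i. black_count (us ! (i - 1))) (leaves s))"
  proof -
    have e: "map (\<lambda>i. blacks (map (map_tree snd) us ! (i - 1))) (leaves s) =
      map (\<lambda>i. black_count (us ! (i - 1))) (leaves s)"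
    proof (intro map_cong refl)
      fix i assume "i \<in> set (leaves s)"
      then have "i - 1 < length us" using lab[of i] by auto
      then show "blacks (map (map_tree snd) us ! (i - 1)) = black_count (us ! (i - 1))" by simp
    qed
    show ?thesis unfolding map_g blacks_graft by (simp only: leaves_map_tree leaves_colour_fill e)
  qed
  also have "map (\<lambda>i. black_count (us ! (i - 1))) (leaves s) = map (\<lambda>i. \<kappa> ! (i - 1)) (leaves s)"
  proof (intro map_cong refl)
    fix i assume "i \<in> set (leaves s)"
    then have i: "i - 1 < length ns" using sD(3) by auto
    have "\<kappa> ! (i - 1) < length (leaves (ss ! (i - 1)))" using \<kappa>(2)[OF i] treesD(4)[OF ss(2)[OF i]]
      by simp
    from black_count_fill[OF this] i show "black_count (us ! (i - 1)) = \<kappa> ! (i - 1)"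
      by (simp add: us_def)
  qed
  also have "sum_list (map (\<lambda>i. \<kappa> ! (i - 1)) (leaves s)) = sum_list \<kappa>"
    using sD(2,3) \<kappa>(1) by (intro sum_list_labels) simp_all
  also have "black_count (colour_fill s j) = j" using j sD(4) by (intro black_count_fill) simp
  finally have black_g: "black_count g = j + sum_list \<kappa>" .
  have "sg (j + sum_list \<kappa>) (sum_list ns) (single K (graft ns s ss)) =
    \<rho> (sum_list ns) (single K (pnt g))"
    using fill_hom_single[OF trees_graft[OF s ss]] white_fill[OF g] by (simp add: fst_g black_g)
  also have "\<dots> = comp PX ns (\<rho> (length ns) (single K (pnt (colour_fill s j))))
      (map2 (\<lambda>n t. \<rho> n (single K t)) ns (map pnt us))"
    unfolding map_g(3)
      by (rule tree_hom_graft[OF Kc \<rho>_hom]) (use paint_tree[OF field V sf] paint_tree[OF field V us(2)] us(1) in auto)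
  also have "map2 (\<lambda>n t. \<rho> n (single K t)) ns (map pnt us) =
    map (\<lambda>i. sg (\<kappa> ! i) (ns ! i) (single K (ss ! i))) [0..<length ns]"
    using us(1) ss by (intro nth_equalityI) (auto simp: us_def fill_hom_single)
  also have "\<rho> (length ns) (single K (pnt (colour_fill s j))) = sg j (length ns) (single K s)"
    by (simp add: fill_hom_single[OF s])
  finally show ?thesis .
qed

lemma sg_composable:
  assumes "composable TV ns e es"
  shows "composable PX ns (sg j (length ns) e) (map (\<lambda>i. sg (\<kappa> ! i) (ns ! i) (es ! i)) [0..<length ns])"
  using assms lin_hom_closed[OF sg_lin] by (auto simp: composable_iff)

lemma sg_comp:
  assumes c: "composable TV ns e es"
    and j: "j < length ns" and \<kappa>: "length \<kappa> = length ns" "\<And>i. i < length ns \<Longrightarrow> \<kappa> ! i < ns ! i"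
  shows "sg (j + sum_list \<kappa>) (sum_list ns) (comp TV ns e es) =
    comp PX ns (sg j (length ns) e) (map (\<lambda>i. sg (\<kappa> ! i) (ns ! i) (es ! i)) [0..<length ns])"
proof -
  let ?G = "\<lambda>n. single K ` trees (carrier V) n"
  let ?l = "\<lambda>es. map (\<lambda>i. sg (\<kappa> ! i) (ns ! i) (es ! i)) [0..<length ns]"
  have G: "?G n \<subseteq> carrier (space TV n)" for n using tree_single_closed[OF Kc] by blast
  have span: "lin_span K (space TV n) (?G n) = carrier (space TV n)" for n
    using free_module_span[OF Kc] unfolding tree_space[OF Kc] .
  show ?thesis
  proof (rule composable_span_induct[OF pre_operad_tree[OF Kc], where E =
    "?G (length ns)" and ns = ns
        and G = "\<lambda>i. ?G (ns ! i)" and Q =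
          "\<lambda>e es. sg (j + sum_list \<kappa>) (sum_list ns) (comp TV ns e es) =
          comp PX ns (sg j (length ns) e) (?l es)"])
    show "submodule {x \<in>
      carrier (space TV (length ns)). sg (j + sum_list \<kappa>) (sum_list ns) (comp TV ns x es) =
        comp PX ns (sg j (length ns) x) (?l es)} K (space TV (length ns))"
      if c: "composable TV ns e es" for e es
      by (rule submodule_equaliser[OF mTV mPX lin_hom_compose[OF pre_operad_root[OF pre_operad_tree[OF Kc] c] sg_lin]
            lin_hom_compose[OF sg_lin pre_operad_root[OF PPX sg_composable[OF c]]]])
    show "submodule {x \<in>
      carrier (space TV (ns ! i)). sg (j + sum_list \<kappa>) (sum_list ns) (comp TV ns e (es[i := x])) =
        comp PX ns (sg j (length ns) e) (?l (es[i := x]))} K (space TV (ns ! i))"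
      if c: "composable TV ns e es" and i: "i < length ns" for e es i
    proof -
      have "?l (es[i := x]) = (?l es)[i := sg (\<kappa> ! i) (ns ! i) x]" for x
      proof (rule nth_equalityI)
        fix m assume "m < length (?l (es[i := x]))"
        then show "?l (es[i := x]) ! m = (?l es)[i := sg (\<kappa> ! i) (ns ! i) x] ! m"
          using c i by (cases "m = i") (auto simp: composable_iff)
      qed simp
      then show ?thesis
        using submodule_equaliser[OF mTV mPX lin_hom_compose[OF pre_operad_arg[OF pre_operad_tree[OF Kc] c i] sg_lin]
            lin_hom_compose[OF sg_lin pre_operad_arg[OF PPX sg_composable[OF c] i]]] by simp
    qed
    fix e es assume e: "e \<in> ?G (length ns)" and es: "length es = length ns"
      "\<And>i. i < length ns \<Longrightarrow> es ! i \<in> ?G (ns ! i)"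
    obtain s where s: "s \<in> trees (carrier V) (length ns)" "e = single K s" using e by auto
    obtain u where u: "\<And>i. i < length ns \<Longrightarrow> u i \<in> trees (carrier V) (ns ! i) \<and> es ! i =
      single K (u i)"
      using es(2) unfolding image_iff by metis
    define ss where "ss = map u [0..<length ns]"
    have ss: "length ss = length ns" "\<And>i. i < length ns \<Longrightarrow> ss ! i \<in> trees (carrier V) (ns ! i)"
      and es': "es = map (single K) ss"
      using u es(1) by (auto simp: ss_def intro!: nth_equalityI)
    have l: "?l es = map (\<lambda>i. sg (\<kappa> ! i) (ns ! i) (single K (ss ! i))) [0..<length ns]"
      using ss(1) by (intro map_cong refl) (simp add: es')
    have ce: "comp TV ns e es = single K (graft ns s ss)"
      unfolding s(2) es' by (rule tree_comp_single[OF Kc])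
    show "sg (j + sum_list \<kappa>) (sum_list ns) (comp TV ns e es) =
      comp PX ns (sg j (length ns) e) (?l es)"
      unfolding l ce unfolding s(2) by (rule sg_graft[OF s(1) ss j \<kappa>])
  next
    show "e \<in> lin_span K (space TV (length ns)) (?G (length ns))"
      using c by (simp add: span composable_iff)
    show "es ! i \<in> lin_span K (space TV (ns ! i)) (?G (ns ! i))" if "i < length ns" for i
      using c that by (simp add: span composable_iff)
    show "length es = length ns" using c by (simp add: composable_iff)
  qed (rule G)+
qed

text \<open>An operadic ideal that contains the relations of the quadratic operad on \<open>V\<close>; hence every colouring of an element that vanishes there vanishes in the white product.\<close>

definition white_ideal :: "nat \<Rightarrow> ('v tree \<Rightarrow> 'k) set" where
  "white_ideal n = {z \<in> carrier (space TV n). \<forall>k<n. sg k n z = \<zero>\<^bsub>space PX n\<^esub>}"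

lemma tree_space_0: "z \<in> carrier (space TV 0) \<Longrightarrow> z = \<zero>\<^bsub>space TV 0\<^esub>"
proof -
  have "trees (carrier V) 0 = {}" by (auto simp: trees_def)
  then show "z \<in> carrier (space TV 0) \<Longrightarrow> z = \<zero>\<^bsub>space TV 0\<^esub>"
    by (auto simp: tree_space[OF Kc] free_module_simps supp_def)
qed

text \<open>For each \<open>k\<close>, \<open>black_distribution\<close> chooses counts for the
  factors within the ranges over which \<open>white_ideal\<close> quantifies. A factor in
  \<open>white_ideal\<close> therefore has a vanishing colouring, and by \<open>sg_comp\<close> so
  has the composite.\<close>

lemma operad_ideal_white: "operad_ideal K TV white_ideal"
  unfolding operad_ideal_def S_submodule_def
proof (intro conjI allI impI ballI)
  show "submodule (white_ideal n) K (space TV n)" for n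
  proof -
    interpret T: module K "space TV n" by (rule mTV)
    interpret P: module K "space PX n" by (rule mPX)
    show ?thesis
      unfolding T.submodule_iff white_ideal_def
      using lin_hom_zero[OF mTV mPX sg_lin] lin_hom_add[OF sg_lin] lin_hom_smult[OF sg_lin] by auto
  qed
  show "act TV n \<sigma> x \<in> white_ideal n" if s: "\<sigma> permutes {1..n}" and x: "x \<in> white_ideal n" for n \<sigma> x
  proof -
    have x': "x \<in> carrier (space TV n)" using x by (simp add: white_ideal_def)
    then show ?thesis
      using x act_closed[OF pre_operad_tree[OF Kc] s x'] lin_hom_zero[OF mPX mPX pre_operad_act[OF PPX s]]
      by (simp add: white_ideal_def sg_act[OF s])
  qed
  fix ns e es
  assume a: "composable TV ns e es \<and> (e \<in> white_ideal (length ns) \<or> (\<exists>i<length ns. es ! i \<in>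
    white_ideal (ns ! i)))"
  then have c: "composable TV ns e es" by simp
  note cD = c[unfolded composable_iff]
  have cc: "comp TV ns e es \<in> carrier (space TV (sum_list ns))"
    by (rule comp_closed[OF pre_operad_tree[OF Kc] c])
  have zero: "comp TV ns e es \<in> white_ideal (sum_list ns)" if "comp TV ns e es =
    \<zero>\<^bsub>space TV (sum_list ns)\<^esub>"
    using that cc lin_hom_zero[OF mTV mPX sg_lin] by (simp add: white_ideal_def)
  show "comp TV ns e es \<in> white_ideal (sum_list ns)"
  \<comment> \<open>Without inputs, or with an input of arity 0, the counts cannot be distributed.
    But no tree is without leaves, so the space of arity 0 is zero and some factor vanishes.\<close>
  proof (cases "ns = []")
    case True
    have "e = \<zero>\<^bsub>space TV (length ns)\<^esub>" using tree_space_0[of e] cD True by simp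
    then show ?thesis using zero comp_zero_root[OF pre_operad_tree[OF Kc] c] by blast
  next
    case ne: False
    show ?thesis
    proof (cases "\<exists>i<length ns. ns ! i = 0")
      case True
      then obtain i where i: "i < length ns" "ns ! i = 0" by blast
      then have "es ! i = \<zero>\<^bsub>space TV (ns ! i)\<^esub>" using tree_space_0[of "es ! i"] cD by auto
      then show ?thesis using zero comp_zero_arg[OF pre_operad_tree[OF Kc] c i(1)] by blast
    next
      case False
      then have pos: "0 < ns ! i" if "i < length ns" for i using that by auto
      have "sg k (sum_list ns) (comp TV ns e es) =
        \<zero>\<^bsub>space PX (sum_list ns)\<^esub>" if k: "k < sum_list ns" for k
      proof -
        obtain j \<kappa> where j: "j < length ns" and \<kappa>: "length \<kappa> = length ns"
          "\<forall>i<length ns. \<kappa> ! i < ns ! i"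
          and kj: "k = j + sum_list \<kappa>" using black_distribution[OF pos ne k] by blast
        have eq: "sg k (sum_list ns) (comp TV ns e es) =
          comp PX ns (sg j (length ns) e) (map (\<lambda>i. sg (\<kappa> ! i) (ns ! i) (es ! i)) [0..<length ns])"
          unfolding kj using \<kappa> by (intro sg_comp[OF c j]) auto
        from a show ?thesis
        proof (elim conjE disjE exE)
          assume "e \<in> white_ideal (length ns)"
          then show ?thesis unfolding eq using j
            by (intro comp_zero_root[OF PPX sg_composable[OF c]]) (simp add: white_ideal_def)
        next
          fix i assume "i < length ns" "es ! i \<in> white_ideal (ns ! i)"
          then show ?thesis unfolding eq using \<kappa>
            by (intro comp_zero_arg[OF PPX sg_composable[OF c],
              of i]) (simp_all add: white_ideal_def)
        qed
      qed
      then show ?thesis using cc by (simp add: white_ideal_def)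
    qed
  qed
qed

text \<open>On a tree with one vertex the colour depends on \<open>k\<close> alone, so the coloured
  decoration is linear in \<open>v\<close>; the twist fixes the colour and acts on \<open>v\<close>
  only.\<close>

lemma decoration_rel_white_ideal: "decoration_rel K V \<subseteq> white_ideal 2"
proof -
  have "sg k 2 r = \<zero>\<^bsub>space PX 2\<^esub>" if r: "r \<in> decoration_rel K V" for k r
  proof -
    let ?c = "single K (if k = 0 then White else Black)"
    have c: "?c \<in> carrier W" by (rule com2_single_closed[OF Kc])
    have op: "Node v (Leaf 2) (Leaf 1) \<in> trees (carrier V) 2" if "v \<in> carrier V" for v
      using that by (auto simp: trees_def)
    have 1: "sg k 2 (corolla K v) = \<rho> 2 (corolla K (tns v ?c))" "sg k 2 (op_corolla K v) =
      \<rho> 2 (op_corolla K (tns v ?c))"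
      if "v \<in> carrier V" for v
      using fill_hom_single[OF corolla_trees[OF that]] fill_hom_single[OF op[OF that]]
      by (simp_all add: corolla_def op_corolla_def paint_def[OF field V])
    have "(\<lambda>v. \<rho> 2 (corolla K (tns v ?c))) \<in> lin_hom K V (space PX 2)"
      using lin_hom_compose[OF tens_homl[OF mV mW c] rep_homD(2)[OF \<rho>_rep,
        unfolded lin_hom_tensor_s2]] .
    then have "(\<lambda>v. sg k 2 (corolla K v)) \<in> lin_hom K V (space PX 2)"
      by (rule lin_hom_cong[OF mV]) (simp add: 1)
    moreover have "sg k 2 (op_corolla K v) = sg k 2 (corolla K (twist V v))" if v: "v \<in>
      carrier V" for v
    proof -
      have "tns v ?c \<in> carrier X" unfolding tensor_s2_simps by (rule tens_closed[OF mV mW v c])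
      from rep_homD(3)[OF \<rho>_rep this] show ?thesis
        using 1(2)[OF v] 1(1)[OF s2_moduleD(4)[OF V v]] twist_tens[OF V sW v c]
          by (simp add: com2_gens_simps(4))
    qed
    ultimately show ?thesis using decoration_rel_kernel_iff[OF V mPX sg_lin] r by blast
  qed
  then show ?thesis using decoration_rel_carrier[OF V] by (auto simp: white_ideal_def)
qed

text \<open>On every tree, \<open>\<Phi>\<close> of the colouring differs from the tensor with a
  fixed class \<open>y0\<close> by a tensor whose second factor is a relation, since both second
  factors have \<open>k\<close> black vertices. This extends linearly. If \<open>x\<close>
  represents a relation, its tensor with \<open>y0\<close> lies in \<open>SP\<close> as well, hence
  so does \<open>\<Phi>\<close> of the colouring of \<open>x\<close>.\<close>

lemma relation_white_ideal:
  assumes x: "x \<in> carrier (space TV 3)" and r: "free_class K V 3 x \<in> R"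
  shows "x \<in> white_ideal 3"
proof -
  have "sg k 3 x = \<zero>\<^bsub>space PX 3\<^esub>" if k: "k < 3" for k
  proof -
    \<comment> \<open>Any coloured tree with three leaves and \<open>k\<close> black vertices serves
      as reference; \<open>k < 3\<close> guarantees that the comb has that count.\<close>
    define s0 where "s0 = right_comb k [1, 2, 3]"
    have s0: "s0 \<in> trees UNIV 3" "blacks s0 = k"
      using k unfolding s0_def trees_def atLeastAtMost_3
        by (auto simp: leaves_right_comb blacks_right_comb)
    define y0 where "y0 = free_class K W 3 (single K (single_tree K s0))"
    have y0: "y0 \<in> carrier FW3" unfolding y0_def by (rule free_class_single_closed(2)[OF s0(1)])
    interpret T: module K "tensor K FV3 FW3" by (rule mT)
    define F where "F z = white_map K V W (free_class K X 3 (fill_hom k 3 z))" for z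
    define G where "G z = tens K FV3 FW3 (free_class K V 3 z) y0" for z
    have F: "F \<in> lin_hom K (space TV 3) (tensor K FV3 FW3)"
      unfolding F_def
      by (rule lin_hom_compose[OF lin_hom_compose[OF fill_hom_lin operad_homD(1)[OF free_class_hom[OF sX]]] white_map_hom[OF field V]])
    have G: "G \<in> lin_hom K (space TV 3) (tensor K FV3 FW3)"
      unfolding G_def by (rule lin_hom_compose[OF operad_homD(1)[OF free_class_hom[OF V]] tens_homl[OF mFV mFW y0]])
    let ?m = "\<ominus>\<^bsub>K\<^esub> \<one>\<^bsub>K\<^esub>"
    have "(\<lambda>z. F z \<oplus>\<^bsub>tensor K FV3 FW3\<^esub> (?m \<odot>\<^bsub>tensor K FV3 FW3\<^esub> G z)) \<in> lin_hom K (space TV 3)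
      (tensor K FV3 FW3)"
      by (rule lin_hom_sum[OF mTV mT F lin_hom_compose[OF G smult_lin_hom[OF mT T.carrier_is_submodule]]]) simp
    then have D: "(\<lambda>z. F z \<ominus>\<^bsub>tensor K FV3 FW3\<^esub> G z) \<in> lin_hom K (space TV 3) (tensor K FV3 FW3)"
      by (rule lin_hom_cong[OF mTV]) (simp add: T.minus_eq T.a_inv_smult lin_hom_closed[OF G])
    have "submodule {z \<in> carrier (space TV 3). F z \<ominus>\<^bsub>tensor K FV3 FW3\<^esub> G z \<in> SP} K (space TV 3)"
      by (rule submodule_vimage[OF mTV mT D submodule_white_span])
    moreover have "single K s \<in> {z \<in> carrier (space TV 3). F z \<ominus>\<^bsub>tensor K FV3 FW3\<^esub> G z \<in> SP}"
      if s: "s \<in> trees (carrier V) 3" for s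
    proof -
      let ?t = "colour_fill s k"
      let ?u = "free_class K W 3 (single K (single_tree K (map_tree snd ?t)))" and ?y =
        "free_class K V 3 (single K s)"
      have t: "?t \<in> CT 3" by (rule colour_fill_trees[OF s])
      have bt: "black_count ?t = k" using k treesD(4)[OF s] by (intro black_count_fill) simp
      have y: "?y \<in> carrier FV3" by (rule free_class_single_closed(1)[OF s])
      have u: "?u \<in> carrier FW3"
        by (rule free_class_single_closed(2)[OF coloured_components(2)[OF t]])
      have "F (single K s) = tens K FV3 FW3 ?y ?u"
        unfolding F_def fill_hom_single[OF s] white_map_paint[OF t] by simp
      then have "F (single K s) \<ominus>\<^bsub>tensor K FV3 FW3\<^esub> G (single K s) = tens K FV3 FW3 ?y (?u \<ominus>\<^bsub>FW3\<^esub> y0)"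
        using lin_hom_diff[OF mFW mT tens_homr[OF mFV mFW y] u y0] by (simp add: G_def)
      also have "\<dots> \<in> SP"
        by (rule white_span_right[OF y])
          (use com2_rels_mem[OF field coloured_components(2)[OF t] s0(1)] bt s0(2) in
            \<open>simp add: y0_def tree_class_eq[OF sW]\<close>)
      finally show ?thesis using tree_single_closed[OF Kc s] by simp
    qed
    ultimately have "carrier (space TV 3) \<subseteq> {z \<in> carrier (space TV 3). F z \<ominus>\<^bsub>tensor K FV3 FW3\<^esub> G z \<in>
      SP}"
      unfolding tree_space[OF Kc] by (rule free_module_subsetI[OF Kc])
    then have d: "F x \<ominus>\<^bsub>tensor K FV3 FW3\<^esub> G x \<in> SP" using x by blast
    have "G x \<in> SP" unfolding G_def by (rule white_span_left[OF r y0])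
    with d have "(F x \<ominus>\<^bsub>tensor K FV3 FW3\<^esub> G x) \<oplus>\<^bsub>tensor K FV3 FW3\<^esub> G x \<in> SP"
      using submodule_white_span unfolding T.submodule_iff by blast
    moreover have "(F x \<ominus>\<^bsub>tensor K FV3 FW3\<^esub> G x) \<oplus>\<^bsub>tensor K FV3 FW3\<^esub> G x = F x"
      using lin_hom_closed[OF F x] lin_hom_closed[OF G x]
        by (simp add: T.minus_eq T.M.a_assoc T.M.l_neg)
    ultimately have "F x \<in> SP" by simp
    have cl: "fill_hom k 3 x \<in> carrier (space TX 3)" by (rule lin_hom_closed[OF fill_hom_lin x])
    have "free_class K X 3 (fill_hom k 3 x) \<in> wr"
      using \<open>F x \<in> SP\<close> free_class_closed[OF sX white_rel_carrier cl]
        by (simp add: white_rel_iff F_def)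
    then have "free_class K X 3 (fill_hom k 3 x) \<in> relation_ideal K X wr 3"
      using relation_ideal_superset[OF sX white_rel_carrier] by blast
    then show ?thesis
      using quad_class_zero_iff[OF sX white_rel_carrier cl] by (simp add: white_product_def)
  qed
  then show ?thesis using x by (simp add: white_ideal_def)
qed

lemma quad_class_zero_white_ideal:
  "x \<in> carrier (space TV n) \<Longrightarrow> quad_class K V R n x = \<zero>\<^bsub>space (quadratic_operad K V R) n\<^esub> \<Longrightarrow> x \<in>
    white_ideal n"
  by (rule quad_class_kernel[OF V R operad_ideal_white decoration_rel_white_ideal relation_white_ideal])

subsection \<open>The canonical morphism\<close>

private abbreviation (input) "OP \<equiv> quadratic_operad K V R"
private abbreviation (input) "CP \<equiv> quadratic_operad K W (com2_rels K)"
private abbreviation (input) "had \<equiv> hadamard K OP CP"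
private abbreviation (input) "\<pi>V \<equiv> quad_class K V R"
private abbreviation (input) "\<pi>W \<equiv> quad_class K W (com2_rels K)"
private abbreviation (input) "htens n \<equiv> tens K (space OP n) (space CP n)"

private lemmas POP = pre_operad_quadratic[OF V R]
private lemmas PCP = pre_operad_quadratic[OF sW S]
private lemmas mOP = pre_operad_module[OF POP]
private lemmas mCP = pre_operad_module[OF PCP]
private lemmas Phad = pre_operad_hadamard[OF POP PCP]
private lemmas mhad = pre_operad_module[OF Phad]
private lemmas \<pi>V_rep = quad_class_rep_hom[OF V R]
private lemmas \<pi>W_rep = quad_class_rep_hom[OF sW S]

private abbreviation (input) "th \<equiv> tensor_hom K V OP CP \<pi>V \<pi>W"

private lemmas th_rep = tensor_hom_rep_hom[OF field V POP PCP \<pi>V_rep \<pi>W_rep]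
private lemmas th_lin = operad_homD(1)[OF rep_homD(1)[OF th_rep]]

lemma tensor_hom_paint:
  assumes "t \<in> CT n"
  shows "th n (single K (pnt t)) =
    htens n (\<pi>V n (single K (map_tree fst t))) (\<pi>W n (single K (single_tree K (map_tree snd t))))"
  using tensor_hom_tens_tree[OF field V POP PCP \<pi>V_rep \<pi>W_rep tens_colour_trees[OF assms]]
  unfolding tens_paint .

private abbreviation (input) "pext \<equiv> lin_ext K pnt"

private lemmas paint_lin = operad_homD(1)[OF paint_hom[OF field V]]

text \<open>\<open>\<Theta>\<close> is the tensor product of the two projections and kills
  \<open>SP\<close>. On painted trees \<open>th\<close> is \<open>\<Theta>\<close> after
  \<open>\<Phi>\<close>, and every class has a painted representative, so whatever
  \<open>\<Phi>\<close> sends into \<open>SP\<close> becomes zero.\<close>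

lemma tensor_hom_white_rel:
  assumes x: "x \<in> carrier (space TX 3)" and r: "free_class K X 3 x \<in> wr"
  shows "th 3 x = \<zero>\<^bsub>space had 3\<^esub>"
proof -
  let ?H = "tensor K (space OP 3) (space CP 3)"
  note mH = module_tensor[OF mOP[of 3] mCP[of 3]]
  let ?qV = "quot_class (free_operad K V) (relation_ideal K V R) 3"
  let ?qW = "quot_class (free_operad K W) (relation_ideal K W (com2_rels K)) 3"
  note qV = operad_homD(1)[OF quot_class_quadratic[OF V R], of 3]
  note qW = operad_homD(1)[OF quot_class_quadratic[OF sW S], of 3]
  have bl: "(\<lambda>a. htens 3 (?qV a) (?qW y)) \<in> lin_hom K FV3 ?H" if "y \<in> carrier FW3" for y
    by (rule lin_hom_compose[OF qV tens_homl[OF mOP mCP lin_hom_closed[OF qW that]]])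
  have br: "(\<lambda>y. htens 3 (?qV a) (?qW y)) \<in> lin_hom K FW3 ?H" if "a \<in> carrier FV3" for a
    by (rule lin_hom_compose[OF qW tens_homr[OF mOP mCP lin_hom_closed[OF qV that]]])
  obtain \<Theta> where \<Theta>: "\<Theta> \<in> lin_hom K (tensor K FV3 FW3) ?H"
    "\<And>a y. a \<in> carrier FV3 \<Longrightarrow> y \<in> carrier FW3 \<Longrightarrow> \<Theta> (tens K FV3 FW3 a y) = htens 3 (?qV a) (?qW y)"
    using tensor_lift[OF mFV mFW mH bl br] by blast
  have qV0: "?qV s = \<zero>\<^bsub>space OP 3\<^esub>" if "s \<in> S_span K (free_operad K V) 3 R" for s
    using that S_span_relation_ideal[OF V R] S_span_carrier(1)
      quot_class_eq_zero_iff[OF pre_operad_free[OF V] submodule_relation_ideal[OF V R], of s 3]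
    by (auto simp: quadratic_operad_def)
  have qW0: "?qW s = \<zero>\<^bsub>space CP 3\<^esub>" if "s \<in> S_span K (free_operad K W) 3 (com2_rels K)" for s
    using that S_span_relation_ideal[OF sW S] S_span_carrier(2)
      quot_class_eq_zero_iff[OF pre_operad_free[OF sW] submodule_relation_ideal[OF sW S], of s 3]
    by (auto simp: quadratic_operad_def)
  have "SP \<subseteq> {z \<in> carrier (tensor K FV3 FW3). \<Theta> z = \<zero>\<^bsub>?H\<^esub>}"
  proof (rule lin_span_least[OF submodule_kernel[OF mT mH \<Theta>(1)]], rule Un_least)
    show "{tens K FV3 FW3 r y | r y. r \<in> S_span K (free_operad K V) 3 R \<and> y \<in> carrier FW3}
      \<subseteq> {z \<in> carrier (tensor K FV3 FW3). \<Theta> z = \<zero>\<^bsub>?H\<^esub>}"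
    proof clarify
      fix s y assume s: "s \<in> S_span K (free_operad K V) 3 R" and y: "y \<in> carrier FW3"
      have "s \<in> carrier FV3" using s S_span_carrier(1) by blast
      then show "tens K FV3 FW3 s y \<in> carrier (tensor K FV3 FW3) \<and> \<Theta> (tens K FV3 FW3 s y) = \<zero>\<^bsub>?H\<^esub>"
        using y \<Theta>(2) qV0[OF s] tens_closed[OF mFV mFW] lin_hom_closed[OF qW y]
          lin_hom_zero[OF mOP mH tens_homl[OF mOP mCP]] by simp
    qed
    show "{tens K FV3 FW3 y s | y s. y \<in> carrier FV3 \<and> s \<in>
      S_span K (free_operad K W) 3 (com2_rels K)}
      \<subseteq> {z \<in> carrier (tensor K FV3 FW3). \<Theta> z = \<zero>\<^bsub>?H\<^esub>}"
    proof clarify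
      fix y s assume y: "y \<in> carrier FV3" and s: "s \<in> S_span K (free_operad K W) 3 (com2_rels K)"
      have "s \<in> carrier FW3" using s S_span_carrier(2) by blast
      then show "tens K FV3 FW3 y s \<in> carrier (tensor K FV3 FW3) \<and> \<Theta> (tens K FV3 FW3 y s) = \<zero>\<^bsub>?H\<^esub>"
        using y \<Theta>(2) qW0[OF s] tens_closed[OF mFV mFW] lin_hom_closed[OF qV y]
          lin_hom_zero[OF mCP mH tens_homr[OF mOP mCP]] by simp
    qed
  qed
  then have kills: "\<Theta> (white_map K V W (free_class K X 3 x)) = \<zero>\<^bsub>?H\<^esub>" using r
    by (auto simp: white_rel_iff)
  \<comment> \<open>\<open>white_map_paint\<close> computes \<open>\<Phi>\<close> on painted trees
    only, so \<open>x\<close> is replaced by a painted representative of its class;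
    \<open>th\<close> does not notice, because it factors through \<open>free_class\<close>.\<close>
  obtain y where y: "y \<in> carrier (space TC 3)" "free_class K X 3 x = free_class K X 3 (pext y)"
    using rep_hom_paint_range[OF field V pre_operad_free[OF sX] free_class_rep_hom[OF sX] x]
      by blast
  obtain g where g: "operad_hom K (free_operad K X) had g"
    "\<And>n x. x \<in> carrier (space TX n) \<Longrightarrow> g n (free_class K X n x) = th n x"
    using free_operad_lift[OF sX Phad th_rep] by blast
  have "th 3 x = th 3 (pext y)"
    using g(2)[OF x] g(2)[OF lin_hom_closed[OF paint_lin y(1)]] y(2) by simp
  also have "\<dots> = \<Theta> (white_map K V W (free_class K X 3 (pext y)))"
  proof (rule tree_hom_eqI[OF Kc mH _ _ _ y(1)])
    show "(\<lambda>y. th 3 (pext y)) \<in> lin_hom K (space TC 3) ?H"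
      using lin_hom_compose[OF paint_lin th_lin] unfolding hadamard_space[OF POP PCP] .
    show "(\<lambda>y. \<Theta> (white_map K V W (free_class K X 3 (pext y)))) \<in> lin_hom K (space TC 3) ?H"
      by (rule lin_hom_compose[OF lin_hom_compose[OF lin_hom_compose[OF paint_lin
              operad_homD(1)[OF free_class_hom[OF sX]]] white_map_hom[OF field V]] \<Theta>(1)])
    show "th 3 (pext (single K t)) =
      \<Theta> (white_map K V W (free_class K X 3 (pext (single K t))))" if t: "t \<in> CT 3" for t
      unfolding lin_ext_single[OF Kc] tensor_hom_paint[OF t] white_map_paint[OF t]
        \<Theta>(2)[OF free_class_single_closed(1)[OF coloured_components(1)[OF t]]
          free_class_single_closed(2)[OF coloured_components(2)[OF t]]]
      by (simp add: quad_class_def[OF V R] quad_class_def[OF sW S])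
  qed
  also have "\<dots> = \<zero>\<^bsub>?H\<^esub>" using kills y(2) by simp
  finally show ?thesis unfolding hadamard_space[OF POP PCP] .
qed

lemma white_canonical_exists:
  obtains f where "operad_hom K PX had f" "\<And>n x. x \<in> carrier (space TX n) \<Longrightarrow> f n (\<rho> n x) = th n x"
  using quadratic_lift[OF sX white_rel_carrier Phad th_rep tensor_hom_white_rel]
  unfolding white_product_def by blast

subsection \<open>Injectivity\<close>

text \<open>The coefficient of the k-th power with colours forgotten. It is defined on coloured
  trees, before any relation is imposed, so it can be prescribed freely on the basis.\<close>

definition shape_part :: "nat \<Rightarrow> nat \<Rightarrow> (('v \<times> colour) tree \<Rightarrow> 'k) \<Rightarrow> 'v tree \<Rightarrow> 'k" where
  "shape_part k n = free_lift K (space TV n)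
    (\<lambda>t. if black_count t = k then single K (map_tree fst t) else \<zero>\<^bsub>space TV n\<^esub>)"

lemma shape_part_closed:
  assumes "t \<in> CT n"
  shows "(if black_count t = k then single K (map_tree fst t) else \<zero>\<^bsub>space TV n\<^esub>) \<in>
    carrier (space TV n)"
proof -
  interpret T: module K "space TV n" by (rule mTV)
  show ?thesis using tree_single_closed[OF Kc coloured_components(1)[OF assms]] by simp
qed

lemma shape_part_lin: "shape_part k n \<in> lin_hom K (space TC n) (space TV n)"
  unfolding shape_part_def tree_space[OF Kc, of "carrier V \<times> UNIV"]
    by (rule free_lift_hom[OF mTV shape_part_closed])

lemma shape_part_single:
  "t \<in> CT n \<Longrightarrow> shape_part k n (single K t) = (if black_count t =
    k then single K (map_tree fst t) else \<zero>\<^bsub>space TV n\<^esub>)"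
  unfolding shape_part_def by (rule free_lift_single[OF mTV shape_part_closed])

text \<open>By \<open>white_fill\<close> a painted tree equals the filling of its shape with its own
  count, and only the summand of that count survives. The range of \<open>k\<close> is exhaustive
  because a tree with \<open>n\<close> leaves has fewer than \<open>n\<close> vertices.\<close>

lemma white_recombine:
  assumes y: "y \<in> carrier (space TC n)"
  shows "\<rho> n (pext y) = finsum (space PX n) (\<lambda>k. sg k n (shape_part k n y)) {..<n}"
proof (rule tree_hom_eqI[OF Kc mPX lin_hom_compose[OF paint_lin operad_homD(1)[OF \<rho>_hom]] _ _ y])
  interpret P: module K "space PX n" by (rule mPX)
  show "(\<lambda>y. finsum (space PX n) (\<lambda>k. sg k n (shape_part k n y)) {..<n}) \<in>
    lin_hom K (space TC n) (space PX n)"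
    by (rule lin_hom_finsum_fun[OF mTC mPX]) (auto intro: lin_hom_compose[OF shape_part_lin sg_lin])
  fix t assume t: "t \<in> CT n"
  let ?k = "black_count t"
  have k: "?k < n" using black_count_less[of t] treesD(4)[OF t] by simp
  have z: "\<rho> n (single K (pnt t)) \<in> carrier (space PX n)"
    by (rule lin_hom_closed[OF operad_homD(1)[OF \<rho>_hom] tree_single_closed[OF Kc paint_tree[OF field V t]]])
  have "finsum (space PX n) (\<lambda>k. sg k n (shape_part k n (single K t))) {..<n} =
    finsum (space PX n) (\<lambda>k. if ?k = k then \<rho> n (single K (pnt t)) else \<zero>\<^bsub>space PX n\<^esub>) {..<n}"
  proof (rule P.finsum_cong')
    fix k
    show "sg k n (shape_part k n (single K t)) = (if ?k =
      k then \<rho> n (single K (pnt t)) else \<zero>\<^bsub>space PX n\<^esub>)"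
      using white_fill[OF t] fill_hom_single[OF coloured_components(1)[OF t]] lin_hom_zero[OF mTV mPX sg_lin]
      by (simp add: shape_part_single[OF t])
  qed (use z in auto)
  also have "\<dots> = \<rho> n (single K (pnt t))"
    using P.finsum_singleton[of ?k "{..<n}" "\<lambda>_. \<rho> n (single K (pnt t))"] k z by simp
  finally show "\<rho> n (pext (single K t)) =
    finsum (space PX n) (\<lambda>k. sg k n (shape_part k n (single K t))) {..<n}"
    by (simp add: lin_ext_single[OF Kc])
qed

lemma shape_part_zero:
  assumes y: "y \<in> carrier (space TC n)" and th0: "th n (pext y) = \<zero>\<^bsub>space had n\<^esub>"
  shows "\<pi>V n (shape_part k n y) = \<zero>\<^bsub>space OP n\<^esub>"
proof -
  note mH = module_tensor[OF mOP[of n] mCP[of n]]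
  interpret O: module K "space OP n" by (rule mOP)
  obtain \<gamma> where \<gamma>: "\<And>n k y. y \<in> carrier (space (com2 K) n) \<Longrightarrow> \<gamma> n k y \<in> carrier K"
    "\<And>n k y z. y \<in> carrier (space (com2 K) n) \<Longrightarrow> z \<in> carrier (space (com2 K) n) \<Longrightarrow>
      \<gamma> n k (y \<oplus>\<^bsub>space (com2 K) n\<^esub> z) = \<gamma> n k y \<oplus>\<^bsub>K\<^esub> \<gamma> n k z"
    "\<And>n k a y. a \<in> carrier K \<Longrightarrow> y \<in> carrier (space (com2 K) n) \<Longrightarrow>
      \<gamma> n k (a \<odot>\<^bsub>space (com2 K) n\<^esub> y) = a \<otimes>\<^bsub>K\<^esub> \<gamma> n k y"
    "\<And>n k s. s \<in> trees UNIV n \<Longrightarrow> \<gamma> n k (\<pi>W n (single K (single_tree K s))) = (if blacks s =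
      k then \<one>\<^bsub>K\<^esub> else \<zero>\<^bsub>K\<^esub>)"
    by (rule com2_coeff[OF field]) blast
  note \<gamma> = \<gamma>[unfolded com2_def]
  have bl: "(\<lambda>x. \<gamma> n k c \<odot>\<^bsub>space OP n\<^esub> x) \<in> lin_hom K (space OP n) (space OP n)" if "c \<in>
    carrier (space CP n)" for c
    by (rule smult_lin_hom[OF mOP O.carrier_is_submodule \<gamma>(1)[OF that]])
  have br: "(\<lambda>c. \<gamma> n k c \<odot>\<^bsub>space OP n\<^esub> x) \<in> lin_hom K (space CP n) (space OP n)" if "x \<in>
    carrier (space OP n)" for x
    using that by (intro lin_homI) (simp_all add: \<gamma>(1-3) O.smult_l_distr O.smult_assoc1)
  \<comment> \<open>\<open>h\<close> is the identity of the first factor tensored with the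
    functional \<open>\<gamma> n k\<close>; applied to a painted tree it returns the shape when the
    count is \<open>k\<close>, and zero otherwise.\<close>
  obtain h where h: "h \<in> lin_hom K (tensor K (space OP n) (space CP n)) (space OP n)"
    "\<And>x c. x \<in> carrier (space OP n) \<Longrightarrow> c \<in> carrier (space CP n) \<Longrightarrow> h (htens n x c) =
      \<gamma> n k c \<odot>\<^bsub>space OP n\<^esub> x"
    using tensor_lift[OF mOP mCP mOP bl br] by blast
  have "h (th n (pext y)) = \<pi>V n (shape_part k n y)"
  proof (rule tree_hom_eqI[OF Kc mOP _ lin_hom_compose[OF shape_part_lin operad_homD(1)[OF rep_homD(1)[OF \<pi>V_rep]]] _ y])
    show "(\<lambda>y. h (th n (pext y))) \<in> lin_hom K (space TC n) (space OP n)"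
      by (rule lin_hom_compose[OF lin_hom_compose[OF paint_lin th_lin[unfolded hadamard_space[OF POP PCP]]] h(1)])
    fix t assume t: "t \<in> CT n"
    have a: "\<pi>V n (single K (map_tree fst t)) \<in> carrier (space OP n)"
      by (rule lin_hom_closed[OF operad_homD(1)[OF rep_homD(1)[OF \<pi>V_rep]]
            tree_single_closed[OF Kc coloured_components(1)[OF t]]])
    have c: "\<pi>W n (single K (single_tree K (map_tree snd t))) \<in> carrier (space CP n)"
      by (rule lin_hom_closed[OF operad_homD(1)[OF rep_homD(1)[OF \<pi>W_rep]]
            tree_single_closed[OF Kc col_trees[OF field coloured_components(2)[OF t]]]])
    show "h (th n (pext (single K t))) = \<pi>V n (shape_part k n (single K t))"
      using a lin_hom_zero[OF mTV mOP operad_homD(1)[OF rep_homD(1)[OF \<pi>V_rep]]]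
      by (simp add: lin_ext_single[OF Kc] tensor_hom_paint[OF t] h(2)[OF a c] \<gamma>(4)[OF coloured_components(2)[OF t]]
          shape_part_single[OF t])
  qed
  moreover have "h \<zero>\<^bsub>space had n\<^esub> = \<zero>\<^bsub>space OP n\<^esub>"
    using lin_hom_zero[OF mH mOP h(1)] unfolding hadamard_space[OF POP PCP] .
  ultimately show ?thesis using th0 by simp
qed

lemma white_injective:
  assumes x: "x \<in> carrier (space TX n)" and th0: "th n x = \<zero>\<^bsub>space had n\<^esub>"
    and f: "operad_hom K PX had f" "\<And>n x. x \<in> carrier (space TX n) \<Longrightarrow> f n (\<rho> n x) = th n x"
  shows "\<rho> n x = \<zero>\<^bsub>space PX n\<^esub>"
proof -
  interpret P: module K "space PX n" by (rule mPX)
  obtain y where y: "y \<in> carrier (space TC n)" "\<rho> n x = \<rho> n (pext y)"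
    using rep_hom_paint_range[OF field V PPX \<rho>_rep x] by blast
  \<comment> \<open>\<open>x\<close> and its coloured representative need only agree in the white
    product; \<open>f\<close> shows that \<open>th\<close> depends on nothing more, so the vanishing
    transfers.\<close>
  have "th n (pext y) = \<zero>\<^bsub>space had n\<^esub>"
    using f(2)[OF x] f(2)[OF lin_hom_closed[OF paint_lin y(1)]] y(2) th0 by simp
  from shape_part_zero[OF y(1) this]
  have "shape_part k n y \<in> white_ideal n" for k
    using quad_class_zero_white_ideal lin_hom_closed[OF shape_part_lin y(1)] by blast
  then have "finsum (space PX n) (\<lambda>k. sg k n (shape_part k n y)) {..<n} =
    finsum (space PX n) (\<lambda>k. \<zero>\<^bsub>space PX n\<^esub>) {..<n}"
    by (intro P.finsum_cong') (auto simp: white_ideal_def)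
  then show ?thesis using white_recombine[OF y(1)] y(2) by simp
qed

subsection \<open>Surjectivity\<close>

text \<open>Decorations by linear combinations of colours reduce to the two basis colours by
  linearity of the corolla in its decoration; \<open>tree_hom_range\<close> passes this on to all
  trees.\<close>

lemma com2_colour_range:
  assumes c: "c \<in> carrier (space CP n)"
  obtains z where "z \<in> carrier (space (tree_operad K (UNIV :: colour set)) n)" "c =
    \<pi>W n (lin_ext K (single_tree K) z)"
proof -
  note hom = map_tree_hom[OF Kc, of UNIV "single K" "carrier W", OF com2_single_closed[OF Kc]]
  obtain x where x: "x \<in> carrier (space (tree_operad K (carrier W)) n)" "c = \<pi>W n x"
    using c unfolding quadratic_carrier[OF sW S] by blast
  have "\<pi>W n x \<in> (\<lambda>z. \<pi>W n (lin_ext K (single_tree K) z)) ` carrier (space (tree_operad K (UNIV :: colour set)) n)"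
  proof (rule tree_hom_range[OF Kc pre_operad_tree[OF Kc] PCP rep_homD(1)[OF \<pi>W_rep]
        operad_hom_compose[OF hom rep_homD(1)[OF \<pi>W_rep]] _ x(1)])
    fix w assume w: "w \<in> carrier W"
    let ?T = "space (tree_operad K (UNIV :: colour set)) 2"
    let ?N = "\<lambda>c. single K (Node c (Leaf 1) (Leaf 2))"
    interpret T: module K ?T by (rule pre_operad_module[OF pre_operad_tree[OF Kc]])
    have N: "?N c \<in> carrier ?T" for c by (rule tree_single_closed[OF Kc corolla_trees[OF UNIV_I]])
    have wc: "w c \<in> carrier K" for c by (rule colour_coeff_closed[OF field V w])
    let ?z = "(w White \<odot>\<^bsub>?T\<^esub> ?N White) \<oplus>\<^bsub>?T\<^esub> (w Black \<odot>\<^bsub>?T\<^esub> ?N Black)"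
    note l2 = operad_homD(1)[OF operad_hom_compose[OF hom rep_homD(1)[OF \<pi>W_rep]], of 2]
    note r2 = rep_homD(2)[OF \<pi>W_rep]
    have sc: "single K c \<in> carrier W" for c by (rule com2_single_closed[OF Kc])
    have "\<pi>W 2 (lin_ext K (single_tree K) ?z) =
      (w White \<odot>\<^bsub>space CP 2\<^esub> \<pi>W 2 (corolla K (single K White))) \<oplus>\<^bsub>space CP 2\<^esub>
      (w Black \<odot>\<^bsub>space CP 2\<^esub> \<pi>W 2 (corolla K (single K Black)))"
      using N wc by (simp add: lin_hom_add[OF l2] lin_hom_smult[OF l2] lin_ext_single[OF Kc] corolla_def)
    also have "\<dots> = \<pi>W 2 (corolla K ((w White \<odot>\<^bsub>W\<^esub> single K White) \<oplus>\<^bsub>W\<^esub> (w Black \<odot>\<^bsub>W\<^esub> single K Black)))"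
      using lin_hom_add[OF r2 smult_colour_closed[OF field V w,
        of White] smult_colour_closed[OF field V w, of Black]]
        lin_hom_smult[OF r2 wc sc] by simp
    also have "\<dots> = \<pi>W 2 (corolla K w)" using colour_decomp[OF field V w] by simp
    finally have "\<pi>W 2 (corolla K w) = \<pi>W 2 (lin_ext K (single_tree K) ?z)" ..
    moreover have "?z \<in> carrier ?T" using N wc by simp
    ultimately show "\<pi>W 2 (single K (Node w (Leaf 1) (Leaf 2))) \<in>
      (\<lambda>z. \<pi>W 2 (lin_ext K (single_tree K) z)) ` carrier (space (tree_operad K (UNIV :: colour set)) 2)"
      unfolding corolla_def by (rule image_eqI)
  qed
  then show ?thesis using that x(2) by blast
qed

lemma white_surjective:
  assumes z: "z \<in> carrier (space had n)"
  shows "z \<in> th n ` carrier (space TX n)"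
proof -
  define I where "I = th n ` carrier (space TX n)"
  let ?H = "tensor K (space OP n) (space CP n)"
  let ?TU = "tree_operad K (UNIV :: colour set)"
  note mH = module_tensor[OF mOP[of n] mCP[of n]]
  note mTU = pre_operad_module[OF pre_operad_tree[OF Kc, of "UNIV :: colour set"], of n]
  interpret TX: module K "space TX n" by (rule mTX)
  have sub: "submodule I K ?H"
    unfolding I_def using submodule_image[OF mTX mhad th_lin TX.carrier_is_submodule]
      unfolding hadamard_space[OF POP PCP] .
  note hom = map_tree_hom[OF Kc, of UNIV "single K" "carrier W", OF com2_single_closed[OF Kc]]
  note lV = operad_homD(1)[OF rep_homD(1)[OF \<pi>V_rep], of n]
  note lW = operad_homD(1)[OF operad_hom_compose[OF hom rep_homD(1)[OF \<pi>W_rep]], of n]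
  have single: "htens n (\<pi>V n (single K s)) (\<pi>W n (lin_ext K (single_tree K) (single K s'))) \<in> I"
    if s: "s \<in> trees (carrier V) n" and s': "s' \<in> trees UNIV n" for s s'
  proof -
    \<comment> \<open>The preimage is the shape \<open>s\<close> with as many black vertices as
      \<open>s'\<close>. Both have \<open>n\<close> leaves, so the count fits, and
      \<open>com2_class_cong\<close> replaces the resulting colour pattern by
      \<open>s'\<close>.\<close>
    let ?t = "colour_fill s (blacks s')"
    have t: "?t \<in> CT n" by (rule colour_fill_trees[OF s])
    have "blacks s' < length (leaves s)" using blacks_less[of s'] treesD(4)[OF s] treesD(4)[OF s']
      by simp
    then have "black_count ?t = blacks s'" by (rule black_count_fill)
    from com2_class_cong[OF field coloured_components(2)[OF t] s' this]
    have "htens n (\<pi>V n (single K s)) (\<pi>W n (lin_ext K (single_tree K) (single K s'))) =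
      th n (single K (pnt ?t))"
      by (simp add: tensor_hom_paint[OF t] lin_ext_single[OF Kc])
    then show ?thesis using tree_single_closed[OF Kc paint_tree[OF field V t]] unfolding I_def
      by simp
  qed
  have step: "htens n (\<pi>V n (single K s)) (\<pi>W n (lin_ext K (single_tree K) y)) \<in> I"
    if s: "s \<in> trees (carrier V) n" and y: "y \<in> carrier (space ?TU n)" for s y
  proof -
    have a: "\<pi>V n (single K s) \<in> carrier (space OP n)"
      by (rule lin_hom_closed[OF lV tree_single_closed[OF Kc s]])
    have "submodule {y \<in>
      carrier (space ?TU n). htens n (\<pi>V n (single K s)) (\<pi>W n (lin_ext K (single_tree K) y)) \<in>
        I} K (space ?TU n)"
      by (rule submodule_vimage[OF mTU mH lin_hom_compose[OF lW tens_homr[OF mOP mCP a]] sub])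
    then have "carrier (space ?TU n) \<subseteq> {y \<in>
      carrier (space ?TU n). htens n (\<pi>V n (single K s)) (\<pi>W n (lin_ext K (single_tree K) y)) \<in> I}"
      unfolding tree_space[OF Kc] using single[OF s] single_closed[OF Kc]
      by (intro free_module_subsetI[OF Kc]) auto
    then show ?thesis using y by blast
  qed
  have tens: "htens n x c \<in> I" if x: "x \<in> carrier (space OP n)" and c: "c \<in>
    carrier (space CP n)" for x c
  proof -
    obtain y where y: "y \<in> carrier (space ?TU n)" "c = \<pi>W n (lin_ext K (single_tree K) y)"
      using com2_colour_range[OF c] .
    obtain u where u: "u \<in> carrier (space TV n)" "x = \<pi>V n u" using x
      unfolding quadratic_carrier[OF V R] by blast
    have "submodule {u \<in> carrier (space TV n). htens n (\<pi>V n u) c \<in> I} K (space TV n)"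
      by (rule submodule_vimage[OF mTV mH lin_hom_compose[OF lV tens_homl[OF mOP mCP c]] sub])
    then have "carrier (space TV n) \<subseteq> {u \<in> carrier (space TV n). htens n (\<pi>V n u) c \<in> I}"
      unfolding tree_space[OF Kc] using step[OF _ y(1)] single_closed[OF Kc]
        unfolding y(2)[symmetric]
      by (intro free_module_subsetI[OF Kc]) auto
    then show ?thesis using u by blast
  qed
  have "lin_span K ?H ((\<lambda>(x, y). htens n x y) ` (carrier (space OP n) \<times> carrier (space CP n))) \<subseteq> I"
    by (rule lin_span_least[OF sub]) (use tens in auto)
  then show ?thesis using z
    unfolding I_def[symmetric] hadamard_space[OF POP PCP] tensor_span[OF mOP mCP] by blast
qed

theorem white_hadamard_iso:
  "\<exists>f. canonical_morphism K V R W (com2_rels K) f \<and> operad_iso K PX (hadamard K OP (com2 K)) f \<and>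
    (\<forall>g. canonical_morphism K V R W (com2_rels K) g \<longrightarrow> (\<forall>n. \<forall>x\<in>carrier (space PX n). g n x = f n x))"
proof -
  obtain f where f: "operad_hom K PX had f" "\<And>n x. x \<in> carrier (space TX n) \<Longrightarrow> f n (\<rho> n x) = th n x"
    using white_canonical_exists by blast
  note fl = operad_homD(1)[OF f(1)]
  have PXc: "carrier (space PX n) = \<rho> n ` carrier (space TX n)" for n
    unfolding white_product_def by (rule quadratic_carrier[OF sX white_rel_carrier])
  have gen: "generator K X wr x = \<rho> 2 (corolla K x)" for x
    by (rule generator_eq[OF sX white_rel_carrier])
  have canonical: "canonical_morphism K V R W (com2_rels K) f"
    unfolding canonical_morphism_def Let_def
  proof (intro conjI ballI)
    fix v w assume v: "v \<in> carrier V" and w: "w \<in> carrier W"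
    have x: "tns v w \<in> carrier X" unfolding tensor_s2_simps by (rule tens_closed[OF mV mW v w])
    show "f 2 (generator K X wr (tns v w)) =
      htens 2 (generator K V R v) (generator K W (com2_rels K) w)"
      unfolding gen generator_eq[OF V R] generator_eq[OF sW S] f(2)[OF corolla_closed[OF sX x]]
      by (rule tensor_hom_corolla_tens[OF field V POP PCP \<pi>V_rep \<pi>W_rep v w])
  qed (rule f(1))
  have bij: "bij_betw (f n) (carrier (space PX n)) (carrier (space had n))" for n
    unfolding bij_betw_def
  proof
    interpret P: module K "space PX n" by (rule mPX)
    interpret H: module K "space had n" by (rule mhad)
    show "inj_on (f n) (carrier (space PX n))"
    proof (rule inj_onI)
      fix x y assume x: "x \<in> carrier (space PX n)" and y: "y \<in>
        carrier (space PX n)" and eq: "f n x = f n y"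
      have "x \<ominus>\<^bsub>space PX n\<^esub> y \<in> carrier (space PX n)" using x y by simp
      then obtain u where u: "u \<in> carrier (space TX n)" "x \<ominus>\<^bsub>space PX n\<^esub> y = \<rho> n u" unfolding PXc
        by blast
      have "f n (x \<ominus>\<^bsub>space PX n\<^esub> y) = \<zero>\<^bsub>space had n\<^esub>"
        using lin_hom_diff[OF mPX mhad fl x y] eq lin_hom_closed[OF fl y] H.diff_zero_iff by simp
      then have "th n u = \<zero>\<^bsub>space had n\<^esub>" using f(2)[OF u(1)] u(2) by simp
      from white_injective[OF u(1) this f] show "x = y" using u(2) P.diff_zero_iff[OF x y] by simp
    qed
    show "f n ` carrier (space PX n) = carrier (space had n)"
    proof
      show "f n ` carrier (space PX n) \<subseteq> carrier (space had n)" using lin_hom_closed[OF fl] by blast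
      show "carrier (space had n) \<subseteq> f n ` carrier (space PX n)"
      proof
        fix z assume "z \<in> carrier (space had n)"
        then obtain u where "u \<in> carrier (space TX n)" "z = th n u" using white_surjective by blast
        then show "z \<in> f n ` carrier (space PX n)" using f(2) unfolding PXc by (metis image_eqI)
      qed
    qed
  qed
  \<comment> \<open>Canonicity prescribes values only for elementary tensors. These span the
    decorations, and a morphism composed with \<open>\<rho>\<close> is determined on
    corollas.\<close>
  have unique: "g n x = f n x"
    if g: "canonical_morphism K V R W (com2_rels K) g" and x: "x \<in> carrier (space PX n)" for g n x
  proof -
    have gh: "operad_hom K PX had g"
      and gg: "\<And>v w. v \<in> carrier V \<Longrightarrow> w \<in> carrier W \<Longrightarrow>
        g 2 (generator K X wr (tns v w)) =
          htens 2 (generator K V R v) (generator K W (com2_rels K) w)"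
      using g unfolding canonical_morphism_def Let_def by blast+
    have fg: "f 2 (generator K X wr (tns v w)) =
      htens 2 (generator K V R v) (generator K W (com2_rels K) w)"
      if "v \<in> carrier V" "w \<in> carrier W" for v w
      using canonical that unfolding canonical_morphism_def Let_def by blast
    obtain u where u: "u \<in> carrier (space TX n)" "x = \<rho> n u" using x unfolding PXc by blast
    have "g n (\<rho> n u) = f n (\<rho> n u)"
    proof (rule tree_hom_unique[OF Kc Phad operad_hom_compose[OF \<rho>_hom gh] operad_hom_compose[OF \<rho>_hom f(1)] _ u(1)])
      fix d assume d: "d \<in> carrier X"
      note r2 = rep_homD(2)[OF \<rho>_rep, unfolded lin_hom_tensor_s2]
      have "g 2 (\<rho> 2 (corolla K d)) = f 2 (\<rho> 2 (corolla K d))"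
      proof (rule tensor_hom_eqI[OF mV mW mhad lin_hom_compose[OF r2 operad_homD(1)[OF gh]] lin_hom_compose[OF r2 fl]])
        show "d \<in> carrier (tensor K V W)" using d unfolding tensor_s2_simps .
        show "g 2 (\<rho> 2 (corolla K (tns v w))) = f 2 (\<rho> 2 (corolla K (tns v w)))"
          if "v \<in> carrier V" "w \<in> carrier W" for v w
          using gg[OF that] fg[OF that] unfolding gen by simp
      qed
      then show "g 2 (\<rho> 2 (single K (Node d (Leaf 1) (Leaf 2)))) =
        f 2 (\<rho> 2 (single K (Node d (Leaf 1) (Leaf 2))))"
        by (simp add: corolla_def)
    qed
    then show ?thesis using u(2) by simp
  qed
  show ?thesis
    unfolding com2_def operad_iso_def using canonical f(1) bij unique by blast
qed

end

text \<open>A canonical morphism is specified only through its values on generators. The last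
  conjunct shows that every such morphism agrees with \<open>f\<close> on all carriers, so the
  isomorphism obtained is the canonical morphism and not merely one of several candidates.\<close>

theorem corollary1p27:
  fixes K :: "('k, 'm) ring_scheme"
    and V :: "('k, 'v) s2_rep"
    and R :: "('v tree \<Rightarrow> 'k) set set"
  assumes "field K"
    and "s2_module K V"
    and "R \<subseteq> carrier (space (free_operad K V) 3)"
  shows "\<exists>f. canonical_morphism K V R (com2_gens K) (com2_rels K) f \<and>
    operad_iso K (white_product K V R (com2_gens K) (com2_rels K))
      (hadamard K (quadratic_operad K V R) (com2 K)) f \<and>
    (\<forall>g. canonical_morphism K V R (com2_gens K) (com2_rels K) g \<longrightarrow>
      (\<forall>n. \<forall>x\<in>carrier (space (white_product K V R (com2_gens K) (com2_rels K)) n). g n x = f n x))"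
  using assms by (rule white_hadamard_iso)

end
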